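(* Let $D$, $H$, $V$, $M$, $\sigma_1$, $\sigma_*$, $h$, $u$, the sets $\Omega_0$, $\Omega_1(u)$, $\Sigma(u)$, $\Omega^d(u)$, $\Omega_2^d(u)$, the spaces $H_0^1(\Omega^d(u))$ and $H_B^1(\Omega_1(u))$, and the functionals $G_d(u,\cdot)$ ($0<d\le 1$) and $G_0(u,\cdot)$ on $L_2(\Omega_0)$ be as defined in the context; in particular, the permittivity of the plate is $\sigma_2(x,z)=d\,\sigma_*(x,z-u(x))$ for $(x,z)\in\Omega_2^d(u)$. If $\theta\in H_B^1(\Omega_1(u))$, then $$ \Gamma\text{-}\lim_{d\to 0} G_d(u,\theta) = G_0(u,\theta)\quad\text{in}\quad L_2(\Omega_0), $$ that is, the $\Gamma$-limit of the functionals $G_d(u,\cdot)$ as $d\to 0$ with respect to the strong topology of $L_2(\Omega_0)$ exists at the point $\theta$ and equals $G_0(u,\theta)$.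
   Context: **Geometry.** $D\subset\mathbb{R}^2$ is a bounded domain with sufficiently smooth boundary ($D$ may also be a bounded open interval in $\mathbb{R}$), with outward unit normal $\nu$ on $\partial D$. The numbers $H>0$, $V>0$, $M>0$, $\sigma_1>0$ are fixed constants. $u:\bar D\to(-H,M)$ is a fixed smooth function satisfying $u=\partial_\nu u=0$ on $\partial D$. For $0<d\le 1$ set $$\Omega_1(u):=\{(x,z)\in D\times\mathbb{R}: -H<z<u(x)\},\qquad \Sigma(u):=\{(x,z)\in D\times\mathbb{R}: z=u(x)\},$$ $$\Omega_2^d(u):=\{(x,z)\in D\times\mathbb{R}: u(x)<z<u(x)+d\},\qquad \Omega^d(u):=\Omega_1(u)\cup\Sigma(u)\cup\Omega_2^d(u),$$ $$\Omega_0:=D\times(-H,M+1),$$ so that $\Omega^d(u)\subset\Omega_0$ for $d\le 1$. **Permittivity.** $\sigma_*$ is a continuous function on $\bar D\times[0,1]$, independent of $d$, with $\sigma_*\ge\sigma_0$ for some constant $\sigma_0>0$. **Boundary function.** $h:\bar D\times[-H,\infty)\times(-H,\infty)\to\mathbb{R}$ is a fixed smooth function with $$h(x,w,w)=V,\qquad h(x,-H,w)=0\qquad\text{for } (x,w)\in\bar D\times(-H,\infty).$$ For $v:\bar D\to(-H,\infty)$ put $h_v(x,z):=h(x,z,v(x))$. In particular $h_u$ and $h_{u+d}$ are defined in this way with $v=u$ and $v=u+d$. **Spaces.** $H_0^1(\Omega^d(u))$ is the subspace of $H^1(\Omega^d(u))$ of functions with zero trace on $\partial\Omega^d(u)$,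 and $$H_B^1(\Omega_1(u)):=\{\theta\in H^1(\Omega_1(u)): \theta=0\ \text{on}\ \partial\Omega_1(u)\setminus\Sigma(u)\}\quad\text{(in the sense of traces)}.$$ Functions in $H_0^1(\Omega^d(u))$ and in $H_B^1(\Omega_1(u))$ are regarded as elements of $L_2(\Omega_0)$ through extension by zero to $\Omega_0$. For $\theta\in H_B^1(\Omega_1(u))$, $\theta[u]$ denotes the trace $x\mapsto\theta(x,u(x))$ of $\theta$ on $\Sigma(u)$. **Functionals.** For $0<d\le1$, $$G_d(u,\theta):=\frac{\sigma_1}{2}\int_{\Omega_1(u)}|\nabla(\theta+h_{u+d})|^2\,\mathrm{d}(x,z)+\frac{d}{2}\int_D\int_{u(x)}^{u(x)+d}\sigma_*(x,z-u(x))\,|\nabla(\theta+h_{u+d})|^2\,\mathrm{d}z\,\mathrm{d}x$$ for $\theta\in H_0^1(\Omega^d(u))$, and $G_d(u,\theta):=\infty$ for $\theta\in L_2(\Omega_0)\setminus H_0^1(\Omega^d(u))$. Moreover, $$G_0(u,\theta):=\frac{\sigma_1}{2}\int_{\Omega_1(u)}|\nabla(\theta+h_u)|^2\,\mathrm{d}(x,z)+\frac12\int_D\sigma_*(x,0)\,\theta[u](x)^2\,(1+|\nabla u(x)|^2)\,\mathrm{d}x$$ for $\theta\in H_B^1(\Omega_1(u))$, and $G_0(u,\theta):=\infty$ for $\theta\in L_2(\Omega_0)\setminus H_B^1(\Omega_1(u))$. Here $\nabla$ acting on functions of $(x,z)$ is the full gradient in $(x,z)$, while $\nabla u$ is the gradient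 in $x$. **$\Gamma$-limit at a point.** $\Gamma\text{-}\lim_{d\to0}G_d(u,\theta)=G_0(u,\theta)$ in $L_2(\Omega_0)$ means: (i) for every family $(\theta_d)_{d}$ in $L_2(\Omega_0)$ with $\theta_d\to\theta$ in $L_2(\Omega_0)$ as $d\to0$, one has $G_0(u,\theta)\le\liminf_{d\to0}G_d(u,\theta_d)$; (ii) there exists a family $(\theta_d)_d$ in $L_2(\Omega_0)$ with $\theta_d\to\theta$ in $L_2(\Omega_0)$ as $d\to0$ and $\limsup_{d\to0}G_d(u,\theta_d)\le G_0(u,\theta)$. *)

theory Defs
  imports "HOL-Analysis.Analysis"
begin

section \<open>Classical differentiability\<close>

text \<open>\<open>C_on k f S\<close> is meant for open \<open>S\<close>: \<open>f\<close> is \<open>k\<close> times continuously differentiable on \<open>S\<close>,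
  expressed through iterated directional derivatives.\<close>

primrec C_on :: "nat \<Rightarrow> ('a::euclidean_space \<Rightarrow> real) \<Rightarrow> 'a set \<Rightarrow> bool" where
  "C_on 0 f S \<longleftrightarrow> continuous_on S f"
| "C_on (Suc k) f S \<longleftrightarrow> (\<forall>x\<in>S. f differentiable (at x)) \<and>
     (\<forall>v. C_on k (\<lambda>x. frechet_derivative f (at x) v) S)"

text \<open>On an arbitrary set, smoothness means being the restriction of a function that is smooth on an
  open neighbourhood.\<close>

definition smooth_on :: "'a::euclidean_space set \<Rightarrow> ('a \<Rightarrow> real) \<Rightarrow> bool" where
  "smooth_on S f \<longleftrightarrow> (\<exists>U g. open U \<and> S \<subseteq> U \<and> (\<forall>k. C_on k g U) \<and> (\<forall>x\<in>S. f x = g x))"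

definition gradient :: "('a::euclidean_space \<Rightarrow> real) \<Rightarrow> 'a \<Rightarrow> 'a" where
  "gradient f x = (THE g. GDERIV f x :> g)"

definition test_functions :: "'a::euclidean_space set \<Rightarrow> ('a \<Rightarrow> real) set" where
  "test_functions S = {\<phi>. (\<forall>k. C_on k \<phi> UNIV) \<and> compact (closure {x. \<phi> x \<noteq> 0}) \<and>
     closure {x. \<phi> x \<noteq> 0} \<subseteq> S}"

section \<open>Domains with differentiable boundary\<close>

definition local_defining_function ::
  "'a::euclidean_space set \<Rightarrow> 'a \<Rightarrow> 'a set \<Rightarrow> ('a \<Rightarrow> real) \<Rightarrow> bool" where
  "local_defining_function D p U \<rho> \<longleftrightarrow> open U \<and> p \<in> U \<and> C_on 1 \<rho> U \<and>
     (\<forall>x\<in>U. gradient \<rho> x \<noteq> 0) \<and> D \<inter> U = {x \<in> U. \<rho> x < 0}"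

text \<open>A \<open>C\<^sup>1\<close> boundary: the weakest regularity for which the normal is defined everywhere and is
  continuous.  In dimension one the condition holds for every bounded open interval.\<close>

definition C1_boundary :: "'a::euclidean_space set \<Rightarrow> bool" where
  "C1_boundary D \<longleftrightarrow> (\<forall>p\<in>frontier D. \<exists>U \<rho>. local_defining_function D p U \<rho>)"

definition outward_unit_normal :: "'a::euclidean_space set \<Rightarrow> 'a \<Rightarrow> 'a \<Rightarrow> bool" where
  "outward_unit_normal D p \<nu> \<longleftrightarrow>
     (\<exists>U \<rho>. local_defining_function D p U \<rho> \<and> \<nu> = gradient \<rho> p /\<^sub>R norm (gradient \<rho> p))"

section \<open>Lebesgue and Sobolev spaces\<close>

text \<open>Elements of the function spaces are represented by functions on the whole ambient space; only
  their values almost everywhere on the domain matter.\<close>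

definition L2 :: "'a::euclidean_space set \<Rightarrow> ('a \<Rightarrow> 'b::euclidean_space) set" where
  "L2 S = {f. set_borel_measurable lebesgue S f \<and>
     set_integrable lebesgue S (\<lambda>x. (norm (f x))\<^sup>2)}"

definition L2_norm :: "'a::euclidean_space set \<Rightarrow> ('a \<Rightarrow> 'b::euclidean_space) \<Rightarrow> real" where
  "L2_norm S f = sqrt (LINT x:S|lebesgue. (norm (f x))\<^sup>2)"

definition has_weak_gradient ::
  "'a::euclidean_space set \<Rightarrow> ('a \<Rightarrow> real) \<Rightarrow> ('a \<Rightarrow> 'a) \<Rightarrow> bool" where
  "has_weak_gradient S f g \<longleftrightarrow>
     (\<forall>K. compact K \<and> K \<subseteq> S \<longrightarrow> set_integrable lebesgue K f \<and> set_integrable lebesgue K g) \<and>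
     (\<forall>\<phi>\<in>test_functions S.
        (LINT x:S|lebesgue. f x *\<^sub>R gradient \<phi> x) = - (LINT x:S|lebesgue. \<phi> x *\<^sub>R g x))"

text \<open>Weak gradients on an open set are unique up to null sets, so integrals of \<open>weak_grad\<close> do not
  depend on the choice.\<close>

definition weak_grad :: "'a::euclidean_space set \<Rightarrow> ('a \<Rightarrow> real) \<Rightarrow> 'a \<Rightarrow> 'a" where
  "weak_grad S f = (SOME g. has_weak_gradient S f g)"

definition H1 :: "'a::euclidean_space set \<Rightarrow> ('a \<Rightarrow> real) set" where
  "H1 S = {f \<in> L2 S. \<exists>g \<in> L2 S. has_weak_gradient S f g}"

definition H1_norm :: "'a::euclidean_space set \<Rightarrow> ('a \<Rightarrow> real) \<Rightarrow> real" where
  "H1_norm S f = sqrt ((L2_norm S f)\<^sup>2 + (L2_norm S (weak_grad S f))\<^sup>2)"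

section \<open>Hausdorff measure and traces\<close>

text \<open>The normalisation makes the \<open>k\<close>-dimensional Hausdorff measure on a \<open>k\<close>-dimensional space agree
  with Lebesgue measure; empty covering sets cost nothing also for \<open>k = 0\<close>.\<close>

definition hausdorff_content :: "nat \<Rightarrow> real \<Rightarrow> 'a::metric_space set \<Rightarrow> ennreal" where
  "hausdorff_content k \<delta> A =
     (INF C \<in> {C :: nat \<Rightarrow> 'a set. A \<subseteq> (\<Union>i. C i) \<and> (\<forall>i. bounded (C i) \<and> diameter (C i) \<le> \<delta>)}.
        \<Sum>i. if C i = {} then 0 else ennreal (unit_ball_vol (real k) * (diameter (C i) / 2) ^ k))"

definition hausdorff_outer :: "nat \<Rightarrow> 'a::metric_space set \<Rightarrow> ennreal" where
  "hausdorff_outer k A = (SUP \<delta>\<in>{0<..}. hausdorff_content k \<delta> A)"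

text \<open>By Caratheodory's criterion the outer measure is countably additive on Borel sets, so its
  values there are those of the measure below.\<close>

definition hausdorff_measure :: "nat \<Rightarrow> 'a::metric_space measure" where
  "hausdorff_measure k = measure_of UNIV (sets borel) (hausdorff_outer k)"

definition surface_measure :: "'a::euclidean_space set \<Rightarrow> 'a measure" where
  "surface_measure S = restrict_space (hausdorff_measure (DIM('a) - 1)) (frontier S)"

text \<open>The trace is the continuous extension to \<open>H1 S\<close>, with values in the square integrable functions
  on the boundary, of the restriction operator \<open>F \<mapsto> F|frontier S\<close> defined for \<open>F\<close> in \<open>H1 S\<close>
  that are continuous up to the boundary.  For bounded Lipschitz domains every function in \<open>H1 S\<close> has a
  trace, unique up to surface null sets.\<close>

definition has_boundary_trace ::
  "'a::euclidean_space set \<Rightarrow> ('a \<Rightarrow> real) \<Rightarrow> ('a \<Rightarrow> real) \<Rightarrow> bool" where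
  "has_boundary_trace S f t \<longleftrightarrow>
     t \<in> borel_measurable (surface_measure S) \<and> integrable (surface_measure S) (\<lambda>p. (t p)\<^sup>2) \<and>
     (\<exists>F :: nat \<Rightarrow> 'a \<Rightarrow> real.
        (\<forall>k. continuous_on (closure S) (F k) \<and> F k \<in> H1 S) \<and>
        (\<lambda>k. H1_norm S (\<lambda>x. F k x - f x)) \<longlonglongrightarrow> 0 \<and>
        (\<lambda>k. \<integral>\<^sup>+ p. ennreal ((F k p - t p)\<^sup>2) \<partial>surface_measure S) \<longlonglongrightarrow> 0)"

definition boundary_trace :: "'a::euclidean_space set \<Rightarrow> ('a \<Rightarrow> real) \<Rightarrow> 'a \<Rightarrow> real" where
  "boundary_trace S f = (SOME t. has_boundary_trace S f t)"

definition H1_zero_trace_on :: "'a::euclidean_space set \<Rightarrow> 'a set \<Rightarrow> ('a \<Rightarrow> real) set" where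
  "H1_zero_trace_on S \<Gamma> =
     {f \<in> H1 S. \<exists>t. has_boundary_trace S f t \<and> (AE p in surface_measure S. p \<in> \<Gamma> \<longrightarrow> t p = 0)}"

text \<open>\<open>extended_by_zero A B X\<close>: the functions in \<open>X\<close>, a space of functions on \<open>B \<subseteq> A\<close>, regarded as
  elements of \<open>L2 A\<close>.\<close>

definition extended_by_zero ::
  "'a::euclidean_space set \<Rightarrow> 'a set \<Rightarrow> ('a \<Rightarrow> real) set \<Rightarrow> ('a \<Rightarrow> real) set" where
  "extended_by_zero A B X = {f \<in> L2 A. f \<in> X \<and> (AE p in lebesgue. p \<in> A - B \<longrightarrow> f p = 0)}"

section \<open>Geometry and functionals\<close>

definition Omega1 :: "'a::euclidean_space set \<Rightarrow> real \<Rightarrow> ('a \<Rightarrow> real) \<Rightarrow> ('a \<times> real) set" where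
  "Omega1 D H u = {(x, z). x \<in> D \<and> - H < z \<and> z < u x}"

definition Sigma_graph :: "'a::euclidean_space set \<Rightarrow> ('a \<Rightarrow> real) \<Rightarrow> ('a \<times> real) set" where
  "Sigma_graph D u = {(x, z). x \<in> D \<and> z = u x}"

definition Omega2 :: "'a::euclidean_space set \<Rightarrow> ('a \<Rightarrow> real) \<Rightarrow> real \<Rightarrow> ('a \<times> real) set" where
  "Omega2 D u d = {(x, z). x \<in> D \<and> u x < z \<and> z < u x + d}"

definition Omega :: "'a::euclidean_space set \<Rightarrow> real \<Rightarrow> ('a \<Rightarrow> real) \<Rightarrow> real \<Rightarrow> ('a \<times> real) set" where
  "Omega D H u d = Omega1 D H u \<union> Sigma_graph D u \<union> Omega2 D u d"

definition Omega0 :: "'a::euclidean_space set \<Rightarrow> real \<Rightarrow> real \<Rightarrow> ('a \<times> real) set" where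
  "Omega0 D H M = D \<times> {- H <..< M + 1}"

definition H10 :: "'a::euclidean_space set \<Rightarrow> real \<Rightarrow> ('a \<Rightarrow> real) \<Rightarrow> real \<Rightarrow>
    ('a \<times> real \<Rightarrow> real) set" where
  "H10 D H u d = H1_zero_trace_on (Omega D H u d) (frontier (Omega D H u d))"

definition HB1 :: "'a::euclidean_space set \<Rightarrow> real \<Rightarrow> ('a \<Rightarrow> real) \<Rightarrow> ('a \<times> real \<Rightarrow> real) set" where
  "HB1 D H u = H1_zero_trace_on (Omega1 D H u) (frontier (Omega1 D H u) - Sigma_graph D u)"

definition subst_boundary :: "('a \<Rightarrow> real \<Rightarrow> real \<Rightarrow> real) \<Rightarrow> ('a \<Rightarrow> real) \<Rightarrow> 'a \<times> real \<Rightarrow> real" where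
  "subst_boundary h v = (\<lambda>(x, z). h x z (v x))"

definition G :: "'a::euclidean_space set \<Rightarrow> real \<Rightarrow> real \<Rightarrow> real \<Rightarrow> ('a \<Rightarrow> real \<Rightarrow> real) \<Rightarrow>
    ('a \<Rightarrow> real \<Rightarrow> real \<Rightarrow> real) \<Rightarrow> ('a \<Rightarrow> real) \<Rightarrow> real \<Rightarrow> ('a \<times> real \<Rightarrow> real) \<Rightarrow> ereal" where
  "G D H M \<sigma>1 \<sigma>s h u d \<theta> =
     (if \<theta> \<in> extended_by_zero (Omega0 D H M) (Omega D H u d) (H10 D H u d) then
        (let w = weak_grad (Omega D H u d) (\<lambda>p. \<theta> p + subst_boundary h (\<lambda>x. u x + d) p) in
         ereal (\<sigma>1 / 2 * (LINT p:Omega1 D H u|lebesgue. (norm (w p))\<^sup>2) +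
           d / 2 * (LINT x:D|lebesgue. LINT z:{u x <..< u x + d}|lebesgue.
                      \<sigma>s x (z - u x) * (norm (w (x, z)))\<^sup>2)))
      else \<infinity>)"

definition G0 :: "'a::euclidean_space set \<Rightarrow> real \<Rightarrow> real \<Rightarrow> real \<Rightarrow> ('a \<Rightarrow> real \<Rightarrow> real) \<Rightarrow>
    ('a \<Rightarrow> real \<Rightarrow> real \<Rightarrow> real) \<Rightarrow> ('a \<Rightarrow> real) \<Rightarrow> ('a \<times> real \<Rightarrow> real) \<Rightarrow> ereal" where
  "G0 D H M \<sigma>1 \<sigma>s h u \<theta> =
     (if \<theta> \<in> extended_by_zero (Omega0 D H M) (Omega1 D H u) (HB1 D H u) then
        (let w = weak_grad (Omega1 D H u) (\<lambda>p. \<theta> p + subst_boundary h u p) in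
         ereal (\<sigma>1 / 2 * (LINT p:Omega1 D H u|lebesgue. (norm (w p))\<^sup>2) +
           1 / 2 * (LINT x:D|lebesgue. \<sigma>s x 0 * (boundary_trace (Omega1 D H u) \<theta> (x, u x))\<^sup>2 *
                      (1 + (norm (gradient u x))\<^sup>2))))
      else \<infinity>)"

definition L2_family :: "'a::euclidean_space set \<Rightarrow> (real \<Rightarrow> 'a \<Rightarrow> real) \<Rightarrow> ('a \<Rightarrow> real) \<Rightarrow> bool" where
  "L2_family S \<theta>s \<theta> \<longleftrightarrow> (\<forall>d\<in>{0<..1}. \<theta>s d \<in> L2 S) \<and>
     ((\<lambda>d. L2_norm S (\<lambda>p. \<theta>s d p - \<theta> p)) \<longlongrightarrow> 0) (at_right 0)"

definition Gamma_limit_at :: "'a::euclidean_space set \<Rightarrow> (real \<Rightarrow> ('a \<Rightarrow> real) \<Rightarrow> ereal) \<Rightarrow>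
    (('a \<Rightarrow> real) \<Rightarrow> ereal) \<Rightarrow> ('a \<Rightarrow> real) \<Rightarrow> bool" where
  "Gamma_limit_at S E E0 \<theta> \<longleftrightarrow>
     (\<forall>\<theta>s. L2_family S \<theta>s \<theta> \<longrightarrow> E0 \<theta> \<le> Liminf (at_right 0) (\<lambda>d. E d (\<theta>s d))) \<and>
     (\<exists>\<theta>s. L2_family S \<theta>s \<theta> \<and> Limsup (at_right 0) (\<lambda>d. E d (\<theta>s d)) \<le> E0 \<theta>)"

end

theory Submission
  imports Defs
begin

text \<open>A function in \<open>H10 D H u d\<close> has to fall from its value \<open>\<tau>(x)\<close> on the graph of \<open>u\<close> to zero
within the distance \<open>d\<close>.  The cheapest way to do so is linear in the vertical variable, with gradient
\<open>- (\<tau>/d) N\<close>, where \<open>N = (- \<nabla>u, 1)\<close> is the upward normal of the graph, not normalised.  As the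
permittivity of the layer is \<open>d \<sigma>\<^sub>*\<close>, this costs the energy
\<open>1/2 \<integral> \<sigma>\<^sub>*(x,0) \<tau>\<^sup>2 (1 + |\<nabla>u|\<^sup>2)\<close> in the limit, while the gradient of the boundary function stays
bounded and contributes nothing there.

The lower bound is proved by duality.  For a test field \<open>\<Phi>\<close> with compact support in \<open>D \<times> (-H, \<infinity>)\<close>
Young's inequality bounds the energy from below by an expression that is affine in the gradient, and
Green's formula moves the derivative from the function to \<open>\<Phi>\<close>; the upper boundary gives no term
because the trace vanishes there (\<open>energy_ge_Jd\<close>).  The resulting functional involves only the
function itself, so convergence in \<open>L\<^sub>2\<close> suffices to pass to the limit (\<open>J_limit\<close>).  Green's formula on
the subgraph of \<open>u\<close> then brings back the gradient together with a boundary term on the graph, and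
since \<open>\<Phi>\<close> can be prescribed independently inside the subgraph and on the graph, the supremum over
\<open>\<Phi>\<close> is the limit energy (\<open>J0_sup\<close>).

For the upper bound \<open>\<theta>\<close> is extended to the layer by reflection across the graph, multiplied by a
factor that falls linearly from one to zero (\<open>reflection_H10\<close>).  The gradient of the extension is
\<open>- (\<tau>/d) N\<close> up to an error that is bounded in \<open>L\<^sub>2\<close> of the layer uniformly in \<open>d\<close>, because \<open>\<theta>\<close>
at depth \<open>s\<close> below the graph differs from its trace by \<open>O(\<surd>s)\<close> in \<open>L\<^sub>2\<close> (\<open>strip_estimate\<close>).  After
rescaling the layer to unit thickness this error is negligible (\<open>recovery_energy\<close>).

The analysis is carried out for Borel functions that vanish off the domain and are integrated over
the whole space (\<open>sobolev_pair\<close>); \<open>H1_representative\<close> and \<open>H1_from_sobolev_pair\<close> translate to classes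
of Lebesgue measurable functions.  Traces enter through Green's formula (\<open>green_trace\<close>).  Their
definition by Hausdorff measure is linked to integrals over \<open>D\<close> by the fact that the projection of the
graph to \<open>D\<close> does not increase distances (\<open>nn_integral_graph_le_hausdorff\<close>).\<close>

section \<open>Smooth functions\<close>

abbreviation BM :: "('a::topological_space => 'b::topological_space) set" where "BM \<equiv> borel_measurable borel"

lemmas integral_congr = Bochner_Integration.integral_cong[OF refl]

lemma C_on_cong:
 assumes "open S" "\<And>x. x \<in> S ==> f x = g x"
 shows "C_on k f S \<longleftrightarrow> C_on k g S"
 using assms(2)
proof (induction k arbitrary: f g)
 case 0
 then show ?case by (simp cong: continuous_on_cong)
next
 case (Suc k)
 have der: "(f has_derivative f') (at x) \<longleftrightarrow> (g has_derivative f') (at x)" if "x \<in> S" for x f'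
  using has_derivative_transform_within_open[OF _ assms(1) that, of f f' UNIV g]
   has_derivative_transform_within_open[OF _ assms(1) that, of g f' UNIV f] Suc.prems by metis
 have "f differentiable at x \<longleftrightarrow> g differentiable at x"
   "frechet_derivative f (at x) = frechet_derivative g (at x)" if "x \<in> S" for x
  using der[OF that] by (auto simp: differentiable_def frechet_derivative_def)
 then show ?case using Suc.IH[of "\<lambda>x. frechet_derivative f (at x) v" "\<lambda>x. frechet_derivative g (at x) v" for v]
  by simp
qed

lemma C_on_subset: "C_on k f S ==> T \<subseteq> S ==> C_on k f T"
 by (induction k arbitrary: f) (auto intro: continuous_on_subset)

lemma C_on_Un:
 assumes "open A" "open B"
 shows "C_on k f A ==> C_on k f B ==> C_on k f (A \<union> B)"
 by (induction k arbitrary: f) (auto intro: continuous_on_open_Un assms)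

lemma C_on_SucD: "C_on (Suc k) f S ==> C_on k f S"
proof (induction k arbitrary: f)
 case 0
 then show ?case by (auto intro!: continuous_at_imp_continuous_on differentiable_imp_continuous_within)
qed auto

lemma C_on_SucI:
 assumes "open S" "\<And>x. x \<in> S ==> (f has_derivative f' x) (at x)"
  "\<And>v. C_on k (\<lambda>x. f' x v) S"
 shows "C_on (Suc k) f S"
proof -
 have "C_on k (\<lambda>x. frechet_derivative f (at x) v) S" for v
  using C_on_cong[OF assms(1), of "\<lambda>x. frechet_derivative f (at x) v" "\<lambda>x. f' x v" k]
   assms(3) frechet_derivative_at[OF assms(2)] by auto
 then show ?thesis using assms(2) by (auto simp: differentiable_def)
qed

lemma C_on_SucD_deriv:
 "C_on (Suc k) f S ==> x \<in> S ==> (f has_derivative frechet_derivative f (at x)) (at x)"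
 by (simp add: frechet_derivative_works)

lemma C_on_const: "open S ==> C_on k (\<lambda>x. c) S"
 by (induction k arbitrary: c) (auto intro!: C_on_SucI[where f'="\<lambda>x v. 0"] simp del: C_on.simps(2))

lemma C_on_bounded_linear: "open S ==> bounded_linear f ==> C_on k f S"
proof (induction k)
 case 0
 then show ?case by (simp add: linear_continuous_on)
next
 case (Suc k)
 show ?case
  by (rule C_on_SucI[where f'="\<lambda>x. f"])
   (use Suc in \<open>auto intro: bounded_linear_imp_has_derivative C_on_const\<close>)
qed

lemma C_on_add: "open S ==> C_on k f S ==> C_on k g S ==> C_on k (\<lambda>x. f x + g x) S"
proof (induction k arbitrary: f g)
 case 0 then show ?case by (auto intro: continuous_intros)
next
 case (Suc k)
 show ?case
  by (rule C_on_SucI[where f'="\<lambda>x v. frechet_derivative f (at x) v + frechet_derivative g (at x) v"])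
   (use Suc.prems in \<open>auto intro!: Suc.IH has_derivative_add simp: frechet_derivative_works\<close>)
qed

lemma C_on_mult: "open S ==> C_on k f S ==> C_on k g S ==> C_on k (\<lambda>x. f x * g x) S"
proof (induction k arbitrary: f g)
 case 0 then show ?case by (auto intro: continuous_intros)
next
 case (Suc k)
 have fg: "C_on k f S" "C_on k g S" using Suc.prems C_on_SucD by blast+
 show ?case
  by (rule C_on_SucI[where f'="\<lambda>x v. f x * frechet_derivative g (at x) v + frechet_derivative f (at x) v * g x"])
   (use Suc.prems fg in \<open>auto intro!: Suc.IH C_on_add has_derivative_mult simp: frechet_derivative_works\<close>)
qed

lemma C_on_sum: "open S ==> (\<And>i. i \<in> I ==> C_on k (f i) S) ==> C_on k (\<lambda>x. \<Sum>i\<in>I. f i x) S"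
 by (induction I rule: infinite_finite_induct) (auto intro: C_on_const C_on_add)

lemma C_on_prod: "open S ==> (\<And>i. i \<in> I ==> C_on k (f i) S) ==> C_on k (\<lambda>x. \<Prod>i\<in>I. f i x) S"
 by (induction I rule: infinite_finite_induct) (auto intro: C_on_const C_on_mult)

text \<open>The chain rule expresses the derivative through products of functions of one order less, so induction on the order
applies.\<close>

lemma C_on_compose:
 fixes \<Phi> :: "'a::euclidean_space => 'b::euclidean_space"
 assumes S: "open S" and "open T" "\<Phi> ` S \<subseteq> T"
 shows "(\<And>b. b \<in> Basis ==> C_on k (\<lambda>x. \<Phi> x \<bullet> b) S) ==> C_on k f T ==> C_on k (\<lambda>x. f (\<Phi> x)) S"
proof (induction k arbitrary: f)
 case 0
 have "continuous_on S \<Phi>"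
  using 0 by (subst continuous_on_componentwise) auto
 then show ?case using 0 continuous_on_compose2[of T f S \<Phi>] assms by auto
next
 case (Suc k)
 define D where "D x v = (\<Sum>b\<in>Basis. frechet_derivative (\<lambda>x. \<Phi> x \<bullet> b) (at x) v *\<^sub>R b)" for x v
 have D: "(\<Phi> has_derivative D x) (at x)" if "x \<in> S" for x
  unfolding D_def
 proof (subst has_derivative_componentwise_within, intro ballI)
  fix b :: 'b assume b: "b \<in> Basis"
  have "((\<lambda>x. \<Phi> x \<bullet> b) has_derivative frechet_derivative (\<lambda>x. \<Phi> x \<bullet> b) (at x)) (at x)"
   using Suc.prems(1)[OF b] that C_on_SucD_deriv by blast
  moreover have "(\<Sum>b'\<in>Basis. frechet_derivative (\<lambda>x. \<Phi> x \<bullet> b') (at x) v *\<^sub>R b') \<bullet> b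
    = frechet_derivative (\<lambda>x. \<Phi> x \<bullet> b) (at x) v" for v
   using b by (simp add: inner_sum_left inner_Basis if_distrib cong: if_cong)
  ultimately show "((\<lambda>x. \<Phi> x \<bullet> b) has_derivative (\<lambda>v. (\<Sum>b'\<in>Basis. frechet_derivative (\<lambda>x. \<Phi> x \<bullet> b') (at x) v *\<^sub>R b') \<bullet> b)) (at x)"
   by simp
 qed
 have f: "(f has_derivative frechet_derivative f (at (\<Phi> x))) (at (\<Phi> x))" if "x \<in> S" for x
  using Suc.prems(2) that assms(3) C_on_SucD_deriv by blast
 show ?case
 proof (rule C_on_SucI[OF S])
  fix x assume x: "x \<in> S"
  have "((f \<circ> \<Phi>) has_derivative (frechet_derivative f (at (\<Phi> x)) \<circ> D x)) (at x)"
   by (rule diff_chain_at[OF D[OF x] f[OF x]])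
  moreover have "frechet_derivative f (at (\<Phi> x)) (D x v) = (\<Sum>b\<in>Basis. frechet_derivative (\<lambda>x. \<Phi> x \<bullet> b) (at x) v * frechet_derivative f (at (\<Phi> x)) b)" for v
  proof -
   have "linear (frechet_derivative f (at (\<Phi> x)))" using f[OF x] has_derivative_linear by blast
   then show ?thesis unfolding D_def by (simp add: linear_sum linear_cmul)
  qed
  ultimately show "((\<lambda>x. f (\<Phi> x)) has_derivative (\<lambda>v. \<Sum>b\<in>Basis. frechet_derivative (\<lambda>x. \<Phi> x \<bullet> b) (at x) v * frechet_derivative f (at (\<Phi> x)) b)) (at x)"
   by (simp add: o_def)
 next
  fix v
  have "C_on k (\<lambda>x. frechet_derivative f (at (\<Phi> x)) b) S" for b
  proof (rule Suc.IH)
   show "C_on k (\<lambda>y. frechet_derivative f (at y) b) T" using Suc.prems(2) by simp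
  qed (use Suc.prems(1) C_on_SucD in blast)
  then show "C_on k (\<lambda>x. \<Sum>b\<in>Basis. frechet_derivative (\<lambda>x. \<Phi> x \<bullet> b) (at x) v * frechet_derivative f (at (\<Phi> x)) b) S"
   using Suc.prems(1) by (intro C_on_sum C_on_mult S) auto
 qed
qed

definition Cinf :: "('a::euclidean_space => real) => 'a set => bool" where
 "Cinf f S \<longleftrightarrow> (\<forall>k. C_on k f S)"

lemma Cinf_const [intro]: "open S ==> Cinf (\<lambda>x. c) S"
 and Cinf_add [intro]: "open S ==> Cinf f S ==> Cinf g S ==> Cinf (\<lambda>x. f x + g x) S"
 and Cinf_mult [intro]: "open S ==> Cinf f S ==> Cinf g S ==> Cinf (\<lambda>x. f x * g x) S"
 and Cinf_linear: "open S ==> bounded_linear f ==> Cinf f S"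
 and Cinf_subset: "Cinf f S ==> T \<subseteq> S ==> Cinf f T"
 and Cinf_Un: "open A ==> open B ==> Cinf f A ==> Cinf f B ==> Cinf f (A \<union> B)"
 and Cinf_prod: "open S ==> (\<And>i. i \<in> I ==> Cinf (F i) S) ==> Cinf (\<lambda>x. \<Prod>i\<in>I. F i x) S"
 and Cinf_sum: "open S ==> (\<And>i. i \<in> I ==> Cinf (F i) S) ==> Cinf (\<lambda>x. \<Sum>i\<in>I. F i x) S"
 unfolding Cinf_def
 by (blast intro: C_on_const, blast intro: C_on_add, blast intro: C_on_mult,
   blast intro: C_on_bounded_linear, blast intro: C_on_subset, blast intro: C_on_Un,
   blast intro: C_on_prod, blast intro: C_on_sum)

lemma Cinf_cong:
 assumes "open S" "\<And>x. x \<in> S ==> f x = g x"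
 shows "Cinf f S \<longleftrightarrow> Cinf g S"
proof -
 have "C_on k f S \<longleftrightarrow> C_on k g S" for k by (rule C_on_cong[OF assms])
 then show ?thesis unfolding Cinf_def by blast
qed

lemma Cinf_compose:
 assumes "open S" "open T" "\<Phi> ` S \<subseteq> T" "\<And>b. b \<in> Basis ==> Cinf (\<lambda>x. \<Phi> x \<bullet> b) S" "Cinf f T"
 shows "Cinf (\<lambda>x. f (\<Phi> x)) S"
proof -
 have "C_on k (\<lambda>x. f (\<Phi> x)) S" for k
  by (rule C_on_compose[OF assms(1-3)]) (use assms(4,5) Cinf_def in blast)+
 then show ?thesis unfolding Cinf_def by blast
qed

lemma Cinf_compose_real:
 fixes f :: "real => real"
 assumes "open S" "open T" "\<And>x. x \<in> S ==> \<phi> x \<in> T" "Cinf \<phi> S" "Cinf f T"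
 shows "Cinf (\<lambda>x. f (\<phi> x)) S"
proof (rule Cinf_compose[where \<Phi>=\<phi> and T=T])
 show "\<phi> ` S \<subseteq> T" using assms(3) by blast
 show "Cinf (\<lambda>x. \<phi> x \<bullet> b) S" if "b \<in> Basis" for b
  using that assms(4) by simp
qed (fact assms)+

lemma Cinf_uminus: "open S ==> Cinf f S ==> Cinf (\<lambda>x. - f x) S"
 using Cinf_mult[of S "\<lambda>x. -1" f] by (auto intro: Cinf_const)

lemma Cinf_diff [intro]: "open S ==> Cinf f S ==> Cinf g S ==> Cinf (\<lambda>x. f x - g x) S"
 using Cinf_add[of S f "\<lambda>x. - g x"] Cinf_uminus[of S g] by auto

lemma Cinf_divide_const [intro]: "open S ==> Cinf f S ==> Cinf (\<lambda>x. f x / c) S"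
 using Cinf_mult[of S f "\<lambda>x. inverse c"] by (auto intro: Cinf_const simp: divide_inverse)

lemma Cinf_fst: "open S ==> Cinf f D ==> open D ==> fst ` S \<subseteq> D ==> Cinf (\<lambda>p. f (fst p)) S"
 by (rule Cinf_compose[where \<Phi>=fst and T=D])
  (auto intro!: Cinf_linear bounded_linear_compose[OF bounded_linear_inner_left bounded_linear_fst])

lemma Cinf_ident_real: "open S ==> Cinf (\<lambda>x::real. x) S"
 by (intro Cinf_linear) (auto intro: bounded_linear_ident)

lemma Cinf_has_derivative: "Cinf f S ==> x \<in> S ==> (f has_derivative frechet_derivative f (at x)) (at x)"
 unfolding Cinf_def using C_on_SucD_deriv[of 0] by blast

lemma Cinf_deriv: "Cinf f S ==> Cinf (\<lambda>x. frechet_derivative f (at x) v) S"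
 unfolding Cinf_def by (metis C_on.simps(2))

lemma Cinf_continuous_on: "Cinf f S ==> continuous_on S f"
 unfolding Cinf_def by (metis C_on.simps(1))

lemma gradient_eqI:
 assumes "(f has_derivative f') (at x)" shows "gradient f x = (\<Sum>b\<in>Basis. f' b *\<^sub>R b)"
proof -
 have lin: "linear f'" using assms has_derivative_linear by blast
 have f': "f' = (\<lambda>v. v \<bullet> (\<Sum>b\<in>Basis. f' b *\<^sub>R b))"
 proof
  fix v
  have "f' v = f' (\<Sum>b\<in>Basis. (v \<bullet> b) *\<^sub>R b)" by (simp add: euclidean_representation)
  also have "... = (\<Sum>b\<in>Basis. (v \<bullet> b) * f' b)" using lin by (simp add: linear_sum linear_cmul)
  finally show "f' v = v \<bullet> (\<Sum>b\<in>Basis. f' b *\<^sub>R b)" by (simp add: inner_sum_right mult.commute)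
 qed
 have G: "GDERIV f x :> (\<Sum>b\<in>Basis. f' b *\<^sub>R b)"
  unfolding gderiv_def using assms f' by (metis (no_types, lifting))
 show ?thesis unfolding gradient_def
 proof (rule the_equality[where P="\<lambda>g. GDERIV f x :> g", OF G])
  fix g assume g: "GDERIV f x :> g"
  have "(\<lambda>v. v \<bullet> g) = (\<lambda>v. v \<bullet> (\<Sum>b\<in>Basis. f' b *\<^sub>R b))"
   by (rule has_derivative_unique[OF g[unfolded gderiv_def] G[unfolded gderiv_def]])
  then show "g = (\<Sum>b\<in>Basis. f' b *\<^sub>R b)"
   by - (rule vector_eq_ldot[THEN iffD1], rule allI, rule fun_cong)
 qed
qed

lemma gradient_inner:
 assumes "(f has_derivative f') (at x)" shows "gradient f x \<bullet> e = f' e"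
proof -
 have lin: "linear f'" using assms has_derivative_linear by blast
 have "f' e = f' (\<Sum>b\<in>Basis. (e \<bullet> b) *\<^sub>R b)" by (simp add: euclidean_representation)
 also have "... = (\<Sum>b\<in>Basis. (e \<bullet> b) * f' b)" using lin by (simp add: linear_sum linear_cmul)
 finally show ?thesis unfolding gradient_eqI[OF assms] by (simp add: inner_commute[of _ e] inner_sum_right mult.commute)
qed

lemma gradient_has_derivative:
 assumes "(f has_derivative f') (at x)" shows "(f has_derivative (\<lambda>e. gradient f x \<bullet> e)) (at x)"
proof -
 have "f' = (\<lambda>e. gradient f x \<bullet> e)" using gradient_inner[OF assms] by auto
 then show ?thesis using assms by simp
qed

lemma gradient_unique:
 assumes "(f has_derivative (\<lambda>e. g \<bullet> e)) (at x)" shows "gradient f x = g"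
 by (rule vector_eq_rdot[THEN iffD1], rule allI, rule gradient_inner[OF assms])

text \<open>The functions \<open>t\<^sup>-\<^sup>j exp(-1/t)\<close>, which are closed under differentiation.\<close>

definition flat_exp :: "nat => real => real" where
 "flat_exp j t = (if t > 0 then exp (- inverse t) * inverse t ^ j else 0)"

lemma flat_exp_tendsto_0: "((\<lambda>t. flat_exp j t) \<longlongrightarrow> 0) (at 0)"
proof -
 have "((\<lambda>t::real. exp (- inverse t) * inverse t ^ j) \<longlongrightarrow> 0) (at_right 0)"
  using filterlim_compose[OF tendsto_power_div_exp_0[of j] filterlim_inverse_at_top_right]
  by (simp add: exp_minus field_simps)
 then have "((\<lambda>t. flat_exp j t) \<longlongrightarrow> 0) (at_right 0)"
  by (rule Lim_transform_eventually) (auto simp: flat_exp_def eventually_at_filter)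
 moreover have "((\<lambda>t. flat_exp j t) \<longlongrightarrow> 0) (at_left 0)"
  by (rule Lim_transform_eventually[of "\<lambda>x. 0"]) (auto simp: flat_exp_def eventually_at_filter)
 ultimately show ?thesis using filterlim_split_at by blast
qed

lemma flat_exp_has_derivative:
 "(flat_exp j has_real_derivative (flat_exp (j + 2) t - of_nat j * flat_exp (j + 1) t)) (at t)"
proof -
 consider "t > 0" | "t < 0" | "t = 0" by linarith
 then show ?thesis
 proof cases
  case 1
  have "((\<lambda>t. exp (- inverse t) * inverse t ^ j) has_real_derivative (flat_exp (j + 2) t - of_nat j * flat_exp (j + 1) t)) (at t)"
  proof (cases j)
   case 0
   then show ?thesis using 1
    by (auto intro!: derivative_eq_intros simp: flat_exp_def power2_eq_square)
  next
   case (Suc i)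
   have "((\<lambda>t. exp (- inverse t) * inverse t ^ Suc i) has_real_derivative
     exp (- inverse t) * (inverse t * inverse t) * inverse t ^ Suc i
     + exp (- inverse t) * (of_nat (Suc i) * inverse t ^ i * - (inverse t * inverse t))) (at t)"
   proof -
    have d: "(inverse has_real_derivative - (inverse t * inverse t)) (at t)"
     using DERIV_inverse[of t] 1 by (simp add: power2_eq_square)
    have e: "((\<lambda>t. exp (- inverse t)) has_real_derivative exp (- inverse t) * (inverse t * inverse t)) (at t)"
     using 1 by (auto intro!: derivative_eq_intros)
    show ?thesis
     using DERIV_mult[OF e DERIV_power[OF d, of "Suc i"]] by (simp add: algebra_simps)
   qed
   then show ?thesis using 1 Suc by (simp add: flat_exp_def algebra_simps)
  qed
  then show ?thesis
   by (rule has_field_derivative_transform_within_open[of _ _ _ "{0<..}"]) (use 1 in \<open>auto simp: flat_exp_def\<close>)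
 next
  case 2
  have "((\<lambda>t. 0) has_real_derivative (flat_exp (j + 2) t - of_nat j * flat_exp (j + 1) t)) (at t)"
   using 2 by (auto intro!: derivative_eq_intros simp: flat_exp_def)
  then show ?thesis
   by (rule has_field_derivative_transform_within_open[of _ _ _ "{..<0}"]) (use 2 in \<open>auto simp: flat_exp_def\<close>)
 next
  case 3
  have "((\<lambda>h. (flat_exp j (0 + h) - flat_exp j 0) / h) \<longlongrightarrow> 0) (at 0)"
   by (rule Lim_transform_eventually[OF flat_exp_tendsto_0[of "Suc j"]])
    (auto simp: flat_exp_def eventually_at_filter field_simps)
  then show ?thesis using 3 unfolding DERIV_def by (simp add: flat_exp_def)
 qed
qed

lemma C_on_flat_exp: "C_on k (flat_exp j) UNIV"
proof (induction k arbitrary: j)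
 case 0
 show ?case using DERIV_isCont[OF flat_exp_has_derivative] by (simp add: continuous_on_eq_continuous_at)
next
 case (Suc k)
 show ?case
 proof (rule C_on_SucI)
  show "(flat_exp j has_derivative (*) (flat_exp (j + 2) t - of_nat j * flat_exp (j + 1) t)) (at t)" for t
   using flat_exp_has_derivative by (simp add: has_field_derivative_def)
  show "C_on k (\<lambda>t. (flat_exp (j + 2) t - of_nat j * flat_exp (j + 1) t) * v) UNIV" for v
   using C_on_add[OF open_UNIV Suc C_on_mult[OF open_UNIV C_on_const[OF open_UNIV] Suc], of "j+2" "- of_nat j" "j+1"]
   by (intro C_on_mult C_on_const) auto
 qed auto
qed

lemma Cinf_flat_exp: "Cinf (flat_exp j) UNIV"
 by (simp add: Cinf_def C_on_flat_exp)

lemma Cinf_inverse: "Cinf inverse {0::real<..}"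
proof -
 have "C_on k inverse {0::real<..}" for k
 proof (induction k)
  case 0 show ?case by (auto intro!: continuous_intros)
 next
  case (Suc k)
  show ?case
  proof (rule C_on_SucI)
   show "(inverse has_derivative (*) (- (inverse t * inverse t))) (at t)" if "t \<in> {0<..}" for t::real
    using DERIV_inverse[of t] that by (simp add: has_field_derivative_def power2_eq_square)
   show "C_on k (\<lambda>t. - (inverse t * inverse t) * v) {0::real<..}" for v
    using C_on_mult[OF _ C_on_mult[OF _ Suc Suc] C_on_const[of _ _ "- v"]] by simp
  qed auto
 qed
 then show ?thesis by (simp add: Cinf_def)
qed

definition smooth_step :: "real => real" where
 "smooth_step t = flat_exp 0 t * inverse (flat_exp 0 t + flat_exp 0 (1 - t))"

lemma smooth_step_0: "t \<le> 0 ==> smooth_step t = 0"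
 and smooth_step_1: "t \<ge> 1 ==> smooth_step t = 1"
 and smooth_step_nonneg: "0 \<le> smooth_step t"
 and smooth_step_le_1: "smooth_step t \<le> 1"
 by (auto simp: smooth_step_def flat_exp_def field_simps add_pos_pos)

lemma Cinf_smooth_step: "Cinf smooth_step UNIV"
proof -
 have c: "Cinf (\<lambda>t. flat_exp 0 (1 - t)) UNIV"
  by (rule Cinf_compose_real[where \<phi>="\<lambda>t. 1 - t", OF _ _ _ _ Cinf_flat_exp]) (auto intro!: Cinf_diff[of _ "\<lambda>t. 1"] Cinf_const Cinf_ident_real)
 have p: "0 < flat_exp 0 t + flat_exp 0 (1 - t)" for t by (auto simp: flat_exp_def add_pos_pos)
 have "Cinf (\<lambda>t. inverse (flat_exp 0 t + flat_exp 0 (1 - t))) UNIV"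
  by (rule Cinf_compose_real[where \<phi>="\<lambda>t. flat_exp 0 t + flat_exp 0 (1 - t)", OF _ _ _ _ Cinf_inverse]) (use p c Cinf_flat_exp in auto)
 then show ?thesis unfolding smooth_step_def[abs_def] using Cinf_flat_exp by auto
qed

section \<open>Test functions and the fundamental lemma\<close>

text \<open>Smoothness near the support suffices: the neighbourhood \<open>V\<close> and the complement of \<open>K\<close> are
open and cover the space, and the function vanishes on the latter.\<close>

lemma test_functionsI:
 assumes "open V" "Cinf f V" "compact K" "K \<subseteq> V" "K \<subseteq> S" "\<And>x. x \<notin> K ==> f x = 0"
 shows "f \<in> test_functions S"
proof -
 have cK: "closed K" using assms(3) compact_imp_closed by blast
 have "Cinf f (- K)" using Cinf_cong[of "- K" f "\<lambda>x. 0"] cK assms(6) by (auto simp: open_Compl)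
 then have "Cinf f (V \<union> - K)" using assms cK by (intro Cinf_Un) (auto simp: open_Compl)
 moreover have "V \<union> - K = UNIV" using assms(4) by auto
 ultimately have "Cinf f UNIV" by simp
 moreover have "{x. f x \<noteq> 0} \<subseteq> K" using assms(6) by auto
 then have "closure {x. f x \<noteq> 0} \<subseteq> K" using cK by (simp add: closure_minimal)
 moreover from this have "compact (closure {x. f x \<noteq> 0})"
  using assms(3) compact_Int_closed[of K "closure {x. f x \<noteq> 0}"] by (simp add: Int_absorb1)
 ultimately show ?thesis using assms(5) unfolding test_functions_def Cinf_def by auto
qed

lemma test_functionsE:
 assumes "f \<in> test_functions S"
 obtains K where "compact K" "K \<subseteq> S" "Cinf f UNIV" "\<And>x. x \<notin> K ==> f x = 0"
 by (rule that[of "closure {x. f x \<noteq> 0}"])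
  (use assms closure_subset[of "{x. f x \<noteq> 0}"] in \<open>auto simp: test_functions_def Cinf_def\<close>)

lemma test_functions_mono: "S \<subseteq> T ==> test_functions S \<subseteq> test_functions T"
 by (auto simp: test_functions_def)

lemma test_functions_mult:
 assumes "f \<in> test_functions S" "open S" "Cinf g S"
 shows "(\<lambda>x. f x * g x) \<in> test_functions S"
proof -
 obtain K where K: "compact K" "K \<subseteq> S" "Cinf f UNIV" "\<And>x. x \<notin> K ==> f x = 0"
  using test_functionsE[OF assms(1)] by blast
 have "Cinf (\<lambda>x. f x * g x) S" using K(3) assms Cinf_subset[of f UNIV S] by blast
 then show ?thesis by (rule test_functionsI[of S _ K, OF assms(2)]) (use K in auto)
qed

lemma test_functions_add:
 assumes "f \<in> test_functions S" "g \<in> test_functions S"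
 shows "(\<lambda>x. f x + g x) \<in> test_functions S"
proof -
 obtain K where K: "compact K" "K \<subseteq> S" "Cinf f UNIV" "\<And>x. x \<notin> K ==> f x = 0"
  using test_functionsE[OF assms(1)] by blast
 obtain L where L: "compact L" "L \<subseteq> S" "Cinf g UNIV" "\<And>x. x \<notin> L ==> g x = 0"
  using test_functionsE[OF assms(2)] by blast
 have "Cinf (\<lambda>x. f x + g x) UNIV" using K(3) L(3) by blast
 then show ?thesis by (rule test_functionsI[of UNIV _ "K \<union> L", OF open_UNIV]) (use K L in auto)
qed

lemma test_functions_cmult:
 assumes "f \<in> test_functions S" shows "(\<lambda>x. c * f x) \<in> test_functions S"
proof -
 obtain K where K: "compact K" "K \<subseteq> S" "Cinf f UNIV" "\<And>x. x \<notin> K ==> f x = 0"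
  using test_functionsE[OF assms(1)] by blast
 have "Cinf (\<lambda>x. c * f x) UNIV" using K(3) by (intro Cinf_mult Cinf_const) auto
 then show ?thesis by (rule test_functionsI[of UNIV _ K, OF open_UNIV]) (use K in auto)
qed

lemma test_functions_zero: "(\<lambda>x. 0) \<in> test_functions S"
 by (rule test_functionsI[of UNIV _ "{}"]) auto

lemma test_function_continuous: "f \<in> test_functions S ==> continuous_on A f"
 using test_functionsE[of f S] Cinf_continuous_on[of f UNIV] continuous_on_subset[of UNIV f A] by blast

lemma test_function_has_derivative:
 "f \<in> test_functions S ==> (f has_derivative (\<lambda>e. gradient f x \<bullet> e)) (at x)"
 using test_functionsE[of f S] Cinf_has_derivative[of f UNIV x] gradient_has_derivative by blast

lemma test_function_deriv: "f \<in> test_functions S ==> (\<lambda>x. gradient f x \<bullet> e) \<in> test_functions S"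
proof -
 assume f: "f \<in> test_functions S"
 obtain K where K: "compact K" "K \<subseteq> S" "Cinf f UNIV" "\<And>x. x \<notin> K ==> f x = 0"
  using test_functionsE[OF f] by blast
 have eq: "(\<lambda>x. gradient f x \<bullet> e) = (\<lambda>x. frechet_derivative f (at x) e)"
  using gradient_inner[OF Cinf_has_derivative[OF K(3)]] by auto
 have z: "gradient f x \<bullet> e = 0" if "x \<notin> K" for x
 proof -
  have "((\<lambda>x. 0) has_derivative (\<lambda>e. 0)) (at x)" by simp
  then have "(f has_derivative (\<lambda>e. 0)) (at x)"
   by (rule has_derivative_transform_within_open[of _ _ _ _ "-K"]) (use K that compact_imp_closed in \<open>auto simp: open_Compl\<close>)
  from gradient_inner[OF this] show ?thesis by simp
 qed
 show ?thesis
  by (rule test_functionsI[of UNIV _ K, OF open_UNIV _ K(1) _ K(2) z])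
   (use eq Cinf_deriv[OF K(3), of e] in auto)
qed

lemma test_function_bounded:
 assumes "f \<in> test_functions S" obtains B where "B \<ge> 0" "\<And>x. \<bar>f x\<bar> \<le> B"
proof -
 obtain K where K: "compact K" "K \<subseteq> S" "Cinf f UNIV" "\<And>x. x \<notin> K ==> f x = 0"
  using test_functionsE[OF assms(1)] by blast
 have "compact (f ` K)" using K test_function_continuous[OF assms] by (auto intro: compact_continuous_image)
 then obtain B where B: "\<And>y. y \<in> f ` K ==> norm y \<le> B" using compact_imp_bounded bounded_iff by metis
 have "\<bar>f x\<bar> \<le> max B 0" for x using B[of "f x"] K(4)[of x] by (cases "x \<in> K") auto
 then show ?thesis by (intro that[of "max B 0"]) auto
qed

lemma test_function_outside: "f \<in> test_functions S ==> x \<notin> S ==> f x = 0"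
 by (erule test_functionsE) blast

lemma test_function_measurable: "f \<in> test_functions S ==> f \<in> BM"
 by (simp add: borel_measurable_continuous_onI test_function_continuous)

lemma test_function_gradient_measurable:
 assumes "f \<in> test_functions S" shows "gradient f \<in> BM"
 using test_function_measurable[OF test_function_deriv[OF assms]]
 by (subst borel_measurable_euclidean_space) simp

text \<open>The product is positive exactly inside the box, so a steep smooth step of it approximates the indicator of the box
from within.\<close>

definition box_bump :: "'a::euclidean_space => 'a => nat => 'a => real" where
 "box_bump a b m x = smooth_step (real m * (\<Prod>i\<in>Basis. flat_exp 0 ((x - a) \<bullet> i) * flat_exp 0 ((b - x) \<bullet> i)))"

lemma Cinf_box_bump: "Cinf (box_bump a b m) (UNIV :: 'a::euclidean_space set)"
proof -
 have lin: "Cinf (\<lambda>x. (x - a) \<bullet> i) (UNIV :: 'a set)" "Cinf (\<lambda>x. (b - x) \<bullet> i) (UNIV :: 'a set)" for i :: 'a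
  using Cinf_linear[OF open_UNIV bounded_linear_inner_left[of i]]
  by (auto simp: inner_diff_left intro!: Cinf_diff Cinf_const)
 have f: "Cinf (\<lambda>x. flat_exp 0 ((x - a) \<bullet> i)) (UNIV :: 'a set)" "Cinf (\<lambda>x. flat_exp 0 ((b - x) \<bullet> i)) (UNIV :: 'a set)" for i :: 'a
  by (rule Cinf_compose_real[OF _ _ _ lin(1) Cinf_flat_exp]; simp)
   (rule Cinf_compose_real[OF _ _ _ lin(2) Cinf_flat_exp]; simp)
 have "Cinf (\<lambda>x. real m * (\<Prod>i\<in>Basis. flat_exp 0 ((x - a) \<bullet> i) * flat_exp 0 ((b - x) \<bullet> i))) (UNIV :: 'a set)"
  by (intro Cinf_mult Cinf_const Cinf_prod open_UNIV f)
 from Cinf_compose_real[OF _ _ _ this Cinf_smooth_step]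
 show ?thesis unfolding box_bump_def[abs_def] by simp
qed

lemma box_bump_bounds: "0 \<le> box_bump a b m x" "box_bump a b m x \<le> 1"
 by (simp_all add: box_bump_def smooth_step_nonneg smooth_step_le_1)

lemma box_bump_outside:
 assumes "x \<notin> box a b" shows "box_bump a b m x = 0"
proof -
 obtain i where i: "i \<in> Basis" "\<not> (a \<bullet> i < x \<bullet> i \<and> x \<bullet> i < b \<bullet> i)"
  using assms by (auto simp: mem_box)
 then have "flat_exp 0 ((x - a) \<bullet> i) * flat_exp 0 ((b - x) \<bullet> i) = 0"
  by (auto simp: flat_exp_def inner_diff_left)
 then have z: "(\<Prod>i\<in>Basis. flat_exp 0 ((x - a) \<bullet> i) * flat_exp 0 ((b - x) \<bullet> i)) = 0"
  using i(1) by (intro prod_zero) auto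
 show ?thesis unfolding box_bump_def z by (simp add: smooth_step_0)
qed

lemma box_bump_tendsto: "(\<lambda>m. box_bump a b m x) \<longlonglongrightarrow> indicator (box a b) x"
proof (cases "x \<in> box a b")
 case False
 then show ?thesis by (simp add: box_bump_outside)
next
 case True
 define B where "B = (\<Prod>i\<in>Basis. flat_exp 0 ((x - a) \<bullet> i) * flat_exp 0 ((b - x) \<bullet> i))"
 have "B > 0" using True unfolding B_def
  by (intro prod_pos) (auto simp: flat_exp_def mem_box inner_diff_left)
 have "box_bump a b m x = 1" if "nat \<lceil>1 / B\<rceil> \<le> m" for m
 proof -
  have "1 / B \<le> real m" using that by linarith
  then have "1 \<le> real m * B" using \<open>B > 0\<close> by (simp add: field_simps)
  then show ?thesis unfolding box_bump_def B_def[symmetric] by (rule smooth_step_1)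
 qed
 then have "\<forall>\<^sub>F m in sequentially. box_bump a b m x = 1"
  unfolding eventually_sequentially by blast
 then show ?thesis using True by (simp add: tendsto_eventually)
qed

lemma box_bump_test: "cbox a b \<subseteq> S ==> box_bump a b m \<in> test_functions S"
 by (rule test_functionsI[of UNIV _ "cbox a b", OF open_UNIV Cinf_box_bump compact_cbox subset_UNIV])
  (use box_subset_cbox[of a b] box_bump_outside in blast)+

lemma box_bump_measurable [measurable]: "box_bump a b m \<in> BM"
 using box_bump_test[of a b UNIV m] by (simp add: test_function_measurable)

lemma open_UN_cbox:
 fixes S :: "'a::euclidean_space set"
 assumes "open S"
 obtains p q :: "nat => 'a" where "\<And>n. cbox (p n) (q n) \<subseteq> S" "S = (\<Union>n. cbox (p n) (q n))"
proof -
 obtain \<D> where D: "countable \<D>" "\<D> \<subseteq> Pow S" "\<And>X. X \<in> \<D> ==> \<exists>a b. X = cbox a b" "\<Union>\<D> = S"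
  using open_countable_Union_open_cbox[OF assms] by metis
 show thesis
 proof (cases "\<D> = {}")
  case True
  then have "S = {}" using D by auto
  then show ?thesis using that[of "\<lambda>n. One" "\<lambda>n. 0"] by (simp add: empty_as_interval[symmetric])
 next
  case False
  then have X: "range (from_nat_into \<D>) = \<D>" using D(1) by (rule range_from_nat_into)
  define X where "X = from_nat_into \<D>"
  note X = X[folded X_def]
  then have "\<forall>n. \<exists>a b. X n = cbox a b" using D(3) by blast
  from choice[OF this] obtain p where "\<forall>n. \<exists>b. X n = cbox (p n) b" ..
  from choice[OF this] obtain q where pq: "\<forall>n. X n = cbox (p n) (q n)" ..
  show ?thesis
  proof (rule that[of p q])
   show "cbox (p n) (q n) \<subseteq> S" for n using X D(2) pq by blast
   show "S = (\<Union>n. cbox (p n) (q n))" using X D(4) pq by auto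
  qed
 qed
qed

lemma AE_box_cbox: "AE x in lborel. x \<in> cbox a b --> x \<in> box a b"
proof -
 have "cbox a b - box a b \<in> null_sets lborel"
  using negligible_frontier_interval[of a b]
  by (subst null_sets_completion_iff[symmetric]) (auto simp: negligible_iff_null_sets)
 from AE_not_in[OF this] show ?thesis by eventually_elim auto
qed

lemma AE_in_open_iff_boxes:
 fixes S :: "'a::euclidean_space set"
 assumes "open S" "\<And>p q. cbox p q \<subseteq> S ==> AE x in lborel. x \<in> box p q --> P x"
 shows "AE x in lborel. x \<in> S --> P x"
proof -
 obtain p q :: "nat => 'a" where pq: "\<And>n. cbox (p n) (q n) \<subseteq> S" "S = (\<Union>n. cbox (p n) (q n))"
  using open_UN_cbox[OF assms(1)] by metis
 have "AE x in lborel. \<forall>n. x \<in> cbox (p n) (q n) --> P x"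
  unfolding AE_all_countable
 proof
  fix n
  show "AE x in lborel. x \<in> cbox (p n) (q n) --> P x"
   using assms(2)[OF pq(1), of n] AE_box_cbox[of "p n" "q n"] by eventually_elim auto
 qed
 then show ?thesis by eventually_elim (use pq in auto)
qed

text \<open>Open boxes are closed under intersection and generate the Borel sets.\<close>

lemma borel_induct_boxes [consumes 1, case_names box empty compl union]:
 fixes A :: "'a::euclidean_space set"
 assumes "A \<in> sets borel" "\<And>a b. P (box a b)" "P {}" "\<And>A. A \<in> sets borel ==> P A ==> P (UNIV - A)"
  "\<And>F. disjoint_family F ==> (\<And>i::nat. F i \<in> sets borel) ==> (\<And>i. P (F i)) ==> P (\<Union>i. F i)"
 shows "P A"
proof -
 have "Int_stable (range (\<lambda>(a, b). box a b :: 'a set))"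
  by (auto simp: Int_stable_def box_Int_box)
 moreover have "(range (\<lambda>(a, b). box a b :: 'a set)) \<subseteq> Pow UNIV" by auto
 moreover have "A \<in> sigma_sets UNIV (range (\<lambda>(a, b). box a b))"
  using assms(1) unfolding borel_eq_box by simp
 ultimately show ?thesis
 proof (induction rule: sigma_sets_induct_disjoint)
  case (compl A)
  then show ?case using assms(4)[of A] by (simp add: borel_eq_box)
 next
  case (union F)
  then show ?case using assms(5)[of F] by (simp add: borel_eq_box subset_eq)
 qed (use assms(2,3) in auto)
qed

lemma AE_zero_if_integral_zero_borel:
 fixes h :: "'a::euclidean_space => real"
 assumes h: "integrable lborel h" and z: "\<And>A. A \<in> sets borel ==> (LINT x|lborel. indicator A x * h x) = 0"
 shows "AE x in lborel. h x = 0"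
proof -
 have [measurable]: "h \<in> BM" using h by simp
 have "AE x in lborel. indicator {x. h x > 0} x * h x = 0"
  using z[of "{x. h x > 0}"] h
  by (intro integral_nonneg_eq_0_iff_AE[THEN iffD1])
   (auto simp: indicator_def intro!: Bochner_Integration.integrable_bound[OF h])
 moreover have "AE x in lborel. - (indicator {x. h x < 0} x * h x) = 0"
  using z[of "{x. h x < 0}"] h
  by (intro integral_nonneg_eq_0_iff_AE[THEN iffD1] integrable_minus)
   (auto simp: indicator_def intro!: Bochner_Integration.integrable_bound[OF h])
 ultimately show ?thesis by eventually_elim (auto simp: indicator_def split: if_splits)
qed

text \<open>Bumps on boxes converge to indicators, so \<open>g\<close> has integral zero over every box inside \<open>S\<close>; a
Dynkin argument extends this to Borel subsets of a fixed box, and boxes exhaust \<open>S\<close>.\<close>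

lemma fundamental_lemma_lborel:
 fixes g :: "'a::euclidean_space => real"
 assumes "open S" and [measurable]: "g \<in> BM"
  and int: "\<And>p q. cbox p q \<subseteq> S ==> set_integrable lborel (cbox p q) g"
  and z: "\<And>\<phi>. \<phi> \<in> test_functions S ==> (LINT x|lborel. \<phi> x * g x) = 0"
 shows "AE x in lborel. x \<in> S --> g x = 0"
proof (rule AE_in_open_iff_boxes[OF assms(1)])
 fix p q assume pq: "cbox p q \<subseteq> S"
 define h where "h x = indicator (box p q) x * g x" for x
 have ic: "integrable lborel (\<lambda>x. indicator (cbox p q) x * g x)"
  using int[OF pq] by (simp add: set_integrable_def)
 have ih: "integrable lborel h" unfolding h_def
  by (rule Bochner_Integration.integrable_bound[OF ic]) (use box_subset_cbox[of p q] in \<open>auto simp: indicator_def\<close>)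
 have [measurable]: "h \<in> BM" using ih by simp
 have iA: "integrable lborel (\<lambda>x. indicator A x * h x)" if [measurable]: "A \<in> sets borel" for A
  by (rule Bochner_Integration.integrable_bound[OF ih]) (auto simp: indicator_def)
 have zA: "(LINT x|lborel. indicator A x * h x) = 0" if "A \<in> sets borel" for A
  using that
 proof (induction A rule: borel_induct_boxes)
  case (box a b)
  have "(\<lambda>m. LINT x|lborel. box_bump p q m x * box_bump a b m x * g x) \<longlonglongrightarrow> (LINT x|lborel. indicator (box a b) x * h x)"
  proof (rule integral_dominated_convergence[where w="\<lambda>x. norm (indicator (cbox p q) x * g x)"])
   show "AE x in lborel. (\<lambda>m. box_bump p q m x * box_bump a b m x * g x) \<longlonglongrightarrow> indicator (box a b) x * h x"
   proof (intro always_eventually allI)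
    fix x show "(\<lambda>m. box_bump p q m x * box_bump a b m x * g x) \<longlonglongrightarrow> indicator (box a b) x * h x"
     using tendsto_mult[OF tendsto_mult[OF box_bump_tendsto[of p q x] box_bump_tendsto[of a b x]] tendsto_const[of "g x"]]
     by (simp add: h_def mult_ac)
   qed
   show "AE x in lborel. norm (box_bump p q m x * box_bump a b m x * g x) \<le> norm (indicator (cbox p q) x * g x)" for m
   proof (intro always_eventually allI)
    fix x
    have "\<bar>box_bump p q m x * box_bump a b m x\<bar> \<le> 1"
     using mult_mono[OF box_bump_bounds(2)[of p q m x] box_bump_bounds(2)[of a b m x]]
      box_bump_bounds(1)[of p q m x] box_bump_bounds(1)[of a b m x]
     by simp
    then have "\<bar>box_bump p q m x * box_bump a b m x\<bar> * \<bar>g x\<bar> \<le> \<bar>g x\<bar>"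
     using mult_right_mono[of _ 1 "\<bar>g x\<bar>"] by simp
    then show "norm (box_bump p q m x * box_bump a b m x * g x) \<le> norm (indicator (cbox p q) x * g x)"
     using box_bump_outside[of x p q m] box_subset_cbox[of p q]
     by (cases "x \<in> box p q") (auto simp: abs_mult)
   qed
   show "integrable lborel (\<lambda>x. norm (indicator (cbox p q) x * g x))" using ic by (rule integrable_norm)
  qed (simp_all add: h_def)
  moreover have "(LINT x|lborel. box_bump p q m x * box_bump a b m x * g x) = 0" for m
   using z[OF test_functions_mult[OF box_bump_test[OF pq, of m] assms(1) Cinf_subset[OF Cinf_box_bump[of a b m]]]] by simp
  ultimately show ?case by (simp add: LIMSEQ_const_iff)
 next
  case (compl A)
  have "(LINT x|lborel. indicator UNIV x * h x) = 0"
  proof -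
   have "(\<lambda>m. LINT x|lborel. box_bump p q m x * g x) \<longlonglongrightarrow> (LINT x|lborel. h x)"
   proof (rule integral_dominated_convergence[where w="\<lambda>x. norm (indicator (cbox p q) x * g x)"])
    show "AE x in lborel. (\<lambda>m. box_bump p q m x * g x) \<longlonglongrightarrow> h x"
     unfolding h_def by (intro always_eventually allI tendsto_intros box_bump_tendsto)
    show "AE x in lborel. norm (box_bump p q m x * g x) \<le> norm (indicator (cbox p q) x * g x)" for m
    proof (intro always_eventually allI)
     fix x
     have "\<bar>box_bump p q m x\<bar> * \<bar>g x\<bar> \<le> \<bar>g x\<bar>"
      using mult_right_mono[of "\<bar>box_bump p q m x\<bar>" 1 "\<bar>g x\<bar>"] box_bump_bounds[of p q m x] by simp
     then show "norm (box_bump p q m x * g x) \<le> norm (indicator (cbox p q) x * g x)"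
      using box_bump_outside[of x p q m] box_subset_cbox[of p q]
      by (cases "x \<in> box p q") (auto simp: abs_mult)
    qed
    show "integrable lborel (\<lambda>x. norm (indicator (cbox p q) x * g x))" using ic by (rule integrable_norm)
   qed (simp_all add: h_def)
   moreover have "(LINT x|lborel. box_bump p q m x * g x) = 0" for m
    using z[OF box_bump_test[OF pq, of m]] by simp
   ultimately show ?thesis by (simp add: LIMSEQ_const_iff)
  qed
  then have "0 = (LINT x|lborel. indicator UNIV x * h x - indicator A x * h x)"
   using compl ih iA by (subst Bochner_Integration.integral_diff) auto
  also have "... = (LINT x|lborel. indicator (UNIV - A) x * h x)"
   by (intro Bochner_Integration.integral_cong) (auto simp: indicator_def)
  finally show ?case by simp
 next
  case (union F)
  have [measurable]: "\<And>i. F i \<in> sets borel" by fact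
  have "(LINT x:(\<Union>i. F i)|lborel. h x) = (\<Sum>i. LINT x:F i|lborel. h x)"
  proof (rule lebesgue_integral_countable_add)
   show "set_integrable lborel (\<Union>i. F i) h" using iA[of "\<Union>i. F i"] by (simp add: set_integrable_def)
  qed (use union in \<open>auto simp: disjoint_family_on_def\<close>)
  then show ?case using union by (simp add: set_lebesgue_integral_def)
 qed simp
 have "AE x in lborel. h x = 0" by (rule AE_zero_if_integral_zero_borel[OF ih]) (rule zA)
 then show "AE x in lborel. x \<in> box p q --> g x = 0"
  by eventually_elim (auto simp: h_def)
qed

section \<open>Square integrable functions and density of test functions\<close>

text \<open>Representatives of elements of \<open>L\<^sub>2\<close>: Borel functions defined everywhere, on the whole
space.\<close>

definition sqint :: "('a::euclidean_space => 'b::euclidean_space) => bool" where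
 "sqint f \<longleftrightarrow> f \<in> BM \<and> integrable lborel (\<lambda>x. (norm (f x))\<^sup>2)"

definition sqn :: "('a::euclidean_space => 'b::euclidean_space) => real" where
 "sqn f = (LINT x|lborel. (norm (f x))\<^sup>2)"

lemma sqn_nonneg: "0 \<le> sqn f" by (simp add: sqn_def)

lemma sqint_measurable [measurable_dest]: "sqint f ==> f \<in> BM" by (simp add: sqint_def)

lemma sqint_bound:
 assumes "sqint f" "g \<in> BM" "AE x in lborel. norm (g x) \<le> c * norm (f x)" "c \<ge> 0"
 shows "sqint g" "sqn g \<le> c\<^sup>2 * sqn f"
proof -
 have i: "integrable lborel (\<lambda>x. c\<^sup>2 * (norm (f x))\<^sup>2)" using assms(1) by (simp add: sqint_def)
 have b: "AE x in lborel. (norm (g x))\<^sup>2 \<le> c\<^sup>2 * (norm (f x))\<^sup>2"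
  using assms(3) by eventually_elim (simp add: power_mult_distrib[symmetric] power_mono)
 have "integrable lborel (\<lambda>x. (norm (g x))\<^sup>2)"
  by (rule Bochner_Integration.integrable_bound[OF i]) (use b assms(2) in auto)
 then show "sqint g" "sqn g \<le> c\<^sup>2 * sqn f"
  using assms(2) integral_mono_AE[OF _ i b] by (auto simp: sqint_def sqn_def)
qed

lemma norm_add_sq: "(norm (a + b :: 'b::real_normed_vector))\<^sup>2 \<le> 2 * (norm a)\<^sup>2 + 2 * (norm b)\<^sup>2"
proof -
 have "(norm (a + b))\<^sup>2 \<le> (norm a + norm b)\<^sup>2" by (simp add: norm_triangle_ineq power_mono)
 also have "... \<le> 2 * (norm a)\<^sup>2 + 2 * (norm b)\<^sup>2" using sum_squares_bound[of "norm a" "norm b"] by (simp add: power2_sum)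
 finally show ?thesis .
qed

lemma sqint_add:
 assumes "sqint f" "sqint g"
 shows "sqint (\<lambda>x. f x + g x)" "sqn (\<lambda>x. f x + g x) \<le> 2 * sqn f + 2 * sqn g"
proof -
 have [measurable]: "f \<in> BM" "g \<in> BM" using assms by (auto simp: sqint_def)
 have i: "integrable lborel (\<lambda>x. 2 * (norm (f x))\<^sup>2 + 2 * (norm (g x))\<^sup>2)" using assms by (simp add: sqint_def)
 have j: "integrable lborel (\<lambda>x. (norm (f x + g x))\<^sup>2)"
  by (rule Bochner_Integration.integrable_bound[OF i]) (use norm_add_sq in \<open>auto simp: abs_of_nonneg intro!: always_eventually\<close>)
 show "sqint (\<lambda>x. f x + g x)" using j by (auto simp: sqint_def)
 have "sqn (\<lambda>x. f x + g x) \<le> (LINT x|lborel. 2 * (norm (f x))\<^sup>2 + 2 * (norm (g x))\<^sup>2)"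
  unfolding sqn_def by (intro integral_mono j i norm_add_sq)
 also have "... = 2 * sqn f + 2 * sqn g" using assms by (simp add: sqint_def sqn_def)
 finally show "sqn (\<lambda>x. f x + g x) \<le> 2 * sqn f + 2 * sqn g" .
qed

lemma sqint_scale: "sqint f ==> sqint (\<lambda>x. c *\<^sub>R f x)" "sqn (\<lambda>x. c *\<^sub>R f x) = c\<^sup>2 * sqn f"
 by (auto simp: sqint_def sqn_def power_mult_distrib)

lemma sqint_uminus: "sqint f ==> sqint (\<lambda>x. - f x)" "sqn (\<lambda>x. - f x) = sqn f"
 by (auto simp: sqint_def sqn_def)

lemma sqint_diff:
 assumes "sqint f" "sqint g"
 shows "sqint (\<lambda>x. f x - g x)" "sqn (\<lambda>x. f x - g x) \<le> 2 * sqn f + 2 * sqn g"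
 using sqint_add[OF assms(1) sqint_uminus(1)[OF assms(2)]] sqint_uminus(2)[of g] by auto

lemma sqint_zero: "sqint (\<lambda>x. 0)" by (simp add: sqint_def)

lemma sqint_sum: "(\<And>i. i \<in> I ==> sqint (f i)) ==> sqint (\<lambda>x. \<Sum>i\<in>I. f i x)"
 by (induction I rule: infinite_finite_induct) (auto intro: sqint_zero sqint_add)

lemma sqint_inner:
 assumes "sqint f" "sqint g"
 shows "integrable lborel (\<lambda>x. f x \<bullet> g x)"
  "\<bar>LINT x|lborel. f x \<bullet> g x\<bar> \<le> sqrt (sqn f) * sqrt (sqn g)"
proof -
 have [measurable]: "f \<in> BM" "g \<in> BM" using assms by (auto simp: sqint_def)
 have ae: "2 * (norm (f x) * norm (g x)) \<le> (norm (f x))\<^sup>2 + (norm (g x))\<^sup>2" for x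
  using sum_squares_bound[of "norm (f x)" "norm (g x)"] by simp
 have i: "integrable lborel (\<lambda>x. (norm (f x))\<^sup>2 + (norm (g x))\<^sup>2)" using assms by (simp add: sqint_def)
 have n: "integrable lborel (\<lambda>x. norm (f x) * norm (g x))"
  by (rule Bochner_Integration.integrable_bound[OF i]) (use ae in \<open>auto simp: abs_of_nonneg intro!: always_eventually order_trans[OF _ ae]\<close>)
 show int: "integrable lborel (\<lambda>x. f x \<bullet> g x)"
  by (rule Bochner_Integration.integrable_bound[OF n]) (auto simp: Cauchy_Schwarz_ineq2 intro!: always_eventually)
 have key: "\<bar>LINT x|lborel. f x \<bullet> g x\<bar> * 2 \<le> t\<^sup>2 * sqn f + (1/t)\<^sup>2 * sqn g" if "t > 0" for t
 proof -
  have p: "\<bar>f x \<bullet> g x\<bar> * 2 \<le> t\<^sup>2 * (norm (f x))\<^sup>2 + (1/t)\<^sup>2 * (norm (g x))\<^sup>2" for x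
  proof -
   have "\<bar>f x \<bullet> g x\<bar> * 2 \<le> 2 * (t * norm (f x)) * ((1/t) * norm (g x))"
    using Cauchy_Schwarz_ineq2[of "f x" "g x"] that by simp
   also have "... \<le> (t * norm (f x))\<^sup>2 + ((1/t) * norm (g x))\<^sup>2" by (rule sum_squares_bound)
   finally show ?thesis by (simp only: power_mult_distrib)
  qed
  have "\<bar>LINT x|lborel. f x \<bullet> g x\<bar> * 2 \<le> (LINT x|lborel. \<bar>f x \<bullet> g x\<bar>) * 2"
   by (simp add: integral_abs_bound)
  also have "... = (LINT x|lborel. \<bar>f x \<bullet> g x\<bar> * 2)" by simp
  also have "... \<le> (LINT x|lborel. t\<^sup>2 * (norm (f x))\<^sup>2 + (1/t)\<^sup>2 * (norm (g x))\<^sup>2)"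
   by (intro integral_mono p) (use assms int in \<open>auto simp: sqint_def\<close>)
  also have "... = t\<^sup>2 * sqn f + (1/t)\<^sup>2 * sqn g" using assms by (simp add: sqint_def sqn_def)
  finally show ?thesis .
 qed
 define a b where "a = sqrt (sqn f)" and "b = sqrt (sqn g)"
 have ab: "sqn f = a\<^sup>2" "sqn g = b\<^sup>2" "a \<ge> 0" "b \<ge> 0" by (auto simp: a_def b_def sqn_nonneg)
 have "\<bar>LINT x|lborel. f x \<bullet> g x\<bar> \<le> a * b + e * (a + b + e)" if e: "e > 0" for e
 proof -
  have p: "a + e > 0" "b + e > 0" using ab e by auto
  define t where "t = sqrt ((b + e) / (a + e))"
  have t: "t > 0" "t\<^sup>2 = (b + e) / (a + e)" "(1/t)\<^sup>2 = (a + e) / (b + e)" using p by (auto simp: t_def power_divide)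
  have "\<bar>LINT x|lborel. f x \<bullet> g x\<bar> * 2 \<le> (b + e) / (a + e) * a\<^sup>2 + (a + e) / (b + e) * b\<^sup>2"
   using key[OF t(1)] t ab by simp
  also have "... \<le> (b + e) / (a + e) * (a + e)\<^sup>2 + (a + e) / (b + e) * (b + e)\<^sup>2"
   using ab e p by (intro add_mono mult_left_mono power_mono) auto
  also have "... = 2 * (a + e) * (b + e)" using p by (simp add: power2_eq_square)
  finally show ?thesis by (simp add: algebra_simps)
 qed note le = this
 have "((\<lambda>e. a * b + e * (a + b + e)) \<longlongrightarrow> a * b + 0 * (a + b + 0)) (at_right 0)"
  by (intro tendsto_intros)
 then have "\<bar>LINT x|lborel. f x \<bullet> g x\<bar> \<le> a * b + 0 * (a + b + 0)"
  by (rule tendsto_lowerbound) (auto simp: eventually_at_filter intro!: always_eventually le)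
 then show "\<bar>LINT x|lborel. f x \<bullet> g x\<bar> \<le> sqrt (sqn f) * sqrt (sqn g)" by (simp add: a_def b_def)
qed

lemma sqn_dominated:
 fixes f :: "'a::euclidean_space => 'b::euclidean_space"
 assumes "\<And>n. s n \<in> BM" "f \<in> BM" "sqint w"
  "\<And>n x. norm (s n x) \<le> norm (w x)" "AE x in lborel. (\<lambda>n. s n x) \<longlonglongrightarrow> f x"
 shows "\<And>n. sqint (s n)" "sqint f" "(\<lambda>n. sqn (\<lambda>x. s n x - f x)) \<longlonglongrightarrow> 0"
proof -
 note [measurable] = assms(1,2)
 have le: "AE x in lborel. norm (f x) \<le> norm (w x)"
  using assms(5)
 proof eventually_elim
  case (elim x)
  show ?case by (rule tendsto_upperbound[OF tendsto_norm[OF elim]]) (auto simp: assms(4))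
 qed
 show s: "\<And>n. sqint (s n)" by (rule sqint_bound(1)[OF assms(3), of _ 1]) (auto simp: assms(4))
 show f: "sqint f" by (rule sqint_bound(1)[OF assms(3), of _ 1]) (use le in auto)
 have "(\<lambda>n. LINT x|lborel. (norm (s n x - f x))\<^sup>2) \<longlonglongrightarrow> (LINT x|(lborel :: 'a measure). (0::real))"
 proof (rule integral_dominated_convergence[where w="\<lambda>x. (2 * norm (w x))\<^sup>2"])
  show "integrable lborel (\<lambda>x. (2 * norm (w x))\<^sup>2)" using assms(3) by (simp add: sqint_def power_mult_distrib)
  show "AE x in lborel. (\<lambda>n. (norm (s n x - f x))\<^sup>2) \<longlonglongrightarrow> 0" using assms(5)
  proof eventually_elim
   case (elim x)
   then have "(\<lambda>n. (norm (s n x - f x))\<^sup>2) \<longlonglongrightarrow> (norm (f x - f x))\<^sup>2"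
    by (intro tendsto_intros)
   then show ?case by simp
  qed
  show "AE x in lborel. norm ((norm (s n x - f x))\<^sup>2) \<le> (2 * norm (w x))\<^sup>2" for n
   using le
  proof eventually_elim
   case (elim x)
   then have "norm (s n x - f x) \<le> 2 * norm (w x)" using norm_triangle_ineq4[of "s n x" "f x"] assms(4)[of n x] by linarith
   then have "(norm (s n x - f x))\<^sup>2 \<le> (2 * norm (w x))\<^sup>2" by (rule power_mono) simp
   then show ?case by simp
  qed
 qed auto
 then show "(\<lambda>n. sqn (\<lambda>x. s n x - f x)) \<longlonglongrightarrow> 0" by (simp add: sqn_def)
qed

lemma test_function_sqint:
 assumes "\<phi> \<in> test_functions S" shows "sqint \<phi>"
proof -
 obtain K where K: "compact K" "\<And>x. x \<notin> K ==> \<phi> x = 0" using test_functionsE[OF assms] by metis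
 obtain B where B: "B \<ge> 0" "\<And>x. \<bar>\<phi> x\<bar> \<le> B" using test_function_bounded[OF assms] by metis
 have [measurable]: "K \<in> sets borel" "\<phi> \<in> BM"
  using K(1) assms by (auto simp: compact_imp_closed borel_closed test_function_measurable)
 have "integrable lborel (\<lambda>x. indicator K x * B\<^sup>2)"
  using K(1) emeasure_compact_finite[of K] by (auto intro!: integrable_mult_left integrable_real_indicator)
 then have "integrable lborel (\<lambda>x. (norm (\<phi> x))\<^sup>2)"
 proof (rule Bochner_Integration.integrable_bound[where g="\<lambda>x. (norm (\<phi> x))\<^sup>2"])
  show "AE x in lborel. norm ((norm (\<phi> x))\<^sup>2) \<le> norm (indicator K x * B\<^sup>2)"
   using K(2) B power_mono[of "\<bar>\<phi> x\<bar>" B 2 for x] by (auto simp: indicator_def intro!: always_eventually)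
 qed auto
 then show ?thesis by (simp add: sqint_def)
qed

text \<open>Density is proved as a closure property: this set is stable under sums, multiples and dominated limits.\<close>

definition L2_test_closure :: "'a::euclidean_space set => ('a => real) set" where
 "L2_test_closure S = {f. sqint f \<and> (\<forall>e>0. \<exists>\<phi>\<in>test_functions S. sqn (\<lambda>x. f x - \<phi> x) < e)}"

lemma L2_test_closureD:
 "f \<in> L2_test_closure S ==> e > 0 ==> \<exists>\<phi>\<in>test_functions S. sqn (\<lambda>x. f x - \<phi> x) < e"
 by (simp add: L2_test_closure_def)

lemma L2_test_closure_add:
 assumes "f \<in> L2_test_closure S" "g \<in> L2_test_closure S"
 shows "(\<lambda>x. f x + g x) \<in> L2_test_closure S"
proof -
 have "\<exists>\<phi>\<in>test_functions S. sqn (\<lambda>x. f x + g x - \<phi> x) < e" if "e > 0" for e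
 proof -
  have e: "e / 4 > 0" using that by simp
  obtain \<phi> where p1: "\<phi> \<in> test_functions S" "sqn (\<lambda>x. f x - \<phi> x) < e/4"
   using L2_test_closureD[OF assms(1) e] by blast
  obtain \<psi> where p2: "\<psi> \<in> test_functions S" "sqn (\<lambda>x. g x - \<psi> x) < e/4"
   using L2_test_closureD[OF assms(2) e] by blast
  note p = p1 p2
  have "sqn (\<lambda>x. (f x - \<phi> x) + (g x - \<psi> x)) \<le> 2 * sqn (\<lambda>x. f x - \<phi> x) + 2 * sqn (\<lambda>x. g x - \<psi> x)"
   using assms p by (intro sqint_add sqint_diff) (auto simp: L2_test_closure_def intro: test_function_sqint)
  then have "sqn (\<lambda>x. f x + g x - (\<phi> x + \<psi> x)) < e" using p by (simp add: algebra_simps)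
  then show ?thesis using test_functions_add[OF p1(1) p2(1)] by (intro bexI[where x="\<lambda>x. \<phi> x + \<psi> x"])
 qed
 then show ?thesis using assms sqint_add by (auto simp: L2_test_closure_def)
qed

lemma L2_test_closure_scale:
 assumes "f \<in> L2_test_closure S" shows "(\<lambda>x. c * f x) \<in> L2_test_closure S"
proof -
 have "\<exists>\<phi>\<in>test_functions S. sqn (\<lambda>x. c * f x - \<phi> x) < e" if "e > 0" for e
 proof -
  have "e / (c\<^sup>2 + 1) > 0" using that by (simp add: add_nonneg_pos)
  then obtain \<phi> where p: "\<phi> \<in> test_functions S" "sqn (\<lambda>x. f x - \<phi> x) < e / (c\<^sup>2 + 1)"
   using assms unfolding L2_test_closure_def by blast
  have "sqn (\<lambda>x. c * f x - c * \<phi> x) = c\<^sup>2 * sqn (\<lambda>x. f x - \<phi> x)"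
   using sqint_scale(2)[of c "\<lambda>x. f x - \<phi> x"] by (simp add: algebra_simps)
  also have "... \<le> (c\<^sup>2 + 1) * sqn (\<lambda>x. f x - \<phi> x)" using sqn_nonneg by (intro mult_right_mono) auto
  also have "... < (c\<^sup>2 + 1) * (e / (c\<^sup>2 + 1))" using p(2) by (intro mult_strict_left_mono) (simp_all add: add_nonneg_pos)
  also have "... = e" by (smt (verit) nonzero_mult_div_cancel_left times_divide_eq_right zero_le_power2)
  finally show ?thesis using test_functions_cmult[OF p(1), of c] by (intro bexI[where x="\<lambda>x. c * \<phi> x"])
 qed
 then show ?thesis using assms sqint_scale(1)[of f c] by (auto simp: L2_test_closure_def)
qed

lemma L2_test_closure_limit:
 assumes "\<And>n. s n \<in> L2_test_closure S" "sqint f" "(\<lambda>n. sqn (\<lambda>x. s n x - f x)) \<longlonglongrightarrow> 0"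
 shows "f \<in> L2_test_closure S"
proof -
 have "\<exists>\<phi>\<in>test_functions S. sqn (\<lambda>x. f x - \<phi> x) < e" if "e > 0" for e
 proof -
  have "e / 4 > 0" using that by simp
  from eventually_happens'[OF sequentially_bot order_tendstoD(2)[OF assms(3) this]]
  obtain n where n: "sqn (\<lambda>x. s n x - f x) < e/4" ..
  obtain \<phi> where p: "\<phi> \<in> test_functions S" "sqn (\<lambda>x. s n x - \<phi> x) < e/4"
   using L2_test_closureD[OF assms(1)[of n] \<open>e / 4 > 0\<close>] by blast
  have s: "sqint (s n)" using assms(1)[of n] by (simp add: L2_test_closure_def)
  have "sqn (\<lambda>x. (s n x - \<phi> x) - (s n x - f x)) \<le> 2 * sqn (\<lambda>x. s n x - \<phi> x) + 2 * sqn (\<lambda>x. s n x - f x)"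
   by (intro sqint_diff s assms(2) test_function_sqint[OF p(1)])
  then have "sqn (\<lambda>x. f x - \<phi> x) < e" using p n by (simp add: algebra_simps)
  then show ?thesis using p(1) by (intro bexI[where x=\<phi>])
 qed
 then show ?thesis using assms(2) by (auto simp: L2_test_closure_def)
qed

lemma L2_test_closure_test: "\<phi> \<in> test_functions S ==> \<phi> \<in> L2_test_closure S"
 by (auto simp: L2_test_closure_def test_function_sqint sqn_def intro!: bexI[of _ \<phi>])

lemma L2_test_closure_dominated:
 assumes "\<And>n. s n \<in> L2_test_closure S" "f \<in> BM" "sqint w"
  "\<And>n x. norm (s n x) \<le> norm (w x)" "AE x in lborel. (\<lambda>n. s n x) \<longlonglongrightarrow> f x"
 shows "f \<in> L2_test_closure S"
proof -
 have m: "\<And>n. s n \<in> BM" using assms(1) by (auto simp: L2_test_closure_def sqint_def)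
 show ?thesis
  by (rule L2_test_closure_limit[OF assms(1) sqn_dominated(2,3)[OF m assms(2-5)]])
qed

lemma sqint_indicator_box: "sqint (indicator (box p q) :: 'a::euclidean_space => real)"
proof -
 have "(\<lambda>x. (norm (indicator (box p q) x :: real))\<^sup>2) = indicator (box p q)" by (auto simp: indicator_def)
 then show ?thesis by (simp add: sqint_def integrable_indicator_iff emeasure_lborel_box_eq)
qed

text \<open>The Borel sets \<open>A\<close> with this property form a Dynkin system that contains all boxes.\<close>

lemma L2_test_closure_indicator:
 fixes S :: "'a::euclidean_space set"
 assumes "open S" "cbox p q \<subseteq> S" "A \<in> sets borel"
 shows "(\<lambda>x. indicator A x * indicator (box p q) x) \<in> L2_test_closure S"
 using assms(3)
proof (induction A rule: borel_induct_boxes)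
 case (box a b)
 show ?case
 proof (rule L2_test_closure_dominated[where w="indicator (box p q) :: 'a => real" and s="\<lambda>m x. box_bump p q m x * box_bump a b m x"])
  show "(\<lambda>x. box_bump p q n x * box_bump a b n x) \<in> L2_test_closure S" for n
   by (intro L2_test_closure_test test_functions_mult box_bump_test assms(1,2) Cinf_subset[OF Cinf_box_bump]) auto
  show "norm (box_bump p q n x * box_bump a b n x) \<le> norm (indicator (box p q) x :: real)" for n x
   using box_bump_bounds[of p q n x] box_bump_bounds[of a b n x] box_bump_outside[of x p q n]
   by (auto simp: indicator_def abs_mult intro!: mult_le_one)
  show "AE x in lborel. (\<lambda>m. box_bump p q m x * box_bump a b m x) \<longlonglongrightarrow> indicator (box a b) x * indicator (box p q) x"
   using tendsto_mult[OF box_bump_tendsto[of a b] box_bump_tendsto[of p q]] by (auto simp: mult.commute intro!: always_eventually)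
 qed (auto simp: sqint_indicator_box)
next
 case empty
 show ?case using L2_test_closure_test[OF test_functions_zero] by simp
next
 case (compl A)
 have "(indicator (box p q) :: 'a => real) \<in> L2_test_closure S"
 proof (rule L2_test_closure_dominated[where w="indicator (box p q) :: 'a => real" and s="\<lambda>m x. box_bump p q m x"])
  show "box_bump p q n \<in> L2_test_closure S" for n
   by (intro L2_test_closure_test box_bump_test assms(2))
  show "norm (box_bump p q n x) \<le> norm (indicator (box p q) x :: real)" for n x
   using box_bump_bounds[of p q n x] box_bump_outside[of x p q n]
   by (auto simp: indicator_def)
 qed (auto simp: sqint_indicator_box box_bump_tendsto)
 then have "(\<lambda>x. indicator (box p q) x + (-1) * (indicator A x * indicator (box p q) x)) \<in> L2_test_closure S"
  by (rule L2_test_closure_add[OF _ L2_test_closure_scale[OF compl(2)]])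
 moreover have "(\<lambda>x. indicator (box p q) x + (-1) * (indicator A x * indicator (box p q) x))
   = (\<lambda>x. indicator (UNIV - A) x * indicator (box p q) x :: real)"
  by (auto simp: indicator_def)
 ultimately show ?case by simp
next
 case (union F)
 have [measurable]: "\<And>i. F i \<in> sets borel" by fact
 have sum: "(\<lambda>x. \<Sum>i<n. indicator (F i) x * indicator (box p q) x) \<in> L2_test_closure S" for n
 proof (induction n)
  case 0
  show ?case using L2_test_closure_test[OF test_functions_zero] by simp
 next
  case (Suc n)
  show ?case using L2_test_closure_add[OF Suc union(3)[of n]] by (simp only: sum.lessThan_Suc)
 qed
 have eq: "(\<Sum>i<n. indicator (F i) x * indicator (box p q) x) = indicator (\<Union>i<n. F i) x * (indicator (box p q) x :: real)" for n x
 proof -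
  have "(indicator (\<Union>i<n. F i) x :: real) = (\<Sum>i<n. indicator (F i) x)"
   using union(1) by (intro indicator_UN_disjoint) (auto simp: disjoint_family_on_def)
  then show ?thesis by (simp add: sum_distrib_right)
 qed
 show ?case
 proof (rule L2_test_closure_dominated[where w="indicator (box p q) :: 'a => real" and s="\<lambda>n x. indicator (\<Union>i<n. F i) x * indicator (box p q) x"])
  show "(\<lambda>x. indicator (\<Union>i<n. F i) x * indicator (box p q) x) \<in> L2_test_closure S" for n
   using sum[of n] by (simp only: eq)
  show "AE x in lborel. (\<lambda>n. indicator (\<Union>i<n. F i) x * indicator (box p q) x) \<longlonglongrightarrow> (indicator (\<Union>i. F i) x * indicator (box p q) x :: real)"
   by (intro always_eventually allI tendsto_mult LIMSEQ_indicator_UN tendsto_const)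
 qed (auto simp: sqint_indicator_box indicator_def)
qed

text \<open>Nonnegative Borel functions are limits of increasing sequences of simple functions.\<close>

lemma L2_test_closure_box_nonneg:
 fixes S :: "'a::euclidean_space set" and f :: "'a => real"
 assumes "open S" "cbox p q \<subseteq> S" "f \<in> BM" "\<And>x. 0 \<le> f x"
  "sqint (\<lambda>x. f x * indicator (box p q) x)"
 shows "(\<lambda>x. f x * indicator (box p q) x) \<in> L2_test_closure S"
 using assms(3,4,5)
proof (induction f rule: borel_measurable_induct_real)
 case (set A)
 then show ?case using L2_test_closure_indicator[OF assms(1,2)] by auto
next
 case (mult u c)
 show ?case
 proof (cases "c = 0")
  case True
  then show ?thesis using L2_test_closure_test[OF test_functions_zero] by simp
 next
  case False
  have "sqint (\<lambda>x. u x * indicator (box p q) x)"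
   using sqint_scale(1)[OF mult.prems, of "1/c"] False by (simp add: mult.assoc)
  then show ?thesis using L2_test_closure_scale[OF mult.IH, of c] by (simp add: mult.assoc)
 qed
next
 case (add u v)
 note [measurable] = add.hyps(1,3)
 have "sqint (\<lambda>x. u x * indicator (box p q) x)" "sqint (\<lambda>x. v x * indicator (box p q) x)"
 proof -
  have le: "\<bar>u x\<bar> \<le> \<bar>v x + u x\<bar>" "\<bar>v x\<bar> \<le> \<bar>v x + u x\<bar>" for x using add.hyps(2)[of x] add.hyps(4)[of x] by auto
  show "sqint (\<lambda>x. u x * indicator (box p q) x)"
   by (rule sqint_bound(1)[OF add.prems, of _ 1]) (use le(1) in \<open>auto split: split_indicator\<close>)
  show "sqint (\<lambda>x. v x * indicator (box p q) x)"
   by (rule sqint_bound(1)[OF add.prems, of _ 1]) (use le(2) in \<open>auto split: split_indicator\<close>)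
 qed
 then show ?case using L2_test_closure_add[OF add.IH(2) add.IH(1)] by (simp add: distrib_right)
next
 case (seq U)
 note [measurable] = seq.hyps(1)
 have le: "U i x \<le> f x" for i x using seq.hyps(3,4) by (intro incseq_le[where X="\<lambda>i. U i x"]) (auto simp: incseq_def le_fun_def)
 have si: "sqint (\<lambda>x. U i x * indicator (box p q) x)" for i
  by (rule sqint_bound(1)[OF seq.prems, of _ 1]) (use seq.hyps(2) order_trans[OF le abs_ge_self] in \<open>auto split: split_indicator\<close>)
 show ?case
 proof (rule L2_test_closure_dominated[where w="\<lambda>x. f x * indicator (box p q) x" and s="\<lambda>n x. U n x * indicator (box p q) x"])
  show "norm (U n x * indicator (box p q) x) \<le> norm (f x * indicator (box p q) x)" for n x
   using seq.hyps(2)[of n x] order_trans[OF le[of n x] abs_ge_self] by (auto split: split_indicator)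
  show "AE x in lborel. (\<lambda>n. U n x * indicator (box p q) x) \<longlonglongrightarrow> f x * indicator (box p q) x"
   using seq.hyps(4) by (auto intro!: always_eventually tendsto_mult)
 qed (use seq.IH seq.prems si in \<open>auto simp: sqint_def\<close>)
qed

theorem L2_density:
 fixes S :: "'a::euclidean_space set" and f :: "'a => real"
 assumes S: "open S" and f: "sqint f" and off: "\<And>x. x \<notin> S ==> f x = 0"
 shows "f \<in> L2_test_closure S"
proof -
 have [measurable]: "f \<in> BM" using f by (simp add: sqint_def)
 obtain p q :: "nat => 'a" where pq: "\<And>n. cbox (p n) (q n) \<subseteq> S" "S = (\<Union>n. cbox (p n) (q n))"
  using open_UN_cbox[OF S] by metis
 define Q where "Q = disjointed (\<lambda>n. box (p n) (q n))"
 have Qm [measurable]: "Q n \<in> sets borel" for n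
 proof -
  have "range (disjointed (\<lambda>n. box (p n) (q n))) \<subseteq> sets borel"
   by (rule sets.range_disjointed_sets) auto
  then show ?thesis unfolding Q_def by blast
 qed
 have Qsub: "Q n \<subseteq> box (p n) (q n)" for n unfolding Q_def by (rule disjointed_subset)
 have Qdisj: "disjoint_family Q" unfolding Q_def by (rule disjoint_family_disjointed)
 have QU: "(\<Union>n. Q n) = (\<Union>n. box (p n) (q n))" unfolding Q_def by (rule UN_disjointed_eq)
 have one: "(\<lambda>x. f x * indicator (Q n) x) \<in> L2_test_closure S" for n
 proof -
  have "(\<lambda>x. (max 0 (s * f x) * indicator (Q n) x) * indicator (box (p n) (q n)) x) \<in> L2_test_closure S" if "\<bar>s\<bar> = 1" for s :: real
  proof (rule L2_test_closure_box_nonneg[OF S pq(1)])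
   show "sqint (\<lambda>x. (max 0 (s * f x) * indicator (Q n) x) * indicator (box (p n) (q n)) x)"
   proof (rule sqint_bound(1)[OF f, of _ 1])
    have "\<bar>max 0 (s * f x)\<bar> \<le> \<bar>f x\<bar>" for x using that abs_mult[of s "f x"] by (auto simp: max_def)
    then show "AE x in lborel. norm ((max 0 (s * f x) * indicator (Q n) x) * indicator (box (p n) (q n)) x) \<le> 1 * norm (f x)"
     by (auto simp: indicator_def intro!: always_eventually)
   qed auto
  qed auto
  from L2_test_closure_add[OF this[of 1] L2_test_closure_scale[OF this[of "-1"], of "-1"]]
  have "(\<lambda>x. (max 0 (1 * f x) * indicator (Q n) x) * indicator (box (p n) (q n)) x +
   (-1) * ((max 0 ((-1) * f x) * indicator (Q n) x) * indicator (box (p n) (q n)) x)) \<in> L2_test_closure S" by simp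
  moreover have "(\<lambda>x. (max 0 (1 * f x) * indicator (Q n) x) * indicator (box (p n) (q n)) x +
   (-1) * ((max 0 ((-1) * f x) * indicator (Q n) x) * indicator (box (p n) (q n)) x)) = (\<lambda>x. f x * indicator (Q n) x)"
   using Qsub[of n] by (auto simp: fun_eq_iff indicator_def max_def)
  ultimately show ?thesis by simp
 qed
 have sum: "(\<lambda>x. \<Sum>i<n. f x * indicator (Q i) x) \<in> L2_test_closure S" for n
 proof (induction n)
  case 0
  show ?case using L2_test_closure_test[OF test_functions_zero] by simp
 next
  case (Suc n)
  show ?case using L2_test_closure_add[OF Suc one[of n]] by (simp only: sum.lessThan_Suc)
 qed
 have eq: "(\<Sum>i<n. f x * indicator (Q i) x) = f x * indicator (\<Union>i<n. Q i) x" for n x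
 proof -
  have "(indicator (\<Union>i<n. Q i) x :: real) = (\<Sum>i<n. indicator (Q i) x)"
   using Qdisj by (intro indicator_UN_disjoint) (auto simp: disjoint_family_on_def)
  then show ?thesis by (simp add: sum_distrib_left)
 qed
 have ae: "AE x in lborel. x \<in> S --> x \<in> (\<Union>n. box (p n) (q n))"
 proof -
  have "AE x in lborel. \<forall>n. x \<in> cbox (p n) (q n) --> x \<in> box (p n) (q n)"
   unfolding AE_all_countable using AE_box_cbox by auto
  then show ?thesis by eventually_elim (use pq(2) in auto)
 qed
 show ?thesis
 proof (rule L2_test_closure_dominated[where w=f and s="\<lambda>n x. f x * indicator (\<Union>i<n. Q i) x"])
  show "(\<lambda>x. f x * indicator (\<Union>i<n. Q i) x) \<in> L2_test_closure S" for n
   using sum[of n] by (simp only: eq)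
  show "AE x in lborel. (\<lambda>n. f x * indicator (\<Union>i<n. Q i) x) \<longlonglongrightarrow> f x"
   using ae
  proof eventually_elim
   case (elim x)
   have "(\<lambda>n. f x * indicator (\<Union>i<n. Q i) x) \<longlonglongrightarrow> f x * indicator (\<Union>i. Q i) x"
    by (intro tendsto_mult LIMSEQ_indicator_UN tendsto_const)
   then show ?case using elim off[of x] QU by (cases "x \<in> S") (auto simp: indicator_def)
  qed
 qed (use f in \<open>auto simp: indicator_def\<close>)
qed

section \<open>Integration by parts\<close>

text \<open>Lebesgue measure is invariant under translation, so the difference quotients of \<open>f\<close> in direction
\<open>e\<close> have integral zero; they converge to \<open>g x \<bullet> e\<close> and are bounded with bounded support.\<close>

lemma C1_compact_integral_deriv_zero:
 fixes f :: "'a::euclidean_space => real"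
 assumes der: "\<And>x. (f has_derivative (\<lambda>e. g x \<bullet> e)) (at x)" and cont: "continuous_on UNIV g"
  and K: "compact K" "\<And>x. x \<notin> K ==> f x = 0"
 shows "(LINT x|lborel. g x \<bullet> e) = 0"
proof -
 have cf: "continuous_on UNIV f" using has_derivative_continuous[OF der] by (simp add: continuous_on_eq_continuous_at)
 have [measurable]: "f \<in> BM" "g \<in> BM" using cf cont by (auto intro: borel_measurable_continuous_onI)
 have gz: "g x = 0" if "x \<notin> K" for x
 proof -
  have "((\<lambda>x. 0) has_derivative (\<lambda>e. 0)) (at x)" by simp
  then have "(f has_derivative (\<lambda>e. 0)) (at x)"
   by (rule has_derivative_transform_within_open[of _ _ _ _ "-K"]) (use K that compact_imp_closed in \<open>auto simp: open_Compl\<close>)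
  then have "(\<lambda>e. g x \<bullet> e) = (\<lambda>e. 0)" using der has_derivative_unique by blast
  then show ?thesis by (metis inner_eq_zero_iff)
 qed
 have "compact (g ` K)" using K(1) cont compact_continuous_image continuous_on_subset by blast
 then obtain B0 where B0: "\<And>y. y \<in> g ` K ==> norm y \<le> B0" using compact_imp_bounded bounded_iff by metis
 define B where "B = max B0 0"
 have B: "norm (g x) \<le> B" for x using B0[of "g x"] gz[of x] by (cases "x \<in> K") (auto simp: B_def)
 have lip: "\<bar>f (x + v) - f x\<bar> \<le> B * norm v" for x v
 proof -
  have on: "onorm (\<lambda>e. g y \<bullet> e) \<le> B" for y
   by (rule onorm_le) (use order_trans[OF Cauchy_Schwarz_ineq2[of "g y"] mult_right_mono[OF B[of y]]] in auto)
  have "norm (f (x + v) - f x) \<le> B * norm (x + v - x)"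
   by (rule differentiable_bound[where f'="\<lambda>x e. g x \<bullet> e" and S=UNIV]) (use der on in auto)
  then show ?thesis by simp
 qed
 obtain r where r: "r > 0" "\<And>x. x \<in> K ==> norm x \<le> r" using K(1) compact_imp_bounded bounded_pos by metis
 define w where "w x = B * norm e * indicator (cball 0 (r + norm e)) x" for x :: 'a
 define s where "s n x = real (Suc n) * (f (x + e /\<^sub>R real (Suc n)) - f x)" for n x
 have "(\<lambda>n. LINT x|lborel. s n x) \<longlonglongrightarrow> (LINT x|lborel. g x \<bullet> e)"
 proof (rule integral_dominated_convergence[where w=w])
  show "integrable lborel w" unfolding w_def
   by (intro integrable_mult_right integrable_real_indicator) (use emeasure_compact_finite[of "cball 0 (r + norm e)"] in \<open>auto simp: less_top\<close>)
  show "AE x in lborel. norm (s n x) \<le> w x" for n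
  proof (intro always_eventually allI)
   fix x
   show "norm (s n x) \<le> w x"
   proof (cases "x \<in> cball 0 (r + norm e)")
    case True
    have "\<bar>f (x + e /\<^sub>R real (Suc n)) - f x\<bar> \<le> B * (norm e / real (Suc n))"
     using lip[of x "e /\<^sub>R real (Suc n)"] by (simp add: field_simps)
    then have "\<bar>s n x\<bar> \<le> real (Suc n) * (B * (norm e / real (Suc n)))"
     unfolding s_def abs_mult by (intro mult_mono) auto
    then show ?thesis using True by (simp add: w_def)
   next
    case False
    have "norm (e /\<^sub>R real (Suc n)) \<le> norm e" by (simp add: mult_left_le_one_le field_simps)
    then have "norm (x + e /\<^sub>R real (Suc n)) > r" using False norm_triangle_ineq4[of "x + e /\<^sub>R real (Suc n)" "e /\<^sub>R real (Suc n)"] by simp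
    moreover have "r + norm e < norm x" using False by simp
    then have "norm x > r" using norm_ge_zero[of e] by linarith
    ultimately have "x + e /\<^sub>R real (Suc n) \<notin> K" "x \<notin> K" using r by (auto simp: not_le dest!: r(2))
    then show ?thesis using K False by (simp add: s_def w_def)
   qed
  qed
  show "AE x in lborel. (\<lambda>n. s n x) \<longlonglongrightarrow> g x \<bullet> e"
  proof (intro always_eventually allI)
   fix x
   have "((\<lambda>t::real. x + t *\<^sub>R e) has_derivative (\<lambda>t. t *\<^sub>R e)) (at 0)" by (auto intro!: derivative_eq_intros)
   from diff_chain_at[OF this, of f "\<lambda>v. g x \<bullet> v"] der[of x]
   have "((\<lambda>t. f (x + t *\<^sub>R e)) has_real_derivative (g x \<bullet> e)) (at 0)"
    by (simp add: o_def has_field_derivative_def mult_commute_abs)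
   then have "((\<lambda>h. (f (x + (0 + h) *\<^sub>R e) - f (x + 0 *\<^sub>R e)) / h) \<longlongrightarrow> g x \<bullet> e) (at 0)" unfolding DERIV_def .
   moreover have "filterlim (\<lambda>n. inverse (real (Suc n))) (at 0) sequentially"
    using LIMSEQ_inverse_real_of_nat by (auto simp: filterlim_at)
   ultimately have "(\<lambda>n. (f (x + (0 + inverse (real (Suc n))) *\<^sub>R e) - f (x + 0 *\<^sub>R e)) / inverse (real (Suc n))) \<longlonglongrightarrow> g x \<bullet> e"
    by (rule filterlim_compose)
   then show "(\<lambda>n. s n x) \<longlonglongrightarrow> g x \<bullet> e" by (simp add: s_def field_simps)
  qed
  show "s n \<in> borel_measurable lborel" for n unfolding s_def by measurable
  show "(\<lambda>x. g x \<bullet> e) \<in> borel_measurable lborel" by measurable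
 qed
 moreover have "(LINT x|lborel. s n x) = 0" for n
 proof -
  have i: "integrable lborel f"
  proof -
   have "integrable lborel (\<lambda>x. indicator K x *\<^sub>R f x)"
    using borel_integrable_compact[OF K(1) continuous_on_subset[OF cf]] by (simp add: set_integrable_def)
   moreover have "(\<lambda>x. indicator K x *\<^sub>R f x) = f" using K(2) by (auto simp: fun_eq_iff split: split_indicator)
   ultimately show ?thesis by simp
  qed
  have d: "integrable lborel (\<lambda>x. f (x + v)) \<and> (LINT x|lborel. f (x + v)) = (LINT x|lborel. f x)" for v
  proof -
   have "integrable (distr lborel borel ((+) v)) f" using i lborel_distr_plus[of v] by simp
   then have "integrable lborel (\<lambda>x. f (v + x))" by (subst (asm) integrable_distr_eq) auto
   moreover have "(LINT x|lborel. f x) = (LINT x|lborel. f (v + x))"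
    by (subst lborel_distr_plus[of v, symmetric], subst integral_distr) auto
   ultimately show ?thesis by (simp add: add.commute)
  qed
  show ?thesis unfolding s_def using i d by simp
 qed
 ultimately show ?thesis by (simp add: LIMSEQ_const_iff)
qed

text \<open>The integral of the derivative of the compactly supported product \<open>k \<phi>\<close> vanishes.\<close>

lemma classical_integration_by_parts:
 fixes k :: "'a::euclidean_space => real"
 assumes S: "open S" and der: "\<And>x. x \<in> S ==> (k has_derivative (\<lambda>e. g x \<bullet> e)) (at x)"
  and cont: "continuous_on S g" and \<phi>: "\<phi> \<in> test_functions S"
 shows "(LINT x|lborel. k x * (gradient \<phi> x \<bullet> e)) = - (LINT x|lborel. \<phi> x * (g x \<bullet> e))"
proof -
 obtain K where K: "compact K" "K \<subseteq> S" "\<And>x. x \<notin> K ==> \<phi> x = 0" using test_functionsE[OF \<phi>] by metis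
 have gz: "gradient \<phi> x = 0" if "x \<notin> K" for x
 proof -
  have "((\<lambda>x. 0) has_derivative (\<lambda>e. 0)) (at x)" by simp
  then have "(\<phi> has_derivative (\<lambda>e. 0)) (at x)"
   by (rule has_derivative_transform_within_open[of _ _ _ _ "-K"]) (use K that compact_imp_closed in \<open>auto simp: open_Compl\<close>)
  then show ?thesis using gradient_unique[of \<phi> 0 x] by simp
 qed
 have cg: "continuous_on UNIV (gradient \<phi>)"
  using test_function_continuous[OF test_function_deriv[OF \<phi>]] by (subst continuous_on_componentwise) auto
 have ck: "continuous_on S k" using has_derivative_continuous[OF der] by (auto intro!: continuous_at_imp_continuous_on)
 define G where "G x = k x *\<^sub>R gradient \<phi> x + \<phi> x *\<^sub>R g x" for x
 have z: "k x * \<phi> x = 0" "G x = 0" if "x \<notin> K" for x using that K gz by (auto simp: G_def)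
 have op: "open (- K)" using K compact_imp_closed by (auto simp: open_Compl)
 have UN: "UNIV = S \<union> - K" using K by auto
 have cG: "continuous_on UNIV G"
  unfolding UN
 proof (rule continuous_on_open_Un[OF S op])
  show "continuous_on S G" unfolding G_def
   by (intro continuous_intros ck cont test_function_continuous[OF \<phi>] continuous_on_subset[OF cg]) auto
  have "continuous_on (- K) G \<longleftrightarrow> continuous_on (- K) (\<lambda>x. 0 :: 'a)" using z(2) by (intro continuous_on_cong) auto
  then show "continuous_on (- K) G" by simp
 qed
 have dG: "((\<lambda>x. k x * \<phi> x) has_derivative (\<lambda>e. G x \<bullet> e)) (at x)" for x
 proof (cases "x \<in> K")
  case True
  then have "x \<in> S" using K by auto
  from has_derivative_mult[OF der[OF this] test_function_has_derivative[OF \<phi>]]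
  show ?thesis by (rule has_derivative_eq_rhs) (auto simp: G_def inner_add_left)
 next
  case False
  have "((\<lambda>x. 0) has_derivative (\<lambda>e. G x \<bullet> e)) (at x)" using z[OF False] by simp
  then show ?thesis
   by (rule has_derivative_transform_within_open[OF _ op]) (use False z in auto)
 qed
 have "(LINT x|lborel. G x \<bullet> e) = 0"
  by (rule C1_compact_integral_deriv_zero[OF dG cG K(1) z(1)])
 moreover have "integrable lborel (\<lambda>x. k x * (gradient \<phi> x \<bullet> e))"
 proof -
  have "continuous_on K (\<lambda>x. k x * (gradient \<phi> x \<bullet> e))"
   using K(2) by (intro continuous_intros continuous_on_subset[OF ck] continuous_on_subset[OF cg]) auto
  from borel_integrable_compact[OF K(1) this] have "integrable lborel (\<lambda>x. indicator K x *\<^sub>R (k x * (gradient \<phi> x \<bullet> e)))"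
   by (simp add: set_integrable_def)
  moreover have "(\<lambda>x. indicator K x *\<^sub>R (k x * (gradient \<phi> x \<bullet> e))) = (\<lambda>x. k x * (gradient \<phi> x \<bullet> e))"
   using gz by (auto simp: fun_eq_iff split: split_indicator)
  ultimately show ?thesis by simp
 qed
 moreover have "integrable lborel (\<lambda>x. \<phi> x * (g x \<bullet> e))"
 proof -
  have "continuous_on K (\<lambda>x. \<phi> x * (g x \<bullet> e))"
   using K(2) by (intro continuous_intros continuous_on_subset[OF cont] test_function_continuous[OF \<phi>]) auto
  from borel_integrable_compact[OF K(1) this] have "integrable lborel (\<lambda>x. indicator K x *\<^sub>R (\<phi> x * (g x \<bullet> e)))"
   by (simp add: set_integrable_def)
  moreover have "(\<lambda>x. indicator K x *\<^sub>R (\<phi> x * (g x \<bullet> e))) = (\<lambda>x. \<phi> x * (g x \<bullet> e))"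
   using K by (auto simp: fun_eq_iff split: split_indicator)
  ultimately show ?thesis by simp
 qed
 ultimately show ?thesis by (simp add: G_def inner_add_left)
qed

section \<open>Borel representatives\<close>

lemma lebesgue_AE_transfer:
 fixes F F' :: "'a::euclidean_space => 'b::euclidean_space"
 assumes ae: "AE x in lborel. F x = F' x" and [measurable]: "F' \<in> BM"
 shows "F \<in> borel_measurable lebesgue" "integrable lebesgue F \<longleftrightarrow> integrable lborel F'"
  "integral\<^sup>L lebesgue F = integral\<^sup>L lborel F'"
proof -
 have ae': "AE x in lebesgue. F x = F' x" using ae by (rule AE_completion)
 have F': "F' \<in> borel_measurable lebesgue" by (rule measurable_completion) simp
 show F: "F \<in> borel_measurable lebesgue"
  by (rule borel_measurable_AE[OF F']) (use ae' in \<open>auto simp: eq_commute\<close>)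
 have "integrable lebesgue F \<longleftrightarrow> integrable lebesgue F'" by (rule integrable_cong_AE[OF F F' ae'])
 then show "integrable lebesgue F \<longleftrightarrow> integrable lborel F'" by (simp add: integrable_completion)
 have "integral\<^sup>L lebesgue F = integral\<^sup>L lebesgue F'" by (rule integral_cong_AE[OF F F' ae'])
 then show "integral\<^sup>L lebesgue F = integral\<^sup>L lborel F'" by (simp add: integral_completion)
qed

lemma borel_representative:
 fixes F :: "'a::euclidean_space => 'b::euclidean_space"
 assumes "F \<in> borel_measurable lebesgue"
 obtains F' where "F' \<in> BM" "AE x in lborel. F x = F' x"
proof -
 have "\<exists>f'\<in>borel_measurable lborel. AE x in lborel. F x \<bullet> i = f' x" for i
  using assms by (intro completion_ex_borel_measurable_real) simp
 then obtain f' where f': "\<And>i. f' i \<in> borel_measurable lborel" "\<And>i. AE x in lborel. F x \<bullet> i = f' i x" by metis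
 show thesis
 proof (rule that[of "\<lambda>x. \<Sum>i\<in>Basis. f' i x *\<^sub>R i"])
  have "AE x in lborel. \<forall>i\<in>Basis. F x \<bullet> i = f' i x"
   using f'(2) by (subst AE_ball_countable) (auto intro: countable_finite)
  then show "AE x in lborel. F x = (\<Sum>i\<in>Basis. f' i x *\<^sub>R i)"
  proof eventually_elim
   case (elim x)
   have "F x = (\<Sum>i\<in>Basis. (F x \<bullet> i) *\<^sub>R i)" by (simp add: euclidean_representation)
   also have "... = (\<Sum>i\<in>Basis. f' i x *\<^sub>R i)" using elim by (intro sum.cong) auto
   finally show ?case .
  qed
 qed (use f' in auto)
qed

lemma L2_representative:
 fixes f :: "'a::euclidean_space => 'b::euclidean_space"
 assumes "f \<in> L2 S" and [measurable]: "S \<in> sets borel"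
 obtains f' where "sqint f'" "\<And>x. x \<notin> S ==> f' x = 0" "AE x in lborel. x \<in> S --> f x = f' x"
proof -
 have "(\<lambda>x. indicator S x *\<^sub>R f x) \<in> borel_measurable lebesgue"
  using assms(1) by (simp add: L2_def set_borel_measurable_def)
 then obtain F where [measurable]: "F \<in> BM" and F: "AE x in lborel. indicator S x *\<^sub>R f x = F x"
  using borel_representative by blast
 define f' where "f' x = indicator S x *\<^sub>R F x" for x
 have [measurable]: "f' \<in> BM" unfolding f'_def by measurable
 have ae: "AE x in lborel. x \<in> S --> f x = f' x" using F by eventually_elim (auto simp: f'_def)
 have "integrable lebesgue (\<lambda>x. indicator S x *\<^sub>R (norm (f x))\<^sup>2)"
  using assms(1) by (simp add: L2_def set_integrable_def)
 moreover have "AE x in lborel. indicator S x *\<^sub>R (norm (f x))\<^sup>2 = (norm (f' x))\<^sup>2"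
  using ae by eventually_elim (auto simp: f'_def split: split_indicator)
 ultimately have "integrable lborel (\<lambda>x. (norm (f' x))\<^sup>2)"
  using lebesgue_AE_transfer(2)[of "\<lambda>x. indicator S x *\<^sub>R (norm (f x))\<^sup>2" "\<lambda>x. (norm (f' x))\<^sup>2"] by simp
 then show thesis by (intro that[of f'] ae) (auto simp: sqint_def f'_def)
qed

lemma set_lebesgue_transfer:
 fixes f f' :: "'a::euclidean_space => 'b::euclidean_space"
 assumes "AE x in lborel. x \<in> S --> f x = f' x" "\<And>x. x \<notin> S ==> f' x = 0" "f' \<in> BM"
 shows "set_borel_measurable lebesgue S f" "set_integrable lebesgue S f \<longleftrightarrow> integrable lborel f'"
  "(LINT x:S|lebesgue. f x) = (LINT x|lborel. f' x)"
proof -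
 have ae: "AE x in lborel. indicator S x *\<^sub>R f x = f' x"
  using assms(1) by eventually_elim (use assms(2) in \<open>auto split: split_indicator\<close>)
 show "set_borel_measurable lebesgue S f" "set_integrable lebesgue S f \<longleftrightarrow> integrable lborel f'"
  "(LINT x:S|lebesgue. f x) = (LINT x|lborel. f' x)"
  using lebesgue_AE_transfer[OF ae assms(3)]
  by (auto simp: set_borel_measurable_def set_integrable_def set_lebesgue_integral_def)
qed

lemma L2_from_representative:
 fixes f f' :: "'a::euclidean_space => 'b::euclidean_space"
 assumes "AE x in lborel. x \<in> S --> f x = f' x" "\<And>x. x \<notin> S ==> f' x = 0" "sqint f'"
 shows "f \<in> L2 S" "(L2_norm S f)\<^sup>2 = sqn f'"
proof -
 have m: "f' \<in> BM" using assms(3) by (simp add: sqint_def)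
 have ae: "AE x in lborel. x \<in> S --> (norm (f x))\<^sup>2 = (norm (f' x))\<^sup>2"
  using assms(1) by eventually_elim auto
 have sq: "set_integrable lebesgue S (\<lambda>x. (norm (f x))\<^sup>2) \<longleftrightarrow> integrable lborel (\<lambda>x. (norm (f' x))\<^sup>2)"
  "(LINT x:S|lebesgue. (norm (f x))\<^sup>2) = (LINT x|lborel. (norm (f' x))\<^sup>2)"
  using set_lebesgue_transfer(2,3)[OF ae] assms(2) m by auto
 show "f \<in> L2 S"
  using set_lebesgue_transfer(1)[OF assms(1,2) m] sq(1) assms(3) by (simp add: L2_def sqint_def)
 show "(L2_norm S f)\<^sup>2 = sqn f'" unfolding L2_norm_def sqn_def
  using sq(2) by (simp add: integral_nonneg)
qed

section \<open>Weak gradients of Borel representatives\<close>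

text \<open>\<open>g\<close> is the weak gradient of \<open>f\<close> on \<open>S\<close>; both vanish off \<open>S\<close>, so
that integrals range over the whole space.\<close>

definition sobolev_pair :: "'a::euclidean_space set => ('a => real) => ('a => 'a) => bool" where
 "sobolev_pair S f g \<longleftrightarrow> sqint f \<and> sqint g \<and> (\<forall>x. x \<notin> S --> f x = 0 \<and> g x = 0) \<and>
   (\<forall>\<phi>\<in>test_functions S. \<forall>e. (LINT x|lborel. f x * (gradient \<phi> x \<bullet> e)) = - (LINT x|lborel. \<phi> x * (g x \<bullet> e)))"

lemma test_gradient_sqint:
 assumes "\<phi> \<in> test_functions S" shows "sqint (gradient \<phi>)"
proof -
 have "sqint (\<lambda>x. \<Sum>b\<in>Basis. (gradient \<phi> x \<bullet> b) *\<^sub>R b)"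
 proof (rule sqint_sum)
  fix b :: 'a
  have "sqint (\<lambda>x. gradient \<phi> x \<bullet> b)" by (rule test_function_sqint[OF test_function_deriv[OF assms]])
  then show "sqint (\<lambda>x. (gradient \<phi> x \<bullet> b) *\<^sub>R b)"
   by (auto simp: sqint_def power_mult_distrib)
 qed
 then show ?thesis by (simp add: euclidean_representation)
qed

lemma test_gradient_outside:
 assumes "\<phi> \<in> test_functions S" "x \<notin> S" shows "gradient \<phi> x = 0"
proof -
 have "\<forall>b\<in>Basis. gradient \<phi> x \<bullet> b = 0" using test_function_outside[OF test_function_deriv[OF assms(1)] assms(2)] by blast
 then show ?thesis by (simp add: euclidean_all_zero_iff)
qed

lemma sqint_times_vec_integrable:
 fixes g :: "'a::euclidean_space => 'b::euclidean_space"
 assumes "sqint f" "sqint g" shows "integrable lborel (\<lambda>x. f x *\<^sub>R g x)"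
proof -
 have [measurable]: "f \<in> BM" "g \<in> BM" using assms by (auto simp: sqint_def)
 have "sqint (\<lambda>x. norm (f x))" "sqint (\<lambda>x. norm (g x))" using assms by (auto simp: sqint_def)
 from sqint_inner(1)[OF this] have "integrable lborel (\<lambda>x. norm (f x) * norm (g x))" by simp
 then show ?thesis by (rule Bochner_Integration.integrable_bound) auto
qed

lemma sqint_compact_integrable:
 fixes g :: "'a::euclidean_space => 'b::euclidean_space"
 assumes "sqint g" "emeasure lborel K < \<infinity>" and [measurable]: "K \<in> sets borel"
 shows "integrable lborel (\<lambda>x. indicator K x *\<^sub>R g x)"
proof -
 have "(\<lambda>x. (norm (indicator K x :: real))\<^sup>2) = indicator K" by (auto simp: indicator_def)
 then have "sqint (indicator K :: 'a => real)" using assms by (simp add: sqint_def integrable_indicator_iff)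
 from sqint_times_vec_integrable[OF this assms(1)] show ?thesis .
qed

lemma sobolev_pair_has_weak_gradient:
 assumes sp: "sobolev_pair S f' g'" and f: "AE x in lborel. x \<in> S --> f x = f' x"
  and g: "AE x in lborel. x \<in> S --> g x = g' x"
 shows "has_weak_gradient S f g"
proof -
 have s: "sqint f'" "sqint g'" "\<And>x. x \<notin> S ==> f' x = 0" "\<And>x. x \<notin> S ==> g' x = 0"
  using sp by (auto simp: sobolev_pair_def)
 have [measurable]: "f' \<in> BM" "g' \<in> BM" using s by (auto simp: sqint_def)
 have 1: "set_integrable lebesgue K f \<and> set_integrable lebesgue K g" if K: "compact K" "K \<subseteq> S" for K
 proof -
  have Kb: "K \<in> sets borel" "emeasure lborel K < \<infinity>" using K emeasure_compact_finite by (auto intro: borel_closed compact_imp_closed)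
  have fk: "AE x in lborel. x \<in> K --> f x = indicator K x *\<^sub>R f' x" using f by eventually_elim (use K in auto)
  have gk: "AE x in lborel. x \<in> K --> g x = indicator K x *\<^sub>R g' x" using g by eventually_elim (use K in auto)
  show ?thesis
   using set_lebesgue_transfer(2)[OF fk] set_lebesgue_transfer(2)[OF gk] Kb
    sqint_compact_integrable[OF s(1) Kb(2,1)] sqint_compact_integrable[OF s(2) Kb(2,1)] by auto
 qed
 have 2: "(LINT x:S|lebesgue. f x *\<^sub>R gradient \<phi> x) = - (LINT x:S|lebesgue. \<phi> x *\<^sub>R g x)" if \<phi>: "\<phi> \<in> test_functions S" for \<phi>
 proof -
  have [measurable]: "\<phi> \<in> BM" "gradient \<phi> \<in> BM"
   using \<phi> test_function_measurable test_function_gradient_measurable by blast+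
  have "AE x in lborel. x \<in> S --> f x *\<^sub>R gradient \<phi> x = f' x *\<^sub>R gradient \<phi> x" using f by eventually_elim auto
  from set_lebesgue_transfer(3)[OF this] have a: "(LINT x:S|lebesgue. f x *\<^sub>R gradient \<phi> x) = (LINT x|lborel. f' x *\<^sub>R gradient \<phi> x)"
   using s(3) by simp
  have "AE x in lborel. x \<in> S --> \<phi> x *\<^sub>R g x = \<phi> x *\<^sub>R g' x" using g by eventually_elim auto
  from set_lebesgue_transfer(3)[OF this] have b: "(LINT x:S|lebesgue. \<phi> x *\<^sub>R g x) = (LINT x|lborel. \<phi> x *\<^sub>R g' x)"
   using s(4) by simp
  have ia: "integrable lborel (\<lambda>x. f' x *\<^sub>R gradient \<phi> x)" by (intro sqint_times_vec_integrable s test_gradient_sqint[OF \<phi>])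
  have ib: "integrable lborel (\<lambda>x. \<phi> x *\<^sub>R g' x)" by (intro sqint_times_vec_integrable s test_function_sqint[OF \<phi>])
  have "(LINT x|lborel. f' x *\<^sub>R gradient \<phi> x) \<bullet> e = - (LINT x|lborel. \<phi> x *\<^sub>R g' x) \<bullet> e" for e
  proof -
   have "(LINT x|lborel. f' x *\<^sub>R gradient \<phi> x) \<bullet> e = (LINT x|lborel. f' x * (gradient \<phi> x \<bullet> e))"
    using integral_inner_left[of e lborel "\<lambda>x. f' x *\<^sub>R gradient \<phi> x"] ia by simp
   moreover have "(LINT x|lborel. \<phi> x *\<^sub>R g' x) \<bullet> e = (LINT x|lborel. \<phi> x * (g' x \<bullet> e))"
    using integral_inner_left[of e lborel "\<lambda>x. \<phi> x *\<^sub>R g' x"] ib by simp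
   ultimately show ?thesis using sp \<phi> by (simp add: sobolev_pair_def)
  qed
  then have "(LINT x|lborel. f' x *\<^sub>R gradient \<phi> x) = - (LINT x|lborel. \<phi> x *\<^sub>R g' x)"
   by - (rule euclidean_eqI, simp)
  then show ?thesis using a b by simp
 qed
 show ?thesis unfolding has_weak_gradient_def using 1 2 by blast
qed

lemma has_weak_gradient_sobolev_pair:
 assumes "sqint f'" "sqint g'" "\<And>x. x \<notin> S ==> f' x = 0" "\<And>x. x \<notin> S ==> g' x = 0"
  and w: "has_weak_gradient S f g" and f: "AE x in lborel. x \<in> S --> f x = f' x"
  and g: "AE x in lborel. x \<in> S --> g x = g' x"
 shows "sobolev_pair S f' g'"
proof -
 have [measurable]: "f' \<in> BM" "g' \<in> BM" using assms by (auto simp: sqint_def)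
 have "(LINT x|lborel. f' x * (gradient \<phi> x \<bullet> e)) = - (LINT x|lborel. \<phi> x * (g' x \<bullet> e))" if \<phi>: "\<phi> \<in> test_functions S" for \<phi> e
 proof -
  have [measurable]: "\<phi> \<in> BM" "gradient \<phi> \<in> BM"
   using \<phi> test_function_measurable test_function_gradient_measurable by blast+
  have "AE x in lborel. x \<in> S --> f x *\<^sub>R gradient \<phi> x = f' x *\<^sub>R gradient \<phi> x" using f by eventually_elim auto
  from set_lebesgue_transfer(3)[OF this] have a: "(LINT x:S|lebesgue. f x *\<^sub>R gradient \<phi> x) = (LINT x|lborel. f' x *\<^sub>R gradient \<phi> x)"
   using assms(3) by simp
  have "AE x in lborel. x \<in> S --> \<phi> x *\<^sub>R g x = \<phi> x *\<^sub>R g' x" using g by eventually_elim auto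
  from set_lebesgue_transfer(3)[OF this] have b: "(LINT x:S|lebesgue. \<phi> x *\<^sub>R g x) = (LINT x|lborel. \<phi> x *\<^sub>R g' x)"
   using assms(4) by simp
  have ia: "integrable lborel (\<lambda>x. f' x *\<^sub>R gradient \<phi> x)" by (intro sqint_times_vec_integrable assms test_gradient_sqint[OF \<phi>])
  have ib: "integrable lborel (\<lambda>x. \<phi> x *\<^sub>R g' x)" by (intro sqint_times_vec_integrable assms test_function_sqint[OF \<phi>])
  have "(LINT x|lborel. f' x *\<^sub>R gradient \<phi> x) \<bullet> e = (LINT x|lborel. f' x * (gradient \<phi> x \<bullet> e))"
   using integral_inner_left[of e lborel "\<lambda>x. f' x *\<^sub>R gradient \<phi> x"] ia by simp
  moreover have "(LINT x|lborel. \<phi> x *\<^sub>R g' x) \<bullet> e = (LINT x|lborel. \<phi> x * (g' x \<bullet> e))"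
   using integral_inner_left[of e lborel "\<lambda>x. \<phi> x *\<^sub>R g' x"] ib by simp
  moreover have "(LINT x|lborel. f' x *\<^sub>R gradient \<phi> x) = - (LINT x|lborel. \<phi> x *\<^sub>R g' x)"
   using w \<phi> a b unfolding has_weak_gradient_def by metis
  ultimately show ?thesis by (metis inner_minus_left)
 qed
 then show ?thesis using assms by (auto simp: sobolev_pair_def)
qed

lemma fundamental_lemma_lebesgue:
 fixes h :: "'a::euclidean_space => real"
 assumes S: "open S" and int: "\<And>K. compact K ==> K \<subseteq> S ==> set_integrable lebesgue K h"
  and z: "\<And>\<phi>. \<phi> \<in> test_functions S ==> (LINT x|lebesgue. \<phi> x * h x) = 0"
 shows "AE x in lborel. x \<in> S --> h x = 0"
proof -
 obtain p q :: "nat => 'a" where pq: "\<And>n. cbox (p n) (q n) \<subseteq> S" "S = (\<Union>n. cbox (p n) (q n))"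
  using open_UN_cbox[OF S] by metis
 define k where "k n x = indicator (\<Union>i\<le>n. cbox (p i) (q i)) x * h x" for n x
 have "(\<lambda>x. indicator S x * h x) \<in> borel_measurable lebesgue"
 proof (rule borel_measurable_LIMSEQ_real)
  fix x
  show "(\<lambda>n. k (n::nat) x) \<longlonglongrightarrow> indicator S x * h x"
  proof (cases "x \<in> S")
   case True
   then obtain m where "x \<in> cbox (p m) (q m)" using pq by auto
   then have "k n x = h x" if "n \<ge> m" for n using that by (auto simp: k_def indicator_def)
   then have "\<forall>\<^sub>F n in sequentially. k n x = h x" unfolding eventually_sequentially by blast
   then show ?thesis using True by (simp add: tendsto_eventually)
  next
   case False
   then have "k n x = 0" for n using pq(1) by (auto simp: k_def indicator_def)
   then show ?thesis using False by simp
  qed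
  fix n
  have "set_integrable lebesgue (\<Union>i\<le>n. cbox (p i) (q i)) h" by (rule int) (use pq(1) in auto)
  then show "k n \<in> borel_measurable lebesgue" unfolding k_def[abs_def] by (simp add: set_integrable_def)
 qed
 then obtain F where F: "F \<in> BM" and ae: "AE x in lborel. indicator S x * h x = F x"
  using borel_representative by blast
 have ae': "AE x in lborel. x \<in> S --> h x = F x" using ae by eventually_elim auto
 have "AE x in lborel. x \<in> S --> F x = 0"
 proof (rule fundamental_lemma_lborel[OF S F])
  fix a b assume ab: "cbox a b \<subseteq> S"
  have "set_integrable lebesgue (cbox a b) h" using int ab by auto
  moreover have "AE x in lborel. x \<in> cbox a b --> h x = indicator (cbox a b) x *\<^sub>R F x" using ae' by eventually_elim (use ab in auto)
  from set_lebesgue_transfer(2)[OF this] have "set_integrable lebesgue (cbox a b) h \<longleftrightarrow> set_integrable lborel (cbox a b) F"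
   using F by (simp add: set_integrable_def)
  ultimately show "set_integrable lborel (cbox a b) F" by simp
 next
  fix \<phi> assume \<phi>: "\<phi> \<in> test_functions S"
  have "AE x in lborel. \<phi> x * h x = \<phi> x * F x" using ae' by eventually_elim (use test_function_outside[OF \<phi>] in auto)
  from lebesgue_AE_transfer(3)[OF this] show "(LINT x|lborel. \<phi> x * F x) = 0"
   using z[OF \<phi>] F test_function_measurable[OF \<phi>] by simp
 qed
 with ae' show ?thesis by eventually_elim auto
qed

lemma set_lebesgue_integrable_test_mult:
 fixes g :: "'a::euclidean_space => 'b::euclidean_space"
 assumes \<phi>: "\<phi> \<in> test_functions S" and int: "\<And>K. compact K ==> K \<subseteq> S ==> set_integrable lebesgue K g"
 shows "integrable lebesgue (\<lambda>x. \<phi> x *\<^sub>R g x)"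
proof -
 obtain K where K: "compact K" "K \<subseteq> S" "\<And>x. x \<notin> K ==> \<phi> x = 0" using test_functionsE[OF \<phi>] by metis
 obtain B where B: "B \<ge> 0" "\<And>x. \<bar>\<phi> x\<bar> \<le> B" using test_function_bounded[OF \<phi>] by metis
 have i: "integrable lebesgue (\<lambda>x. indicator K x *\<^sub>R g x)" using int[OF K(1,2)] by (simp add: set_integrable_def)
 have "integrable lebesgue (\<lambda>x. \<phi> x *\<^sub>R (indicator K x *\<^sub>R g x))"
 proof (rule Bochner_Integration.integrable_bound[where g="\<lambda>x. \<phi> x *\<^sub>R (indicator K x *\<^sub>R g x)"])
  show "integrable lebesgue (\<lambda>x. B * norm (indicator K x *\<^sub>R g x))"
   by (intro integrable_mult_right integrable_norm i)
  have "\<phi> \<in> borel_measurable lebesgue" using test_function_measurable[OF \<phi>] by (simp add: measurable_completion)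
  then show "(\<lambda>x. \<phi> x *\<^sub>R (indicator K x *\<^sub>R g x)) \<in> borel_measurable lebesgue"
   by (rule borel_measurable_scaleR[OF _ borel_measurable_integrable[OF i]])
  show "AE x in lebesgue. norm (\<phi> x *\<^sub>R (indicator K x *\<^sub>R g x)) \<le> norm (B * norm (indicator K x *\<^sub>R g x))"
  proof (intro always_eventually allI)
   fix x
   have "norm (\<phi> x *\<^sub>R (indicator K x *\<^sub>R g x)) \<le> B * norm (indicator K x *\<^sub>R g x)"
    unfolding norm_scaleR[of "\<phi> x"] by (rule mult_right_mono[OF B(2)]) simp
   then show "norm (\<phi> x *\<^sub>R (indicator K x *\<^sub>R g x)) \<le> norm (B * norm (indicator K x *\<^sub>R g x))" by simp
  qed
 qed
 moreover have "(\<lambda>x. \<phi> x *\<^sub>R (indicator K x *\<^sub>R g x)) = (\<lambda>x. \<phi> x *\<^sub>R g x)"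
  using K(3) by (auto simp: fun_eq_iff split: split_indicator)
 ultimately show ?thesis by simp
qed

lemma weak_gradient_unique:
 assumes S: "open S" and g: "has_weak_gradient S f g" and k: "has_weak_gradient S f k"
 shows "AE x in lborel. x \<in> S --> g x = k x"
proof -
 have ig: "\<And>K. compact K ==> K \<subseteq> S ==> set_integrable lebesgue K g"
  and ik: "\<And>K. compact K ==> K \<subseteq> S ==> set_integrable lebesgue K k"
  using g k unfolding has_weak_gradient_def by blast+
 have "AE x in lborel. x \<in> S --> (g x - k x) \<bullet> i = 0" for i
 proof (rule fundamental_lemma_lebesgue[OF S])
  show "set_integrable lebesgue K (\<lambda>x. (g x - k x) \<bullet> i)" if "compact K" "K \<subseteq> S" for K
  proof -
   have "integrable lebesgue (\<lambda>x. (indicator K x *\<^sub>R g x - indicator K x *\<^sub>R k x) \<bullet> i)"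
    using ig[OF that] ik[OF that] by (intro integrable_inner_left Bochner_Integration.integrable_diff) (auto simp: set_integrable_def)
   then show ?thesis by (simp add: set_integrable_def inner_diff_left right_diff_distrib)
  qed
  fix \<phi> assume \<phi>: "\<phi> \<in> test_functions S"
  have Sx: "(LINT x:S|lebesgue. \<phi> x *\<^sub>R g x) = (LINT x|lebesgue. \<phi> x *\<^sub>R g x)" for g :: "'a => 'a"
   unfolding set_lebesgue_integral_def
   by (intro Bochner_Integration.integral_cong) (use test_function_outside[OF \<phi>] in \<open>auto split: split_indicator\<close>)
  have eq: "(LINT x|lebesgue. \<phi> x *\<^sub>R g x) = (LINT x|lebesgue. \<phi> x *\<^sub>R k x)"
   using g k \<phi> Sx[of g] Sx[of k] unfolding has_weak_gradient_def by (metis neg_equal_iff_equal)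
  have ii: "integrable lebesgue (\<lambda>x. \<phi> x *\<^sub>R g x)" "integrable lebesgue (\<lambda>x. \<phi> x *\<^sub>R k x)"
   using set_lebesgue_integrable_test_mult[OF \<phi>] ig ik by blast+
  have "(LINT x|lebesgue. \<phi> x * ((g x - k x) \<bullet> i)) = (LINT x|lebesgue. (\<phi> x *\<^sub>R g x - \<phi> x *\<^sub>R k x) \<bullet> i)"
   by (simp add: inner_diff_left right_diff_distrib)
  also have "... = (LINT x|lebesgue. \<phi> x *\<^sub>R g x - \<phi> x *\<^sub>R k x) \<bullet> i"
   using ii by (intro integral_inner_left) auto
  also have "... = 0" using ii eq by simp
  finally show "(LINT x|lebesgue. \<phi> x * ((g x - k x) \<bullet> i)) = 0" .
 qed
 then have "AE x in lborel. \<forall>i\<in>Basis. x \<in> S --> (g x - k x) \<bullet> i = 0"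
  by (subst AE_ball_countable) (auto intro: countable_finite)
 then show ?thesis
 proof eventually_elim
  case (elim x)
  then show ?case using euclidean_all_zero_iff[of "g x - k x"] by auto
 qed
qed

lemma weak_grad_AE:
 assumes "open S" "has_weak_gradient S f g"
 shows "AE x in lborel. x \<in> S --> weak_grad S f x = g x"
 unfolding weak_grad_def
 by (rule weak_gradient_unique[OF assms(1) someI[of "has_weak_gradient S f", OF assms(2)] assms(2)])

lemma H1_representative:
 assumes "f \<in> H1 S" "open S"
 obtains f' g' where "sobolev_pair S f' g'" "AE x in lborel. x \<in> S --> f x = f' x"
proof -
 have S: "S \<in> sets borel" using assms(2) by simp
 obtain g where g: "f \<in> L2 S" "g \<in> L2 S" "has_weak_gradient S f g" using assms(1) by (auto simp: H1_def)
 obtain f' where f': "sqint f'" "\<And>x. x \<notin> S ==> f' x = 0" "AE x in lborel. x \<in> S --> f x = f' x"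
  using L2_representative[OF g(1) S] by metis
 obtain g' where g': "sqint g'" "\<And>x. x \<notin> S ==> g' x = 0" "AE x in lborel. x \<in> S --> g x = g' x"
  using L2_representative[OF g(2) S] by metis
 show thesis
  by (rule that[OF has_weak_gradient_sobolev_pair[OF f'(1) g'(1) f'(2) g'(2) g(3) f'(3) g'(3)] f'(3)])
qed

lemma H1_from_sobolev_pair:
 assumes "sobolev_pair S f' g'" "AE x in lborel. x \<in> S --> f x = f' x" "open S"
 shows "f \<in> H1 S" "AE x in lborel. x \<in> S --> weak_grad S f x = g' x" "(H1_norm S f)\<^sup>2 = sqn f' + sqn g'"
proof -
 have s: "sqint f'" "sqint g'" "\<And>x. x \<notin> S ==> f' x = 0" "\<And>x. x \<notin> S ==> g' x = 0"
  using assms(1) by (auto simp: sobolev_pair_def)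
 have w: "has_weak_gradient S f g'" by (rule sobolev_pair_has_weak_gradient[OF assms(1,2)]) simp
 have f: "f \<in> L2 S" "(L2_norm S f)\<^sup>2 = sqn f'" by (rule L2_from_representative[OF assms(2) s(3,1)]; assumption)+
 have g: "g' \<in> L2 S" by (rule L2_from_representative(1)[OF _ s(4,2)]) auto
 show "f \<in> H1 S" using f g w by (auto simp: H1_def)
 show ae: "AE x in lborel. x \<in> S --> weak_grad S f x = g' x" by (rule weak_grad_AE[OF assms(3) w])
 have "(L2_norm S (weak_grad S f))\<^sup>2 = sqn g'" by (rule L2_from_representative(2)[OF ae s(4,2)]) auto
 then show "(H1_norm S f)\<^sup>2 = sqn f' + sqn g'" using f by (simp add: H1_norm_def sqn_nonneg)
qed

lemma sobolev_pair_diff: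
 assumes "sobolev_pair S f g" "sobolev_pair S f' g'"
 shows "sobolev_pair S (\<lambda>x. f x - f' x) (\<lambda>x. g x - g' x)"
proof -
 have "(LINT x|lborel. (f x - f' x) * (gradient \<phi> x \<bullet> e)) = - (LINT x|lborel. \<phi> x * ((g x - g' x) \<bullet> e))" if \<phi>: "\<phi> \<in> test_functions S" for \<phi> e
 proof -
  have sd: "sqint (\<lambda>x. gradient \<phi> x \<bullet> e)" by (rule test_function_sqint[OF test_function_deriv[OF \<phi>]])
  have sg: "sqint (\<lambda>x. g x \<bullet> e)" if "sqint g" for g :: "'a => 'a"
   by (rule sqint_bound(1)[OF that, of _ "norm e"]) (use that order_trans[OF Cauchy_Schwarz_ineq2 eq_refl[OF mult.commute]] in \<open>auto simp: sqint_def\<close>)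
  have i: "integrable lborel (\<lambda>x. f x * (gradient \<phi> x \<bullet> e))" "integrable lborel (\<lambda>x. f' x * (gradient \<phi> x \<bullet> e))"
   "integrable lborel (\<lambda>x. \<phi> x * (g x \<bullet> e))" "integrable lborel (\<lambda>x. \<phi> x * (g' x \<bullet> e))"
   using assms sqint_inner(1)[OF _ sd] sqint_inner(1)[OF test_function_sqint[OF \<phi>] sg] by (auto simp: sobolev_pair_def)
  show ?thesis using assms \<phi> i by (simp add: sobolev_pair_def inner_diff_left right_diff_distrib left_diff_distrib)
 qed
 then show ?thesis using assms by (auto simp: sobolev_pair_def sqint_diff)
qed

section \<open>Hausdorff measure and graphs\<close>

definition ball_cost :: "nat => 'a::metric_space set => ennreal" where
 "ball_cost k C = (if C = {} then 0 else ennreal (unit_ball_vol (real k) * (diameter C / 2) ^ k))"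

definition fine_cover :: "real => 'a::metric_space set => (nat => 'a set) => bool" where
 "fine_cover \<delta> A C \<longleftrightarrow> A \<subseteq> (\<Union>i. C i) \<and> (\<forall>i. bounded (C i) \<and> diameter (C i) \<le> \<delta>)"

lemma hausdorff_content_alt: "hausdorff_content k \<delta> A = (INF C\<in>Collect (fine_cover \<delta> A). \<Sum>i. ball_cost k (C i))"
 unfolding hausdorff_content_def ball_cost_def fine_cover_def by simp

lemma hausdorff_content_le: "fine_cover \<delta> A C ==> hausdorff_content k \<delta> A \<le> (\<Sum>i. ball_cost k (C i))"
 unfolding hausdorff_content_alt by (rule INF_lower) simp

lemma hausdorff_content_greatest:
 "(\<And>C. fine_cover \<delta> A C ==> x \<le> (\<Sum>i. ball_cost k (C i))) ==> x \<le> hausdorff_content k \<delta> A"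
 unfolding hausdorff_content_alt by (rule INF_greatest) simp

lemma hausdorff_content_antimono: "\<delta> \<le> \<delta>' ==> hausdorff_content k \<delta>' A \<le> hausdorff_content k \<delta> A"
 by (intro hausdorff_content_greatest hausdorff_content_le) (auto simp: fine_cover_def intro: order_trans)

lemma hausdorff_content_mono: "A \<subseteq> B ==> hausdorff_content k \<delta> A \<le> hausdorff_content k \<delta> B"
 by (intro hausdorff_content_greatest hausdorff_content_le) (auto simp: fine_cover_def)

lemma hausdorff_content_le_outer: "\<delta> > 0 ==> hausdorff_content k \<delta> A \<le> hausdorff_outer k A"
 unfolding hausdorff_outer_def by (rule SUP_upper) simp

lemma hausdorff_outer_least: "(\<And>\<delta>. \<delta> > 0 ==> hausdorff_content k \<delta> A \<le> x) ==> hausdorff_outer k A \<le> x"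
 unfolding hausdorff_outer_def by (rule SUP_least) simp

lemma hausdorff_outer_mono: "A \<subseteq> B ==> hausdorff_outer k A \<le> hausdorff_outer k B"
 by (intro hausdorff_outer_least order_trans[OF hausdorff_content_mono hausdorff_content_le_outer])

lemma hausdorff_content_empty:
 assumes "\<delta> > 0" shows "hausdorff_content k \<delta> {} = 0"
proof -
 have "hausdorff_content k \<delta> ({} :: 'a set) \<le> (\<Sum>i. ball_cost k ((\<lambda>i. {} :: 'a set) i))"
  by (rule hausdorff_content_le) (use assms in \<open>auto simp: fine_cover_def\<close>)
 then show ?thesis by (simp add: ball_cost_def)
qed

lemma hausdorff_outer_empty: "hausdorff_outer k {} = 0"
 using hausdorff_outer_least[of k "{}" 0] by (simp add: hausdorff_content_empty)

lemma hausdorff_content_UN: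
 "hausdorff_content k \<delta> (\<Union>n. A n) \<le> (\<Sum>n. hausdorff_content k \<delta> (A n :: 'a::metric_space set))"
proof (rule ennreal_le_epsilon)
 fix e :: real assume fin: "(\<Sum>n. hausdorff_content k \<delta> (A n)) < top" and e: "e > 0"
 have "\<exists>C. fine_cover \<delta> (A n) C \<and> (\<Sum>i. ball_cost k (C i)) \<le> hausdorff_content k \<delta> (A n) + ennreal (e * (1/2) ^ Suc n)" for n
 proof (rule ccontr)
  assume neg: "\<not> ?thesis"
  have "hausdorff_content k \<delta> (A n) + ennreal (e * (1/2) ^ Suc n) \<le> hausdorff_content k \<delta> (A n)"
   by (rule hausdorff_content_greatest) (use neg in \<open>auto simp: not_le intro: less_imp_le\<close>)
  moreover have "hausdorff_content k \<delta> (A n) \<noteq> top" using ennreal_suminf_lessD[OF fin, of n] by simp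
  moreover have "e * (1/2) ^ Suc n > 0" using e by simp
  ultimately show False
   by (cases "hausdorff_content k \<delta> (A n)") (auto simp: ennreal_plus[symmetric] simp del: ennreal_plus)
 qed
 then obtain C where C: "\<And>n. fine_cover \<delta> (A n) (C n)"
  "\<And>n. (\<Sum>i. ball_cost k (C n i)) \<le> hausdorff_content k \<delta> (A n) + ennreal (e * (1/2) ^ Suc n)" by metis
 define E where "E j = (case prod_decode j of (m, i) => C m i)" for j
 have "fine_cover \<delta> (\<Union>n. A n) E"
  unfolding fine_cover_def
 proof (intro conjI allI subsetI)
  fix x assume "x \<in> (\<Union>n. A n)"
  then obtain n i where "x \<in> C n i" using C(1) unfolding fine_cover_def by blast
  then have "x \<in> E (prod_encode (n, i))" by (simp add: E_def)
  then show "x \<in> (\<Union>j. E j)" by blast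
 qed (use C(1) in \<open>auto simp: E_def fine_cover_def split: prod.split\<close>)
 then have "hausdorff_content k \<delta> (\<Union>n. A n) \<le> (\<Sum>j. ball_cost k (E j))" by (rule hausdorff_content_le)
 also have "... = (\<Sum>j. (\<lambda>(m, i). ball_cost k (C m i)) (prod_decode j))"
  by (simp add: E_def split_beta)
 also have "... = (\<Sum>m. \<Sum>i. ball_cost k (C m i))"
  by (rule suminf_ennreal_2dimen) simp
 also have "... \<le> (\<Sum>m. hausdorff_content k \<delta> (A m) + ennreal (e * (1/2) ^ Suc m))"
  by (intro suminf_le C) auto
 also have "... = (\<Sum>m. hausdorff_content k \<delta> (A m)) + (\<Sum>m. ennreal (e * (1/2) ^ Suc m))"
  by (rule suminf_add[symmetric]) auto
 also have "(\<Sum>m. ennreal (e * (1/2) ^ Suc m)) = ennreal e"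
 proof (rule suminf_ennreal_eq)
  show "(\<lambda>m. e * (1/2) ^ Suc m) sums e" using sums_mult[OF power_half_series, of e] by simp
 qed (use e in auto)
 finally show "hausdorff_content k \<delta> (\<Union>n. A n) \<le> (\<Sum>n. hausdorff_content k \<delta> (A n)) + ennreal e" .
qed

lemma hausdorff_outer_UN: "hausdorff_outer k (\<Union>n. A n) \<le> (\<Sum>n. hausdorff_outer k (A n))"
 by (rule hausdorff_outer_least, rule order_trans[OF hausdorff_content_UN])
  (auto intro!: suminf_le hausdorff_content_le_outer)

lemma hausdorff_outer_Un: "hausdorff_outer k (A \<union> B) \<le> hausdorff_outer k A + hausdorff_outer k B"
proof -
 let ?X = "\<lambda>n::nat. if n = 0 then A else if n = 1 then B else {}"
 have "A \<union> B = (\<Union>n. ?X n)" by (auto split: if_splits)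
 then have "hausdorff_outer k (A \<union> B) \<le> (\<Sum>n. hausdorff_outer k (?X n))" using hausdorff_outer_UN[of k ?X] by simp
 also have "... = (\<Sum>n<2. hausdorff_outer k (?X n))"
  by (rule suminf_finite) (auto simp: hausdorff_outer_empty)
 also have "... = hausdorff_outer k A + hausdorff_outer k B" by (simp add: numeral_2_eq_2)
 finally show ?thesis .
qed

lemma hausdorff_content_separated:
 assumes sep: "\<And>a b. a \<in> A ==> b \<in> B ==> r \<le> dist a b" and \<delta>: "0 < \<delta>" "\<delta> < r"
 shows "hausdorff_content k \<delta> A + hausdorff_content k \<delta> B \<le> hausdorff_content k \<delta> (A \<union> B)"
proof (rule hausdorff_content_greatest)
 fix C assume C: "fine_cover \<delta> (A \<union> B) C"
 define P where "P X i = (if C i \<inter> X = {} then {} else C i)" for X i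
 have f: "fine_cover \<delta> X (P X)" if "X \<subseteq> A \<union> B" for X
  using C that \<delta> unfolding fine_cover_def P_def by (auto split: if_splits) blast
 have "hausdorff_content k \<delta> A + hausdorff_content k \<delta> B \<le> (\<Sum>i. ball_cost k (P A i)) + (\<Sum>i. ball_cost k (P B i))"
  by (intro add_mono hausdorff_content_le f) auto
 also have "... = (\<Sum>i. ball_cost k (P A i) + ball_cost k (P B i))" by (rule suminf_add) auto
 also have "... \<le> (\<Sum>i. ball_cost k (C i))"
 proof (intro suminf_le)
  fix i
  have "\<not> (C i \<inter> A \<noteq> {} \<and> C i \<inter> B \<noteq> {})"
  proof
   assume "C i \<inter> A \<noteq> {} \<and> C i \<inter> B \<noteq> {}"
   then obtain a b where ab: "a \<in> C i" "a \<in> A" "b \<in> C i" "b \<in> B" by blast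
   have "dist a b \<le> diameter (C i)" using C ab by (intro diameter_bounded_bound) (auto simp: fine_cover_def)
   also have "... \<le> \<delta>" using C by (simp add: fine_cover_def)
   finally show False using sep[OF ab(2,4)] \<delta> by simp
  qed
  then show "ball_cost k (P A i) + ball_cost k (P B i) \<le> ball_cost k (C i)"
   by (auto simp: P_def ball_cost_def)
 qed auto
 finally show "hausdorff_content k \<delta> A + hausdorff_content k \<delta> B \<le> (\<Sum>i. ball_cost k (C i))" .
qed

lemma hausdorff_outer_separated:
 assumes sep: "\<And>a b. a \<in> A ==> b \<in> B ==> r \<le> dist a b" and r: "r > 0"
 shows "hausdorff_outer k A + hausdorff_outer k B \<le> hausdorff_outer k (A \<union> B)"
proof -
 have "hausdorff_content k a A + hausdorff_content k b B \<le> hausdorff_outer k (A \<union> B)" if "a > 0" "b > 0" for a b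
 proof -
  define d where "d = min (min a b) (r / 2)"
  have d: "0 < d" "d < r" "d \<le> a" "d \<le> b" using that r by (auto simp: d_def)
  have "hausdorff_content k a A + hausdorff_content k b B \<le> hausdorff_content k d A + hausdorff_content k d B"
   by (intro add_mono hausdorff_content_antimono d)
  also have "... \<le> hausdorff_content k d (A \<union> B)" by (rule hausdorff_content_separated[OF sep d(1,2)])
  also have "... \<le> hausdorff_outer k (A \<union> B)" by (rule hausdorff_content_le_outer[OF d(1)])
  finally show ?thesis .
 qed note 1 = this
 have 2: "hausdorff_outer k A + hausdorff_content k b B \<le> hausdorff_outer k (A \<union> B)" if "b > 0" for b
  unfolding hausdorff_outer_def[of k A]
  by (subst ennreal_SUP_add_left[symmetric]) (auto intro!: SUP_least 1 that)
 show ?thesis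
  unfolding hausdorff_outer_def[of k B]
  by (subst ennreal_SUP_add_right) (auto intro!: SUP_least 2)
qed

text \<open>The part of \<open>A\<close> off \<open>F\<close> is cut into shells according to the distance to \<open>F\<close>.
Shells that are not adjacent have positive distance, so their measures add up to at most that of \<open>A\<close>; hence the
shells close to \<open>F\<close> have small total measure, and the remaining ones have positive distance to
\<open>F\<close>.\<close>

lemma closed_caratheodory:
 fixes F :: "'a::metric_space set"
 assumes F: "closed F"
 shows "hausdorff_outer k (A \<inter> F) + hausdorff_outer k (A - F) \<le> hausdorff_outer k A"
proof (cases "F = {} \<or> hausdorff_outer k A = top")
 case True
 then show ?thesis by (auto simp: hausdorff_outer_empty)
next
 case False
 let ?f = "hausdorff_outer k"
 have ne: "F \<noteq> {}" and fin: "?f A < top" using False by (auto simp: less_top)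
 define B where "B n = {a \<in> A. 1 / real (Suc n) \<le> infdist a F}" for n
 define R where "R n = B (Suc n) - B n" for n
 have idist: "infdist x F \<le> infdist y F + dist x y" for x y by (rule infdist_triangle)
 have BA: "?f (A \<inter> F) + ?f (B n) \<le> ?f A" for n
 proof -
  have "?f (A \<inter> F) + ?f (B n) \<le> ?f (A \<inter> F \<union> B n)"
  proof (rule hausdorff_outer_separated[where r="1 / real (Suc n)"])
   fix a b assume a: "a \<in> A \<inter> F" and b: "b \<in> B n"
   have "infdist a F = 0" using a by simp
   then show "1 / real (Suc n) \<le> dist a b" using b idist[of b a] by (simp add: B_def dist_commute)
  qed simp
  also have "... \<le> ?f A" by (rule hausdorff_outer_mono) (auto simp: B_def)
  finally show ?thesis .
 qed
 have lt: "1 / real (m + 2) < 1 / real (m + 1)" for m by (simp add: field_simps)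
 have Rlow: "1 / real (m + 2) \<le> infdist x F" and Rup: "infdist x F < 1 / real (m + 1)" and RsubA: "x \<in> A" if "x \<in> R m" for x m
  using that by (auto simp: R_def B_def add.commute not_le)
 have sums: "(\<Sum>j<n. ?f (R (2 * j + c))) \<le> ?f (\<Union>j<n. R (2 * j + c))" for n c
 proof (induction n)
  case 0 then show ?case by (simp add: hausdorff_outer_empty)
 next
  case (Suc n)
  have "(\<Sum>j<Suc n. ?f (R (2 * j + c))) \<le> ?f (\<Union>j<n. R (2 * j + c)) + ?f (R (2 * n + c))"
   using Suc by (simp add: add_right_mono)
  also have "... \<le> ?f ((\<Union>j<n. R (2 * j + c)) \<union> R (2 * n + c))"
  proof (cases "n = 0")
   case True then show ?thesis by (simp add: hausdorff_outer_empty)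
  next
   case False
   show ?thesis
   proof (rule hausdorff_outer_separated[where r="1 / real (2 * n + c) - 1 / real (2 * n + c + 1)"])
    fix a b assume "a \<in> (\<Union>j<n. R (2 * j + c))" and b: "b \<in> R (2 * n + c)"
    then obtain j where j: "j < n" "a \<in> R (2 * j + c)" by auto
    have "1 / real (2 * n + c) \<le> 1 / real (2 * j + c + 2)" using j(1) by (intro divide_left_mono) auto
    also have "... \<le> infdist a F" using Rlow[OF j(2)] by simp
    finally show "1 / real (2 * n + c) - 1 / real (2 * n + c + 1) \<le> dist a b"
     using Rup[OF b] idist[of a b] by simp
   next
    have "1 / real (2 * n + c + 1) < 1 / real (2 * n + c)"
     using False by (intro divide_strict_left_mono) auto
    then show "0 < 1 / real (2 * n + c) - 1 / real (2 * n + c + 1)" by simp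
   qed
  qed
  also have "(\<Union>j<n. R (2 * j + c)) \<union> R (2 * n + c) = (\<Union>j<Suc n. R (2 * j + c))"
   by (auto simp: lessThan_Suc)
  finally show ?case .
 qed
 have sumA: "(\<Sum>j<n. ?f (R (2 * j + c))) \<le> ?f A" for n c
  by (rule order_trans[OF sums hausdorff_outer_mono]) (use RsubA in blast)
 have "(\<Sum>j<2 * n. ?f (R j)) = (\<Sum>j<n. ?f (R (2 * j + 0))) + (\<Sum>j<n. ?f (R (2 * j + 1)))" for n
  by (induction n) (auto simp: algebra_simps)
 then have ev: "(\<Sum>j<2 * n. ?f (R j)) \<le> ?f A + ?f A" for n
  using add_mono[OF sumA[of 0 n] sumA[of 1 n]] by simp
 have "(\<Sum>j<n. ?f (R j)) \<le> ?f A + ?f A" for n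
  by (rule order_trans[OF sum_mono2 ev[of n]]) auto
 then have "(\<Sum>j. ?f (R j)) \<le> ?f A + ?f A" unfolding suminf_eq_SUP by (rule SUP_least)
 moreover have "?f A + ?f A < top" using fin by (auto simp: less_top)
 ultimately have Tfin: "(\<Sum>j. ?f (R j)) < top" by (rule le_less_trans)
 have cover: "A - F \<subseteq> B n \<union> (\<Union>j. R (j + n))" for n
 proof
  fix x assume x: "x \<in> A - F"
  then have pos: "infdist x F > 0" using in_closed_iff_infdist_zero[OF F ne, of x] infdist_nonneg[of x F] by force
  show "x \<in> B n \<union> (\<Union>j. R (j + n))"
  proof (cases "x \<in> B n")
   case False
   define m where "m = (LEAST m. x \<in> B m)"
   obtain m0 where "1 / real (Suc m0) < infdist x F" using nat_approx_posE[OF pos] by auto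
   then have "x \<in> B m0" using x by (auto simp: B_def)
   then have m: "x \<in> B m" unfolding m_def by (rule LeastI)
   have "m > n"
   proof (rule ccontr)
    assume "\<not> n < m"
    then have "1 / real (Suc n) \<le> 1 / real (Suc m)" by (intro divide_left_mono) auto
    then show False using m False by (auto simp: B_def)
   qed
   then obtain j where j: "m = Suc (j + n)" using less_iff_Suc_add by (metis add.commute)
   then have "x \<notin> B (j + n)" using not_less_Least[of "j + n" "\<lambda>m. x \<in> B m"] unfolding m_def[symmetric] by simp
   then have "x \<in> R (j + n)" using m j by (simp add: R_def)
   then show ?thesis by blast
  qed simp
 qed
 show ?thesis
 proof (rule ennreal_le_epsilon)
  fix e :: real assume e: "e > 0"
  have "(\<Sum>j. ?f (R j)) < (\<Sum>j. ?f (R j)) + ennreal e"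
   using Tfin e by (cases "\<Sum>j. ?f (R j)") (auto simp: ennreal_plus[symmetric] ennreal_less_iff simp del: ennreal_plus)
  have "\<exists>n. (\<Sum>j. ?f (R j)) \<le> (\<Sum>j<n. ?f (R j)) + ennreal e"
  proof (rule ccontr)
   assume "\<not> ?thesis"
   then have "(\<Sum>j<n. ?f (R j)) + ennreal e \<le> (\<Sum>j. ?f (R j))" for n by (auto simp: not_le intro: less_imp_le)
   then have "(SUP n. (\<Sum>j<n. ?f (R j)) + ennreal e) \<le> (\<Sum>j. ?f (R j))" by (intro SUP_least)
   moreover have "(SUP n. (\<Sum>j<n. ?f (R j)) + ennreal e) = (\<Sum>j. ?f (R j)) + ennreal e"
    by (subst ennreal_SUP_add_left) (auto simp: suminf_eq_SUP)
   ultimately show False using \<open>(\<Sum>j. ?f (R j)) < (\<Sum>j. ?f (R j)) + ennreal e\<close> by simp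
  qed
  then obtain n where n: "(\<Sum>j. ?f (R j)) \<le> (\<Sum>j<n. ?f (R j)) + ennreal e" ..
  have split: "(\<Sum>j. ?f (R j)) = (\<Sum>j. ?f (R (j + n))) + (\<Sum>j<n. ?f (R j))"
   by (rule suminf_offset) auto
  have Pfin: "(\<Sum>j<n. ?f (R j)) < top" using Tfin split by (auto simp: less_top)
  have tail: "(\<Sum>j. ?f (R (j + n))) \<le> ennreal e"
  proof -
   have "(\<Sum>j<n. ?f (R j)) + (\<Sum>j. ?f (R (j + n))) \<le> (\<Sum>j<n. ?f (R j)) + ennreal e"
    using n split by (simp only: add.commute)
   moreover have "(\<Sum>j<n. ?f (R j)) \<noteq> \<infinity>" using Pfin by (simp only: infinity_ennreal_def less_top)
   ultimately show ?thesis unfolding ennreal_add_left_cancel_le by blast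
  qed
  have "?f (A - F) \<le> ?f (B n \<union> (\<Union>j. R (j + n)))" by (rule hausdorff_outer_mono[OF cover])
  also have "... \<le> ?f (B n) + ?f (\<Union>j. R (j + n))" by (rule hausdorff_outer_Un)
  also have "... \<le> ?f (B n) + (\<Sum>j. ?f (R (j + n)))" by (intro add_left_mono hausdorff_outer_UN)
  also have "... \<le> ?f (B n) + ennreal e" by (intro add_left_mono tail)
  finally have "?f (A \<inter> F) + ?f (A - F) \<le> (?f (A \<inter> F) + ?f (B n)) + ennreal e"
   by (simp add: add.assoc add_left_mono)
  also have "... \<le> ?f A + ennreal e" by (intro add_right_mono BA)
  finally show "?f (A \<inter> F) + ?f (A - F) \<le> ?f A + ennreal e" .
 qed
qed

lemma measure_space_hausdorff: "measure_space UNIV (sets (borel :: 'a::metric_space measure)) (hausdorff_outer k)"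
proof -
 interpret P: sigma_algebra "UNIV :: 'a set" "Pow UNIV" by (rule sigma_algebra_Pow)
 have oms: "outer_measure_space (Pow UNIV) (hausdorff_outer k :: 'a set => ennreal)"
  unfolding outer_measure_space_def positive_def increasing_def countably_subadditive_def
  by (auto simp: hausdorff_outer_empty intro: hausdorff_outer_mono hausdorff_outer_UN)
 define L where "L = lambda_system UNIV (Pow UNIV) (hausdorff_outer k :: 'a set => ennreal)"
 have L: "measure_space UNIV L (hausdorff_outer k)" unfolding L_def by (rule P.caratheodory_lemma[OF oms])
 then have sL: "sigma_algebra UNIV L" by (simp add: measure_space_def)
 have "F \<in> L" if "closed F" for F
  unfolding L_def P.lambda_system_eq
  using closed_caratheodory[OF that, of k] hausdorff_outer_Un[of k "A \<inter> F" "A - F" for A]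
  by (auto intro!: antisym simp: Int_Diff_Un)
 then have "sigma_sets UNIV (Collect closed) \<subseteq> L" by (intro sigma_algebra.sigma_sets_subset[OF sL]) auto
 then have sub: "sets (borel :: 'a measure) \<subseteq> L" by (simp add: borel_eq_closed)
 have "countably_additive L (hausdorff_outer k)" "positive L (hausdorff_outer k)" using L by (auto simp: measure_space_def)
 moreover have "range A \<subseteq> L" "\<Union> (range A) \<in> L" if "range A \<subseteq> sets borel" for A :: "nat => 'a set"
 proof -
  have "\<Union> (range A) \<in> sets borel" using that by auto
  then show "range A \<subseteq> L" "\<Union> (range A) \<in> L" using that sub by auto
 qed
 ultimately have "countably_additive (sets (borel :: 'a measure)) (hausdorff_outer k)" "positive (sets (borel :: 'a measure)) (hausdorff_outer k)"
  using sub unfolding countably_additive_def positive_def by blast+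
 then show ?thesis using sets.sigma_algebra_axioms[of "borel :: 'a measure"] by (simp add: measure_space_def)
qed

lemma sets_hausdorff_measure [simp, measurable_cong]: "sets (hausdorff_measure k) = sets borel"
 and space_hausdorff_measure [simp]: "space (hausdorff_measure k) = UNIV"
 unfolding hausdorff_measure_def
 using sets.sets_measure_of_eq[of borel "hausdorff_outer k"] by (auto simp: space_measure_of_conv)

lemma emeasure_hausdorff_measure: "A \<in> sets borel ==> emeasure (hausdorff_measure k) A = hausdorff_outer k A"
 unfolding hausdorff_measure_def
 using measure_space_hausdorff[of k]
 by (subst emeasure_measure_of_conv) (auto simp: measure_space_def sets.sigma_sets_eq[of borel, simplified])

text \<open>The projection of a set of diameter \<open>r\<close> lies in a ball of radius \<open>r\<close>, whereas the Hausdorff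
content charges it with the volume of a ball of radius \<open>r/2\<close>; this is the factor \<open>2 ^ DIM('a)\<close>.\<close>

lemma lborel_le_hausdorff_outer:
 fixes E :: "'a::euclidean_space set" and A :: "('a \<times> 'b::metric_space) set"
 assumes E: "E \<in> sets borel" "E \<subseteq> fst ` A"
 shows "emeasure lborel E \<le> 2 ^ DIM('a) * hausdorff_outer (DIM('a)) A"
proof -
 have le: "emeasure lborel E / 2 ^ DIM('a) \<le> hausdorff_content (DIM('a)) 1 A"
 proof (rule hausdorff_content_greatest)
  fix C assume C: "fine_cover 1 A C"
  define x where "x i = fst (SOME p. p \<in> C i)" for i
  define Q where "Q i = (if C i = {} then {} else cball (x i) (diameter (C i)))" for i
  have "E \<subseteq> (\<Union>i. Q i)"
  proof
   fix y assume "y \<in> E"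
   then obtain p where p: "p \<in> A" "fst p = y" using E by auto
   then obtain i where i: "p \<in> C i" using C by (auto simp: fine_cover_def)
   have "(SOME p. p \<in> C i) \<in> C i" using i by (rule someI)
   then have "dist (SOME p. p \<in> C i) p \<le> diameter (C i)"
    using C i by (intro diameter_bounded_bound) (auto simp: fine_cover_def)
   then have "dist (x i) y \<le> diameter (C i)" unfolding x_def p(2)[symmetric] using dist_fst_le order_trans by blast
   then show "y \<in> (\<Union>i. Q i)" using i by (auto simp: Q_def)
  qed
  then have "emeasure lborel E \<le> emeasure lborel (\<Union>i. Q i)" by (rule emeasure_mono) (auto simp: Q_def)
  also have "... \<le> (\<Sum>i. emeasure lborel (Q i))" by (rule emeasure_subadditive_countably) (auto simp: Q_def)
  also have "... \<le> (\<Sum>i. 2 ^ DIM('a) * ball_cost (DIM('a)) (C i))"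
  proof (intro suminf_le)
   fix i
   have d: "0 \<le> diameter (C i)" by (rule diameter_ge_0) (use C in \<open>auto simp: fine_cover_def\<close>)
   have "unit_ball_vol (real DIM('a)) * diameter (C i) ^ DIM('a) = 2 ^ DIM('a) * (unit_ball_vol (real DIM('a)) * (diameter (C i) / 2) ^ DIM('a))"
    by (simp add: power_divide)
   moreover have "ennreal (2 ^ DIM('a)) = 2 ^ DIM('a)" by (simp add: ennreal_power[symmetric])
   ultimately have "ennreal (unit_ball_vol (real DIM('a)) * diameter (C i) ^ DIM('a)) = 2 ^ DIM('a) * ennreal (unit_ball_vol (real DIM('a)) * (diameter (C i) / 2) ^ DIM('a))"
    using d by (metis ennreal_mult' zero_le_numeral zero_le_power)
   then show "emeasure lborel (Q i) \<le> 2 ^ DIM('a) * ball_cost (DIM('a)) (C i)"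
    using d by (simp add: Q_def ball_cost_def emeasure_cball)
  qed auto
  also have "... = 2 ^ DIM('a) * (\<Sum>i. ball_cost (DIM('a)) (C i))" by simp
  finally show "emeasure lborel E / 2 ^ DIM('a) \<le> (\<Sum>i. ball_cost (DIM('a)) (C i))"
  proof (rule divide_le_posI_ennreal[rotated])
   have "(2 :: ennreal) ^ DIM('a) = ennreal (2 ^ DIM('a))" by (simp add: ennreal_power[symmetric])
   then show "(0 :: ennreal) < 2 ^ DIM('a)" by simp
  qed
 qed
 have "emeasure lborel E \<le> 2 ^ DIM('a) * (emeasure lborel E / 2 ^ DIM('a))"
 proof -
  have p: "(2 :: ennreal) ^ DIM('a) = ennreal (2 ^ DIM('a))" by (simp add: ennreal_power[symmetric])
  have "emeasure lborel E * ennreal (2 ^ DIM('a)) / ennreal (2 ^ DIM('a)) = emeasure lborel E"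
   by (rule ennreal_mult_divide_eq) auto
  then show ?thesis unfolding p by (simp add: ennreal_times_divide mult.commute)
 qed
 also have "... \<le> 2 ^ DIM('a) * hausdorff_outer (DIM('a)) A"
  by (intro mult_left_mono order_trans[OF le hausdorff_content_le_outer]) auto
 finally show ?thesis .
qed

lemma diameter_isometry_le:
 assumes "bounded C" "\<And>x y. dist (\<rho> x) (\<rho> y) = dist x y"
 shows "diameter (\<rho> ` C) \<le> diameter C"
proof (cases "C = {}")
 case False
 have "(SUP (x, y)\<in>\<rho> ` C \<times> \<rho> ` C. dist x y) \<le> diameter C"
  by (rule cSUP_least) (use False diameter_bounded_bound[OF assms(1)] assms(2) in auto)
 then show ?thesis using False by (simp add: diameter_def)
qed simp

lemma hausdorff_outer_isometry:
 assumes "\<And>x y. dist (\<rho> x) (\<rho> y) = dist x y"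
 shows "hausdorff_outer k (\<rho> ` A) \<le> hausdorff_outer k A"
proof (rule hausdorff_outer_least)
 fix \<delta> :: real assume \<delta>: "\<delta> > 0"
 have "hausdorff_content k \<delta> (\<rho> ` A) \<le> hausdorff_content k \<delta> A"
 proof (rule hausdorff_content_greatest)
  fix C assume C: "fine_cover \<delta> A C"
  have b: "bounded (\<rho> ` C i)" for i
  proof -
   have "bounded (C i)" using C by (simp add: fine_cover_def)
   then obtain x e where "\<forall>y\<in>C i. dist x y \<le> e" by (auto simp: bounded_def)
   then show ?thesis unfolding bounded_def using assms by (metis imageE)
  qed
  have d: "diameter (\<rho> ` C i) \<le> diameter (C i)" for i
   using C by (intro diameter_isometry_le assms) (auto simp: fine_cover_def)
  have "fine_cover \<delta> (\<rho> ` A) (\<lambda>i. \<rho> ` C i)"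
   unfolding fine_cover_def using C b order_trans[OF d] by (auto simp: fine_cover_def) blast
  then have "hausdorff_content k \<delta> (\<rho> ` A) \<le> (\<Sum>i. ball_cost k (\<rho> ` C i))" by (rule hausdorff_content_le)
  also have "... \<le> (\<Sum>i. ball_cost k (C i))"
  proof (intro suminf_le)
   fix i
   have "0 \<le> diameter (\<rho> ` C i)" by (rule diameter_ge_0[OF b])
   then show "ball_cost k (\<rho> ` C i) \<le> ball_cost k (C i)" using d[of i]
    by (auto simp: ball_cost_def intro!: ennreal_leI mult_left_mono power_mono unit_ball_vol_nonneg)
  qed auto
  finally show "hausdorff_content k \<delta> (\<rho> ` A) \<le> (\<Sum>i. ball_cost k (C i))" .
 qed
 also have "... \<le> hausdorff_outer k A" by (rule hausdorff_content_le_outer[OF \<delta>])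
 finally show "hausdorff_content k \<delta> (\<rho> ` A) \<le> hausdorff_outer k A" .
qed

lemma nn_integral_hausdorff_involution:
 fixes \<rho> :: "'a::metric_space => 'a"
 assumes iso: "\<And>x y. dist (\<rho> x) (\<rho> y) = dist x y" and inv: "\<And>x. \<rho> (\<rho> x) = x"
  and [measurable]: "\<rho> \<in> borel \<rightarrow>\<^sub>M borel" "f \<in> BM"
 shows "(\<integral>\<^sup>+p. f (\<rho> p) \<partial>hausdorff_measure k) \<le> (\<integral>\<^sup>+p. f p \<partial>hausdorff_measure k)"
proof -
 have [measurable]: "\<rho> \<in> measurable (hausdorff_measure k) borel" by measurable
 have "(\<integral>\<^sup>+p. f (\<rho> p) \<partial>hausdorff_measure k) = (\<integral>\<^sup>+p. f p \<partial>distr (hausdorff_measure k) borel \<rho>)"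
  by (rule nn_integral_distr[symmetric]) auto
 also have "... \<le> (\<integral>\<^sup>+p. f p \<partial>hausdorff_measure k)"
 proof (rule nn_integral_mono_measure)
  show "distr (hausdorff_measure k) borel \<rho> \<le> hausdorff_measure k"
  proof (rule le_measure[THEN iffD2, rule_format])
   fix A assume "A \<in> sets (distr (hausdorff_measure k) borel \<rho>)"
   then have A [measurable]: "A \<in> sets borel" by simp
   have eq: "\<rho> -` A = \<rho> ` A" using inv by (auto simp: image_iff) metis
   have m: "\<rho> -` A \<in> sets borel" using measurable_sets[of \<rho> borel borel A] by simp
   show "emeasure (distr (hausdorff_measure k) borel \<rho>) A \<le> emeasure (hausdorff_measure k) A"
    using m hausdorff_outer_isometry[OF iso, of k A]
    by (simp add: emeasure_distr emeasure_hausdorff_measure eq)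
  qed auto
 qed auto
 finally show ?thesis .
qed

text \<open>Bounds on the boundary surface become bounds over \<open>D\<close> in this way.\<close>

lemma nn_integral_graph_le_hausdorff:
 fixes \<gamma> :: "'a::euclidean_space => real" and f :: "'a \<times> real => ennreal"
 assumes [measurable]: "\<gamma> \<in> BM" "D \<in> sets borel" "f \<in> BM" "\<Gamma> \<in> sets borel"
  and sub: "\<And>x. x \<in> D ==> (x, \<gamma> x) \<in> \<Gamma>"
 shows "(\<integral>\<^sup>+x. f (x, \<gamma> x) * indicator D x \<partial>lborel)
  \<le> 2 ^ DIM('a) * (\<integral>\<^sup>+p. f p * indicator \<Gamma> p \<partial>hausdorff_measure DIM('a))"
proof -
 define g where "g x = (x, \<gamma> x)" for x
 have [measurable]: "g \<in> borel \<rightarrow>\<^sub>M borel" unfolding g_def by (simp add: borel_prod[symmetric])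
 let ?H = "hausdorff_measure DIM('a) :: ('a \<times> real) measure"
 let ?M = "distr (density lborel (indicator D)) borel g"
 let ?N = "density (scale_measure (2 ^ DIM('a)) ?H) (indicator \<Gamma>)"
 have "(\<integral>\<^sup>+x. f (x, \<gamma> x) * indicator D x \<partial>lborel) = (\<integral>\<^sup>+p. f p \<partial>?M)"
  by (simp add: nn_integral_distr nn_integral_density g_def mult.commute)
 also have "... \<le> (\<integral>\<^sup>+p. f p \<partial>?N)"
 proof (rule nn_integral_mono_measure)
  show "?M \<le> ?N"
  proof (rule le_measure[THEN iffD2, rule_format])
   fix A assume "A \<in> sets ?M"
   then have A [measurable]: "A \<in> sets borel" by simp
   have m: "g -` A \<inter> D \<in> sets borel" using measurable_sets[of g borel borel A] by auto
   have "emeasure ?M A = emeasure lborel (g -` A \<inter> D)"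
   proof -
    have gA: "g -` A \<in> sets borel" using measurable_sets[of g borel borel A] by simp
    have "emeasure ?M A = emeasure (density lborel (indicator D)) (g -` A)"
     by (subst emeasure_distr) auto
    also have "... = (\<integral>\<^sup>+x. indicator D x * indicator (g -` A) x \<partial>lborel)"
     by (rule emeasure_density) (use gA in auto)
    also have "... = (\<integral>\<^sup>+x. indicator (g -` A \<inter> D) x \<partial>lborel)"
     by (intro nn_integral_cong) (auto split: split_indicator)
    also have "... = emeasure lborel (g -` A \<inter> D)" using m by simp
    finally show ?thesis .
   qed
   also have "... \<le> 2 ^ DIM('a) * hausdorff_outer DIM('a) (A \<inter> \<Gamma>)"
    by (rule lborel_le_hausdorff_outer[OF m]) (use sub in \<open>force simp: g_def\<close>)
   also have "... = emeasure ?N A"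
   proof -
    have "emeasure ?N A = (\<integral>\<^sup>+p. indicator \<Gamma> p * indicator A p \<partial>scale_measure (2 ^ DIM('a)) ?H)"
     by (rule emeasure_density) auto
    also have "... = (\<integral>\<^sup>+p. indicator (A \<inter> \<Gamma>) p \<partial>scale_measure (2 ^ DIM('a)) ?H)"
     by (intro nn_integral_cong) (auto split: split_indicator)
    also have "... = emeasure (scale_measure (2 ^ DIM('a)) ?H) (A \<inter> \<Gamma>)" by (rule nn_integral_indicator) auto
    finally show ?thesis by (simp add: emeasure_hausdorff_measure)
   qed
   finally show "emeasure ?M A \<le> emeasure ?N A" .
  qed auto
 qed auto
 also have "... = 2 ^ DIM('a) * (\<integral>\<^sup>+p. f p * indicator \<Gamma> p \<partial>?H)"
  by (simp add: nn_integral_density nn_integral_scale_measure mult.commute)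
 finally show ?thesis .
qed

section \<open>Fubini and vertical shears\<close>

lemma fst_borel [measurable]: "fst \<in> borel_measurable (borel :: ('a::euclidean_space \<times> real) measure)"
 and snd_borel [measurable]: "snd \<in> borel_measurable (borel :: ('a::euclidean_space \<times> real) measure)"
 by (auto intro!: borel_measurable_continuous_onI continuous_intros)

lemma section_measurable:
 fixes f :: "'a::euclidean_space \<times> real => 'b::topological_space"
 assumes "f \<in> BM" shows "(\<lambda>z. f (x, z)) \<in> BM"
 using measurable_compose[OF _ assms, of "\<lambda>z. (x, z)" borel] by simp

lemma lborel_nn_Fubini:
 fixes f :: "'a::euclidean_space \<times> real => ennreal"
 assumes "f \<in> BM"
 shows "(\<integral>\<^sup>+p. f p \<partial>lborel) = (\<integral>\<^sup>+x. \<integral>\<^sup>+z. f (x, z) \<partial>lborel \<partial>lborel)"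
  "(\<lambda>x. \<integral>\<^sup>+z. f (x, z) \<partial>lborel) \<in> BM"
proof -
 have f: "f \<in> borel_measurable (lborel \<Otimes>\<^sub>M lborel)" using assms by (simp add: lborel_prod)
 show "(\<integral>\<^sup>+p. f p \<partial>lborel) = (\<integral>\<^sup>+x. \<integral>\<^sup>+z. f (x, z) \<partial>lborel \<partial>lborel)"
  using lborel.nn_integral_fst[OF f] by (simp add: lborel_prod)
 show "(\<lambda>x. \<integral>\<^sup>+z. f (x, z) \<partial>lborel) \<in> BM"
  using lborel.borel_measurable_nn_integral_fst[OF f] by simp
qed

lemma lborel_Fubini:
 fixes f :: "'a::euclidean_space \<times> real => real"
 assumes "integrable lborel f"
 shows "(LINT p|lborel. f p) = (LINT x|lborel. LINT z|lborel. f (x, z))"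
  "integrable lborel (\<lambda>x. LINT z|lborel. f (x, z))" "AE x in lborel. integrable lborel (\<lambda>z. f (x, z))"
proof -
 have f: "integrable (lborel \<Otimes>\<^sub>M lborel) f" using assms by (simp add: lborel_prod)
 show "(LINT p|lborel. f p) = (LINT x|lborel. LINT z|lborel. f (x, z))"
  using lborel_pair.integral_fst'[OF f] by (simp add: lborel_prod)
 show "integrable lborel (\<lambda>x. LINT z|lborel. f (x, z))" "AE x in lborel. integrable lborel (\<lambda>z. f (x, z))"
  using lborel_pair.integrable_fst'[OF f] lborel_pair.AE_integrable_fst'[OF f] by auto
qed

lemma AE_lborel_fst:
 fixes P :: "'a::euclidean_space \<times> real => bool"
 assumes "AE p in lborel. P p" shows "AE x in lborel. AE z in lborel. P (x, z)"
proof (rule lborel_pair.AE_pair)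
 show "AE p in lborel \<Otimes>\<^sub>M lborel. P p" unfolding lborel_prod by (rule assms)
qed

lemma nn_integral_shear:
 fixes f :: "'a::euclidean_space \<times> real => ennreal"
 assumes [measurable]: "f \<in> BM" "w \<in> BM" and c: "c \<noteq> 0"
 shows "(\<integral>\<^sup>+p. f p \<partial>lborel) = ennreal \<bar>c\<bar> * (\<integral>\<^sup>+p. f (fst p, w (fst p) + c * snd p) \<partial>lborel)"
proof -
 have "(\<integral>\<^sup>+p. f p \<partial>lborel) = (\<integral>\<^sup>+x. \<integral>\<^sup>+z. f (x, z) \<partial>lborel \<partial>lborel)" by (rule lborel_nn_Fubini) simp
 also have "... = (\<integral>\<^sup>+x. ennreal \<bar>c\<bar> * (\<integral>\<^sup>+t. f (x, w x + c * t) \<partial>lborel) \<partial>lborel)"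
  by (intro nn_integral_cong nn_integral_real_affine c section_measurable) simp
 also have "... = ennreal \<bar>c\<bar> * (\<integral>\<^sup>+x. \<integral>\<^sup>+t. f (x, w x + c * t) \<partial>lborel \<partial>lborel)"
  using lborel_nn_Fubini(2)[of "\<lambda>p. f (fst p, w (fst p) + c * snd p)"]
  by (intro nn_integral_cmult) simp
 also have "... = ennreal \<bar>c\<bar> * (\<integral>\<^sup>+p. f (fst p, w (fst p) + c * snd p) \<partial>lborel)"
  by (subst lborel_nn_Fubini(1)[of "\<lambda>p. f (fst p, w (fst p) + c * snd p)"]) simp_all
 finally show ?thesis .
qed

lemma lborel_shear:
 fixes w :: "'a::euclidean_space => real"
 assumes [measurable]: "w \<in> BM" and c: "c \<noteq> 0"
 shows "(lborel :: ('a \<times> real) measure) = density (distr lborel borel (\<lambda>p. (fst p, w (fst p) + c * snd p))) (\<lambda>_. ennreal \<bar>c\<bar>)"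
proof (rule measure_eqI)
 fix A :: "('a \<times> real) set" assume "A \<in> sets lborel"
 then have [measurable]: "A \<in> sets borel" by simp
 have "emeasure lborel A = (\<integral>\<^sup>+p. indicator A p \<partial>lborel)" by simp
 also have "... = ennreal \<bar>c\<bar> * (\<integral>\<^sup>+p. indicator A (fst p, w (fst p) + c * snd p) \<partial>lborel)"
  by (rule nn_integral_shear) (use c in auto)
 also have "... = emeasure (density (distr lborel borel (\<lambda>p. (fst p, w (fst p) + c * snd p))) (\<lambda>_. ennreal \<bar>c\<bar>)) A"
 proof -
  let ?T = "\<lambda>p. (fst p, w (fst p) + c * snd p) :: 'a \<times> real"
  have "emeasure (density (distr lborel borel ?T) (\<lambda>_. ennreal \<bar>c\<bar>)) A = (\<integral>\<^sup>+p. ennreal \<bar>c\<bar> * indicator A p \<partial>distr lborel borel ?T)"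
   by (rule emeasure_density) auto
  also have "... = (\<integral>\<^sup>+p. ennreal \<bar>c\<bar> * indicator A (?T p) \<partial>lborel)"
   by (rule nn_integral_distr) auto
  also have "... = ennreal \<bar>c\<bar> * (\<integral>\<^sup>+p. indicator A (?T p) \<partial>lborel)" by (rule nn_integral_cmult) measurable
  finally show ?thesis by simp
 qed
 finally show "emeasure lborel A = emeasure (density (distr lborel borel (\<lambda>p. (fst p, w (fst p) + c * snd p))) (\<lambda>_. ennreal \<bar>c\<bar>)) A" .
qed simp

text \<open>With \<open>c = 1\<close> this flattens the graph of \<open>w\<close>, with \<open>c = -1\<close> it describes
reflections, and with small \<open>c\<close> it stretches a thin layer to unit thickness.\<close>

lemma integral_shear:
 fixes f :: "'a::euclidean_space \<times> real => 'b::euclidean_space"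
 assumes [measurable]: "f \<in> BM" "w \<in> BM" and c: "c \<noteq> 0"
 shows "(LINT p|lborel. f p) = \<bar>c\<bar> *\<^sub>R (LINT p|lborel. f (fst p, w (fst p) + c * snd p))"
  "integrable lborel f \<longleftrightarrow> integrable lborel (\<lambda>p. f (fst p, w (fst p) + c * snd p))"
proof -
 let ?T = "\<lambda>p. (fst p, w (fst p) + c * snd p) :: 'a \<times> real"
 have "(LINT p|lborel. f p) = (LINT p|density (distr lborel borel ?T) (\<lambda>_. ennreal \<bar>c\<bar>). f p)"
  by (subst lborel_shear[OF assms(2) c]) simp
 also have "... = (LINT p|distr lborel borel ?T. \<bar>c\<bar> *\<^sub>R f p)" by (rule integral_density) auto
 also have "... = \<bar>c\<bar> *\<^sub>R (LINT p|lborel. f (?T p))" by (subst integral_distr) auto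
 finally show "(LINT p|lborel. f p) = \<bar>c\<bar> *\<^sub>R (LINT p|lborel. f (?T p))" .
 have "integrable lborel f \<longleftrightarrow> integrable (density (distr lborel borel ?T) (\<lambda>_. ennreal \<bar>c\<bar>)) f"
  by (subst lborel_shear[OF assms(2) c]) simp
 also have "... \<longleftrightarrow> integrable (distr lborel borel ?T) (\<lambda>p. \<bar>c\<bar> *\<^sub>R f p)" by (rule integrable_density) auto
 also have "... \<longleftrightarrow> integrable lborel (\<lambda>p. \<bar>c\<bar> *\<^sub>R f (?T p))" by (subst integrable_distr_eq) auto
 also have "... \<longleftrightarrow> integrable lborel (\<lambda>p. f (?T p))"
 proof
  assume "integrable lborel (\<lambda>p. \<bar>c\<bar> *\<^sub>R f (?T p))"
  then have "integrable lborel (\<lambda>p. (1 / \<bar>c\<bar>) *\<^sub>R (\<bar>c\<bar> *\<^sub>R f (?T p)))" by (rule integrable_scaleR_right)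
  then show "integrable lborel (\<lambda>p. f (?T p))" using c by simp
 qed (rule integrable_scaleR_right)
 finally show "integrable lborel f \<longleftrightarrow> integrable lborel (\<lambda>p. f (?T p))" .
qed

lemma sqint_shear:
 fixes f :: "'a::euclidean_space \<times> real => 'b::euclidean_space"
 assumes f: "sqint f" and [measurable]: "w \<in> BM" and c: "c \<noteq> 0"
 shows "sqint (\<lambda>p. f (fst p, w (fst p) + c * snd p))"
  "sqn f = \<bar>c\<bar> * sqn (\<lambda>p. f (fst p, w (fst p) + c * snd p))"
proof -
 have [measurable]: "f \<in> BM" using f by (simp add: sqint_def)
 show "sqint (\<lambda>p. f (fst p, w (fst p) + c * snd p))"
  using f integral_shear(2)[of "\<lambda>p. (norm (f p))\<^sup>2" w c] c by (simp add: sqint_def)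
 show "sqn f = \<bar>c\<bar> * sqn (\<lambda>p. f (fst p, w (fst p) + c * snd p))"
  using integral_shear(1)[of "\<lambda>p. (norm (f p))\<^sup>2" w c] c by (simp add: sqn_def)
qed

section \<open>The derivative of the smooth step\<close>

definition step_deriv :: "real => real" where
 "step_deriv t = frechet_derivative smooth_step (at t) 1"

lemma step_has_derivative: "(smooth_step has_real_derivative step_deriv t) (at t)"
proof -
 have d: "(smooth_step has_derivative frechet_derivative smooth_step (at t)) (at t)"
  using Cinf_has_derivative[OF Cinf_smooth_step] by simp
 have "frechet_derivative smooth_step (at t) h = step_deriv t * h" for h
  using linear_cmul[OF has_derivative_linear[OF d], of h 1] by (simp add: step_deriv_def mult.commute)
 then have "frechet_derivative smooth_step (at t) = (*) (step_deriv t)" by auto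
 then show ?thesis using d by (simp add: has_field_derivative_def)
qed

lemma step_deriv_cont: "continuous_on UNIV step_deriv"
 unfolding step_deriv_def[abs_def] by (rule Cinf_continuous_on[OF Cinf_deriv[OF Cinf_smooth_step]])

lemma step_deriv_outside: "t \<notin> {0..1} ==> step_deriv t = 0"
proof -
 assume t: "t \<notin> {0..1}"
 have "(smooth_step has_real_derivative 0) (at t)"
 proof (cases "t < 0")
  case True
  have "((\<lambda>t. 0) has_real_derivative 0) (at t)" by simp
  then show ?thesis
   by (rule has_field_derivative_transform_within_open[of _ _ _ "{..<0}"]) (use True smooth_step_0 in auto)
 next
  case False
  have "((\<lambda>t. 1) has_real_derivative 0) (at t)" by simp
  then show ?thesis
   by (rule has_field_derivative_transform_within_open[of _ _ _ "{1<..}"]) (use False t smooth_step_1 in auto)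
 qed
 then show ?thesis using step_has_derivative DERIV_unique by blast
qed

lemma step_deriv_bounded: obtains B where "B \<ge> 0" "\<And>t. \<bar>step_deriv t\<bar> \<le> B"
proof -
 have "compact (step_deriv ` {0..1})"
  using continuous_on_subset[OF step_deriv_cont] by (intro compact_continuous_image) auto
 then obtain B where B: "\<And>y. y \<in> step_deriv ` {0..1} ==> norm y \<le> B" using compact_imp_bounded bounded_iff by metis
 have "\<bar>step_deriv t\<bar> \<le> max B 0" for t using B[of "step_deriv t"] step_deriv_outside[of t] by (cases "t \<in> {0..1}") auto
 then show thesis by (intro that[of "max B 0"]) auto
qed

lemma step_deriv_measurable [measurable]: "step_deriv \<in> BM"
 by (rule borel_measurable_continuous_onI[OF step_deriv_cont])

lemma step_deriv_integral: "(LINT t|lborel. step_deriv t) = 1" "integrable lborel step_deriv"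
proof -
 have eq: "step_deriv = (\<lambda>t. indicator {0..1} t *\<^sub>R step_deriv t)"
  using step_deriv_outside by (auto simp: fun_eq_iff split: split_indicator)
 have "(LINT t|lborel. indicator {0..1} t *\<^sub>R step_deriv t) = smooth_step 1 - smooth_step 0"
  by (rule integral_FTC_atLeastAtMost)
   (auto intro!: continuous_on_subset[OF step_deriv_cont] has_vector_derivative_at_within
    step_has_derivative[unfolded has_real_derivative_iff_has_vector_derivative])
 then show "(LINT t|lborel. step_deriv t) = 1" by (subst eq) (simp add: smooth_step_0 smooth_step_1)
 show "integrable lborel step_deriv"
  by (subst eq) (intro borel_integrable_compact[unfolded set_integrable_def] continuous_on_subset[OF step_deriv_cont], auto)
qed

section \<open>Green's formula on subgraphs\<close>

lemma sobolev_pairD: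
 "sobolev_pair S f g ==> \<phi> \<in> test_functions S ==>
  (LINT x|lborel. f x * (gradient \<phi> x \<bullet> e)) = - (LINT x|lborel. \<phi> x * (g x \<bullet> e))"
 unfolding sobolev_pair_def by blast

text \<open>The upward normal of the graph, not normalised: its norm is the surface density, so that flux integrals over the graph
become plain integrals over \<open>D\<close>.\<close>

definition gnormal :: "'a::euclidean_space set => ('a => real) => 'a => 'a \<times> real" where
 "gnormal D v x = (if x \<in> D then (- gradient v x, 1) else 0)"

text \<open>\<open>\<tau>\<close> is the trace of \<open>f\<close> on the graph of \<open>v\<close> in the sense of Green's
formula.  The test functions vanish near the lateral and the lower boundary, so that only the graph contributes.\<close>

definition green_trace :: "'a::euclidean_space set => real => ('a => real) => ('a \<times> real => real) => ('a \<times> real => 'a \<times> real) => ('a => real) => bool" where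
 "green_trace D H v f g \<tau> \<longleftrightarrow> sqint \<tau> \<and> (\<forall>x. x \<notin> D --> \<tau> x = 0) \<and>
  (\<forall>\<phi>\<in>test_functions (D \<times> {-H<..}). \<forall>e.
   (LINT p|lborel. f p * (gradient \<phi> p \<bullet> e)) + (LINT p|lborel. \<phi> p * (g p \<bullet> e))
    = (LINT x|lborel. \<tau> x * (\<phi> (x, v x) * (gnormal D v x \<bullet> e))))"

text \<open>The subgraph of \<open>v\<close> over \<open>D\<close>, of height at least \<open>c\<close> everywhere.\<close>

locale graph_domain =
 fixes D :: "'a::euclidean_space set" and H c M L :: real and v :: "'a => real"
 assumes D: "open D" "bounded D" and v: "Cinf v D" "v \<in> BM"
  and c: "c > 0" and L: "L \<ge> 0"
  and v_low: "\<And>x. x \<in> D ==> - H + c \<le> v x" and v_up: "\<And>x. x \<in> D ==> v x \<le> M"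
  and grad: "\<And>x. x \<in> D ==> norm (gradient v x) \<le> L"
begin

abbreviation "\<Omega> \<equiv> Omega1 D H v"

lemma v_cont: "continuous_on D v" by (rule Cinf_continuous_on[OF v(1)])

lemma v_deriv: "x \<in> D ==> (v has_derivative (\<lambda>a. gradient v x \<bullet> a)) (at x)"
 by (rule gradient_has_derivative[OF Cinf_has_derivative[OF v(1)]])

lemma grad_inner_Cinf: "Cinf (\<lambda>x. gradient v x \<bullet> a) D"
proof -
 have "gradient v x \<bullet> a = frechet_derivative v (at x) a" if "x \<in> D" for x
  by (rule gradient_inner[OF Cinf_has_derivative[OF v(1) that]])
 then have "Cinf (\<lambda>x. gradient v x \<bullet> a) D \<longleftrightarrow> Cinf (\<lambda>x. frechet_derivative v (at x) a) D"
  by (intro Cinf_cong D(1))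
 then show ?thesis using Cinf_deriv[OF v(1), of a] by simp
qed

lemma gnormal_measurable [measurable]: "gnormal D v \<in> BM"
proof -
 have "continuous_on D (gradient v)"
  using Cinf_continuous_on[OF grad_inner_Cinf] by (subst continuous_on_componentwise) auto
 then have "continuous_on D (\<lambda>x. (- gradient v x, 1::real))" by (intro continuous_intros)
 from borel_measurable_continuous_on_indicator[OF _ this]
 have "(\<lambda>x. indicator D x *\<^sub>R (- gradient v x, 1::real)) \<in> BM" using D by simp
 moreover have "(\<lambda>x. indicator D x *\<^sub>R (- gradient v x, 1::real)) = gnormal D v"
  by (auto simp: gnormal_def fun_eq_iff zero_prod_def split: split_indicator)
 ultimately show ?thesis by simp
qed

lemma gnormal_bound: "norm (gnormal D v x) \<le> L + 1"
proof (cases "x \<in> D")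
 case True
 have "norm (- gradient v x, 1::real) \<le> norm (gradient v x) + 1"
  using norm_Pair_le[of "- gradient v x" "1::real"] by simp
 then show ?thesis using True grad[OF True] by (simp add: gnormal_def)
qed (use L in \<open>simp add: gnormal_def\<close>)

lemma D_borel [measurable]: "D \<in> sets borel" using D by simp

lemma v_borel [measurable]: "v \<in> BM" by (rule v(2))

lemma Omega_open: "open \<Omega>"
proof -
 have "continuous_on (D \<times> {-H<..}) (\<lambda>p. v (fst p) - snd p)"
  by (intro continuous_intros continuous_on_compose2[OF v_cont]) auto
 from continuous_open_preimage[OF this open_Times[OF D(1) open_greaterThan] open_greaterThan[of 0]]
 have "open (D \<times> {-H<..} \<inter> (\<lambda>p. v (fst p) - snd p) -` {0<..})" .
 also have "D \<times> {-H<..} \<inter> (\<lambda>p. v (fst p) - snd p) -` {0<..} = \<Omega>" by (auto simp: Omega1_def)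
 finally show ?thesis .
qed

lemma Omega_borel [measurable]: "\<Omega> \<in> sets borel" using Omega_open by simp

lemma Omega_sub: "\<Omega> \<subseteq> D \<times> {- H<..}" by (auto simp: Omega1_def)

lemma Omega_bounded: "bounded \<Omega>"
 by (rule bounded_subset[of "D \<times> {-H..M}"]) (use D v_up in \<open>force simp: Omega1_def intro!: bounded_Times\<close>)+

lemma closure_compact: "compact (closure \<Omega>)" using Omega_bounded by (simp add: compact_closure)

lemma graph_in_closure:
 assumes "x \<in> D" shows "(x, v x) \<in> closure \<Omega>" "(x, v x) \<in> frontier \<Omega>"
proof -
 have "(\<lambda>n. (x, v x - c / 2 / real (Suc n))) \<longlonglongrightarrow> (x, v x - 0)"
  by (intro tendsto_intros LIMSEQ_Suc lim_const_over_n)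
 moreover have "(x, v x - c / 2 / real (Suc n)) \<in> \<Omega>" for n
 proof -
  have "c / 2 / real (Suc n) \<le> c / 2" using c by (simp add: field_simps)
  moreover have "0 < c / 2 / real (Suc n)" using c by simp
  ultimately show ?thesis using assms v_low[OF assms] c by (auto simp: Omega1_def)
 qed
 ultimately show "(x, v x) \<in> closure \<Omega>" unfolding closure_sequential by (intro exI conjI) auto
 then show "(x, v x) \<in> frontier \<Omega>" using Omega_open by (simp add: frontier_def interior_open Omega1_def)
qed

lemma lborel_D_finite: "emeasure lborel D < \<infinity>"
 using emeasure_bounded_finite[OF D(2)] by simp

lemma sqint_bounded_on_D:
 fixes k :: "'a => 'b::euclidean_space"
 assumes [measurable]: "k \<in> BM" and "\<And>x. norm (k x) \<le> B" "\<And>x. x \<notin> D ==> k x = 0"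
 shows "sqint k"
proof -
 have "integrable lborel (\<lambda>x. indicator D x * B\<^sup>2)"
  using lborel_D_finite by (intro integrable_mult_left integrable_real_indicator) auto
 then have "integrable lborel (\<lambda>x. (norm (k x))\<^sup>2)"
  by (rule Bochner_Integration.integrable_bound)
   (use assms(2,3) in \<open>auto intro!: always_eventually power_mono split: split_indicator\<close>)
 then show ?thesis by (simp add: sqint_def)
qed

lemma cutoff_Cinf: "Cinf (\<lambda>p. smooth_step (r * (v (fst p) - snd p) - 1)) (D \<times> UNIV)"
proof -
 have o: "open (D \<times> (UNIV :: real set))" using D by (simp add: open_Times)
 have "Cinf (\<lambda>p. r * (v (fst p) - snd p) - 1) (D \<times> (UNIV::real set))"
  by (intro Cinf_diff Cinf_mult Cinf_const o Cinf_fst[OF o v(1) D(1)] Cinf_linear bounded_linear_snd) auto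
 from Cinf_compose_real[OF o _ _ this Cinf_smooth_step] show ?thesis by simp
qed

lemma cutoff_test:
 assumes \<phi>: "\<phi> \<in> test_functions (D \<times> {-H<..})" and r: "r > 0"
 shows "(\<lambda>p. \<phi> p * smooth_step (r * (v (fst p) - snd p) - 1)) \<in> test_functions \<Omega>"
proof -
 have o: "open (D \<times> (UNIV :: real set))" using D by (simp add: open_Times)
 obtain K where K: "compact K" "K \<subseteq> D \<times> {-H<..}" "Cinf \<phi> UNIV" "\<And>x. x \<notin> K ==> \<phi> x = 0" using test_functionsE[OF \<phi>] by blast
 define K' where "K' = {p\<in>K. 1 / r \<le> v (fst p) - snd p}"
 have cont: "continuous_on K (\<lambda>p. v (fst p) - snd p)"
  using K(2) by (intro continuous_intros continuous_on_compose2[OF v_cont]) auto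
 have "closed (K \<inter> (\<lambda>p. v (fst p) - snd p) -` {1/r..})"
  by (rule continuous_closed_preimage[OF cont]) (use K(1) in \<open>auto intro: compact_imp_closed\<close>)
 moreover have "K \<inter> (\<lambda>p. v (fst p) - snd p) -` {1/r..} = K'" by (auto simp: K'_def)
 ultimately have "compact K'" using K(1) compact_Int_closed[of K K'] by (auto simp: K'_def Int_absorb1 Collect_conj_eq)
 moreover have "K' \<subseteq> \<Omega>"
 proof
  fix p assume p: "p \<in> K'"
  then have a: "p \<in> D \<times> {-H<..}" "1 / r \<le> v (fst p) - snd p" using K(2) by (auto simp: K'_def)
  have "1 / r > 0" using r by simp
  with a(2) have "v (fst p) - snd p > 0" by linarith
  then show "p \<in> \<Omega>" using a(1) by (auto simp: Omega1_def split_beta)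
 qed
 moreover have "\<phi> p * smooth_step (r * (v (fst p) - snd p) - 1) = 0" if "p \<notin> K'" for p
 proof (cases "p \<in> K")
  case True
  then have "v (fst p) - snd p < 1 / r" using that by (simp add: K'_def)
  then have "r * (v (fst p) - snd p) - 1 \<le> 0" using r by (simp add: field_simps)
  then show ?thesis by (simp add: smooth_step_0)
 qed (use K(4) in simp)
 moreover have "Cinf (\<lambda>p. \<phi> p * smooth_step (r * (v (fst p) - snd p) - 1)) (D \<times> UNIV)"
  using Cinf_subset[OF K(3)] by (intro Cinf_mult o cutoff_Cinf) auto
 ultimately show ?thesis
  by (intro test_functionsI[OF o, of _ K']) (auto simp: K'_def dest: subsetD[OF K(2)])
qed

lemma cutoff_gradient:
 assumes \<phi>: "\<phi> \<in> test_functions (D \<times> {-H<..})" and r: "r > 0"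
 shows "gradient (\<lambda>p. \<phi> p * smooth_step (r * (v (fst p) - snd p) - 1)) p \<bullet> e
  = (gradient \<phi> p \<bullet> e) * smooth_step (r * (v (fst p) - snd p) - 1)
   - r * (\<phi> p * step_deriv (r * (v (fst p) - snd p) - 1) * (gnormal D v (fst p) \<bullet> e))"
proof (cases "fst p \<in> D")
 case False
 then have "p \<notin> \<Omega>" "p \<notin> D \<times> {-H<..}" by (auto simp: Omega1_def)
 then show ?thesis using test_gradient_outside[OF cutoff_test[OF assms]] test_gradient_outside[OF \<phi>] test_function_outside[OF \<phi>]
  by simp
next
 case True
 obtain x z where p: "p = (x, z)" by (cases p)
 obtain e1 e2 where e: "e = (e1, e2)" by (cases e)
 let ?q = "\<lambda>p :: 'a \<times> real. r * (v (fst p) - snd p) - 1"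
 have dv: "((\<lambda>p. v (fst p)) has_derivative (\<lambda>h. gradient v (fst p) \<bullet> fst h)) (at p)"
 proof -
  have "(v has_derivative (\<lambda>a. gradient v (fst p) \<bullet> a)) (at (fst p))" by (rule v_deriv[OF True])
  from diff_chain_at[OF has_derivative_fst[OF has_derivative_ident] this]
  show ?thesis by (simp add: o_def)
 qed
 have dq: "(?q has_derivative (\<lambda>h. r * (gradient v (fst p) \<bullet> fst h - snd h))) (at p)"
  using dv by (auto intro!: derivative_eq_intros)
 have ds: "((\<lambda>p. smooth_step (?q p)) has_derivative (\<lambda>h. step_deriv (?q p) * (r * (gradient v (fst p) \<bullet> fst h - snd h)))) (at p)"
  using diff_chain_at[OF dq step_has_derivative[of "?q p", unfolded has_field_derivative_def]] by (simp add: o_def)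
 from gradient_inner[OF has_derivative_mult[OF test_function_has_derivative[OF \<phi>] ds], of e]
 show ?thesis using True by (simp add: p e gnormal_def algebra_simps)
qed

lemma sqint_trace_test:
 assumes \<phi>: "\<phi> \<in> test_functions S"
 shows "sqint (\<lambda>x. \<phi> (x, v x) * (gnormal D v x \<bullet> e))"
proof -
 obtain B where B: "B \<ge> 0" "\<And>x. \<bar>\<phi> x\<bar> \<le> B" using test_function_bounded[OF \<phi>] by metis
 have [measurable]: "\<phi> \<in> BM" by (rule test_function_measurable[OF \<phi>])
 show ?thesis
 proof (rule sqint_bounded_on_D)
  show "norm (\<phi> (x, v x) * (gnormal D v x \<bullet> e)) \<le> B * ((L + 1) * norm e)" for x
  proof -
   have "\<bar>gnormal D v x \<bullet> e\<bar> \<le> (L + 1) * norm e"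
    using order_trans[OF Cauchy_Schwarz_ineq2 mult_right_mono[OF gnormal_bound]] by simp
   then show ?thesis unfolding real_norm_def abs_mult using B L by (intro mult_mono) auto
  qed
  show "\<phi> (x, v x) * (gnormal D v x \<bullet> e) = 0" if "x \<notin> D" for x using that by (simp add: gnormal_def)
 qed measurable
qed

text \<open>The test function is cut off near the graph by the smooth step of \<open>r (v - z) - 1\<close>.  As \<open>r\<close>
grows, the derivative of the step concentrates on the graph with total mass one and produces the boundary term.\<close>

lemma green_continuous:
 assumes sp: "sobolev_pair \<Omega> f g" and F: "continuous_on (closure \<Omega>) F" "\<And>p. p \<in> \<Omega> ==> f p = F p"
 shows "green_trace D H v f g (\<lambda>x. if x \<in> D then F (x, v x) else 0)"
proof -
 have s: "sqint f" "sqint g" "\<And>x. x \<notin> \<Omega> ==> f x = 0" "\<And>x. x \<notin> \<Omega> ==> g x = 0"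
  using sp by (auto simp: sobolev_pair_def)
 have [measurable]: "f \<in> BM" "g \<in> BM" using s by (auto simp: sqint_def)
 have "compact (F ` closure \<Omega>)" by (rule compact_continuous_image[OF F(1) closure_compact])
 then obtain BF0 where "\<And>y. y \<in> F ` closure \<Omega> ==> norm y \<le> BF0" using compact_imp_bounded bounded_iff by metis
 then have BF: "\<bar>F p\<bar> \<le> max BF0 0" if "p \<in> closure \<Omega>" for p using that by force
 define BF where "BF = max BF0 0"
 have BF: "\<And>p. p \<in> closure \<Omega> ==> \<bar>F p\<bar> \<le> BF" "BF \<ge> 0" using BF by (auto simp: BF_def)
 have fB: "\<bar>f p\<bar> \<le> BF" for p
  using BF(1)[of p] F(2)[of p] s(3)[of p] BF(2) closure_subset[of \<Omega>] by (cases "p \<in> \<Omega>") auto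
 let ?\<tau> = "\<lambda>x. if x \<in> D then F (x, v x) else 0"
 have mF: "(\<lambda>x. if x \<in> D then F (x, v x) else 0) \<in> BM"
 proof -
  have "continuous_on D (\<lambda>x. F (x, v x))"
   by (intro continuous_on_compose2[OF F(1)] continuous_intros v_cont) (use graph_in_closure in auto)
  from borel_measurable_continuous_on_indicator[OF D_borel this] show ?thesis
  proof -
   have "(\<lambda>x. indicator D x *\<^sub>R F (x, v x)) = (\<lambda>x. if x \<in> D then F (x, v x) else 0)" by (auto simp: indicator_def)
   then show ?thesis using \<open>(\<lambda>x. indicator D x *\<^sub>R F (x, v x)) \<in> BM\<close> by metis
  qed
 qed
 have t1: "sqint ?\<tau>"
  by (rule sqint_bounded_on_D[OF mF]) (use BF graph_in_closure in auto)
 have main: "(LINT p|lborel. f p * (gradient \<phi> p \<bullet> e)) + (LINT p|lborel. \<phi> p * (g p \<bullet> e))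
    = (LINT x|lborel. ?\<tau> x * (\<phi> (x, v x) * (gnormal D v x \<bullet> e)))"
  if \<phi>: "\<phi> \<in> test_functions (D \<times> {-H<..})" for \<phi> e
 proof -
  have [measurable]: "\<phi> \<in> BM" "gradient \<phi> \<in> BM"
   using \<phi> test_function_measurable test_function_gradient_measurable by blast+
  have [measurable]: "smooth_step \<in> BM"
   by (rule borel_measurable_continuous_onI[OF Cinf_continuous_on[OF Cinf_smooth_step]])
  obtain B where B: "B \<ge> 0" "\<And>x. \<bar>\<phi> x\<bar> \<le> B" using test_function_bounded[OF \<phi>] by metis
  obtain B' where B': "B' \<ge> 0" "\<And>t. \<bar>step_deriv t\<bar> \<le> B'" using step_deriv_bounded by metis
  define r where "r n = real (Suc n)" for n
  have r: "r n > 0" for n by (simp add: r_def)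
  define cut where "cut n p = smooth_step (r n * (v (fst p) - snd p) - 1)" for n p
  have [measurable]: "cut n \<in> BM" for n unfolding cut_def by measurable
  have cutB: "0 \<le> cut n p" "cut n p \<le> 1" for n p by (simp_all add: cut_def smooth_step_nonneg smooth_step_le_1)
  have cutlim: "(\<lambda>n. cut n p) \<longlonglongrightarrow> 1" if "p \<in> \<Omega>" for p
  proof -
   have pos: "v (fst p) - snd p > 0" using that by (auto simp: Omega1_def)
   obtain m where m: "2 / (v (fst p) - snd p) < real m" using reals_Archimedean2 by blast
   have "cut n p = 1" if "n \<ge> m" for n
   proof -
    have "2 / (v (fst p) - snd p) \<le> r n" using m that by (simp add: r_def)
    then have "2 \<le> r n * (v (fst p) - snd p)" using pos by (simp add: field_simps)
    then show ?thesis unfolding cut_def by (intro smooth_step_1) simp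
   qed
   then have "\<forall>\<^sub>F n in sequentially. cut n p = 1" unfolding eventually_sequentially by blast
   then show ?thesis by (rule tendsto_eventually)
  qed
  define N where "N p = gnormal D v (fst p) \<bullet> e" for p :: "'a \<times> real"
  have [measurable]: "N \<in> BM" unfolding N_def by measurable
  define J where "J n p = f p * (\<phi> p * step_deriv (r n * (v (fst p) - snd p) - 1) * N p)" for n p
  have i1: "integrable lborel (\<lambda>p. f p * (gradient \<phi> p \<bullet> e))"
   using sqint_inner(1)[OF s(1) test_function_sqint[OF test_function_deriv[OF \<phi>]]] by simp
  have ge: "sqint (\<lambda>p. g p \<bullet> e)"
   by (rule sqint_bound(1)[OF s(2), of _ "norm e"]) (use order_trans[OF Cauchy_Schwarz_ineq2 eq_refl[OF mult.commute]] in auto)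
  have i2: "integrable lborel (\<lambda>p. \<phi> p * (g p \<bullet> e))"
   using sqint_inner(1)[OF test_function_sqint[OF \<phi>] ge] by simp
  have i1n: "integrable lborel (\<lambda>p. f p * (gradient \<phi> p \<bullet> e) * cut n p)" for n
   by (rule Bochner_Integration.integrable_bound[OF i1]) (use cutB in \<open>auto simp: abs_mult mult_left_le intro!: always_eventually\<close>)
  have lim1: "(\<lambda>n. LINT p|lborel. f p * (gradient \<phi> p \<bullet> e) * cut n p) \<longlonglongrightarrow> (LINT p|lborel. f p * (gradient \<phi> p \<bullet> e))"
  proof (rule integral_dominated_convergence[where w="\<lambda>p. norm (f p * (gradient \<phi> p \<bullet> e))"])
   show "integrable lborel (\<lambda>p. norm (f p * (gradient \<phi> p \<bullet> e)))" by (rule integrable_norm[OF i1])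
   show "AE p in lborel. (\<lambda>n. f p * (gradient \<phi> p \<bullet> e) * cut n p) \<longlonglongrightarrow> f p * (gradient \<phi> p \<bullet> e)"
   proof (intro always_eventually allI)
    fix p show "(\<lambda>n. f p * (gradient \<phi> p \<bullet> e) * cut n p) \<longlonglongrightarrow> f p * (gradient \<phi> p \<bullet> e)"
     using tendsto_mult_left[OF cutlim, of p "f p * (gradient \<phi> p \<bullet> e)"] s(3)[of p] by (cases "p \<in> \<Omega>") auto
   qed
   show "AE p in lborel. norm (f p * (gradient \<phi> p \<bullet> e) * cut n p) \<le> norm (f p * (gradient \<phi> p \<bullet> e))" for n
    using cutB by (auto simp: abs_mult mult_left_le intro!: always_eventually)
  qed auto
  have lim2: "(\<lambda>n. LINT p|lborel. \<phi> p * (g p \<bullet> e) * cut n p) \<longlonglongrightarrow> (LINT p|lborel. \<phi> p * (g p \<bullet> e))"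
  proof (rule integral_dominated_convergence[where w="\<lambda>p. norm (\<phi> p * (g p \<bullet> e))"])
   show "integrable lborel (\<lambda>p. norm (\<phi> p * (g p \<bullet> e)))" by (rule integrable_norm[OF i2])
   show "AE p in lborel. (\<lambda>n. \<phi> p * (g p \<bullet> e) * cut n p) \<longlonglongrightarrow> \<phi> p * (g p \<bullet> e)"
   proof (intro always_eventually allI)
    fix p show "(\<lambda>n. \<phi> p * (g p \<bullet> e) * cut n p) \<longlonglongrightarrow> \<phi> p * (g p \<bullet> e)"
     using tendsto_mult_left[OF cutlim, of p "\<phi> p * (g p \<bullet> e)"] s(4)[of p] by (cases "p \<in> \<Omega>") auto
   qed
   show "AE p in lborel. norm (\<phi> p * (g p \<bullet> e) * cut n p) \<le> norm (\<phi> p * (g p \<bullet> e))" for n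
    using cutB by (auto simp: abs_mult mult_left_le intro!: always_eventually)
  qed auto
  have [measurable]: "J n \<in> BM" for n unfolding J_def by measurable
  have NB: "\<bar>N p\<bar> \<le> (L + 1) * norm e" for p unfolding N_def
   using order_trans[OF Cauchy_Schwarz_ineq2 mult_right_mono[OF gnormal_bound]] by simp
  define w where "w p = indicator (D \<times> {0..1}) p * (BF * (B * B' * ((L + 1) * norm e)))" for p :: "'a \<times> real"
  have iw: "integrable lborel w" unfolding w_def
  proof (intro integrable_mult_left integrable_real_indicator)
   have "bounded (D \<times> {0..1::real})" using D(2) by (intro bounded_Times) auto
   from emeasure_bounded_finite[OF this] show "emeasure lborel (D \<times> {0..1::real}) < \<infinity>" by simp
  qed (use D in \<open>auto intro!: borel_Times\<close>)
  define J' where "J' n p = J n (fst p, (v (fst p) - 1 / r n) + (- (1 / r n)) * snd p)" for n p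
  have J'eq: "J' n p = f (fst p, v (fst p) - (snd p + 1) / r n) * (\<phi> (fst p, v (fst p) - (snd p + 1) / r n) * step_deriv (snd p) * N p)" for n p
  proof -
   have e1: "(v (fst p) - 1 / r n) + (- (1 / r n)) * snd p = v (fst p) - (snd p + 1) / r n" by (simp add: add_divide_distrib)
   have e2: "r n * ((snd p + 1) / r n) - 1 = snd p" using r[of n] by simp
   show ?thesis unfolding J'_def J_def e1 using r[of n] by (simp add: e2 N_def)
  qed
  have J'bound: "norm (J' n p) \<le> w p" for n p
  proof (cases "p \<in> D \<times> {0..1}")
   case True
   have "norm (J' n p) \<le> BF * (B * B' * ((L + 1) * norm e))"
    unfolding J'eq real_norm_def abs_mult using B B' NB L BF(2) by (intro mult_mono fB mult_nonneg_nonneg) auto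
   then show ?thesis using True by (simp add: w_def)
  next
   case False
   then have "J' n p = 0" unfolding J'eq N_def using step_deriv_outside[of "snd p"] by (cases p) (auto simp: gnormal_def)
   then show ?thesis using False by (simp add: w_def)
  qed
  have [measurable]: "J' n \<in> BM" for n unfolding J'_def by measurable
  have iJ': "integrable lborel (J' n)" for n
   by (rule Bochner_Integration.integrable_bound[OF iw]) (use order_trans[OF J'bound abs_ge_self] in \<open>auto intro!: always_eventually\<close>)
  have iJ: "integrable lborel (J n)" "r n * (LINT p|lborel. J n p) = (LINT p|lborel. J' n p)" for n
  proof -
   have jj: "(\<lambda>p. J n (fst p, (v (fst p) - 1 / r n) + (- (1 / r n)) * snd p)) = J' n" by (simp add: fun_eq_iff J'_def)
   have sh: "(LINT p|lborel. J n p) = \<bar>- (1 / r n)\<bar> *\<^sub>R (LINT p|lborel. J n (fst p, (v (fst p) - 1 / r n) + (- (1 / r n)) * snd p))"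
    "integrable lborel (J n) \<longleftrightarrow> integrable lborel (\<lambda>p. J n (fst p, (v (fst p) - 1 / r n) + (- (1 / r n)) * snd p))"
    by (rule integral_shear; use r[of n] in simp)+
   show "integrable lborel (J n)" using sh(2) iJ'[of n] unfolding jj by simp
   show "r n * (LINT p|lborel. J n p) = (LINT p|lborel. J' n p)" using sh(1) r[of n] unfolding jj by simp
  qed
  define J0 where "J0 p = (?\<tau> (fst p) * (\<phi> (fst p, v (fst p)) * N p)) * step_deriv (snd p)" for p
  have mJ0 [measurable]: "J0 \<in> BM"
   unfolding J0_def using mF by measurable
  have lim3: "(\<lambda>n. LINT p|lborel. J' n p) \<longlonglongrightarrow> (LINT p|lborel. J0 p)"
  proof (rule integral_dominated_convergence[where w=w])
   show "AE p in lborel. (\<lambda>n. J' n p) \<longlonglongrightarrow> J0 p"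
   proof (intro always_eventually allI)
    fix p :: "'a \<times> real"
    obtain x t where p: "p = (x, t)" by (cases p)
    show "(\<lambda>n. J' n p) \<longlonglongrightarrow> J0 p"
    proof (cases "x \<in> D \<and> t \<in> {0..1}")
     case False
     then have "J' n p = 0" for n using J'bound[of n p] by (auto simp: w_def p)
     moreover have "J0 p = 0" using False step_deriv_outside[of t] by (auto simp: J0_def p)
     ultimately show ?thesis by simp
    next
     case True
     then have x: "x \<in> D" and t: "t \<ge> 0" by auto
     have rlim: "filterlim r at_top sequentially"
      unfolding r_def[abs_def] by (rule filterlim_compose[OF filterlim_real_sequentially filterlim_Suc])
     have "(\<lambda>n. (t + 1) / r n) \<longlonglongrightarrow> 0" by (rule tendsto_divide_0[OF tendsto_const filterlim_at_top_imp_at_infinity[OF rlim]])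
     then have l: "(\<lambda>n. (x, v x - (t + 1) / r n)) \<longlonglongrightarrow> (x, v x)"
      using tendsto_diff[OF tendsto_const, of _ 0 sequentially "v x"] by (intro tendsto_Pair) auto
     have "\<forall>\<^sub>F n in sequentially. (t + 1) / r n < c"
      using order_tendstoD(2)[OF \<open>(\<lambda>n. (t + 1) / r n) \<longlonglongrightarrow> 0\<close> c] .
     then have inO: "\<forall>\<^sub>F n in sequentially. (x, v x - (t + 1) / r n) \<in> \<Omega>"
     proof eventually_elim
      case (elim n)
      have "(t + 1) / r n > 0" using t r[of n] by simp
      then show ?case using elim x v_low[OF x] by (simp add: Omega1_def)
     qed
     have "(\<lambda>n. F (x, v x - (t + 1) / r n)) \<longlonglongrightarrow> F (x, v x)"
     proof (rule continuous_on_tendsto_compose[OF F(1) l graph_in_closure(1)[OF x]])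
      show "\<forall>\<^sub>F n in sequentially. (x, v x - (t + 1) / r n) \<in> closure \<Omega>"
       using inO by eventually_elim (use closure_subset in blast)
     qed
     then have "(\<lambda>n. f (x, v x - (t + 1) / r n)) \<longlonglongrightarrow> F (x, v x)"
      by (rule Lim_transform_eventually) (use inO in eventually_elim, simp add: F(2))
     moreover have "(\<lambda>n. \<phi> (x, v x - (t + 1) / r n)) \<longlonglongrightarrow> \<phi> (x, v x)"
      by (rule continuous_on_tendsto_compose[OF test_function_continuous[OF \<phi>, of UNIV] l]) auto
     ultimately have "(\<lambda>n. f (x, v x - (t + 1) / r n) * (\<phi> (x, v x - (t + 1) / r n) * step_deriv t * N p)) \<longlonglongrightarrow> F (x, v x) * (\<phi> (x, v x) * step_deriv t * N p)"
      by (intro tendsto_intros)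
     then show ?thesis unfolding J'eq using x by (simp add: J0_def p mult_ac)
    qed
   qed
  qed (use iw J'bound in auto)
  have J0int: "(LINT p|lborel. J0 p) = (LINT x|lborel. ?\<tau> x * (\<phi> (x, v x) * (gnormal D v x \<bullet> e)))"
  proof -
   have "integrable lborel J0"
   proof (rule Bochner_Integration.integrable_bound[OF iw mJ0[unfolded measurable_lborel2[symmetric]]])
    show "AE p in lborel. norm (J0 p) \<le> norm (w p)"
    proof (intro always_eventually allI)
     fix p :: "'a \<times> real"
     show "norm (J0 p) \<le> norm (w p)"
     proof (cases "p \<in> D \<times> {0..1}")
      case True
      then have "\<bar>?\<tau> (fst p)\<bar> \<le> BF" using BF(1)[OF graph_in_closure(1)] by auto
      then have "norm (J0 p) \<le> BF * (B * ((L + 1) * norm e)) * B'"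
       unfolding J0_def real_norm_def abs_mult using B B' NB[of p] L BF(2) by (intro mult_mono mult_nonneg_nonneg) auto
      then show ?thesis using True by (simp add: w_def mult_ac)
     next
      case False
      then have "J0 p = 0" using step_deriv_outside[of "snd p"] by (cases p) (auto simp: J0_def)
      then show ?thesis by simp
     qed
    qed
   qed
   from lborel_Fubini(1)[OF this] show ?thesis unfolding J0_def N_def fst_conv snd_conv by (simp add: step_deriv_integral)
  qed
  have eq: "(LINT p|lborel. J' n p) = (LINT p|lborel. f p * (gradient \<phi> p \<bullet> e) * cut n p) + (LINT p|lborel. \<phi> p * (g p \<bullet> e) * cut n p)" for n
  proof -
   have t: "(\<lambda>p. \<phi> p * cut n p) \<in> test_functions \<Omega>" unfolding cut_def by (rule cutoff_test[OF \<phi> r])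
   have gr: "gradient (\<lambda>p. \<phi> p * cut n p) p \<bullet> e = (gradient \<phi> p \<bullet> e) * cut n p - r n * (\<phi> p * step_deriv (r n * (v (fst p) - snd p) - 1) * N p)" for p
    unfolding cut_def N_def by (rule cutoff_gradient[OF \<phi> r])
   have "(LINT p|lborel. f p * (gradient (\<lambda>p. \<phi> p * cut n p) p \<bullet> e)) = - (LINT p|lborel. (\<phi> p * cut n p) * (g p \<bullet> e))"
    by (rule sobolev_pairD[OF sp t])
   moreover have "(LINT p|lborel. f p * (gradient (\<lambda>p. \<phi> p * cut n p) p \<bullet> e)) = (LINT p|lborel. f p * (gradient \<phi> p \<bullet> e) * cut n p - r n * J n p)"
    unfolding gr J_def by (intro Bochner_Integration.integral_cong) (auto simp: algebra_simps)
   moreover have "... = (LINT p|lborel. f p * (gradient \<phi> p \<bullet> e) * cut n p) - (LINT p|lborel. J' n p)"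
    using i1n iJ by (subst Bochner_Integration.integral_diff) auto
   moreover have "(LINT p|lborel. (\<phi> p * cut n p) * (g p \<bullet> e)) = (LINT p|lborel. \<phi> p * (g p \<bullet> e) * cut n p)"
    by (simp add: mult_ac)
   ultimately show ?thesis by simp
  qed
  show ?thesis
   using LIMSEQ_unique[OF tendsto_add[OF lim1 lim2] lim3[unfolded eq]] J0int by simp
 qed
 show ?thesis unfolding green_trace_def using t1 main by auto
qed

end

section \<open>Traces on the graph\<close>

lemma sobolev_pair_outside: "sobolev_pair S f g ==> x \<notin> S ==> f x = 0 \<and> g x = 0"
 and sobolev_pair_sqint: "sobolev_pair S f g ==> sqint f" "sobolev_pair S f g ==> sqint g"
 unfolding sobolev_pair_def by blast+

lemma sqn_nn:
 assumes "sqint f" shows "ennreal (sqn f) = (\<integral>\<^sup>+x. ennreal ((norm (f x))\<^sup>2) \<partial>lborel)"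
 unfolding sqn_def using assms by (intro nn_integral_eq_integral[symmetric]) (auto simp: sqint_def)

lemma sqintI_nn:
 assumes [measurable]: "f \<in> BM" and "(\<integral>\<^sup>+x. ennreal ((norm (f x))\<^sup>2) \<partial>lborel) < \<infinity>"
 shows "sqint f"
 unfolding sqint_def using assms(2) by (auto intro!: integrableI_bounded)

lemma sqnI_nn:
 assumes "f \<in> BM" "(\<integral>\<^sup>+x. ennreal ((norm (f x))\<^sup>2) \<partial>lborel) \<le> ennreal C" "C \<ge> 0"
 shows "sqint f" "sqn f \<le> C"
proof -
 show s: "sqint f" by (rule sqintI_nn[OF assms(1)]) (use assms(2) le_less_trans in fastforce)
 show "sqn f \<le> C" using assms(2,3) unfolding sqn_nn[OF s, symmetric] by simp
qed

lemma sqint_inner_tendsto: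
 assumes "\<And>n. sqint (s n)" "sqint f" "sqint g" "(\<lambda>n. sqn (\<lambda>x. s n x - f x)) \<longlonglongrightarrow> 0"
 shows "(\<lambda>n. LINT x|lborel. s n x \<bullet> g x) \<longlonglongrightarrow> (LINT x|lborel. f x \<bullet> g x)"
proof -
 have "(\<lambda>n. sqrt (sqn (\<lambda>x. s n x - f x)) * sqrt (sqn g)) \<longlonglongrightarrow> sqrt 0 * sqrt (sqn g)"
  by (intro tendsto_intros assms)
 then have l: "(\<lambda>n. sqrt (sqn (\<lambda>x. s n x - f x)) * sqrt (sqn g)) \<longlonglongrightarrow> 0" by simp
 have "(\<lambda>n. (LINT x|lborel. s n x \<bullet> g x) - (LINT x|lborel. f x \<bullet> g x)) \<longlonglongrightarrow> 0"
 proof (rule Lim_null_comparison[OF always_eventually l], rule allI)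
  fix n
  have "(LINT x|lborel. s n x \<bullet> g x) - (LINT x|lborel. f x \<bullet> g x) = (LINT x|lborel. (s n x - f x) \<bullet> g x)"
   using sqint_inner(1)[OF assms(1)[of n] assms(3)] sqint_inner(1)[OF assms(2,3)] by (simp add: inner_diff_left)
  then show "norm ((LINT x|lborel. s n x \<bullet> g x) - (LINT x|lborel. f x \<bullet> g x)) \<le> sqrt (sqn (\<lambda>x. s n x - f x)) * sqrt (sqn g)"
   using sqint_inner(2)[OF sqint_diff(1)[OF assms(1,2)] assms(3)] by simp
 qed
 then show ?thesis by (simp add: LIM_zero_iff)
qed

lemma sqint_inner_const: "sqint g ==> sqint (\<lambda>x. g x \<bullet> e)"
 by (rule sqint_bound(1)[of g _ "norm e"]) (use order_trans[OF Cauchy_Schwarz_ineq2 eq_refl[OF mult.commute]] in \<open>auto simp: sqint_def\<close>)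

lemma sqn_inner_const: "sqint g ==> sqn (\<lambda>x. g x \<bullet> e) \<le> (norm e)\<^sup>2 * sqn g"
 by (rule sqint_bound(2)[of g _ "norm e"]) (use order_trans[OF Cauchy_Schwarz_ineq2 eq_refl[OF mult.commute]] in \<open>auto simp: sqint_def\<close>)

lemma sobolev_pair_cong_AE:
 assumes "sobolev_pair S f g" "AE x in lborel. f' x = f x" "f' \<in> BM" "\<And>x. x \<notin> S ==> f' x = 0"
 shows "sobolev_pair S f' g"
proof -
 have s: "sqint f" "sqint g" "\<And>x. x \<notin> S ==> f x = 0" "\<And>x. x \<notin> S ==> g x = 0"
  using assms(1) by (auto simp: sobolev_pair_def)
 have [measurable]: "f \<in> BM" using s by (simp add: sqint_def)
 note [measurable] = assms(3)
 have "sqint f'" by (rule sqint_bound(1)[OF s(1), of _ 1]) (use assms in auto)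
 moreover have "(LINT x|lborel. f' x * (gradient \<phi> x \<bullet> e)) = - (LINT x|lborel. \<phi> x * (g x \<bullet> e))" if \<phi>: "\<phi> \<in> test_functions S" for \<phi> e
 proof -
  have [measurable]: "gradient \<phi> \<in> BM" by (rule test_function_gradient_measurable[OF \<phi>])
  have "(LINT x|lborel. f' x * (gradient \<phi> x \<bullet> e)) = (LINT x|lborel. f x * (gradient \<phi> x \<bullet> e))"
   by (rule integral_cong_AE) (use assms(2) in auto)
  then show ?thesis using sobolev_pairD[OF assms(1) \<phi>] by simp
 qed
 ultimately show ?thesis using s assms(4) unfolding sobolev_pair_def by blast
qed

lemma sobolev_pair_restrict:
 assumes "sobolev_pair S f g" "S' \<subseteq> S" "S' \<in> sets borel"
 shows "sobolev_pair S' (\<lambda>p. indicator S' p * f p) (\<lambda>p. indicator S' p *\<^sub>R g p)"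
proof -
 have s: "sqint f" "sqint g" using assms(1) by (auto simp: sobolev_pair_def)
 note [measurable] = assms(3)
 have [measurable]: "f \<in> BM" "g \<in> BM" using s by (auto simp: sqint_def)
 have "sqint (\<lambda>p. indicator S' p * f p)" "sqint (\<lambda>p. indicator S' p *\<^sub>R g p)"
  by (rule sqint_bound(1)[OF s(1), of _ 1]; auto split: split_indicator)
   (rule sqint_bound(1)[OF s(2), of _ 1]; auto split: split_indicator)
 moreover have "(LINT x|lborel. (indicator S' x * f x) * (gradient \<phi> x \<bullet> e)) = - (LINT x|lborel. \<phi> x * ((indicator S' x *\<^sub>R g x) \<bullet> e))"
  if \<phi>: "\<phi> \<in> test_functions S'" for \<phi> e
 proof -
  have "(LINT x|lborel. (indicator S' x * f x) * (gradient \<phi> x \<bullet> e)) = (LINT x|lborel. f x * (gradient \<phi> x \<bullet> e))"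
   using test_gradient_outside[OF \<phi>] by (intro integral_congr) (auto split: split_indicator)
  moreover have "(LINT x|lborel. \<phi> x * ((indicator S' x *\<^sub>R g x) \<bullet> e)) = (LINT x|lborel. \<phi> x * (g x \<bullet> e))"
   using test_function_outside[OF \<phi>] by (intro integral_congr) (auto split: split_indicator)
  ultimately show ?thesis using sobolev_pairD[OF assms(1)] \<phi> test_functions_mono[OF assms(2)] by auto
 qed
 ultimately show ?thesis unfolding sobolev_pair_def by (auto simp del: split_paired_All)
qed

lemma green_traceD:
 "green_trace D H v f g \<tau> ==> \<phi> \<in> test_functions (D \<times> {-H<..}) ==>
  (LINT p|lborel. f p * (gradient \<phi> p \<bullet> e)) + (LINT p|lborel. \<phi> p * (g p \<bullet> e))
    = (LINT x|lborel. \<tau> x * (\<phi> (x, v x) * (gnormal D v x \<bullet> e)))"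
 unfolding green_trace_def by blast

text \<open>A cutoff in the vertical direction that equals one on the part of the domain that matters and vanishes near its
bottom.\<close>

lemma plateau:
 assumes "a < (b::real)"
 obtains \<kappa> where "\<kappa> \<in> test_functions {a<..}" "\<And>z. b \<le> z ==> z \<le> B ==> \<kappa> z = 1 \<and> gradient \<kappa> z = 0"
  "\<And>z. 0 \<le> \<kappa> z" "\<And>z. \<kappa> z \<le> 1"
proof -
 define \<kappa> where "\<kappa> z = smooth_step (4 * (z - a) / (b - a) - 1) * smooth_step (B + 2 - z)" for z
 have C: "Cinf \<kappa> UNIV"
 proof -
  have "Cinf (\<lambda>z. 4 * (z - a) / (b - a) - 1) UNIV"
   by (intro Cinf_diff Cinf_divide_const Cinf_mult Cinf_const Cinf_ident_real open_UNIV)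
  note 1 = Cinf_compose_real[OF open_UNIV open_UNIV _ this Cinf_smooth_step]
  have "Cinf (\<lambda>z. B + 2 - z) UNIV" by (intro Cinf_diff Cinf_const Cinf_ident_real open_UNIV)
  note 2 = Cinf_compose_real[OF open_UNIV open_UNIV _ this Cinf_smooth_step]
  show ?thesis unfolding \<kappa>_def[abs_def] by (intro Cinf_mult open_UNIV 1 2) auto
 qed
 have t: "\<kappa> \<in> test_functions {a<..}"
 proof (rule test_functionsI[OF open_UNIV C, of "{a + (b - a) / 4..B + 2}"])
  fix z assume "z \<notin> {a + (b - a) / 4..B + 2}"
  then consider "z < a + (b - a) / 4" | "z > B + 2" by force
  then show "\<kappa> z = 0"
  proof cases
   case 1
   then have "4 * (z - a) / (b - a) - 1 \<le> 0" using assms by (simp add: field_simps)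
   then show ?thesis by (simp add: \<kappa>_def smooth_step_0)
  qed (simp add: \<kappa>_def smooth_step_0)
 next
  show "{a + (b - a) / 4..B + 2} \<subseteq> {a<..}"
  proof
   fix x assume "x \<in> {a + (b - a) / 4..B + 2}"
   then have "a + (b - a) / 4 \<le> x" by simp
   then have "a < x" using assms by argo
   then show "x \<in> {a<..}" by simp
  qed
 qed auto
 have one: "\<kappa> z = 1" if "a + (b - a) / 2 < z" "z < B + 1" for z
 proof -
  have "1 \<le> 4 * (z - a) / (b - a) - 1" using that assms by (simp add: field_simps)
  then show ?thesis using that by (simp add: \<kappa>_def smooth_step_1)
 qed
 have g: "gradient \<kappa> z = 0" if "b \<le> z" "z \<le> B" for z
 proof (rule gradient_unique)
  have "((\<lambda>x. 1) has_derivative (\<lambda>e. 0 \<bullet> e)) (at z)" by simp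
  then show "(\<kappa> has_derivative (\<lambda>e. 0 \<bullet> e)) (at z)"
   by (rule has_derivative_transform_within_open[of _ _ _ _ "{a + (b - a) / 2<..<B + 1}"])
    (use that assms one in \<open>auto simp: field_simps\<close>)
 qed
 show thesis
 proof (rule that[OF t])
  show "\<kappa> z = 1 \<and> gradient \<kappa> z = 0" if "b \<le> z" "z \<le> B" for z
   using that g one[of z] assms by (auto simp: field_simps)
 qed (auto simp: \<kappa>_def smooth_step_nonneg smooth_step_le_1 mult_le_one)
qed

lemma tensor_test:
 assumes "open D" "\<eta> \<in> test_functions D" "\<kappa> \<in> test_functions I"
 shows "(\<lambda>p. \<eta> (fst p) * \<kappa> (snd p)) \<in> test_functions (D \<times> (I :: real set))"
  "gradient (\<lambda>p. \<eta> (fst p) * \<kappa> (snd p)) p \<bullet> (0, 1) = \<eta> (fst p) * gradient \<kappa> (snd p)"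
proof -
 obtain K where K: "compact K" "K \<subseteq> D" "Cinf \<eta> UNIV" "\<And>x. x \<notin> K ==> \<eta> x = 0"
  using test_functionsE[OF assms(2)] by blast
 obtain J where J: "compact J" "J \<subseteq> I" "Cinf \<kappa> UNIV" "\<And>x. x \<notin> J ==> \<kappa> x = 0"
  using test_functionsE[OF assms(3)] by blast
 have "Cinf (\<lambda>p. \<eta> (fst p)) (UNIV :: ('a \<times> real) set)" by (rule Cinf_fst[OF open_UNIV K(3)]) auto
 moreover have "Cinf (\<lambda>p. \<kappa> (snd p)) (UNIV :: ('a \<times> real) set)"
  by (rule Cinf_compose_real[where \<phi>=snd, OF open_UNIV open_UNIV _ _ J(3)]) (auto intro!: Cinf_linear bounded_linear_snd)
 ultimately have C: "Cinf (\<lambda>p. \<eta> (fst p) * \<kappa> (snd p)) (UNIV :: ('a \<times> real) set)" by (intro Cinf_mult open_UNIV)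
 show t: "(\<lambda>p. \<eta> (fst p) * \<kappa> (snd p)) \<in> test_functions (D \<times> I)"
 proof (rule test_functionsI[OF open_UNIV C, of "K \<times> J"])
  show "compact (K \<times> J)" using K(1) J(1) by (rule compact_Times)
  show "K \<times> J \<subseteq> D \<times> I" using K(2) J(2) by blast
  fix p assume "p \<notin> K \<times> J"
  then show "\<eta> (fst p) * \<kappa> (snd p) = 0" using K(4)[of "fst p"] J(4)[of "snd p"] by (cases p) auto
 qed auto
 have d1: "((\<lambda>p. \<eta> (fst p)) has_derivative (\<lambda>h. gradient \<eta> (fst p) \<bullet> fst h)) (at p)"
  using diff_chain_at[OF has_derivative_fst[OF has_derivative_ident] test_function_has_derivative[OF assms(2), of "fst p"]] by (simp add: o_def)
 have d2: "((\<lambda>p. \<kappa> (snd p)) has_derivative (\<lambda>h. gradient \<kappa> (snd p) \<bullet> snd h)) (at p)"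
  using diff_chain_at[OF has_derivative_snd[OF has_derivative_ident] test_function_has_derivative[OF assms(3), of "snd p"]] by (simp add: o_def)
 show "gradient (\<lambda>p. \<eta> (fst p) * \<kappa> (snd p)) p \<bullet> (0, 1) = \<eta> (fst p) * gradient \<kappa> (snd p)"
  unfolding gradient_inner[OF has_derivative_mult[OF d1 d2]] by simp
qed

context graph_domain begin

text \<open>Both sides of Green's formula are continuous in \<open>L\<^sub>2\<close>.\<close>

lemma green_limit:
 assumes sp: "sqint f" "sqint g" and k: "\<And>k. sqint (fk k)" "\<And>k. sqint (gk k)"
  and lim: "(\<lambda>k. sqn (\<lambda>p. fk k p - f p)) \<longlonglongrightarrow> 0" "(\<lambda>k. sqn (\<lambda>p. gk k p - g p)) \<longlonglongrightarrow> 0"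
  and gr: "\<And>k. green_trace D H v (fk k) (gk k) (\<tau>k k)"
  and \<tau>: "sqint \<tau>" "\<And>x. x \<notin> D ==> \<tau> x = 0" "(\<lambda>k. sqn (\<lambda>x. \<tau>k k x - \<tau> x)) \<longlonglongrightarrow> 0"
 shows "green_trace D H v f g \<tau>"
proof -
 have "(LINT p|lborel. f p * (gradient \<phi> p \<bullet> e)) + (LINT p|lborel. \<phi> p * (g p \<bullet> e))
    = (LINT x|lborel. \<tau> x * (\<phi> (x, v x) * (gnormal D v x \<bullet> e)))"
  if \<phi>: "\<phi> \<in> test_functions (D \<times> {-H<..})" for \<phi> e
 proof -
  have 1: "(\<lambda>k. LINT p|lborel. fk k p * (gradient \<phi> p \<bullet> e)) \<longlonglongrightarrow> (LINT p|lborel. f p * (gradient \<phi> p \<bullet> e))"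
   using sqint_inner_tendsto[OF k(1) sp(1) test_function_sqint[OF test_function_deriv[OF \<phi>]] lim(1), of e] by simp
  have ge: "(\<lambda>k. sqn (\<lambda>p. gk k p \<bullet> e - g p \<bullet> e)) \<longlonglongrightarrow> 0"
  proof (rule Lim_null_comparison)
   show "\<forall>\<^sub>F k in sequentially. norm (sqn (\<lambda>p. gk k p \<bullet> e - g p \<bullet> e)) \<le> (norm e)\<^sup>2 * sqn (\<lambda>p. gk k p - g p)"
    using sqn_inner_const[OF sqint_diff(1)[OF k(2) sp(2)]] by (auto simp: sqn_nonneg inner_diff_left)
   show "(\<lambda>k. (norm e)\<^sup>2 * sqn (\<lambda>p. gk k p - g p)) \<longlonglongrightarrow> 0" using tendsto_mult_right_zero[OF lim(2)] by simp
  qed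
  have 2: "(\<lambda>k. LINT p|lborel. \<phi> p * (gk k p \<bullet> e)) \<longlonglongrightarrow> (LINT p|lborel. \<phi> p * (g p \<bullet> e))"
   using sqint_inner_tendsto[OF sqint_inner_const[OF k(2)] sqint_inner_const[OF sp(2)] test_function_sqint[OF \<phi>] ge]
   by (simp add: mult.commute)
  have \<tau>k: "sqint (\<tau>k k)" for k using gr[of k] by (simp add: green_trace_def)
  have 3: "(\<lambda>k. LINT x|lborel. \<tau>k k x * (\<phi> (x, v x) * (gnormal D v x \<bullet> e))) \<longlonglongrightarrow> (LINT x|lborel. \<tau> x * (\<phi> (x, v x) * (gnormal D v x \<bullet> e)))"
   using sqint_inner_tendsto[OF \<tau>k \<tau>(1) sqint_trace_test[OF \<phi>] \<tau>(3)] by simp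
  show ?thesis using LIMSEQ_unique[OF tendsto_add[OF 1 2] 3[folded green_traceD[OF gr \<phi>]]] .
 qed
 then show ?thesis using \<tau> unfolding green_trace_def by blast
qed

lemma trace_L2_bound:
 assumes m: "q \<in> BM"
 shows "(\<integral>\<^sup>+x. ennreal ((norm (if x \<in> D then q (x, v x) else 0 :: real))\<^sup>2) \<partial>lborel)
  \<le> 2 ^ DIM('a) * (\<integral>\<^sup>+p. ennreal ((q p)\<^sup>2) \<partial>surface_measure \<Omega>)"
proof -
 have "(\<integral>\<^sup>+x. ennreal ((norm (if x \<in> D then q (x, v x) else 0 :: real))\<^sup>2) \<partial>lborel) = (\<integral>\<^sup>+x. ennreal ((q (x, v x))\<^sup>2) * indicator D x \<partial>lborel)"
  by (intro nn_integral_cong) (auto split: split_indicator)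
 also have "... \<le> 2 ^ DIM('a) * (\<integral>\<^sup>+p. ennreal ((q p)\<^sup>2) * indicator (frontier \<Omega>) p \<partial>hausdorff_measure DIM('a))"
  by (rule nn_integral_graph_le_hausdorff[of v D "\<lambda>p. ennreal ((q p)\<^sup>2)"]) (use m graph_in_closure in auto)
 also have "(\<integral>\<^sup>+p. ennreal ((q p)\<^sup>2) * indicator (frontier \<Omega>) p \<partial>hausdorff_measure DIM('a)) = (\<integral>\<^sup>+p. ennreal ((q p)\<^sup>2) \<partial>surface_measure \<Omega>)"
  unfolding surface_measure_def by (subst nn_integral_restrict_space) auto
 finally show ?thesis .
qed

text \<open>The functions in the definition of the boundary trace are continuous up to the boundary and satisfy Green's formula;
the bound of integrals over \<open>D\<close> by surface integrals makes their values on the graph converge in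
\<open>L\<^sub>2\<close>.\<close>

lemma trace_approximation:
 assumes \<theta>: "\<theta> \<in> H1 \<Omega>" and tr: "has_boundary_trace \<Omega> \<theta> t"
  and rep: "sobolev_pair \<Omega> f g" "AE p in lborel. p \<in> \<Omega> --> \<theta> p = f p"
 defines "\<tau> \<equiv> (\<lambda>x. if x \<in> D then t (x, v x) else 0)"
 obtains F fk gk where "\<And>k. continuous_on (closure \<Omega>) (F k)" "\<And>k. sobolev_pair \<Omega> (fk k) (gk k)"
  "\<And>k p. p \<in> \<Omega> ==> fk k p = F k p"
  "(\<lambda>k. sqn (\<lambda>p. fk k p - f p)) \<longlonglongrightarrow> 0" "(\<lambda>k. sqn (\<lambda>p. gk k p - g p)) \<longlonglongrightarrow> 0"
  "(\<lambda>k. \<integral>\<^sup>+p. ennreal ((F k p - t p)\<^sup>2) \<partial>surface_measure \<Omega>) \<longlonglongrightarrow> 0"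
  "sqint \<tau>" "(\<lambda>k. sqn (\<lambda>x. (if x \<in> D then F k (x, v x) else 0) - \<tau> x)) \<longlonglongrightarrow> 0"
  "green_trace D H v f g \<tau>"
proof -
 obtain F :: "nat => 'a \<times> real => real" where F: "\<And>k. continuous_on (closure \<Omega>) (F k)" "\<And>k. F k \<in> H1 \<Omega>"
  "(\<lambda>k. H1_norm \<Omega> (\<lambda>x. F k x - \<theta> x)) \<longlonglongrightarrow> 0"
  "(\<lambda>k. \<integral>\<^sup>+p. ennreal ((F k p - t p)\<^sup>2) \<partial>surface_measure \<Omega>) \<longlonglongrightarrow> 0"
  using tr unfolding has_boundary_trace_def by blast
 have t: "t \<in> borel_measurable (surface_measure \<Omega>)" "integrable (surface_measure \<Omega>) (\<lambda>p. (t p)\<^sup>2)"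
  using tr unfolding has_boundary_trace_def by auto
 have sets_fr: "frontier \<Omega> \<inter> space (hausdorff_measure DIM('a)) \<in> sets (hausdorff_measure DIM('a))" by simp
 define t1 where "t1 p = indicator (frontier \<Omega>) p * t p" for p
 have [measurable]: "t1 \<in> BM"
  using t(1) borel_measurable_restrict_space_iff[OF sets_fr, of t] by (simp add: surface_measure_def t1_def[abs_def])
 define F1 where "F1 k p = indicator (closure \<Omega>) p * F k p" for k p
 have F1m [measurable]: "F1 k \<in> BM" for k
  using borel_measurable_continuous_on_indicator[OF _ F(1)] by (simp add: F1_def[abs_def])
 have surf: "(\<integral>\<^sup>+p. q p \<partial>surface_measure \<Omega>) = (\<integral>\<^sup>+p. q' p \<partial>surface_measure \<Omega>)" if "\<And>p. p \<in> frontier \<Omega> ==> q p = q' p" for q q'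
  using that by (intro nn_integral_cong) (auto simp: surface_measure_def space_restrict_space)
 have frc: "p \<in> frontier \<Omega> ==> p \<in> closure \<Omega>" for p by (simp add: frontier_def)
 have "\<exists>g'. sobolev_pair \<Omega> (\<lambda>p. indicator \<Omega> p * F k p) g'" for k
 proof -
  obtain f' g' where fg: "sobolev_pair \<Omega> f' g'" "AE p in lborel. p \<in> \<Omega> --> F k p = f' p"
   using H1_representative[OF F(2) Omega_open] by metis
  have z: "f' p = 0" if "p \<notin> \<Omega>" for p using sobolev_pair_outside[OF fg(1) that] by simp
  have "sobolev_pair \<Omega> (\<lambda>p. indicator \<Omega> p * F k p) g'"
  proof (rule sobolev_pair_cong_AE[OF fg(1)])
   show "AE p in lborel. indicator \<Omega> p * F k p = f' p" using fg(2) by eventually_elim (use z in \<open>auto split: split_indicator\<close>)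
   have "(\<lambda>p. indicator \<Omega> p * F k p) = (\<lambda>p. indicator \<Omega> p * F1 k p)"
    using closure_subset[of \<Omega>] by (auto simp: F1_def fun_eq_iff split: split_indicator)
   then show "(\<lambda>p. indicator \<Omega> p * F k p) \<in> BM" by simp
  qed simp
  then show ?thesis by (rule exI[of _ g'])
 qed
 then have "\<forall>k. \<exists>g'. sobolev_pair \<Omega> (\<lambda>p. indicator \<Omega> p * F k p) g'" by blast
 from choice[OF this] obtain gk where gk: "\<And>k. sobolev_pair \<Omega> (\<lambda>p. indicator \<Omega> p * F k p) (gk k)" by blast
 define fk where "fk k p = indicator \<Omega> p * F k p" for k p
 have fk: "sobolev_pair \<Omega> (fk k) (gk k)" "\<And>p. p \<in> \<Omega> ==> fk k p = F k p" for k
  using gk[of k] by (auto simp: fk_def[abs_def])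
 have s: "sqint f" "sqint g" "sqint (fk k)" "sqint (gk k)" for k using rep(1) fk(1)[of k] by (auto simp: sobolev_pair_def)
 have nrm: "(H1_norm \<Omega> (\<lambda>x. F k x - \<theta> x))\<^sup>2 = sqn (\<lambda>p. fk k p - f p) + sqn (\<lambda>p. gk k p - g p)" for k
 proof (rule H1_from_sobolev_pair(3)[OF sobolev_pair_diff[OF fk(1) rep(1)] _ Omega_open])
  show "AE x in lborel. x \<in> \<Omega> --> F k x - \<theta> x = fk k x - f x" using rep(2) by eventually_elim (use fk(2) in auto)
 qed
 have n0: "(\<lambda>k. sqn (\<lambda>p. fk k p - f p) + sqn (\<lambda>p. gk k p - g p)) \<longlonglongrightarrow> 0"
  using tendsto_power[OF F(3), of 2] unfolding nrm by simp
 have l1: "(\<lambda>k. sqn (\<lambda>p. fk k p - f p)) \<longlonglongrightarrow> 0"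
  by (rule Lim_null_comparison[OF _ n0]) (auto simp: sqn_nonneg)
 have l2: "(\<lambda>k. sqn (\<lambda>p. gk k p - g p)) \<longlonglongrightarrow> 0"
  by (rule Lim_null_comparison[OF _ n0]) (auto simp: sqn_nonneg)
 have \<tau>eq: "\<tau> = (\<lambda>x. if x \<in> D then t1 (x, v x) else 0)"
  using graph_in_closure(2) by (auto simp: \<tau>_def t1_def fun_eq_iff)
 have mD: "(\<lambda>x. if x \<in> D then q (x, v x) else 0) \<in> BM" if [measurable]: "q \<in> BM" for q :: "'a \<times> real => real"
  by measurable
 have \<tau>s: "sqint \<tau>"
 proof (rule sqintI_nn)
  have "(\<integral>\<^sup>+x. ennreal ((norm (\<tau> x))\<^sup>2) \<partial>lborel) \<le> 2 ^ DIM('a) * (\<integral>\<^sup>+p. ennreal ((t1 p)\<^sup>2) \<partial>surface_measure \<Omega>)"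
   unfolding \<tau>eq by (rule trace_L2_bound) simp
  also have "(\<integral>\<^sup>+p. ennreal ((t1 p)\<^sup>2) \<partial>surface_measure \<Omega>) = (\<integral>\<^sup>+p. ennreal ((t p)\<^sup>2) \<partial>surface_measure \<Omega>)"
   by (rule surf) (simp add: t1_def)
  also have "... = ennreal (integral\<^sup>L (surface_measure \<Omega>) (\<lambda>p. (t p)\<^sup>2))"
   by (rule nn_integral_eq_integral[OF t(2)]) simp
  finally show "(\<integral>\<^sup>+x. ennreal ((norm (\<tau> x))\<^sup>2) \<partial>lborel) < \<infinity>"
   by (rule le_less_trans) (auto simp: ennreal_mult_less_top power_less_top_ennreal)
 qed (unfold \<tau>eq, rule mD, simp)
 have \<tau>k: "green_trace D H v (fk k) (gk k) (\<lambda>x. if x \<in> D then F k (x, v x) else 0)" for k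
  by (rule green_continuous[OF fk(1) F(1) fk(2)])
 have l3: "(\<lambda>k. sqn (\<lambda>x. (if x \<in> D then F k (x, v x) else 0) - \<tau> x)) \<longlonglongrightarrow> 0"
 proof -
  have eq: "(\<lambda>x. (if x \<in> D then F k (x, v x) else 0) - \<tau> x) = (\<lambda>x. if x \<in> D then (F1 k (x, v x) - t1 (x, v x)) else 0)" for k
   using graph_in_closure(1) by (auto simp: \<tau>eq F1_def)
  have le: "ennreal (sqn (\<lambda>x. (if x \<in> D then F k (x, v x) else 0) - \<tau> x)) \<le> 2 ^ DIM('a) * (\<integral>\<^sup>+p. ennreal ((F k p - t p)\<^sup>2) \<partial>surface_measure \<Omega>)" for k
  proof -
   have si: "sqint (\<lambda>x. (if x \<in> D then F k (x, v x) else 0) - \<tau> x)"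
    using \<tau>k[of k] \<tau>s by (intro sqint_diff) (auto simp: green_trace_def)
   have "ennreal (sqn (\<lambda>x. (if x \<in> D then F k (x, v x) else 0) - \<tau> x)) = (\<integral>\<^sup>+x. ennreal ((norm (if x \<in> D then F1 k (x, v x) - t1 (x, v x) else 0))\<^sup>2) \<partial>lborel)"
    unfolding sqn_nn[OF si] unfolding fun_cong[OF eq] ..
   also have "... \<le> 2 ^ DIM('a) * (\<integral>\<^sup>+p. ennreal ((F1 k p - t1 p)\<^sup>2) \<partial>surface_measure \<Omega>)"
    by (rule trace_L2_bound) simp
   also have "(\<integral>\<^sup>+p. ennreal ((F1 k p - t1 p)\<^sup>2) \<partial>surface_measure \<Omega>) = (\<integral>\<^sup>+p. ennreal ((F k p - t p)\<^sup>2) \<partial>surface_measure \<Omega>)"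
    by (rule surf) (simp add: t1_def F1_def frc)
   finally show ?thesis .
  qed
  have "(\<lambda>k. 2 ^ DIM('a) * (\<integral>\<^sup>+p. ennreal ((F k p - t p)\<^sup>2) \<partial>surface_measure \<Omega>)) \<longlonglongrightarrow> 2 ^ DIM('a) * 0"
   by (rule ennreal_tendsto_cmult[OF _ F(4)]) (auto simp: power_less_top_ennreal)
  then have l: "(\<lambda>k. 2 ^ DIM('a) * (\<integral>\<^sup>+p. ennreal ((F k p - t p)\<^sup>2) \<partial>surface_measure \<Omega>)) \<longlonglongrightarrow> ennreal 0" by simp
  have "(\<lambda>k. ennreal (sqn (\<lambda>x. (if x \<in> D then F k (x, v x) else 0) - \<tau> x))) \<longlonglongrightarrow> ennreal 0"
   by (rule tendsto_sandwich[where f="\<lambda>_. 0", OF _ always_eventually[OF allI[OF le]] _ l]) auto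
  then show ?thesis by (rule tendsto_ennrealD) (auto simp: sqn_nonneg)
 qed
 show thesis
  by (rule that[OF F(1) fk l1 l2 F(4) \<tau>s l3 green_limit[OF s(1,2) s(3,4) l1 l2 \<tau>k \<tau>s _ l3]]) (auto simp: \<tau>_def)
qed

lemma shifted_domain:
 assumes "s < c" shows "graph_domain D H (c - s) (M + \<bar>s\<bar>) L (\<lambda>x. v x - s)"
  "x \<in> D ==> gradient (\<lambda>x. v x - s) x = gradient v x"
proof -
 have g: "gradient (\<lambda>x. v x - s) x = gradient v x" if "x \<in> D" for x
  by (rule gradient_unique) (auto intro!: derivative_eq_intros v_deriv[OF that])
 then show "x \<in> D ==> gradient (\<lambda>x. v x - s) x = gradient v x" .
 show "graph_domain D H (c - s) (M + \<bar>s\<bar>) L (\<lambda>x. v x - s)"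
 proof
  show "Cinf (\<lambda>x. v x - s) D" using v(1) D(1) by auto
  show "- H + (c - s) \<le> v x - s" "v x - s \<le> M + \<bar>s\<bar>" if "x \<in> D" for x using v_low[OF that] v_up[OF that] by auto
  show "norm (gradient (\<lambda>x. v x - s) x) \<le> L" if "x \<in> D" for x using grad[OF that] g[OF that] by simp
 qed (use D L assms in auto)
qed

text \<open>Green's formulas on the subgraphs of \<open>v\<close> and \<open>v - s\<close>, tested with functions of
\<open>x\<close> alone near the graph, identify the increment with the integral of the vertical derivative over the segment of
length \<open>s\<close>; the Cauchy-Schwarz inequality gives the factor \<open>s\<close>.\<close>

lemma vertical_increment:
 assumes sp: "sobolev_pair \<Omega> f g" and F: "continuous_on (closure \<Omega>) F" "\<And>p. p \<in> \<Omega> ==> f p = F p"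
  and s: "0 < s" "s < c"
 shows "(\<integral>\<^sup>+x. ennreal ((if x \<in> D then F (x, v x) - F (x, v x - s) else 0)\<^sup>2) \<partial>lborel) \<le> ennreal (s * sqn g)"
proof -
 interpret vs: graph_domain D H "c - s" "M + \<bar>s\<bar>" L "\<lambda>x. v x - s" by (rule shifted_domain(1)[OF s(2)])
 have sf: "sqint f" "sqint g" by (rule sobolev_pair_sqint[OF sp])+
 have [measurable]: "f \<in> BM" "g \<in> BM" using sf by (auto simp: sqint_def)
 have sub: "vs.\<Omega> \<subseteq> \<Omega>" using s by (auto simp: Omega1_def)
 define f1 where "f1 p = indicator vs.\<Omega> p * f p" for p
 define g1 where "g1 p = indicator vs.\<Omega> p *\<^sub>R g p" for p
 have sp1: "sobolev_pair vs.\<Omega> f1 g1" unfolding f1_def[abs_def] g1_def[abs_def]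
  by (rule sobolev_pair_restrict[OF sp sub vs.Omega_borel])
 have sf1: "sqint f1" "sqint g1" by (rule sobolev_pair_sqint[OF sp1])+
 let ?\<tau> = "\<lambda>x. if x \<in> D then F (x, v x) else 0" and ?\<tau>1 = "\<lambda>x. if x \<in> D then F (x, v x - s) else 0"
 have gr: "green_trace D H v f g ?\<tau>" by (rule green_continuous[OF sp F])
 have gr1: "green_trace D H (\<lambda>x. v x - s) f1 g1 ?\<tau>1"
  by (rule vs.green_continuous[OF sp1 continuous_on_subset[OF F(1) closure_mono[OF sub]]])
   (use sub F(2) in \<open>auto simp: f1_def\<close>)
 have \<tau>: "sqint ?\<tau>" "sqint ?\<tau>1" using gr gr1 by (auto simp: green_trace_def)
 define S where "S = {p. fst p \<in> D \<and> v (fst p) - s \<le> snd p \<and> snd p < v (fst p)}"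
 have [measurable]: "S \<in> sets borel" unfolding S_def by measurable
 have Sb: "bounded S"
  by (rule bounded_subset[of "D \<times> {-H..M}"]) (use D v_up v_low s in \<open>force simp: S_def intro!: bounded_Times\<close>)+
 have Sfin: "emeasure lborel S < \<infinity>" by (rule emeasure_bounded_finite[OF Sb])
 define e :: "'a \<times> real" where "e = (0, 1)"
 define k where "k p = indicator S p * (g p \<bullet> e)" for p
 have ik: "integrable lborel k" unfolding k_def
  using sqint_compact_integrable[OF sqint_inner_const[OF sf(2)] Sfin, of e] by simp
 have [measurable]: "k \<in> BM" using ik by simp
 define R where "R x = (LINT z|lborel. k (x, z))" for x
 have iR: "integrable lborel R" unfolding R_def by (rule lborel_Fubini(2)[OF ik])
 have [measurable]: "R \<in> BM" using iR by simp
 have \<tau>m [measurable]: "?\<tau> \<in> BM" "?\<tau>1 \<in> BM" using \<tau> by (auto simp: sqint_def)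
 define h where "h x = ?\<tau> x - ?\<tau>1 x - R x" for x
 have hm [measurable]: "h \<in> BM" unfolding h_def using \<tau>m by measurable
 obtain \<kappa> where \<kappa>: "\<kappa> \<in> test_functions {-H<..}"
  "\<And>z. -H + (c - s) \<le> z ==> z \<le> M ==> \<kappa> z = 1 \<and> gradient \<kappa> z = 0"
  using plateau[of "-H" "-H + (c - s)" M] s(2) by (metis add.commute add_less_cancel_left add_0 diff_gt_0_iff_gt less_add_same_cancel1)
 have "AE x in lborel. x \<in> D --> h x = 0"
 proof (rule fundamental_lemma_lborel[OF D(1) hm])
  fix p q :: 'a
  have [measurable]: "cbox p q \<in> sets borel" by simp
  have fin: "emeasure lborel (cbox p q) < \<infinity>" by (rule emeasure_compact_finite) simp
  have "integrable lborel (\<lambda>x. indicator (cbox p q) x *\<^sub>R ?\<tau> x - indicator (cbox p q) x *\<^sub>R ?\<tau>1 x - indicator (cbox p q) x *\<^sub>R R x)"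
   by (intro Bochner_Integration.integrable_diff sqint_compact_integrable[OF \<tau>(1) fin] sqint_compact_integrable[OF \<tau>(2) fin]
     integrable_mult_indicator iR) auto
  then show "set_integrable lborel (cbox p q) h" by (simp add: set_integrable_def h_def algebra_simps)
 next
  fix \<eta> assume \<eta>: "\<eta> \<in> test_functions D"
  define \<phi> where "\<phi> p = \<eta> (fst p) * \<kappa> (snd p)" for p
  have \<phi>: "\<phi> \<in> test_functions (D \<times> {-H<..})" "gradient \<phi> p \<bullet> e = \<eta> (fst p) * gradient \<kappa> (snd p)" for p
   unfolding \<phi>_def[abs_def] e_def using tensor_test[OF D(1) \<eta> \<kappa>(1)] by auto
  have \<kappa>1: "\<kappa> (v x) = 1" "\<kappa> (v x - s) = 1" if "x \<in> D" for x
   using \<kappa>(2)[of "v x"] \<kappa>(2)[of "v x - s"] v_low[OF that] v_up[OF that] s by auto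
  have N1: "gnormal D v x \<bullet> e = indicator D x" "gnormal D (\<lambda>x. v x - s) x \<bullet> e = indicator D x" for x
   by (auto simp: gnormal_def e_def)
  have G: "(LINT p|lborel. f p * (gradient \<phi> p \<bullet> e)) + (LINT p|lborel. \<phi> p * (g p \<bullet> e)) = (LINT x|lborel. ?\<tau> x * \<eta> x)"
  proof -
   have "(LINT x|lborel. ?\<tau> x * (\<phi> (x, v x) * (gnormal D v x \<bullet> e))) = (LINT x|lborel. ?\<tau> x * \<eta> x)"
    by (intro integral_congr) (use \<kappa>1 in \<open>auto simp: \<phi>_def N1\<close>)
   then show ?thesis using green_traceD[OF gr \<phi>(1)] by simp
  qed
  have G1: "(LINT p|lborel. f1 p * (gradient \<phi> p \<bullet> e)) + (LINT p|lborel. \<phi> p * (g1 p \<bullet> e)) = (LINT x|lborel. ?\<tau>1 x * \<eta> x)"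
  proof -
   have "(LINT x|lborel. ?\<tau>1 x * (\<phi> (x, v x - s) * (gnormal D (\<lambda>x. v x - s) x \<bullet> e))) = (LINT x|lborel. ?\<tau>1 x * \<eta> x)"
    by (intro integral_congr) (use \<kappa>1 in \<open>auto simp: \<phi>_def N1\<close>)
   then show ?thesis using green_traceD[OF gr1 \<phi>(1)] by simp
  qed
  have sd: "sqint (\<lambda>p. gradient \<phi> p \<bullet> e)" by (rule test_function_sqint[OF test_function_deriv[OF \<phi>(1)]])
  have i: "integrable lborel (\<lambda>p. f p * (gradient \<phi> p \<bullet> e))" "integrable lborel (\<lambda>p. f1 p * (gradient \<phi> p \<bullet> e))"
    "integrable lborel (\<lambda>p. \<phi> p * (g p \<bullet> e))" "integrable lborel (\<lambda>p. \<phi> p * (g1 p \<bullet> e))"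
   using sqint_inner(1)[OF sf(1) sd] sqint_inner(1)[OF sf1(1) sd] sqint_inner(1)[OF test_function_sqint[OF \<phi>(1)] sqint_inner_const[OF sf(2)]]
    sqint_inner(1)[OF test_function_sqint[OF \<phi>(1)] sqint_inner_const[OF sf1(2)]] by auto
  have pt: "f p * (gradient \<phi> p \<bullet> e) - f1 p * (gradient \<phi> p \<bullet> e) + (\<phi> p * (g p \<bullet> e) - \<phi> p * (g1 p \<bullet> e)) = \<eta> (fst p) * k p" for p
  proof (cases "p \<in> S")
   case True
   obtain x z where p: "p = (x, z)" by (cases p)
   have x: "x \<in> D" "v x - s \<le> z" "z < v x" using True by (auto simp: S_def p)
   then have "\<kappa> z = 1 \<and> gradient \<kappa> z = 0" using v_low[OF x(1)] v_up[OF x(1)] by (intro \<kappa>(2)) auto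
   moreover have "p \<notin> vs.\<Omega>" using x by (auto simp: p Omega1_def)
   ultimately show ?thesis using True by (simp add: \<phi>(2) f1_def g1_def k_def \<phi>_def p)
  next
   case False
   show ?thesis
   proof (cases "p \<in> vs.\<Omega>")
    case True
    then show ?thesis using False by (simp add: f1_def g1_def k_def)
   next
    case notin: False
    then have "p \<notin> \<Omega>" using False by (auto simp: Omega1_def S_def)
    then show ?thesis using sobolev_pair_outside[OF sp, of p] False by (simp add: f1_def g1_def k_def)
   qed
  qed
  have i\<tau>: "integrable lborel (\<lambda>x. ?\<tau> x * \<eta> x)" "integrable lborel (\<lambda>x. ?\<tau>1 x * \<eta> x)"
   using sqint_inner(1)[OF \<tau>(1) test_function_sqint[OF \<eta>]] sqint_inner(1)[OF \<tau>(2) test_function_sqint[OF \<eta>]] by auto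
  have iek: "integrable lborel (\<lambda>p. \<eta> (fst p) * k p)"
   unfolding pt[symmetric] by (intro Bochner_Integration.integrable_add Bochner_Integration.integrable_diff i)
  have "(LINT x|lborel. ?\<tau> x * \<eta> x) - (LINT x|lborel. ?\<tau>1 x * \<eta> x) = (LINT p|lborel. \<eta> (fst p) * k p)"
   unfolding pt[symmetric] G[symmetric] G1[symmetric] using i by simp
  also have "... = (LINT x|lborel. \<eta> x * R x)"
   using lborel_Fubini(1)[OF iek] by (simp add: R_def)
  finally have eq: "(LINT x|lborel. ?\<tau> x * \<eta> x) - (LINT x|lborel. ?\<tau>1 x * \<eta> x) = (LINT x|lborel. \<eta> x * R x)" .
  have iR': "integrable lborel (\<lambda>x. \<eta> x * R x)"
   using lborel_Fubini(2)[OF iek] by (simp add: R_def)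
  have "(LINT x|lborel. \<eta> x * h x) = (LINT x|lborel. (?\<tau> x * \<eta> x - ?\<tau>1 x * \<eta> x) - \<eta> x * R x)"
   by (intro integral_congr) (simp add: h_def algebra_simps)
  also have "... = 0" using eq i\<tau> iR' by simp
  finally show "(LINT x|lborel. \<eta> x * h x) = 0" .
 qed
 then have ae: "AE x in lborel. ennreal ((if x \<in> D then F (x, v x) - F (x, v x - s) else 0)\<^sup>2) = ennreal ((R x)\<^sup>2)"
 proof eventually_elim
  case (elim x)
  have "R x = 0" if "x \<notin> D" using that by (simp add: R_def k_def S_def)
  then show ?case using elim by (auto simp: h_def)
 qed
 have le: "ennreal ((R x)\<^sup>2) \<le> ennreal s * (\<integral>\<^sup>+z. ennreal ((norm (g (x, z)))\<^sup>2) \<partial>lborel)" for x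
 proof -
  have [measurable]: "(\<lambda>z. k (x, z)) \<in> BM" "(\<lambda>z. g (x, z)) \<in> BM" by (intro section_measurable; simp)+
  have "ennreal \<bar>R x\<bar> \<le> (\<integral>\<^sup>+z. ennreal \<bar>k (x, z)\<bar> \<partial>lborel)"
  proof (cases "integrable lborel (\<lambda>z. k (x, z))")
   case True
   from integral_norm_bound_ennreal[OF this] show ?thesis by (simp add: R_def)
  next
   case False
   then show ?thesis by (simp add: R_def not_integrable_integral_eq)
  qed
  also have "... \<le> (\<integral>\<^sup>+z. indicator {v x - s..<v x} z * ennreal (norm (g (x, z))) \<partial>lborel)"
  proof (intro nn_integral_mono)
   fix z
   have "\<bar>g (x, z) \<bullet> e\<bar> \<le> norm (g (x, z))" using Cauchy_Schwarz_ineq2[of "g (x, z)" e] by (simp add: e_def)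
   then show "ennreal \<bar>k (x, z)\<bar> \<le> indicator {v x - s..<v x} z * ennreal (norm (g (x, z)))"
    by (auto simp: k_def S_def split: split_indicator intro!: ennreal_leI)
  qed
  finally have "(ennreal \<bar>R x\<bar>)\<^sup>2 \<le> (\<integral>\<^sup>+z. indicator {v x - s..<v x} z * ennreal (norm (g (x, z))) \<partial>lborel)\<^sup>2" by (rule power_mono) simp
  also have "... \<le> (\<integral>\<^sup>+z. (indicator {v x - s..<v x} z)\<^sup>2 \<partial>lborel) * (\<integral>\<^sup>+z. (ennreal (norm (g (x, z))))\<^sup>2 \<partial>lborel)"
   by (rule Cauchy_Schwarz_nn_integral) auto
  also have "(\<integral>\<^sup>+z. (indicator {v x - s..<v x} z :: ennreal)\<^sup>2 \<partial>lborel) = (\<integral>\<^sup>+z. indicator {v x - s..<v x} z \<partial>lborel)"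
   by (intro nn_integral_cong) (auto split: split_indicator)
  also have "... = ennreal s" using s by simp
  finally show ?thesis by (simp add: ennreal_power)
 qed
 have "(\<integral>\<^sup>+x. ennreal ((if x \<in> D then F (x, v x) - F (x, v x - s) else 0)\<^sup>2) \<partial>lborel) = (\<integral>\<^sup>+x. ennreal ((R x)\<^sup>2) \<partial>lborel)"
  by (rule nn_integral_cong_AE[OF ae])
 also have "... \<le> (\<integral>\<^sup>+x. ennreal s * (\<integral>\<^sup>+z. ennreal ((norm (g (x, z)))\<^sup>2) \<partial>lborel) \<partial>lborel)"
  by (intro nn_integral_mono le)
 also have "... = ennreal s * (\<integral>\<^sup>+x. \<integral>\<^sup>+z. ennreal ((norm (g (x, z)))\<^sup>2) \<partial>lborel \<partial>lborel)"
  using lborel_nn_Fubini(2)[of "\<lambda>p. ennreal ((norm (g p))\<^sup>2)"] by (intro nn_integral_cmult) simp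
 also have "(\<integral>\<^sup>+x. \<integral>\<^sup>+z. ennreal ((norm (g (x, z)))\<^sup>2) \<partial>lborel \<partial>lborel) = ennreal (sqn g)"
  using lborel_nn_Fubini(1)[of "\<lambda>p. ennreal ((norm (g p))\<^sup>2)"] sqn_nn[OF sf(2)] by simp
 also have "ennreal s * ennreal (sqn g) = ennreal (s * sqn g)" using s sqn_nonneg[of g] by (simp add: ennreal_mult)
 finally show ?thesis .
qed

lemma sqint_tensor:
 assumes "sqint \<tau>" "0 \<le> d"
 shows "sqint (\<lambda>p :: 'a \<times> real. \<tau> (fst p) * indicator {0<..<d} (snd p))"
  "sqn (\<lambda>p :: 'a \<times> real. \<tau> (fst p) * indicator {0<..<d} (snd p)) \<le> d * sqn (\<tau> :: 'a => real)"
proof -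
 have [measurable]: "\<tau> \<in> BM" using assms by (simp add: sqint_def)
 have m: "(\<lambda>p :: 'a \<times> real. \<tau> (fst p) * indicator {0<..<d} (snd p)) \<in> BM" by measurable
 have "(\<integral>\<^sup>+p. ennreal ((norm (\<tau> (fst p) * indicator {0<..<d} (snd p)))\<^sup>2) \<partial>(lborel :: ('a \<times> real) measure))
  = (\<integral>\<^sup>+x. \<integral>\<^sup>+z. ennreal ((norm (\<tau> x * indicator {0<..<d} z))\<^sup>2) \<partial>lborel \<partial>lborel)"
  by (subst lborel_nn_Fubini(1)) (use m in auto)
 also have "... = (\<integral>\<^sup>+x. \<integral>\<^sup>+z. ennreal ((norm (\<tau> x))\<^sup>2) * indicator {0<..<d} z \<partial>lborel \<partial>lborel)"
  by (intro nn_integral_cong) (auto split: split_indicator)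
 also have "... = (\<integral>\<^sup>+x. ennreal ((norm (\<tau> x))\<^sup>2) * ennreal d \<partial>lborel)"
  using assms(2) by (intro nn_integral_cong) (simp add: nn_integral_cmult_indicator)
 also have "... = ennreal (sqn \<tau>) * ennreal d" unfolding sqn_nn[OF assms(1)] by (rule nn_integral_multc) measurable
 also have "... = ennreal (d * sqn \<tau>)" using assms(2) sqn_nonneg[of \<tau>] by (simp add: ennreal_mult mult.commute)
 finally have "(\<integral>\<^sup>+p. ennreal ((norm (\<tau> (fst p) * indicator {0<..<d} (snd p)))\<^sup>2) \<partial>(lborel :: ('a \<times> real) measure)) \<le> ennreal (d * sqn \<tau>)" by simp
 from sqnI_nn[OF m this] show "sqint (\<lambda>p :: 'a \<times> real. \<tau> (fst p) * indicator {0<..<d} (snd p))"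
  "sqn (\<lambda>p :: 'a \<times> real. \<tau> (fst p) * indicator {0<..<d} (snd p)) \<le> d * sqn \<tau>"
  using assms(2) sqn_nonneg[of \<tau>] by auto
qed

text \<open>The second coordinate is the depth below the graph.\<close>

definition strip :: "(('a \<times> real) => real) => ('a => real) => real => 'a \<times> real => real" where
 "strip f \<tau> d p = indicator (D \<times> {0<..<d}) p * (f (fst p, v (fst p) - snd p) - \<tau> (fst p))"

lemma strip_measurable [measurable]:
 assumes [measurable]: "f \<in> BM" "\<tau> \<in> BM"
 shows "strip f \<tau> d \<in> BM"
proof -
 have [measurable]: "D \<times> {0<..<d} \<in> sets borel" by (rule borel_Times) auto
 show ?thesis unfolding strip_def[abs_def] by measurable
qed

lemma strip_continuous:
 assumes sp: "sobolev_pair \<Omega> f g" and F: "continuous_on (closure \<Omega>) F" "\<And>p. p \<in> \<Omega> ==> f p = F p"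
  and d: "0 < d" "d < c"
 shows "sqint (strip f (\<lambda>x. if x \<in> D then F (x, v x) else 0) d)"
  "sqn (strip f (\<lambda>x. if x \<in> D then F (x, v x) else 0) d) \<le> d\<^sup>2 * sqn g"
proof -
 let ?\<tau> = "\<lambda>x. if x \<in> D then F (x, v x) else 0"
 have fm [measurable]: "f \<in> BM" using sobolev_pair_sqint[OF sp] by (auto simp: sqint_def)
 have tm [measurable]: "?\<tau> \<in> BM" using green_continuous[OF sp F] by (auto simp: green_trace_def sqint_def)
 have m: "strip f ?\<tau> d \<in> BM" by (rule strip_measurable[OF fm tm])
 have "(\<integral>\<^sup>+p. ennreal ((norm (strip f ?\<tau> d p))\<^sup>2) \<partial>lborel) = (\<integral>\<^sup>+x. \<integral>\<^sup>+s. ennreal ((norm (strip f ?\<tau> d (x, s)))\<^sup>2) \<partial>lborel \<partial>lborel)"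
  by (subst lborel_nn_Fubini(1)) (use m in auto)
 also have "... = (\<integral>\<^sup>+s. \<integral>\<^sup>+x. ennreal ((norm (strip f ?\<tau> d (x, s)))\<^sup>2) \<partial>lborel \<partial>lborel)"
  by (rule lborel_pair.Fubini'[symmetric]) (use m in \<open>simp add: lborel_prod case_prod_beta'\<close>)
 also have "... \<le> (\<integral>\<^sup>+s. ennreal (d * sqn g) * indicator {0<..<d} s \<partial>lborel)"
 proof (intro nn_integral_mono)
  fix s :: real
  show "(\<integral>\<^sup>+x. ennreal ((norm (strip f ?\<tau> d (x, s)))\<^sup>2) \<partial>lborel) \<le> ennreal (d * sqn g) * indicator {0<..<d} s"
  proof (cases "s \<in> {0<..<d}")
   case False
   then show ?thesis by (simp add: strip_def)
  next
   case True
   have "(norm (strip f ?\<tau> d (x, s)))\<^sup>2 = (if x \<in> D then F (x, v x) - F (x, v x - s) else 0)\<^sup>2" for x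
   proof (cases "x \<in> D")
    case x: True
    have "(x, v x - s) \<in> \<Omega>" using True d x v_low[OF x] by (auto simp: Omega1_def)
    then show ?thesis using x True F(2) by (simp add: strip_def power2_commute)
   qed (simp add: strip_def)
   then have "(\<integral>\<^sup>+x. ennreal ((norm (strip f ?\<tau> d (x, s)))\<^sup>2) \<partial>lborel) \<le> ennreal (s * sqn g)"
    using vertical_increment[OF sp F, of s] True d by simp
   also have "... \<le> ennreal (d * sqn g)" using True sqn_nonneg[of g] by (intro ennreal_leI mult_right_mono) auto
   finally show ?thesis using True by simp
  qed
 qed
 also have "... = ennreal (d * sqn g) * ennreal d" using d by (simp add: nn_integral_cmult_indicator)
 also have "... = ennreal (d\<^sup>2 * sqn g)" using d sqn_nonneg[of g] by (simp add: ennreal_mult[symmetric] power2_eq_square mult_ac)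
 finally have "(\<integral>\<^sup>+p. ennreal ((norm (strip f ?\<tau> d p))\<^sup>2) \<partial>lborel) \<le> ennreal (d\<^sup>2 * sqn g)" .
 from sqnI_nn[OF m this] show "sqint (strip f ?\<tau> d)" "sqn (strip f ?\<tau> d) \<le> d\<^sup>2 * sqn g" using sqn_nonneg[of g] by auto
qed

lemma strip_diff:
 assumes f: "sqint f" "sqint f'" and \<tau>: "sqint \<tau>" "sqint \<tau>'" and d: "0 < d"
 shows "sqint (\<lambda>p. strip f \<tau> d p - strip f' \<tau>' d p)"
  "sqn (\<lambda>p. strip f \<tau> d p - strip f' \<tau>' d p) \<le> 2 * sqn (\<lambda>p. f p - f' p) + 2 * d * sqn (\<lambda>x. \<tau> x - \<tau>' x)"
proof -
 have [measurable]: "f \<in> BM" "f' \<in> BM" "\<tau> \<in> BM" "\<tau>' \<in> BM"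
  using assms by (auto simp: sqint_def)
 define A where "A p = f (fst p, v (fst p) + (-1) * snd p) - f' (fst p, v (fst p) + (-1) * snd p)" for p
 define B where "B p = (\<tau> (fst p) - \<tau>' (fst p)) * indicator {0<..<d} (snd p)" for p :: "'a \<times> real"
 have A: "sqint A" "sqn A = sqn (\<lambda>p. f p - f' p)"
  using sqint_shear[OF sqint_diff(1)[OF f] v(2), of "-1"] unfolding A_def by auto
 have B: "sqint B" "sqn B \<le> d * sqn (\<lambda>x. \<tau> x - \<tau>' x)"
  using sqint_tensor[OF sqint_diff(1)[OF \<tau>], of d] d unfolding B_def by auto
 note AB = sqint_diff[OF A(1) B(1)]
 have le: "norm (strip f \<tau> d p - strip f' \<tau>' d p) \<le> 1 * norm (A p - B p)" for p
  by (cases p) (auto simp: strip_def A_def B_def split: split_indicator)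
 have st: "sqint (\<lambda>p. strip f \<tau> d p - strip f' \<tau>' d p)" "sqn (\<lambda>p. strip f \<tau> d p - strip f' \<tau>' d p) \<le> 1\<^sup>2 * sqn (\<lambda>p. A p - B p)"
  by (rule sqint_bound[OF AB(1), of _ 1]; use le in auto)+
 show "sqint (\<lambda>p. strip f \<tau> d p - strip f' \<tau>' d p)" by (rule st(1))
 show "sqn (\<lambda>p. strip f \<tau> d p - strip f' \<tau>' d p) \<le> 2 * sqn (\<lambda>p. f p - f' p) + 2 * d * sqn (\<lambda>x. \<tau> x - \<tau>' x)"
 proof -
  have "S \<le> 2 * a + 2 * d * b" if "S \<le> 1\<^sup>2 * X" "X \<le> 2 * A' + 2 * B'" "A' = a" "B' \<le> d * b" for S X A' B' a b :: real
   using that by simp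
  from this[OF st(2) AB(2) A(2) B(2)] show ?thesis .
 qed
qed

text \<open>\<open>vertical_increment\<close> is integrated over the depth for the continuous approximations.  Passing to the
limit costs a constant factor.\<close>

lemma strip_estimate:
 assumes "\<And>k. continuous_on (closure \<Omega>) (F k)" "\<And>k. sobolev_pair \<Omega> (fk k) (gk k)"
  "\<And>k p. p \<in> \<Omega> ==> fk k p = F k p"
  "(\<lambda>k. sqn (\<lambda>p. fk k p - f p)) \<longlonglongrightarrow> 0" "(\<lambda>k. sqn (\<lambda>p. gk k p - g p)) \<longlonglongrightarrow> 0"
  "sqint f" "sqint g" "sqint \<tau>" "(\<lambda>k. sqn (\<lambda>x. (if x \<in> D then F k (x, v x) else 0) - \<tau> x)) \<longlonglongrightarrow> 0"
  and d: "0 < d" "d < c"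
 shows "sqint (strip f \<tau> d)" "sqn (strip f \<tau> d) \<le> 4 * d\<^sup>2 * sqn g"
proof -
 let ?\<tau> = "\<lambda>k x. if x \<in> D then F k (x, v x) else 0"
 have \<tau>k: "sqint (?\<tau> k)" for k using green_continuous[OF assms(2,1,3)] by (auto simp: green_trace_def)
 have fk: "sqint (fk k)" "sqint (gk k)" for k using sobolev_pair_sqint[OF assms(2)] by auto
 have sk: "sqint (strip (fk k) (?\<tau> k) d)" "sqn (strip (fk k) (?\<tau> k) d) \<le> d\<^sup>2 * sqn (gk k)" for k
  by (rule strip_continuous[OF assms(2,1,3) d]; assumption)+
 have dk: "sqint (\<lambda>p. strip (fk k) (?\<tau> k) d p - strip f \<tau> d p)"
  "sqn (\<lambda>p. strip (fk k) (?\<tau> k) d p - strip f \<tau> d p) \<le> 2 * sqn (\<lambda>p. fk k p - f p) + 2 * d * sqn (\<lambda>x. ?\<tau> k x - \<tau> x)" for k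
  by (rule strip_diff[OF fk(1) assms(6) \<tau>k assms(8) d(1)])+
 have eq: "strip f \<tau> d = (\<lambda>p. strip (fk k) (?\<tau> k) d p - (strip (fk k) (?\<tau> k) d p - strip f \<tau> d p))" for k by auto
 show "sqint (strip f \<tau> d)" using sqint_diff(1)[OF sk(1)[of 0] dk(1)[of 0]] by simp
 have b: "sqn (strip f \<tau> d) \<le> 2 * (d\<^sup>2 * (2 * sqn g + 2 * sqn (\<lambda>p. gk k p - g p))) + 2 * (2 * sqn (\<lambda>p. fk k p - f p) + 2 * d * sqn (\<lambda>x. ?\<tau> k x - \<tau> x))" for k
 proof -
  have "sqn (strip f \<tau> d) \<le> 2 * sqn (strip (fk k) (?\<tau> k) d) + 2 * sqn (\<lambda>p. strip (fk k) (?\<tau> k) d p - strip f \<tau> d p)"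
   using sqint_diff(2)[OF sk(1)[of k] dk(1)[of k]] by simp
  moreover have "sqn (gk k) \<le> 2 * sqn g + 2 * sqn (\<lambda>p. gk k p - g p)"
   using sqint_add(2)[OF assms(7) sqint_diff(1)[OF fk(2)[of k] assms(7)]] by simp
  then have "d\<^sup>2 * sqn (gk k) \<le> d\<^sup>2 * (2 * sqn g + 2 * sqn (\<lambda>p. gk k p - g p))" by (intro mult_left_mono) auto
  moreover have "S \<le> 2 * e + 2 * w" if "S \<le> 2 * a + 2 * b" "x \<le> e" "a \<le> x" "b \<le> w" for S a b x e w :: real
   using that by simp
  ultimately show ?thesis using sk(2)[of k] dk(2)[of k] by blast
 qed
 have "(\<lambda>k. 2 * (d\<^sup>2 * (2 * sqn g + 2 * sqn (\<lambda>p. gk k p - g p))) + 2 * (2 * sqn (\<lambda>p. fk k p - f p) + 2 * d * sqn (\<lambda>x. ?\<tau> k x - \<tau> x)))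
   \<longlonglongrightarrow> 2 * (d\<^sup>2 * (2 * sqn g + 2 * 0)) + 2 * (2 * 0 + 2 * d * 0)"
  by (intro tendsto_intros assms)
 from LIMSEQ_le_const[OF this] b have "sqn (strip f \<tau> d) \<le> 2 * (d\<^sup>2 * (2 * sqn g + 2 * 0)) + 2 * (2 * 0 + 2 * d * 0)" by blast
 then show "sqn (strip f \<tau> d) \<le> 4 * d\<^sup>2 * sqn g" by (simp add: mult_ac)
qed

end

section \<open>Reflection across the graph\<close>

lemma closure_Omega1:
 assumes D: "open D" and vc: "continuous_on UNIV v" and low: "\<And>x. x \<in> closure D ==> - H < v x"
 shows "closure (Omega1 D H v) = {(x, z). x \<in> closure D \<and> - H \<le> z \<and> z \<le> (v x :: real)}"
proof
 have "closed {p. fst p \<in> closure D \<and> - H \<le> snd p \<and> snd p \<le> v (fst p)}"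
 proof -
  have "{p. fst p \<in> closure D \<and> - H \<le> snd p \<and> snd p \<le> v (fst p)} = (closure D \<times> {-H..}) \<inter> {p. snd p \<le> v (fst p)}" by auto
  moreover have "closed {p :: 'a \<times> real. snd p \<le> v (fst p)}"
   by (intro closed_Collect_le continuous_intros continuous_on_compose2[OF vc]) auto
  ultimately show ?thesis by (simp add: closed_Int closed_Times)
 qed
 then show "closure (Omega1 D H v) \<subseteq> {(x, z). x \<in> closure D \<and> - H \<le> z \<and> z \<le> v x}"
  by (intro closure_minimal) (use closure_subset in \<open>fastforce simp: Omega1_def case_prod_unfold\<close>)+
 show "{(x, z). x \<in> closure D \<and> - H \<le> z \<and> z \<le> v x} \<subseteq> closure (Omega1 D H v)"
 proof clarify
  fix x z assume x: "x \<in> closure D" and z: "- H \<le> z" "z \<le> v x"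
  obtain X where X: "\<And>n. X n \<in> D" "X \<longlonglongrightarrow> x" using x unfolding closure_sequential by blast
  define \<mu> where "\<mu> = (z + H) / (v x + H)"
  have vH: "v x + H > 0" using low[OF x] by simp
  have \<mu>: "0 \<le> \<mu>" "\<mu> \<le> 1" "z = - H + \<mu> * (v x + H)" using z vH by (auto simp: \<mu>_def)
  define l where "l n = \<mu> + (1/2 - \<mu>) * inverse (real (Suc n))" for n
  have l: "0 < l n" "l n < 1" for n
  proof -
   define t where "t = inverse (real (Suc n))"
   have t: "0 < t" "t \<le> 1" by (auto simp: t_def field_simps)
   have "l n = \<mu> * (1 - t) + t / 2" unfolding l_def t_def[symmetric] by (simp add: algebra_simps)
   moreover have "0 \<le> \<mu> * (1 - t)" "\<mu> * (1 - t) \<le> 1 - t" using \<mu> t by (auto intro: mult_left_le_one_le)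
   ultimately show "0 < l n" "l n < 1" using t by linarith+
  qed
  have "l \<longlonglongrightarrow> \<mu> + (1/2 - \<mu>) * 0" unfolding l_def by (intro tendsto_intros LIMSEQ_inverse_real_of_nat)
  moreover have "(\<lambda>n. v (X n)) \<longlonglongrightarrow> v x" by (rule continuous_on_tendsto_compose[OF vc X(2)]) auto
  ultimately have "(\<lambda>n. (X n, - H + l n * (v (X n) + H))) \<longlonglongrightarrow> (x, - H + (\<mu> + (1/2 - \<mu>) * 0) * (v x + H))"
   by (intro tendsto_intros X(2))
  then have "(\<lambda>n. (X n, - H + l n * (v (X n) + H))) \<longlonglongrightarrow> (x, z)" using \<mu>(3) by simp
  moreover have "(X n, - H + l n * (v (X n) + H)) \<in> Omega1 D H v" for n
  proof -
   have "v (X n) + H > 0" using low[of "X n"] X(1)[of n] closure_subset by force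
   moreover have "l n * (v (X n) + H) < v (X n) + H" using l[of n] calculation by (simp add: mult_less_cancel_right1)
   ultimately have "- H + l n * (v (X n) + H) < v (X n)" "- H < - H + l n * (v (X n) + H)"
    using mult_pos_pos[OF l(1)[of n], of "v (X n) + H"] by linarith+
   then show ?thesis using X(1) by (auto simp: Omega1_def)
  qed
  ultimately show "(x, z) \<in> closure (Omega1 D H v)"
   unfolding closure_sequential by (intro exI[of _ "\<lambda>n. (X n, - H + l n * (v (X n) + H))"]) simp
 qed
qed

lemma AE_not_graph:
 fixes v :: "'a::euclidean_space => real"
 assumes [measurable]: "v \<in> BM"
 shows "AE p in lborel. snd p \<noteq> v (fst p)"
proof -
 have "(\<integral>\<^sup>+p. indicator {p. snd p = v (fst p)} p \<partial>lborel) = (\<integral>\<^sup>+x. \<integral>\<^sup>+z. indicator {p. snd p = v (fst p)} (x, z) \<partial>lborel \<partial>lborel)"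
  by (rule lborel_nn_Fubini) measurable
 also have "... = (\<integral>\<^sup>+x. \<integral>\<^sup>+z. indicator {v x} z \<partial>lborel \<partial>lborel)"
  by (intro nn_integral_cong) (auto split: split_indicator)
 also have "... = 0" by simp
 finally have "{p. snd p = v (fst p)} \<in> null_sets lborel" by (auto simp: null_sets_def)
 from AE_not_in[OF this] show ?thesis by simp
qed

text \<open>The layer of thickness \<open>d\<close> above the graph is the reflection of a layer below it.\<close>

locale reflection_domain = graph_domain +
 fixes d :: real
 assumes d: "0 < d" "d < c" and vc: "continuous_on UNIV v" and v0: "\<And>x. x \<notin> D ==> v x = 0" and cH: "c \<le> H"
begin

text \<open>Vertical reflection across the graph; it preserves Lebesgue measure.\<close>

definition T :: "'a \<times> real => 'a \<times> real" where "T p = (fst p, 2 * v (fst p) + (-1) * snd p)"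

definition U :: "('a \<times> real) set" where "U = {p. fst p \<in> D \<and> v (fst p) < snd p \<and> snd p < v (fst p) + d}"

text \<open>Falls linearly from one on the graph to zero on the top of the layer.\<close>

definition taper :: "'a \<times> real => real" where "taper p = (v (fst p) + d - snd p) / d"

text \<open>The transposed derivative of the reflection: it maps the gradient of \<open>f\<close> at \<open>T p\<close> to the
gradient of \<open>f \<circ> T\<close> at \<open>p\<close>.\<close>

definition Brefl :: "'a => 'a \<times> real => 'a \<times> real" where
 "Brefl x w = (fst w - (2 * snd w) *\<^sub>R fst (gnormal D v x), - snd w)"

definition fU :: "('a \<times> real => real) => 'a \<times> real => real" where
 "fU f p = indicator U p * (f (T p) * taper p)"

definition gU :: "('a \<times> real => real) => ('a \<times> real => 'a \<times> real) => 'a \<times> real => 'a \<times> real" where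
 "gU f g p = indicator U p *\<^sub>R (taper p *\<^sub>R Brefl (fst p) (g (T p)) - (f (T p) / d) *\<^sub>R gnormal D v (fst p))"

abbreviation "\<Omega>d \<equiv> Omega1 D H (\<lambda>x. v x + d)"

lemma T_T [simp]: "T (T p) = p" by (simp add: T_def prod_eq_iff)

lemma T_borel [measurable]: "T \<in> BM" unfolding T_def by measurable

lemma U_borel [measurable]: "U \<in> sets borel" unfolding U_def by measurable

lemma taper_borel [measurable]: "taper \<in> BM" unfolding taper_def by measurable

lemma Brefl_borel:
 fixes k :: "'a \<times> real => 'a \<times> real"
 assumes [measurable]: "k \<in> BM"
 shows "(\<lambda>p. Brefl (fst p) (k p)) \<in> BM"
proof -
 have 1: "(\<lambda>p. fst (k p)) \<in> BM" "(\<lambda>p. snd (k p)) \<in> BM"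
  by (rule measurable_compose[OF assms fst_borel] measurable_compose[OF assms snd_borel])+
 have 2: "(\<lambda>p. fst (gnormal D v (fst p))) \<in> borel_measurable (borel :: ('a \<times> real) measure)"
  by (rule measurable_compose[OF measurable_compose[OF fst_borel gnormal_measurable] fst_borel])
 show ?thesis unfolding Brefl_def
  by (intro borel_measurable_Pair borel_measurable_diff borel_measurable_scaleR borel_measurable_times borel_measurable_uminus
    borel_measurable_const 1 2)
qed

lemma Brefl_bound: "norm (Brefl x w) \<le> (2 * L + 4) * norm w"
proof -
 have 1: "norm (fst w) \<le> norm w" "\<bar>snd w\<bar> \<le> norm w" using norm_fst_le[of "fst w" "snd w"] norm_snd_le[of "snd w" "fst w"] by auto
 have 2: "norm (fst (gnormal D v x)) \<le> L + 1"
  using norm_fst_le[of "fst (gnormal D v x)" "snd (gnormal D v x)"] gnormal_bound[of x] by simp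
 have "norm (Brefl x w) \<le> norm (fst w - (2 * snd w) *\<^sub>R fst (gnormal D v x)) + norm (- snd w)"
  unfolding Brefl_def by (rule norm_Pair_le)
 also have "... \<le> norm (fst w) + norm ((2 * snd w) *\<^sub>R fst (gnormal D v x)) + norm (- snd w)"
  by (rule add_right_mono[OF norm_triangle_ineq4])
 also have "norm ((2 * snd w) *\<^sub>R fst (gnormal D v x)) \<le> 2 * norm w * (L + 1)"
  using 1(2) 2 by (simp add: abs_mult mult_mono)
 finally show ?thesis using 1 by (simp add: algebra_simps)
qed

lemma Brefl_diff: "Brefl x w - Brefl x w' = Brefl x (w - w')"
 by (simp add: Brefl_def prod_eq_iff algebra_simps)

lemma Brefl_0 [simp]: "Brefl x 0 = 0" by (simp add: Brefl_def zero_prod_def)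

lemma U_taper: "p \<in> U ==> 0 \<le> taper p \<and> taper p \<le> 1" using d by (auto simp: U_def taper_def)

lemma fU_sqint:
 assumes "sqint f" shows "sqint (fU f)" "sqn (fU f) \<le> sqn f"
proof -
 have [measurable]: "f \<in> BM" using assms by (simp add: sqint_def)
 have s: "sqint (\<lambda>p. f (T p))" "sqn f = sqn (\<lambda>p. f (T p))"
  using sqint_shear[OF assms, of "\<lambda>x. 2 * v x" "-1"] unfolding T_def by auto
 have m: "fU f \<in> BM" unfolding fU_def by measurable
 have "norm (fU f p) \<le> 1 * norm (f (T p))" for p
  using U_taper[of p] by (auto simp: fU_def abs_mult mult_left_le split: split_indicator)
 then have ae: "AE p in lborel. norm (fU f p) \<le> 1 * norm (f (T p))" by simp
 show "sqint (fU f)" "sqn (fU f) \<le> sqn f" using sqint_bound[OF s(1) m ae] s(2) by auto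
qed

lemma gU_sqint:
 assumes "sqint f" "sqint g"
 shows "sqint (gU f g)" "sqn (gU f g) \<le> 2 * ((2 * L + 4)\<^sup>2 * sqn g) + 2 * (((L + 1) / d)\<^sup>2 * sqn f)"
proof -
 have [measurable]: "f \<in> BM" "g \<in> BM" using assms by (auto simp: sqint_def)
 have s: "sqint (\<lambda>p. f (T p))" "sqn f = sqn (\<lambda>p. f (T p))" "sqint (\<lambda>p. g (T p))" "sqn g = sqn (\<lambda>p. g (T p))"
  using sqint_shear[OF assms(1), of "\<lambda>x. 2 * v x" "-1"] sqint_shear[OF assms(2), of "\<lambda>x. 2 * v x" "-1"] unfolding T_def by auto
 have [measurable]: "(\<lambda>p. Brefl (fst p) (g (T p))) \<in> BM" by (rule Brefl_borel) measurable
 define A where "A p = indicator U p *\<^sub>R (taper p *\<^sub>R Brefl (fst p) (g (T p)))" for p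
 define B where "B p = indicator U p *\<^sub>R ((f (T p) / d) *\<^sub>R gnormal D v (fst p))" for p
 have mAB: "A \<in> BM" "B \<in> BM" unfolding A_def B_def by measurable
 have "norm (A p) \<le> (2 * L + 4) * norm (g (T p))" for p
 proof (cases "p \<in> U")
  case True
  have "norm (A p) \<le> 1 * norm (Brefl (fst p) (g (T p)))"
   using U_taper[OF True] True unfolding A_def by (simp add: mult_left_le_one_le)
  then show ?thesis using Brefl_bound[of "fst p" "g (T p)"] by simp
 qed (use L in \<open>simp add: A_def\<close>)
 then have A: "AE p in lborel. norm (A p) \<le> (2 * L + 4) * norm (g (T p))" by simp
 have "norm (B p) \<le> (L + 1) / d * norm (f (T p))" for p
 proof -
  have "norm (B p) \<le> \<bar>f (T p) / d\<bar> * norm (gnormal D v (fst p))" by (auto simp: B_def split: split_indicator)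
  also have "... \<le> \<bar>f (T p) / d\<bar> * (L + 1)" by (intro mult_left_mono gnormal_bound) auto
  finally show ?thesis using d by (simp add: mult_ac abs_divide)
 qed
 then have B: "AE p in lborel. norm (B p) \<le> (L + 1) / d * norm (f (T p))" by simp
 have L2: "2 * L + 4 \<ge> 0" "(L + 1) / d \<ge> 0" using L d by auto
 note bA = sqint_bound[OF s(3) mAB(1) A L2(1)] and bB = sqint_bound[OF s(1) mAB(2) B L2(2)]
 have eq: "gU f g = (\<lambda>p. A p - B p)" by (auto simp: gU_def A_def B_def fun_eq_iff split: split_indicator)
 show "sqint (gU f g)" unfolding eq by (rule sqint_diff(1)[OF bA(1) bB(1)])
 show "sqn (gU f g) \<le> 2 * ((2 * L + 4)\<^sup>2 * sqn g) + 2 * (((L + 1) / d)\<^sup>2 * sqn f)"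
  unfolding eq using sqint_diff(2)[OF bA(1) bB(1)] bA(2) bB(2) s by simp
qed

lemma fU_diff: "fU f p - fU f' p = fU (\<lambda>p. f p - f' p) p"
 by (simp add: fU_def algebra_simps)

lemma gU_diff: "gU f g p - gU f' g' p = gU (\<lambda>p. f p - f' p) (\<lambda>p. g p - g' p) p"
proof -
 have B: "Brefl (fst p) (g (T p) - g' (T p)) = Brefl (fst p) (g (T p)) - Brefl (fst p) (g' (T p))"
  by (rule Brefl_diff[symmetric])
 show ?thesis unfolding gU_def B by (simp add: algebra_simps diff_divide_distrib split: split_indicator)
qed

lemma T_in_W:
 assumes "p \<in> \<Omega>d" shows "T p \<in> D \<times> {-H<..}"
 using assms v_low[of "fst p"] d by (auto simp: Omega1_def T_def)

lemma phi_T: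
 assumes \<phi>: "\<phi> \<in> test_functions \<Omega>d"
 shows "(\<lambda>p. \<phi> (T p) * ((d + snd p - v (fst p)) / d)) \<in> test_functions (D \<times> {-H<..})"
  and "fst p \<in> D ==> gradient (\<lambda>p. \<phi> (T p) * ((d + snd p - v (fst p)) / d)) p \<bullet> h = (d + snd p - v (fst p)) / d * (gradient \<phi> (T p) \<bullet> (fst h, 2 * (gradient v (fst p) \<bullet> fst h) - snd h))
    + \<phi> (T p) * ((snd h - gradient v (fst p) \<bullet> fst h) / d)"
proof -
 have o: "open (D \<times> (UNIV :: real set))" using D by (simp add: open_Times)
 obtain K where K: "compact K" "K \<subseteq> \<Omega>d" "Cinf \<phi> UNIV" "\<And>x. x \<notin> K ==> \<phi> x = 0" using test_functionsE[OF \<phi>] by blast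
 have cv: "Cinf (\<lambda>p. v (fst p)) (D \<times> (UNIV :: real set))" by (rule Cinf_fst[OF o v(1) D(1)]) auto
 have cs: "Cinf snd (D \<times> (UNIV :: real set))" by (rule Cinf_linear[OF o bounded_linear_snd])
 have cT: "Cinf (\<lambda>p. \<phi> (T p)) (D \<times> UNIV)"
 proof (rule Cinf_compose[where \<Phi>=T, OF o open_UNIV _ _ K(3)])
  fix b :: "'a \<times> real"
  have "Cinf (\<lambda>p. fst p \<bullet> fst b) (D \<times> (UNIV :: real set))"
   by (rule Cinf_linear[OF o bounded_linear_compose[OF bounded_linear_inner_left bounded_linear_fst]])
  moreover have "Cinf (\<lambda>p. (2 * v (fst p) + (-1) * snd p) * snd b) (D \<times> (UNIV :: real set))"
   by (intro Cinf_mult Cinf_add Cinf_const o cv cs)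
  ultimately have "Cinf (\<lambda>p. fst p \<bullet> fst b + (2 * v (fst p) + (-1) * snd p) * snd b) (D \<times> (UNIV :: real set))"
   by (rule Cinf_add[OF o])
  then show "Cinf (\<lambda>p. T p \<bullet> b) (D \<times> UNIV)" by (simp add: T_def inner_prod_def)
 qed auto
 have cm: "Cinf (\<lambda>p. (d + snd p - v (fst p)) / d) (D \<times> (UNIV :: real set))"
  by (intro Cinf_divide_const Cinf_diff Cinf_add Cinf_const o cv cs)
 have contT: "continuous_on UNIV T" unfolding T_def[abs_def] by (intro continuous_intros continuous_on_compose2[OF vc]) auto
 show t: "(\<lambda>p. \<phi> (T p) * ((d + snd p - v (fst p)) / d)) \<in> test_functions (D \<times> {-H<..})"
 proof (rule test_functionsI[OF o Cinf_mult[OF o cT cm], of "T ` K"])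
  show "compact (T ` K)" by (rule compact_continuous_image[OF continuous_on_subset[OF contT] K(1)]) simp
  show "T ` K \<subseteq> D \<times> {-H<..}" using K(2) T_in_W by blast
  then show "T ` K \<subseteq> D \<times> UNIV" by auto
  fix p assume "p \<notin> T ` K"
  then have "T p \<notin> K" using T_T[of p] by (metis image_eqI)
  then show "\<phi> (T p) * ((d + snd p - v (fst p)) / d) = 0" using K(4) by simp
 qed
 assume p: "fst p \<in> D"
 have dv: "((\<lambda>p. v (fst p)) has_derivative (\<lambda>h. gradient v (fst p) \<bullet> fst h)) (at p)"
  using diff_chain_at[OF has_derivative_fst[OF has_derivative_ident] v_deriv[OF p]] by (simp add: o_def)
 have dT: "(T has_derivative (\<lambda>h. (fst h, 2 * (gradient v (fst p) \<bullet> fst h) - snd h))) (at p)"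
  unfolding T_def[abs_def] using dv by (auto intro!: derivative_eq_intros)
 have d\<phi>: "((\<lambda>p. \<phi> (T p)) has_derivative (\<lambda>h. gradient \<phi> (T p) \<bullet> (fst h, 2 * (gradient v (fst p) \<bullet> fst h) - snd h))) (at p)"
  using diff_chain_at[OF dT test_function_has_derivative[OF \<phi>]] by (simp add: o_def)
 have dm: "((\<lambda>p. (d + snd p - v (fst p)) / d) has_derivative (\<lambda>h. (snd h - gradient v (fst p) \<bullet> fst h) / d)) (at p)"
  using dv d by (auto intro!: derivative_eq_intros)
 show "gradient (\<lambda>p. \<phi> (T p) * ((d + snd p - v (fst p)) / d)) p \<bullet> h = (d + snd p - v (fst p)) / d * (gradient \<phi> (T p) \<bullet> (fst h, 2 * (gradient v (fst p) \<bullet> fst h) - snd h))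
    + \<phi> (T p) * ((snd h - gradient v (fst p) \<bullet> fst h) / d)"
  unfolding gradient_inner[OF has_derivative_mult[OF d\<phi> dm]] by simp
qed

text \<open>The change of variables by the reflection turns the left-hand side into Green's formula for \<open>f\<close> with the
test function of \<open>phi_T\<close>; the normal points in the opposite direction.\<close>

lemma reflection_green:
 assumes sp: "sobolev_pair \<Omega> f g" and gr: "green_trace D H v f g \<tau>" and \<phi>: "\<phi> \<in> test_functions \<Omega>d"
 shows "(LINT p|lborel. fU f p * (gradient \<phi> p \<bullet> e)) + (LINT p|lborel. \<phi> p * (gU f g p \<bullet> e))
  = - (LINT x|lborel. \<tau> x * (\<phi> (x, v x) * (gnormal D v x \<bullet> e)))"
proof -
 obtain a b where e: "e = (a, b)" by (cases e)
 have s: "sqint f" "sqint g" by (rule sobolev_pair_sqint[OF sp])+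
 have [measurable]: "f \<in> BM" "g \<in> BM" using s by (auto simp: sqint_def)
 have [measurable]: "\<phi> \<in> BM" "gradient \<phi> \<in> BM"
  using \<phi> test_function_measurable test_function_gradient_measurable by blast+
 have \<tau>: "sqint \<tau>" "\<And>x. x \<notin> D ==> \<tau> x = 0" using gr by (auto simp: green_trace_def)
 define \<psi> where "\<psi> p = \<phi> (T p) * ((d + snd p - v (fst p)) / d)" for p
 have \<psi>: "\<psi> \<in> test_functions (D \<times> {-H<..})" unfolding \<psi>_def[abs_def] by (rule phi_T(1)[OF \<phi>])
 have g\<psi>: "gradient \<psi> p \<bullet> h = (d + snd p - v (fst p)) / d * (gradient \<phi> (T p) \<bullet> (fst h, 2 * (gradient v (fst p) \<bullet> fst h) - snd h))
    + \<phi> (T p) * ((snd h - gradient v (fst p) \<bullet> fst h) / d)" if "fst p \<in> D" for p h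
  unfolding \<psi>_def[abs_def] by (rule phi_T(2)[OF \<phi> that])
 define k where "k x = gradient v x \<bullet> a" for x
 have W: "open (D \<times> {-H<..})" using D by (simp add: open_Times)
 have ck: "Cinf (\<lambda>p. k (fst p)) (D \<times> {-H<..})" unfolding k_def by (rule Cinf_fst[OF W grad_inner_Cinf D(1)]) auto
 define \<psi>2 where "\<psi>2 p = \<psi> p * k (fst p)" for p
 have \<psi>2: "\<psi>2 \<in> test_functions (D \<times> {-H<..})" unfolding \<psi>2_def[abs_def] by (rule test_functions_mult[OF \<psi> W ck])
 have g\<psi>2: "gradient \<psi>2 p \<bullet> (0, 1) = k (fst p) * (gradient \<psi> p \<bullet> (0, 1))" if "fst p \<in> D" for p
 proof -
  have dk: "(k has_derivative frechet_derivative k (at (fst p))) (at (fst p))"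
   by (rule Cinf_has_derivative[of _ D]) (use grad_inner_Cinf[of a] that in \<open>auto simp: k_def[abs_def]\<close>)
  have lin: "frechet_derivative k (at (fst p)) 0 = 0" using linear_0[OF has_derivative_linear[OF dk]] .
  have "((\<lambda>p. k (fst p)) has_derivative (\<lambda>h. frechet_derivative k (at (fst p)) (fst h))) (at p)"
   using diff_chain_at[OF has_derivative_fst[OF has_derivative_ident] dk] by (simp add: o_def)
  from gradient_inner[OF has_derivative_mult[OF test_function_has_derivative[OF \<psi>] this], of "(0, 1)"]
  show ?thesis unfolding \<psi>2_def[abs_def] by (simp add: lin)
 qed
 have pt: "fU f (T p) * (gradient \<phi> (T p) \<bullet> e) + \<phi> (T p) * (gU f g (T p) \<bullet> e)
  = (f p * (gradient \<psi> p \<bullet> (a, - b)) + \<psi> p * (g p \<bullet> (a, - b))) + 2 * (f p * (gradient \<psi>2 p \<bullet> (0, 1)) + \<psi>2 p * (g p \<bullet> (0, 1)))" for p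
 proof (cases "p \<in> \<Omega>")
  case False
  then have "f p = 0" "g p = 0" using sobolev_pair_outside[OF sp] by auto
  then show ?thesis by (simp add: fU_def gU_def)
 next
  case True
  obtain x z where p: "p = (x, z)" by (cases p)
  have x: "x \<in> D" "z < v x" using True by (auto simp: p Omega1_def)
  show ?thesis
  proof (cases "v x - d < z")
   case False
   then have "T p \<notin> \<Omega>d" "T p \<notin> U" by (auto simp: p T_def Omega1_def U_def)
   then have z: "\<phi> (T p) = 0" "gradient \<phi> (T p) = 0" using test_function_outside[OF \<phi>] test_gradient_outside[OF \<phi>] by auto
   then show ?thesis using x by (simp add: \<psi>_def \<psi>2_def g\<psi> g\<psi>2 p)
  next
   case z: True
   then have "T p \<in> U" using x d by (auto simp: p T_def U_def)
   moreover have "taper (T p) = (d + z - v x) / d" by (simp add: taper_def T_def p)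
   moreover have "gnormal D v x = (- gradient v x, 1)" using x by (simp add: gnormal_def)
   moreover obtain G1 G2 where G: "g p = (G1, G2)" by (cases "g p")
   moreover obtain P1 P2 where P: "gradient \<phi> (T p) = (P1, P2)" by (cases "gradient \<phi> (T p)")
   moreover have "fst (T p) = x" by (simp add: T_def p)
   moreover have "gradient \<psi> p \<bullet> (a, - b) = (d + z - v x) / d * (P1 \<bullet> a + P2 * (2 * k x + b)) + \<phi> (T p) * ((- b - k x) / d)"
    using x P by (simp add: g\<psi> p k_def)
   moreover have "gradient \<psi>2 p \<bullet> (0, 1) = k x * ((d + z - v x) / d * (- P2) + \<phi> (T p) / d)"
    using x P by (simp add: g\<psi> g\<psi>2 p)
   ultimately show ?thesis
    by (simp add: fU_def gU_def Brefl_def e \<psi>_def \<psi>2_def p k_def inner_diff_left inner_add_left)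
     (simp add: algebra_simps add_divide_distrib diff_divide_distrib)
  qed
 qed
 have sh: "(LINT p|lborel. q p) = (LINT p|lborel. q (T p))" if [measurable]: "q \<in> BM" for q :: "'a \<times> real => real"
  using integral_shear(1)[of q "\<lambda>x. 2 * v x" "-1"] by (simp add: T_def)
 have iT: "integrable lborel (\<lambda>p. q (T p))" if "integrable lborel q" for q :: "'a \<times> real => real"
  using integral_shear(2)[of q "\<lambda>x. 2 * v x" "-1"] that by (simp add: T_def)
 have sd: "sqint (\<lambda>p. gradient \<phi> p \<bullet> h)" for h by (rule test_function_sqint[OF test_function_deriv[OF \<phi>]])
 have iL: "integrable lborel (\<lambda>p. fU f p * (gradient \<phi> p \<bullet> e))" "integrable lborel (\<lambda>p. \<phi> p * (gU f g p \<bullet> e))"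
  using sqint_inner(1)[OF fU_sqint(1)[OF s(1)] sd] sqint_inner(1)[OF test_function_sqint[OF \<phi>] sqint_inner_const[OF gU_sqint(1)[OF s]]] by auto
 have i2: "integrable lborel (\<lambda>p. f p * (gradient \<eta> p \<bullet> h))" "integrable lborel (\<lambda>p. \<eta> p * (g p \<bullet> h))" if "\<eta> \<in> test_functions (D \<times> {-H<..})" for \<eta> h
  using sqint_inner(1)[OF s(1) test_function_sqint[OF test_function_deriv[OF that]]]
   sqint_inner(1)[OF test_function_sqint[OF that] sqint_inner_const[OF s(2)]] by auto
 have "(LINT p|lborel. fU f p * (gradient \<phi> p \<bullet> e)) + (LINT p|lborel. \<phi> p * (gU f g p \<bullet> e))
   = (LINT p|lborel. fU f (T p) * (gradient \<phi> (T p) \<bullet> e)) + (LINT p|lborel. \<phi> (T p) * (gU f g (T p) \<bullet> e))"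
  using sh[OF borel_measurable_integrable[OF iL(1), unfolded measurable_lborel2]] sh[OF borel_measurable_integrable[OF iL(2), unfolded measurable_lborel2]] by simp
 also have "... = (LINT p|lborel. fU f (T p) * (gradient \<phi> (T p) \<bullet> e) + \<phi> (T p) * (gU f g (T p) \<bullet> e))"
  using iT[OF iL(1)] iT[OF iL(2)] by simp
 also have "... = ((LINT p|lborel. f p * (gradient \<psi> p \<bullet> (a, - b))) + (LINT p|lborel. \<psi> p * (g p \<bullet> (a, - b))))
   + 2 * ((LINT p|lborel. f p * (gradient \<psi>2 p \<bullet> (0, 1))) + (LINT p|lborel. \<psi>2 p * (g p \<bullet> (0, 1))))"
  unfolding pt using i2[OF \<psi>] i2[OF \<psi>2] by simp
 also have "... = (LINT x|lborel. \<tau> x * (\<psi> (x, v x) * (gnormal D v x \<bullet> (a, - b)))) + 2 * (LINT x|lborel. \<tau> x * (\<psi>2 (x, v x) * (gnormal D v x \<bullet> (0, 1))))"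
  unfolding green_traceD[OF gr \<psi>] green_traceD[OF gr \<psi>2] ..
 also have "... = (LINT x|lborel. \<tau> x * (\<psi> (x, v x) * (gnormal D v x \<bullet> (a, - b))) + 2 * (\<tau> x * (\<psi>2 (x, v x) * (gnormal D v x \<bullet> (0, 1)))))"
  using sqint_inner(1)[OF \<tau>(1) sqint_trace_test[OF \<psi>]] sqint_inner(1)[OF \<tau>(1) sqint_trace_test[OF \<psi>2]] by simp
 also have "... = (LINT x|lborel. - (\<tau> x * (\<phi> (x, v x) * (gnormal D v x \<bullet> e))))"
 proof (intro integral_congr)
  fix x
  show "\<tau> x * (\<psi> (x, v x) * (gnormal D v x \<bullet> (a, - b))) + 2 * (\<tau> x * (\<psi>2 (x, v x) * (gnormal D v x \<bullet> (0, 1)))) = - (\<tau> x * (\<phi> (x, v x) * (gnormal D v x \<bullet> e)))"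
  proof (cases "x \<in> D")
   case True
   have "\<psi> (x, v x) = \<phi> (x, v x)" using d by (simp add: \<psi>_def T_def)
   then show ?thesis using True by (simp add: \<psi>2_def gnormal_def e k_def algebra_simps)
  qed (simp add: \<tau>)
 qed
 finally show ?thesis by simp
qed

text \<open>The boundary terms from the two sides of the graph cancel, so no singular part of the gradient is left on it.\<close>

lemma reflection_sobolev_pair:
 assumes sp: "sobolev_pair \<Omega> f g" and gr: "green_trace D H v f g \<tau>"
 shows "sobolev_pair \<Omega>d (\<lambda>p. f p + fU f p) (\<lambda>p. g p + gU f g p)"
proof -
 have s: "sqint f" "sqint g" by (rule sobolev_pair_sqint[OF sp])+
 have sub: "\<Omega>d \<subseteq> D \<times> {-H<..}" by (auto simp: Omega1_def)
 have "(LINT p|lborel. (f p + fU f p) * (gradient \<phi> p \<bullet> e)) = - (LINT p|lborel. \<phi> p * ((g p + gU f g p) \<bullet> e))"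
  if \<phi>: "\<phi> \<in> test_functions \<Omega>d" for \<phi> e
 proof -
  have \<phi>W: "\<phi> \<in> test_functions (D \<times> {-H<..})" using test_functions_mono[OF sub] \<phi> by blast
  have sd: "sqint (\<lambda>p. gradient \<phi> p \<bullet> e)" by (rule test_function_sqint[OF test_function_deriv[OF \<phi>]])
  have i: "integrable lborel (\<lambda>p. fU f p * (gradient \<phi> p \<bullet> e))" "integrable lborel (\<lambda>p. \<phi> p * (gU f g p \<bullet> e))"
   "integrable lborel (\<lambda>p. f p * (gradient \<phi> p \<bullet> e))" "integrable lborel (\<lambda>p. \<phi> p * (g p \<bullet> e))"
   using sqint_inner(1)[OF fU_sqint(1)[OF s(1)] sd] sqint_inner(1)[OF test_function_sqint[OF \<phi>] sqint_inner_const[OF gU_sqint(1)[OF s]]]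
    sqint_inner(1)[OF s(1) sd] sqint_inner(1)[OF test_function_sqint[OF \<phi>] sqint_inner_const[OF s(2)]] by auto
  show ?thesis using green_traceD[OF gr \<phi>W, of e] reflection_green[OF sp gr \<phi>, of e] i
   by (simp add: distrib_right distrib_left inner_add_left)
 qed
 moreover have "f p + fU f p = 0 \<and> g p + gU f g p = 0" if "p \<notin> \<Omega>d" for p
 proof -
  have "p \<notin> \<Omega>" using that d by (auto simp: Omega1_def)
  moreover have "p \<notin> U"
  proof
   assume "p \<in> U"
   then have "p \<in> \<Omega>d" using v_low[of "fst p"] c by (auto simp: U_def Omega1_def split_beta)
   then show False using that by simp
  qed
  ultimately show ?thesis using sobolev_pair_outside[OF sp] by (simp add: fU_def gU_def)
 qed
 moreover have "sqint (\<lambda>p. f p + fU f p)" "sqint (\<lambda>p. g p + gU f g p)"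
  by (rule sqint_add(1)[OF s(1) fU_sqint(1)[OF s(1)]]) (rule sqint_add(1)[OF s(2) gU_sqint(1)[OF s]])
 ultimately show ?thesis unfolding sobolev_pair_def by blast
qed

lemma v_low_closure: "x \<in> closure D ==> - H < v x"
 using v_low[of x] v0[of x] c cH by (cases "x \<in> D") auto

lemma upper_domain: "graph_domain D H (c + d) (M + d) L (\<lambda>x. v x + d)"
 using shifted_domain(1)[of "-d"] d c by simp

text \<open>Continuous approximations of \<open>\<theta>\<close> are extended in the same way.  The extensions vanish on the top
of the layer, and on the lateral boundary, where \<open>v = 0\<close>, the reflection is an isometry that preserves the surface
measure and hence the convergence of traces to zero.\<close>

lemma reflection_H10:
 assumes \<theta>: "\<theta> \<in> H1 \<Omega>" and tr: "has_boundary_trace \<Omega> \<theta> t"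
  and tz: "AE p in surface_measure \<Omega>. p \<in> frontier \<Omega> - Sigma_graph D v --> t p = 0"
  and rep: "sobolev_pair \<Omega> f g" "AE p in lborel. p \<in> \<Omega> --> \<theta> p = f p"
 shows "(\<lambda>p. f p + fU f p) \<in> H1_zero_trace_on \<Omega>d (frontier \<Omega>d)"
proof -
 interpret up: graph_domain D H "c + d" "M + d" L "\<lambda>x. v x + d" by (rule upper_domain)
 obtain F fk gk where A: "\<And>k. continuous_on (closure \<Omega>) (F k)" "\<And>k. sobolev_pair \<Omega> (fk k) (gk k)"
  "\<And>k p. p \<in> \<Omega> ==> fk k p = F k p"
  "(\<lambda>k. sqn (\<lambda>p. fk k p - f p)) \<longlonglongrightarrow> 0" "(\<lambda>k. sqn (\<lambda>p. gk k p - g p)) \<longlonglongrightarrow> 0"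
  "(\<lambda>k. \<integral>\<^sup>+p. ennreal ((F k p - t p)\<^sup>2) \<partial>surface_measure \<Omega>) \<longlonglongrightarrow> 0"
  "sqint (\<lambda>x. if x \<in> D then t (x, v x) else 0)"
  "(\<lambda>k. sqn (\<lambda>x. (if x \<in> D then F k (x, v x) else 0) - (if x \<in> D then t (x, v x) else 0))) \<longlonglongrightarrow> 0"
  and gr: "green_trace D H v f g (\<lambda>x. if x \<in> D then t (x, v x) else 0)"
  by (rule trace_approximation[OF \<theta> tr rep]) (rule that)
 have t: "t \<in> borel_measurable (surface_measure \<Omega>)" using tr unfolding has_boundary_trace_def by auto
 have cl: "closure \<Omega> = {(x, z). x \<in> closure D \<and> - H \<le> z \<and> z \<le> v x}"
  by (rule closure_Omega1[OF D(1) vc v_low_closure])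
 have cld: "closure \<Omega>d = {(x, z). x \<in> closure D \<and> - H \<le> z \<and> z \<le> v x + d}"
  by (rule closure_Omega1[OF D(1)]) (use v_low_closure d in \<open>force intro!: continuous_intros vc\<close>)+
 have spd: "sobolev_pair \<Omega>d (\<lambda>p. f p + fU f p) (\<lambda>p. g p + gU f g p)" by (rule reflection_sobolev_pair[OF rep(1) gr])
 have spk: "sobolev_pair \<Omega>d (\<lambda>p. fk k p + fU (fk k) p) (\<lambda>p. gk k p + gU (fk k) (gk k) p)" for k
  by (rule reflection_sobolev_pair[OF A(2) green_continuous[OF A(2) A(1) A(3)]])
 (* The reflected extension of \<open>F k\<close>, continuous up to the boundary. *)
 define E where "E k p = (if snd p \<le> v (fst p) then F k p else F k (T p) * taper p)" for k p
 have Tcl: "T (x, z) \<in> closure \<Omega>" if "(x, z) \<in> closure \<Omega>d" "v x \<le> z" for x z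
 proof -
  have "- H + d \<le> v x" using v_low[of x] v0[of x] d cH c by (cases "x \<in> D") auto
  then show ?thesis using that unfolding cl cld by (auto simp: T_def)
 qed
 have Econt: "continuous_on (closure \<Omega>d) (E k)" for k
 proof -
  have cT: "continuous_on UNIV T" unfolding T_def[abs_def] by (intro continuous_intros continuous_on_compose2[OF vc]) auto
  have ct: "continuous_on UNIV taper" unfolding taper_def[abs_def] by (intro continuous_intros continuous_on_compose2[OF vc]) (use d in auto)
  let ?B = "closure \<Omega>d \<inter> {p. v (fst p) \<le> snd p}"
  have "closed {p :: 'a \<times> real. v (fst p) \<le> snd p}"
   by (intro closed_Collect_le continuous_intros continuous_on_compose2[OF vc]) auto
  then have cB: "closed ?B" by (intro closed_Int) auto
  have cg: "continuous_on ?B (\<lambda>p. F k (T p) * taper p)"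
   by (intro continuous_intros continuous_on_compose2[OF A(1)] continuous_on_subset[OF cT] continuous_on_subset[OF ct])
    (use Tcl in auto)
  have "continuous_on (closure \<Omega> \<union> ?B) (\<lambda>p. if snd p \<le> v (fst p) then F k p else F k (T p) * taper p)"
  proof (rule continuous_on_cases[OF closed_closure cB A(1) cg], intro allI impI)
   fix p :: "'a \<times> real"
   assume "p \<in> closure \<Omega> \<and> \<not> snd p \<le> v (fst p) \<or> p \<in> ?B \<and> snd p \<le> v (fst p)"
   then have "snd p = v (fst p)" by (auto simp: cl)
   then show "F k p = F k (T p) * taper p" using d by (cases p) (simp add: T_def taper_def)
  qed
  moreover have "closure \<Omega> \<union> ?B = closure \<Omega>d" unfolding cl cld using d by auto
  ultimately show ?thesis unfolding E_def[abs_def] by simp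
 qed
 have Eae: "AE p in lborel. p \<in> \<Omega>d --> E k p = fk k p + fU (fk k) p" for k
  using AE_not_graph[OF v(2)]
 proof eventually_elim
  case (elim p)
  obtain x z where p: "p = (x, z)" by (cases p)
  show ?case
  proof
   assume "p \<in> \<Omega>d"
   then have x: "x \<in> D" "- H < z" "z < v x + d" by (auto simp: p Omega1_def)
   show "E k p = fk k p + fU (fk k) p"
   proof (cases "z < v x")
    case True
    then have "p \<in> \<Omega>" "p \<notin> U" using x by (auto simp: p Omega1_def U_def)
    then show ?thesis using True A(3) by (simp add: E_def p fU_def)
   next
    case False
    then have z: "v x < z" using elim by (simp add: p)
    then have "p \<in> U" "p \<notin> \<Omega>" "T p \<in> \<Omega>" using x v_low[OF x(1)] d by (auto simp: p Omega1_def U_def T_def)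
    then show ?thesis using z A(3) sobolev_pair_outside[OF A(2)] by (simp add: E_def p fU_def)
   qed
  qed
 qed
 have EH1: "E k \<in> H1 \<Omega>d" for k by (rule H1_from_sobolev_pair(1)[OF spk Eae up.Omega_open])
 have nrm: "(H1_norm \<Omega>d (\<lambda>x. E k x - (f x + fU f x)))\<^sup>2 = sqn (\<lambda>p. fk k p + fU (fk k) p - (f p + fU f p)) + sqn (\<lambda>p. gk k p + gU (fk k) (gk k) p - (g p + gU f g p))" for k
 proof (rule H1_from_sobolev_pair(3)[OF sobolev_pair_diff[OF spk spd] _ up.Omega_open])
  show "AE x in lborel. x \<in> \<Omega>d --> E k x - (f x + fU f x) = fk k x + fU (fk k) x - (f x + fU f x)"
   using Eae[of k] by eventually_elim auto
 qed
 have s: "sqint f" "sqint g" "sqint (fk k)" "sqint (gk k)" for k using sobolev_pair_sqint[OF rep(1)] sobolev_pair_sqint[OF A(2)] by auto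
 have sd: "sqint (\<lambda>p. fk k p - f p)" "sqint (\<lambda>p. gk k p - g p)" for k using sqint_diff(1) s by auto
 have b1: "sqn (\<lambda>p. fk k p + fU (fk k) p - (f p + fU f p)) \<le> 4 * sqn (\<lambda>p. fk k p - f p)" for k
 proof -
  have "(\<lambda>p. fk k p + fU (fk k) p - (f p + fU f p)) = (\<lambda>p. (fk k p - f p) + fU (\<lambda>p. fk k p - f p) p)"
   by (simp add: fU_diff[symmetric] fun_eq_iff)
  then show ?thesis using sqint_add(2)[OF sd(1)[of k] fU_sqint(1)[OF sd(1)[of k]]] fU_sqint(2)[OF sd(1)[of k]] by simp
 qed
 define C where "C = 2 * (2 * ((L + 1) / d)\<^sup>2)"
 define C' where "C' = 2 + 2 * (2 * (2 * L + 4)\<^sup>2)"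
 have b2: "sqn (\<lambda>p. gk k p + gU (fk k) (gk k) p - (g p + gU f g p)) \<le> C' * sqn (\<lambda>p. gk k p - g p) + C * sqn (\<lambda>p. fk k p - f p)" for k
 proof -
  have "(\<lambda>p. gk k p + gU (fk k) (gk k) p - (g p + gU f g p)) = (\<lambda>p. (gk k p - g p) + gU (\<lambda>p. fk k p - f p) (\<lambda>p. gk k p - g p) p)"
   by (simp add: gU_diff[symmetric] fun_eq_iff)
  then show ?thesis using sqint_add(2)[OF sd(2)[of k] gU_sqint(1)[OF sd(1)[of k] sd(2)[of k]]] gU_sqint(2)[OF sd(1)[of k] sd(2)[of k]]
   by (simp add: C_def C'_def algebra_simps)
 qed
 have "(\<lambda>k. (H1_norm \<Omega>d (\<lambda>x. E k x - (f x + fU f x)))\<^sup>2) \<longlonglongrightarrow> 0"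
 proof (rule Lim_null_comparison)
  show "\<forall>\<^sub>F k in sequentially. norm ((H1_norm \<Omega>d (\<lambda>x. E k x - (f x + fU f x)))\<^sup>2) \<le> 4 * sqn (\<lambda>p. fk k p - f p) + (C' * sqn (\<lambda>p. gk k p - g p) + C * sqn (\<lambda>p. fk k p - f p))"
  proof (intro always_eventually allI)
   fix k
   have "norm ((H1_norm \<Omega>d (\<lambda>x. E k x - (f x + fU f x)))\<^sup>2) = (H1_norm \<Omega>d (\<lambda>x. E k x - (f x + fU f x)))\<^sup>2" by simp
   then show "norm ((H1_norm \<Omega>d (\<lambda>x. E k x - (f x + fU f x)))\<^sup>2) \<le> 4 * sqn (\<lambda>p. fk k p - f p) + (C' * sqn (\<lambda>p. gk k p - g p) + C * sqn (\<lambda>p. fk k p - f p))"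
    using add_mono[OF b1[of k] b2[of k]] unfolding nrm by simp
  qed
  have "(\<lambda>k. 4 * sqn (\<lambda>p. fk k p - f p) + (C' * sqn (\<lambda>p. gk k p - g p) + C * sqn (\<lambda>p. fk k p - f p))) \<longlonglongrightarrow> 4 * 0 + (C' * 0 + C * 0)"
   by (intro tendsto_intros A)
  then show "(\<lambda>k. 4 * sqn (\<lambda>p. fk k p - f p) + (C' * sqn (\<lambda>p. gk k p - g p) + C * sqn (\<lambda>p. fk k p - f p))) \<longlonglongrightarrow> 0" by simp
 qed
 from tendsto_real_sqrt[OF this] have H0: "(\<lambda>k. H1_norm \<Omega>d (\<lambda>x. E k x - (f x + fU f x))) \<longlonglongrightarrow> 0"
  by (simp add: H1_norm_def)
 define t1 where "t1 p = indicator (Sigma_graph D v) p * (indicator (frontier \<Omega>) p * t p)" for p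
 have Sb [measurable]: "Sigma_graph D v \<in> sets borel"
 proof -
  have "Sigma_graph D v = {p. fst p \<in> D \<and> snd p = v (fst p)}" by (auto simp: Sigma_graph_def)
  then show ?thesis by simp
 qed
 have [measurable]: "(\<lambda>p. indicator (frontier \<Omega>) p * t p) \<in> BM"
  using t borel_measurable_restrict_space_iff[of "frontier \<Omega>" "hausdorff_measure DIM('a)" t] by (simp add: surface_measure_def)
 have t1m [measurable]: "t1 \<in> BM" unfolding t1_def by measurable
 have [measurable]: "(\<lambda>p. indicator (closure \<Omega>) p * F k p) \<in> BM" for k
  using borel_measurable_continuous_on_indicator[OF _ A(1)] by simp
 define q where "q k p = ennreal ((indicator (closure \<Omega>) p * F k p - t1 p)\<^sup>2) * indicator (frontier \<Omega>) p" for k p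
 have [measurable]: "q k \<in> BM" for k unfolding q_def by measurable
 have qint: "(\<integral>\<^sup>+p. q k p \<partial>hausdorff_measure DIM('a)) = (\<integral>\<^sup>+p. ennreal ((F k p - t p)\<^sup>2) \<partial>surface_measure \<Omega>)" for k
 proof -
  have "(\<integral>\<^sup>+p. q k p \<partial>hausdorff_measure DIM('a)) = (\<integral>\<^sup>+p. ennreal ((indicator (closure \<Omega>) p * F k p - t1 p)\<^sup>2) \<partial>surface_measure \<Omega>)"
   unfolding q_def surface_measure_def by (subst nn_integral_restrict_space) auto
  also have "... = (\<integral>\<^sup>+p. ennreal ((F k p - t p)\<^sup>2) \<partial>surface_measure \<Omega>)"
  proof (rule nn_integral_cong_AE)
   have "AE p in surface_measure \<Omega>. p \<in> frontier \<Omega>" by (rule AE_I2) (simp add: surface_measure_def space_restrict_space)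
   with tz show "AE p in surface_measure \<Omega>. ennreal ((indicator (closure \<Omega>) p * F k p - t1 p)\<^sup>2) = ennreal ((F k p - t p)\<^sup>2)"
   proof eventually_elim
    case (elim p)
    then have "p \<in> closure \<Omega>" by (simp add: frontier_def)
    moreover have "t1 p = t p" using elim by (cases "p \<in> Sigma_graph D v") (auto simp: t1_def)
    ultimately show ?case by simp
   qed
  qed
  finally show ?thesis .
 qed
 define \<rho> where "\<rho> p = (fst p, - snd p)" for p :: "'a \<times> real"
 have \<rho>: "dist (\<rho> p) (\<rho> p') = dist p p'" "\<rho> (\<rho> p) = p" for p p' by (auto simp: \<rho>_def dist_prod_def dist_real_def power2_commute)
 have [measurable]: "\<rho> \<in> borel \<rightarrow>\<^sub>M borel" unfolding \<rho>_def by measurable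
 have pt: "ennreal ((E k p - 0)\<^sup>2) \<le> q k p + q k (\<rho> p)" if fr: "p \<in> frontier \<Omega>d" for k p
 proof -
  obtain x z where p: "p = (x, z)" by (cases p)
  have x: "x \<in> closure D" "- H \<le> z" "z \<le> v x + d" and pcl: "(x, z) \<in> closure \<Omega>d" and out: "(x, z) \<notin> \<Omega>d"
   using fr cld up.Omega_open by (auto simp: p frontier_def interior_open)
  have key: "q k (y, w) = ennreal ((F k (y, w))\<^sup>2)" if "(y, w) \<in> closure \<Omega>" "y \<notin> D \<or> w = - H" for y w
  proof -
   have "(y, w) \<notin> \<Omega>" "(y, w) \<notin> Sigma_graph D v"
    using that v_low[of y] c by (auto simp: Omega1_def Sigma_graph_def)
   then show ?thesis using that(1) Omega_open by (simp add: q_def t1_def frontier_def interior_open)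
  qed
  show ?thesis
  proof (cases "z = v x + d")
   case True
   then show ?thesis using d by (simp add: E_def p taper_def)
  next
   case False
   then have alt: "x \<notin> D \<or> z = - H" using out x by (auto simp: Omega1_def)
   show ?thesis
   proof (cases "z \<le> v x")
    case True
    then have "(x, z) \<in> closure \<Omega>" using x cl by auto
    from key[OF this alt] show ?thesis using True by (simp add: E_def p)
   next
    case z: False
    then have "x \<notin> D" using alt v_low_closure[OF x(1)] by auto
    then have v: "v x = 0" by (rule v0)
    then have T: "T (x, z) = (x, - z)" "\<rho> p = (x, - z)" by (auto simp: T_def \<rho>_def p)
    have "(x, - z) \<in> closure \<Omega>" using Tcl[OF pcl] z T by simp
    from key[OF this] \<open>x \<notin> D\<close> have "q k (\<rho> p) = ennreal ((F k (x, - z))\<^sup>2)" by (simp add: T)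
    moreover have "(F k (x, - z) * taper p)\<^sup>2 \<le> (F k (x, - z))\<^sup>2"
    proof -
     have "0 \<le> taper p" "taper p \<le> 1" using z x v d by (auto simp: taper_def p)
     then have "(taper p)\<^sup>2 \<le> 1" by (simp add: power_le_one)
     then show ?thesis by (simp add: power_mult_distrib mult_left_le)
    qed
    ultimately show ?thesis using z by (simp add: E_def p T(1) add_increasing ennreal_leI)
   qed
  qed
 qed
 have qlim: "(\<lambda>k. \<integral>\<^sup>+p. ennreal ((E k p - 0)\<^sup>2) \<partial>surface_measure \<Omega>d) \<longlonglongrightarrow> 0"
 proof (rule tendsto_sandwich[where f="\<lambda>_. 0"])
  have le: "(\<integral>\<^sup>+p. ennreal ((E k p - 0)\<^sup>2) \<partial>surface_measure \<Omega>d) \<le> 2 * (\<integral>\<^sup>+p. ennreal ((F k p - t p)\<^sup>2) \<partial>surface_measure \<Omega>)" for k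
  proof -
   have "(\<integral>\<^sup>+p. ennreal ((E k p - 0)\<^sup>2) \<partial>surface_measure \<Omega>d) = (\<integral>\<^sup>+p. ennreal ((E k p - 0)\<^sup>2) * indicator (frontier \<Omega>d) p \<partial>hausdorff_measure DIM('a))"
    unfolding surface_measure_def by (subst nn_integral_restrict_space) auto
   also have "... \<le> (\<integral>\<^sup>+p. q k p + q k (\<rho> p) \<partial>hausdorff_measure DIM('a))"
    by (intro nn_integral_mono) (use pt in \<open>auto split: split_indicator\<close>)
   also have "... = (\<integral>\<^sup>+p. q k p \<partial>hausdorff_measure DIM('a)) + (\<integral>\<^sup>+p. q k (\<rho> p) \<partial>hausdorff_measure DIM('a))"
    by (rule nn_integral_add) measurable
   also have "... \<le> (\<integral>\<^sup>+p. q k p \<partial>hausdorff_measure DIM('a)) + (\<integral>\<^sup>+p. q k p \<partial>hausdorff_measure DIM('a))"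
    by (intro add_left_mono nn_integral_hausdorff_involution[OF \<rho>]) measurable
   finally show ?thesis by (simp add: qint mult_2)
  qed
  then show "\<forall>\<^sub>F k in sequentially. (\<integral>\<^sup>+p. ennreal ((E k p - 0)\<^sup>2) \<partial>surface_measure \<Omega>d) \<le> 2 * (\<integral>\<^sup>+p. ennreal ((F k p - t p)\<^sup>2) \<partial>surface_measure \<Omega>)"
   by simp
  show "(\<lambda>k. 2 * (\<integral>\<^sup>+p. ennreal ((F k p - t p)\<^sup>2) \<partial>surface_measure \<Omega>)) \<longlonglongrightarrow> 0"
   using ennreal_tendsto_cmult[OF _ A(6), of 2] by simp
 qed auto
 have "has_boundary_trace \<Omega>d (\<lambda>p. f p + fU f p) (\<lambda>p. 0)"
  unfolding has_boundary_trace_def using Econt EH1 H0 qlim by (intro conjI exI[of _ E]) auto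
 moreover have "(\<lambda>p. f p + fU f p) \<in> H1 \<Omega>d" by (rule H1_from_sobolev_pair(1)[OF spd _ up.Omega_open]) simp
 ultimately show ?thesis unfolding H1_zero_trace_on_def by auto
qed

end

section \<open>Boundary data\<close>

lemma gradient_continuous_on:
 assumes "Cinf f S" shows "continuous_on S (gradient f)"
proof (subst continuous_on_componentwise, intro ballI)
 fix b :: 'a assume "b \<in> Basis"
 have "continuous_on S (\<lambda>x. frechet_derivative f (at x) b)" by (rule Cinf_continuous_on[OF Cinf_deriv[OF assms]])
 moreover have "gradient f x \<bullet> b = frechet_derivative f (at x) b" if "x \<in> S" for x
  by (rule gradient_inner[OF Cinf_has_derivative[OF assms that]])
 ultimately show "continuous_on S (\<lambda>x. gradient f x \<bullet> b)" by (simp cong: continuous_on_cong)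
qed

text \<open>All quantities are continuous functions of \<open>(d, x, z)\<close> on a compact set; compactness gives the bounds and
the uniform convergence.\<close>

lemma boundary_data:
 fixes D :: "'a::euclidean_space set" and u :: "'a => real" and h :: "'a => real => real => real"
 assumes D: "open D" "bounded D"
  and u_smooth: "smooth_on (closure D) u"
  and u_range: "\<forall>x\<in>closure D. - H < u x"
  and h_smooth: "smooth_on (closure D \<times> {- H..} \<times> {- H<..}) (\<lambda>(x, z, w). h x z w)"
 obtains hg C where "C \<ge> 0"
  "\<And>d p. 0 \<le> d ==> d \<le> 1 ==> p \<in> Omega0 D H M ==> (subst_boundary h (\<lambda>x. u x + d) has_derivative (\<lambda>e. hg d p \<bullet> e)) (at p)"
  "\<And>d. 0 \<le> d ==> d \<le> 1 ==> continuous_on (Omega0 D H M) (hg d)"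
  "\<And>d p. 0 \<le> d ==> d \<le> 1 ==> p \<in> Omega0 D H M ==> norm (hg d p) \<le> C"
  "\<And>d p. 0 \<le> d ==> d \<le> 1 ==> p \<in> Omega0 D H M ==> \<bar>subst_boundary h (\<lambda>x. u x + d) p\<bar> \<le> C"
  "\<And>\<epsilon>. \<epsilon> > 0 ==> \<exists>\<delta>>0. \<forall>d p. 0 \<le> d --> d \<le> 1 --> d < \<delta> --> p \<in> Omega0 D H M --> norm (hg d p - hg 0 p) < \<epsilon>"
proof -
 obtain U g where U: "open U" "closure D \<times> {- H..} \<times> {- H<..} \<subseteq> U" "Cinf g U"
  and g: "\<forall>q\<in>closure D \<times> {- H..} \<times> {- H<..}. (\<lambda>(x, z, w). h x z w) q = g q"
  using h_smooth unfolding smooth_on_def Cinf_def by blast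
 obtain V ug where V: "open V" "closure D \<subseteq> V" "Cinf ug V" and ug: "\<forall>x\<in>closure D. u x = ug x"
  using u_smooth unfolding smooth_on_def Cinf_def by blast
 define P where "P q = (case q of (d, x, z) => (x, z, ug x + d))" for q :: "real \<times> 'a \<times> real"
 define K where "K = {0..1::real} \<times> closure D \<times> {- H..M + 1}"
 have K: "compact K" unfolding K_def using D(2) by (intro compact_Times) (auto simp: compact_closure)
 have PK: "P ` K \<subseteq> U"
 proof
  fix q assume "q \<in> P ` K"
  then obtain d x z where q: "q = (x, z, ug x + d)" "0 \<le> d" "x \<in> closure D" "- H \<le> z" by (auto simp: P_def K_def)
  have "- H < ug x + d" using u_range ug q by force
  then show "q \<in> U" using U(2) q by auto
 qed
 have cug: "continuous_on K (\<lambda>q. ug (fst (snd q)))"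
  by (intro continuous_on_compose2[OF Cinf_continuous_on[OF V(3)]] continuous_intros) (use V(2) in \<open>auto simp: K_def\<close>)
 have cP: "continuous_on K P"
 proof -
  have "P = (\<lambda>q. (fst (snd q), snd (snd q), ug (fst (snd q)) + fst q))" by (auto simp: P_def fun_eq_iff)
  then show ?thesis using cug by (auto intro!: continuous_intros)
 qed
 define j where "j q = (let y = gradient g (P q) in (fst y + snd (snd y) *\<^sub>R gradient ug (fst (snd q)), fst (snd y)))" for q
 have cgP: "continuous_on K (\<lambda>q. gradient g (P q))"
  by (rule continuous_on_compose2[OF gradient_continuous_on[OF U(3)] cP PK])
 have cgu: "continuous_on K (\<lambda>q. gradient ug (fst (snd q)))"
  by (intro continuous_on_compose2[OF gradient_continuous_on[OF V(3)]] continuous_intros) (use V(2) in \<open>auto simp: K_def\<close>)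
 have cj: "continuous_on K j" unfolding j_def[abs_def] Let_def by (intro continuous_intros cgP cgu)
 define hg where "hg d p = j (d, p)" for d p
 have inK: "(d, p) \<in> K" if "0 \<le> d" "d \<le> 1" "p \<in> Omega0 D H M" for d p
  using that closure_subset[of D] by (auto simp: K_def Omega0_def)
 have "bounded (j ` K)" by (rule compact_imp_bounded[OF compact_continuous_image[OF cj K]])
 then obtain C1 where C1: "\<And>q. q \<in> K ==> norm (j q) \<le> C1" unfolding bounded_iff by blast
 have cg: "continuous_on K (\<lambda>q. g (P q))" by (rule continuous_on_compose2[OF Cinf_continuous_on[OF U(3)] cP PK])
 have "bounded ((\<lambda>q. g (P q)) ` K)" by (rule compact_imp_bounded[OF compact_continuous_image[OF cg K]])
 then obtain C2 where C2: "\<And>q. q \<in> K ==> norm (g (P q)) \<le> C2" unfolding bounded_iff by blast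
 have eqh: "subst_boundary h (\<lambda>x. u x + d) p = g (P (d, p))" if "0 \<le> d" "p \<in> Omega0 D H M" for d p
 proof -
  obtain x z where p: "p = (x, z)" by (cases p)
  have "x \<in> closure D" "- H \<le> z" using that closure_subset[of D] by (auto simp: p Omega0_def)
  moreover from this have "- H < u x + d" using u_range that(1) by force
  ultimately have "(x, z, u x + d) \<in> closure D \<times> {- H..} \<times> {- H<..}" by auto
  then show ?thesis using g ug \<open>x \<in> closure D\<close> by (force simp: subst_boundary_def P_def p)
 qed
 have op: "open (Omega0 D H M)" unfolding Omega0_def by (intro open_Times D(1)) auto
 show thesis
 proof (rule that[of "max (max C1 C2) 0" hg])
  fix d :: real and p assume d: "0 \<le> d" "d \<le> 1" and p: "p \<in> Omega0 D H M"
  obtain x z where xz: "p = (x, z)" by (cases p)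
  have x: "x \<in> V" using p closure_subset[of D] V(2) by (auto simp: xz Omega0_def)
  have du: "(ug has_derivative (\<lambda>a. gradient ug x \<bullet> a)) (at x)" by (rule gradient_has_derivative[OF Cinf_has_derivative[OF V(3) x]])
  have "P (d, p) \<in> U" using PK inK[OF d p] by blast
  then have dg: "(g has_derivative (\<lambda>a. gradient g (P (d, p)) \<bullet> a)) (at (P (d, p)))" by (rule gradient_has_derivative[OF Cinf_has_derivative[OF U(3)]])
  have du': "((\<lambda>p. ug (fst p)) has_derivative (\<lambda>a. gradient ug x \<bullet> fst a)) (at p)"
   using diff_chain_at[OF has_derivative_fst[OF has_derivative_ident], of ug _ p] du by (simp add: o_def xz)
  have dP: "((\<lambda>p. P (d, p)) has_derivative (\<lambda>a. (fst a, snd a, gradient ug x \<bullet> fst a))) (at p)"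
  proof -
   have "(\<lambda>p. P (d, p)) = (\<lambda>p. (fst p, snd p, ug (fst p) + d))" by (auto simp: P_def fun_eq_iff)
   then show ?thesis using du' by (auto intro!: derivative_eq_intros)
  qed
  have "((\<lambda>p. g (P (d, p))) has_derivative (\<lambda>a. gradient g (P (d, p)) \<bullet> (fst a, snd a, gradient ug x \<bullet> fst a))) (at p)"
   using diff_chain_at[OF dP dg] by (simp add: o_def)
  moreover have "gradient g (P (d, p)) \<bullet> (fst a, snd a, gradient ug x \<bullet> fst a) = hg d p \<bullet> a" for a
   by (cases "gradient g (P (d, p))") (simp add: hg_def j_def Let_def xz inner_prod_def inner_add_left)
  ultimately have "((\<lambda>p. g (P (d, p))) has_derivative (\<lambda>a. hg d p \<bullet> a)) (at p)" by simp
  then show "(subst_boundary h (\<lambda>x. u x + d) has_derivative (\<lambda>e. hg d p \<bullet> e)) (at p)"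
   by (rule has_derivative_transform_within_open[OF _ op p]) (use eqh d in auto)
  show "norm (hg d p) \<le> max (max C1 C2) 0" using C1[OF inK[OF d p]] by (simp add: hg_def)
  show "\<bar>subst_boundary h (\<lambda>x. u x + d) p\<bar> \<le> max (max C1 C2) 0" using C2[OF inK[OF d p]] eqh[OF d(1) p] by simp
 next
  fix d :: real assume d: "0 \<le> d" "d \<le> 1"
  show "continuous_on (Omega0 D H M) (hg d)" unfolding hg_def[abs_def]
   by (intro continuous_on_compose2[OF cj] continuous_intros) (use inK d in auto)
 next
  fix \<epsilon> :: real assume "\<epsilon> > 0"
  then obtain \<delta> where \<delta>: "\<delta> > 0" "\<And>q q'. q \<in> K ==> q' \<in> K ==> dist q' q < \<delta> ==> dist (j q') (j q) < \<epsilon>"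
   using compact_uniformly_continuous[OF cj K] unfolding uniformly_continuous_on_def by metis
  have "norm (hg d p - hg 0 p) < \<epsilon>" if "0 \<le> d" "d \<le> 1" "d < \<delta>" "p \<in> Omega0 D H M" for d p
  proof -
   have "dist (d, p) (0, p) < \<delta>" using that by (simp add: dist_Pair_Pair)
   from \<delta>(2)[OF inK inK this] show ?thesis using that by (simp add: hg_def dist_norm)
  qed
  then show "\<exists>\<delta>>0. \<forall>d p. 0 \<le> d --> d \<le> 1 --> d < \<delta> --> p \<in> Omega0 D H M --> norm (hg d p - hg 0 p) < \<epsilon>"
   using \<delta>(1) by blast
 qed auto
qed

lemma sqint_bounded_on:
 fixes k :: "'a::euclidean_space => 'b::euclidean_space"
 assumes S: "bounded S" "S \<in> sets borel" and k: "k \<in> BM" "\<And>x. norm (k x) \<le> B" "\<And>x. x \<notin> S ==> k x = 0"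
 shows "sqint k"
proof -
 note [measurable] = S(2) k(1)
 have "integrable lborel (\<lambda>x. indicator S x * B\<^sup>2)"
  using emeasure_bounded_finite[OF S(1)] by (intro integrable_mult_left integrable_real_indicator) auto
 then have "integrable lborel (\<lambda>x. (norm (k x))\<^sup>2)"
  by (rule Bochner_Integration.integrable_bound)
   (use k(2,3) in \<open>auto intro!: always_eventually power_mono split: split_indicator\<close>)
 then show ?thesis by (simp add: sqint_def)
qed

lemma classical_sobolev_pair:
 fixes k :: "'a::euclidean_space => real"
 assumes S: "open S" "bounded S" and der: "\<And>x. x \<in> S ==> (k has_derivative (\<lambda>e. Gk x \<bullet> e)) (at x)"
  and cont: "continuous_on S Gk" and bd: "\<And>x. x \<in> S ==> \<bar>k x\<bar> \<le> C" "\<And>x. x \<in> S ==> norm (Gk x) \<le> C" and C: "C \<ge> 0"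
 shows "sobolev_pair S (\<lambda>x. indicator S x * k x) (\<lambda>x. indicator S x *\<^sub>R Gk x)"
proof -
 have ck: "continuous_on S k" using has_derivative_continuous[OF der] by (auto intro!: continuous_at_imp_continuous_on)
 have m: "(\<lambda>x. indicator S x * k x) \<in> BM" "(\<lambda>x. indicator S x *\<^sub>R Gk x) \<in> BM"
  using borel_measurable_continuous_on_indicator[OF _ ck] borel_measurable_continuous_on_indicator[OF _ cont] S(1) by auto
 have Sb: "S \<in> sets borel" using S(1) by simp
 have "sqint (\<lambda>x. indicator S x * k x)" "sqint (\<lambda>x. indicator S x *\<^sub>R Gk x)"
  by (rule sqint_bounded_on[OF S(2) Sb m(1), of C]; use bd C in \<open>auto split: split_indicator\<close>)
   (rule sqint_bounded_on[OF S(2) Sb m(2), of C]; use bd C in \<open>auto split: split_indicator\<close>)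
 moreover have "(LINT x|lborel. (indicator S x * k x) * (gradient \<phi> x \<bullet> e)) = - (LINT x|lborel. \<phi> x * ((indicator S x *\<^sub>R Gk x) \<bullet> e))"
  if \<phi>: "\<phi> \<in> test_functions S" for \<phi> e
 proof -
  have "(LINT x|lborel. (indicator S x * k x) * (gradient \<phi> x \<bullet> e)) = (LINT x|lborel. k x * (gradient \<phi> x \<bullet> e))"
   using test_gradient_outside[OF \<phi>] by (intro integral_congr) (auto split: split_indicator)
  moreover have "(LINT x|lborel. \<phi> x * ((indicator S x *\<^sub>R Gk x) \<bullet> e)) = (LINT x|lborel. \<phi> x * (Gk x \<bullet> e))"
   using test_function_outside[OF \<phi>] by (intro integral_congr) (auto split: split_indicator)
  ultimately show ?thesis using classical_integration_by_parts[OF S(1) der cont \<phi>] by simp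
 qed
 ultimately show ?thesis unfolding sobolev_pair_def by auto
qed

lemma sobolev_pair_add:
 assumes "sobolev_pair S f g" "sobolev_pair S f' g'"
 shows "sobolev_pair S (\<lambda>x. f x + f' x) (\<lambda>x. g x + g' x)"
proof -
 have z: "sobolev_pair S (\<lambda>x. 0) (\<lambda>x. 0)" unfolding sobolev_pair_def by (simp add: sqint_zero)
 from sobolev_pair_diff[OF assms(1) sobolev_pair_diff[OF z assms(2)]] show ?thesis by simp
qed

section \<open>Quadratic functionals\<close>

lemma sqn_tendsto:
 assumes "\<And>n. sqint (s n)" "sqint f" "(\<lambda>n. sqn (\<lambda>x. s n x - f x)) \<longlonglongrightarrow> 0"
 shows "(\<lambda>n. sqn (s n)) \<longlonglongrightarrow> sqn f"
proof -
 have eq: "sqn (s n) = sqn (\<lambda>x. s n x - f x) + 2 * ((LINT x|lborel. s n x \<bullet> f x) - (LINT x|lborel. f x \<bullet> f x)) + sqn f" for n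
 proof -
  have d: "sqint (\<lambda>x. s n x - f x)" by (rule sqint_diff(1)[OF assms(1,2)])
  have "(LINT x|lborel. (norm (s n x))\<^sup>2) = (LINT x|lborel. (norm (s n x - f x))\<^sup>2 + 2 * (s n x \<bullet> f x - f x \<bullet> f x) + (norm (f x))\<^sup>2)"
   by (intro integral_congr) (simp add: power2_norm_eq_inner inner_diff_left inner_diff_right inner_commute)
  also have "... = (LINT x|lborel. (norm (s n x - f x))\<^sup>2) + 2 * ((LINT x|lborel. s n x \<bullet> f x) - (LINT x|lborel. f x \<bullet> f x)) + (LINT x|lborel. (norm (f x))\<^sup>2)"
   using sqint_inner(1)[OF assms(1,2)] sqint_inner(1)[OF assms(2,2)] d assms(2) by (simp add: sqint_def)
  finally show ?thesis by (simp add: sqn_def)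
 qed
 have "(\<lambda>n. sqn (\<lambda>x. s n x - f x) + 2 * ((LINT x|lborel. s n x \<bullet> f x) - (LINT x|lborel. f x \<bullet> f x)) + sqn f)
   \<longlonglongrightarrow> 0 + 2 * ((LINT x|lborel. f x \<bullet> f x) - (LINT x|lborel. f x \<bullet> f x)) + sqn f"
  by (intro tendsto_intros assms sqint_inner_tendsto[OF assms(1,2,2,3)])
 then show ?thesis unfolding eq[symmetric] by simp
qed

lemma weighted_sqint:
 fixes f :: "'a::euclidean_space => 'b::euclidean_space"
 assumes f: "sqint f" and b: "b \<in> BM" "\<And>x. 0 \<le> b x" "\<And>x. b x \<le> B"
 shows "sqint (\<lambda>x. sqrt (b x) *\<^sub>R f x)" "sqn (\<lambda>x. sqrt (b x) *\<^sub>R f x) = (LINT x|lborel. b x * (norm (f x))\<^sup>2)"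
  "integrable lborel (\<lambda>x. b x * (norm (f x))\<^sup>2)" "sqn (\<lambda>x. sqrt (b x) *\<^sub>R f x) \<le> B * sqn f"
proof -
 note [measurable] = b(1)
 have [measurable]: "f \<in> BM" using f by (simp add: sqint_def)
 have B: "B \<ge> 0" using b(2,3)[of undefined] by linarith
 have m: "(\<lambda>x. sqrt (b x) *\<^sub>R f x) \<in> BM" by measurable
 have ae: "AE x in lborel. norm (sqrt (b x) *\<^sub>R f x) \<le> sqrt B * norm (f x)"
  using b by (auto intro!: always_eventually mult_right_mono)
 have sB: "sqrt B \<ge> 0" "(sqrt B)\<^sup>2 = B" using B by auto
 show s: "sqint (\<lambda>x. sqrt (b x) *\<^sub>R f x)" by (rule sqint_bound(1)[OF f m ae sB(1)])
 show "sqn (\<lambda>x. sqrt (b x) *\<^sub>R f x) \<le> B * sqn f" using sqint_bound(2)[OF f m ae sB(1)] sB(2) by simp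
 show "sqn (\<lambda>x. sqrt (b x) *\<^sub>R f x) = (LINT x|lborel. b x * (norm (f x))\<^sup>2)"
  using b(2) by (simp add: sqn_def power_mult_distrib)
 show "integrable lborel (\<lambda>x. b x * (norm (f x))\<^sup>2)"
  using s b(2) by (simp add: sqint_def power_mult_distrib)
qed

lemma quadratic_tendsto:
 fixes f :: "'a::euclidean_space => 'b::euclidean_space"
 assumes s: "\<And>n. sqint (s n)" "sqint f" "(\<lambda>n. sqn (\<lambda>x. s n x - f x)) \<longlonglongrightarrow> 0" and a: "sqint a"
  and b: "b \<in> BM" "\<And>x. 0 \<le> b x" "\<And>x. b x \<le> B"
 shows "(\<lambda>n. (LINT x|lborel. s n x \<bullet> a x) - (LINT x|lborel. b x * (norm (s n x))\<^sup>2))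
   \<longlonglongrightarrow> (LINT x|lborel. f x \<bullet> a x) - (LINT x|lborel. b x * (norm (f x))\<^sup>2)"
proof (intro tendsto_diff sqint_inner_tendsto[OF s(1,2) a s(3)])
 note w = weighted_sqint[OF _ b]
 have "(\<lambda>n. sqn (\<lambda>x. sqrt (b x) *\<^sub>R s n x - sqrt (b x) *\<^sub>R f x)) \<longlonglongrightarrow> 0"
 proof (rule Lim_null_comparison)
  show "\<forall>\<^sub>F n in sequentially. norm (sqn (\<lambda>x. sqrt (b x) *\<^sub>R s n x - sqrt (b x) *\<^sub>R f x)) \<le> B * sqn (\<lambda>x. s n x - f x)"
   using w(4)[OF sqint_diff(1)[OF s(1,2)]] by (auto simp: scaleR_diff_right sqn_nonneg)
  show "(\<lambda>n. B * sqn (\<lambda>x. s n x - f x)) \<longlonglongrightarrow> 0" using tendsto_mult_right_zero[OF s(3)] by simp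
 qed
 from sqn_tendsto[OF w(1)[OF s(1)] w(1)[OF s(2)] this]
 show "(\<lambda>n. LINT x|lborel. b x * (norm (s n x))\<^sup>2) \<longlonglongrightarrow> (LINT x|lborel. b x * (norm (f x))\<^sup>2)"
  unfolding w(2)[OF s(1)] w(2)[OF s(2)] .
qed

lemma L2_density_vector:
 fixes F :: "'a::euclidean_space => 'b::euclidean_space"
 assumes S: "open S" and F: "sqint F" "\<And>x. x \<notin> S ==> F x = 0"
 obtains \<Phi> where "\<And>k e. \<Phi> k e \<in> test_functions S" "(\<lambda>k. sqn (\<lambda>x. (\<Sum>e\<in>Basis. \<Phi> k e x *\<^sub>R e) - F x)) \<longlonglongrightarrow> 0"
proof -
 have "\<forall>q. \<exists>\<phi>. \<phi> \<in> test_functions S \<and> sqn (\<lambda>x. F x \<bullet> snd q - \<phi> x) < inverse (real (Suc (fst q)))"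
 proof
  fix q :: "nat \<times> 'b"
  have "(\<lambda>x. F x \<bullet> snd q) \<in> L2_test_closure S"
   by (rule L2_density[OF S sqint_inner_const[OF F(1)]]) (simp add: F(2))
  then show "\<exists>\<phi>. \<phi> \<in> test_functions S \<and> sqn (\<lambda>x. F x \<bullet> snd q - \<phi> x) < inverse (real (Suc (fst q)))"
   using L2_test_closureD[of _ S "inverse (real (Suc (fst q)))"] by (auto simp: Bex_def)
 qed
 from choice[OF this] obtain \<phi> where \<phi>: "\<And>q. \<phi> q \<in> test_functions S \<and> sqn (\<lambda>x. F x \<bullet> snd q - \<phi> q x) < inverse (real (Suc (fst q)))"
  by blast
 define \<Phi> where "\<Phi> k e = \<phi> (k, e)" for k e
 have t: "\<Phi> k e \<in> test_functions S" "sqn (\<lambda>x. F x \<bullet> e - \<Phi> k e x) < inverse (real (Suc k))" for k e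
  using \<phi>[of "(k, e)"] by (auto simp: \<Phi>_def)
 have eq: "sqn (\<lambda>x. (\<Sum>e\<in>Basis. \<Phi> k e x *\<^sub>R e) - F x) = (\<Sum>e\<in>Basis. sqn (\<lambda>x. F x \<bullet> e - \<Phi> k e x))" for k
 proof -
  have pt: "(norm ((\<Sum>e\<in>Basis. \<Phi> k e x *\<^sub>R e) - F x))\<^sup>2 = (\<Sum>e\<in>Basis. (norm (F x \<bullet> e - \<Phi> k e x))\<^sup>2)" for x
  proof -
   have c: "((\<Sum>e\<in>Basis. \<Phi> k e x *\<^sub>R e) - F x) \<bullet> e = \<Phi> k e x - F x \<bullet> e" if "e \<in> Basis" for e
    using that by (simp add: inner_diff_left inner_sum_left inner_Basis if_distrib cong: if_cong)
   have "(norm ((\<Sum>e\<in>Basis. \<Phi> k e x *\<^sub>R e) - F x))\<^sup>2 = (\<Sum>e\<in>Basis. (((\<Sum>e\<in>Basis. \<Phi> k e x *\<^sub>R e) - F x) \<bullet> e)\<^sup>2)"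
    unfolding power2_norm_eq_inner by (subst euclidean_inner) (simp add: power2_eq_square)
   also have "... = (\<Sum>e\<in>Basis. (norm (F x \<bullet> e - \<Phi> k e x))\<^sup>2)"
    by (intro sum.cong refl) (simp add: c power2_commute)
   finally show ?thesis .
  qed
  have "sqint (\<lambda>x. F x \<bullet> e - \<Phi> k e x)" for e
   by (intro sqint_diff(1) sqint_inner_const F test_function_sqint[OF t(1)])
  then show ?thesis unfolding sqn_def pt by (intro Bochner_Integration.integral_sum) (simp add: sqint_def)
 qed
 have "(\<lambda>k. sqn (\<lambda>x. (\<Sum>e\<in>Basis. \<Phi> k e x *\<^sub>R e) - F x)) \<longlonglongrightarrow> 0"
  unfolding eq
 proof (rule tendsto_null_sum)
  fix e :: 'b
  show "(\<lambda>k. sqn (\<lambda>x. F x \<bullet> e - \<Phi> k e x)) \<longlonglongrightarrow> 0"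
   by (rule Lim_null_comparison[OF _ LIMSEQ_inverse_real_of_nat]) (use t(2) in \<open>auto simp: sqn_nonneg less_imp_le\<close>)
 qed
 then show thesis using that[of \<Phi>] t(1) by blast
qed

section \<open>The dual lower bound\<close>

text \<open>Test fields are given by scalar test functions, one for each basis vector.\<close>

definition vfield :: "('e => 'b => real) => 'b => 'e::euclidean_space" where
 "vfield \<Phi> p = (\<Sum>e\<in>Basis. \<Phi> e p *\<^sub>R e)"

definition divg :: "('b::euclidean_space => 'b => real) => 'b => real" where
 "divg \<Phi> p = (\<Sum>e\<in>Basis. gradient (\<Phi> e) p \<bullet> e)"

lemma vfield_inner: "vfield \<Phi> p \<bullet> y = (\<Sum>e\<in>Basis. \<Phi> e p * (y \<bullet> e))"
 unfolding vfield_def inner_sum_left by (simp add: inner_commute[of y])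

lemma vfield_sqint:
 fixes \<Phi> :: "'e::euclidean_space => 'b::euclidean_space => real"
 assumes "\<And>e. \<Phi> e \<in> test_functions S" shows "sqint (vfield \<Phi>)"
 unfolding vfield_def[abs_def]
proof (rule sqint_sum)
 fix e :: 'e
 show "sqint (\<lambda>p. \<Phi> e p *\<^sub>R e)" using test_function_sqint[OF assms[of e]]
  by (auto simp: sqint_def power_mult_distrib)
qed

lemma divg_sqint:
 fixes \<Phi> :: "'b::euclidean_space => 'b => real"
 assumes "\<And>e. \<Phi> e \<in> test_functions S" shows "sqint (divg \<Phi>)"
 unfolding divg_def[abs_def] by (rule sqint_sum, rule test_function_sqint[OF test_function_deriv[OF assms]])

lemma vfield_bounded:
 fixes \<Phi> :: "'e::euclidean_space => 'b::euclidean_space => real"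
 assumes "\<And>e. \<Phi> e \<in> test_functions S"
 shows "\<exists>B\<ge>0. \<forall>p. norm (vfield \<Phi> p) \<le> B"
proof -
 have "\<exists>B. B \<ge> 0 \<and> (\<forall>p. \<bar>\<Phi> e p\<bar> \<le> B)" for e by (rule test_function_bounded[OF assms]) blast
 then have "\<forall>e. \<exists>B. B \<ge> 0 \<and> (\<forall>p. \<bar>\<Phi> e p\<bar> \<le> B)" by blast
 from choice[OF this] obtain B where B: "\<And>e. B e \<ge> 0" "\<And>e p. \<bar>\<Phi> e p\<bar> \<le> B e" by blast
 have "norm (vfield \<Phi> p) \<le> (\<Sum>e\<in>Basis. B e)" for p
 proof -
  have "norm (vfield \<Phi> p) \<le> (\<Sum>e\<in>Basis. norm (\<Phi> e p *\<^sub>R (e :: 'e)))" unfolding vfield_def by (rule norm_sum)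
  also have "... \<le> (\<Sum>e\<in>Basis. B e)" by (rule sum_mono) (use B in simp)
  finally show ?thesis .
 qed
 moreover have "0 \<le> (\<Sum>e\<in>Basis. B e)" using B(1) by (simp add: sum_nonneg)
 ultimately show ?thesis by blast
qed

lemma vfield_continuous:
 fixes \<Phi> :: "'e::euclidean_space => 'b::euclidean_space => real"
 assumes "\<And>e. \<Phi> e \<in> test_functions S" shows "continuous_on A (vfield \<Phi>)"
 unfolding vfield_def[abs_def] by (intro continuous_intros test_function_continuous[OF assms])

lemma green_vfield:
 fixes D :: "'a::euclidean_space set"
 assumes gr: "green_trace D H v f g \<tau>" and s: "sqint f" "sqint g" and \<Phi>: "\<And>e. \<Phi> e \<in> test_functions (D \<times> {-H<..})"
  and it: "\<And>e. sqint (\<lambda>x. \<Phi> e (x, v x) * (gnormal D v x \<bullet> e))"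
 shows "(LINT p|lborel. f p * divg \<Phi> p) + (LINT p|lborel. vfield \<Phi> p \<bullet> g p) = (LINT x|lborel. \<tau> x * (vfield \<Phi> (x, v x) \<bullet> gnormal D v x))"
proof -
 have \<tau>: "sqint \<tau>" using gr by (simp add: green_trace_def)
 have i: "integrable lborel (\<lambda>p. f p * (gradient (\<Phi> e) p \<bullet> e))" "integrable lborel (\<lambda>p. \<Phi> e p * (g p \<bullet> e))"
  "integrable lborel (\<lambda>x. \<tau> x * (\<Phi> e (x, v x) * (gnormal D v x \<bullet> e)))" for e
  using sqint_inner(1)[OF s(1) test_function_sqint[OF test_function_deriv[OF \<Phi>]]]
   sqint_inner(1)[OF test_function_sqint[OF \<Phi>] sqint_inner_const[OF s(2)]] sqint_inner(1)[OF \<tau> it] by auto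
 have "(LINT p|lborel. f p * divg \<Phi> p) = (\<Sum>e\<in>Basis. LINT p|lborel. f p * (gradient (\<Phi> e) p \<bullet> e))"
  unfolding divg_def sum_distrib_left by (rule Bochner_Integration.integral_sum[OF i(1)])
 moreover have "(LINT p|lborel. vfield \<Phi> p \<bullet> g p) = (\<Sum>e\<in>Basis. LINT p|lborel. \<Phi> e p * (g p \<bullet> e))"
  unfolding vfield_inner by (rule Bochner_Integration.integral_sum[OF i(2)])
 moreover have "(LINT x|lborel. \<tau> x * (vfield \<Phi> (x, v x) \<bullet> gnormal D v x)) = (\<Sum>e\<in>Basis. LINT x|lborel. \<tau> x * (\<Phi> e (x, v x) * (gnormal D v x \<bullet> e)))"
  unfolding vfield_inner sum_distrib_left by (rule Bochner_Integration.integral_sum[OF i(3)])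
 ultimately show ?thesis using green_traceD[OF gr \<Phi>] by (simp add: sum.distrib[symmetric])
qed

lemma integral_dominated_tendsto:
 fixes s :: "nat => 'a::euclidean_space => real"
 assumes "f \<in> BM" "\<And>n. s n \<in> BM" "integrable lborel w"
  "AE x in lborel. (\<lambda>n. s n x) \<longlonglongrightarrow> f x" "\<And>n x. \<bar>s n x\<bar> \<le> w x"
 shows "(\<lambda>n. LINT x|lborel. s n x) \<longlonglongrightarrow> (LINT x|lborel. f x)"
 by (rule integral_dominated_convergence[where w=w]) (use assms in auto)

lemma integrable_indicator_bounded:
 fixes S :: "'a::euclidean_space set"
 assumes "bounded S" "S \<in> sets borel" shows "integrable lborel (\<lambda>x. C * indicator S x :: real)"
 using emeasure_bounded_finite[OF assms(1)] assms(2) by (intro integrable_mult_right integrable_real_indicator) auto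

text \<open>\<open>sg\<close> stands for the permittivity and \<open>hg d\<close> for the gradient of the boundary function with
\<open>v = u + d\<close>; only their bounds and continuity matter for the energies.\<close>

locale plate = graph_domain D H c M L u for D :: "'a::euclidean_space set" and H c M L u +
 fixes \<sigma>1 \<sigma>0 \<sigma>C Ch :: real and sg :: "'a \<times> real => real" and hg :: "real => 'a \<times> real => 'a \<times> real"
 assumes \<sigma>: "\<sigma>1 > 0" "\<sigma>0 > 0"
  and sg_m [measurable]: "sg \<in> BM"
  and sg_low: "\<And>x s. x \<in> D ==> s \<in> {0..1} ==> \<sigma>0 \<le> sg (x, s)"
  and sg_up: "\<And>x s. x \<in> D ==> s \<in> {0..1} ==> sg (x, s) \<le> \<sigma>C"
  and sg_cont: "\<And>x. x \<in> D ==> continuous_on {0..1} (\<lambda>s. sg (x, s))"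
  and Ch: "Ch \<ge> 0"
  and hg_cont: "\<And>d. 0 \<le> d ==> d \<le> 1 ==> continuous_on (Omega0 D H M) (hg d)"
  and hg_bd: "\<And>d p. 0 \<le> d ==> d \<le> 1 ==> p \<in> Omega0 D H M ==> norm (hg d p) \<le> Ch"
  and hg_lim: "\<And>\<epsilon>. \<epsilon> > 0 ==> \<exists>\<delta>>0. \<forall>d p. 0 \<le> d --> d \<le> 1 --> d < \<delta> --> p \<in> Omega0 D H M --> norm (hg d p - hg 0 p) < \<epsilon>"
begin

abbreviation "\<Omega>0 \<equiv> Omega0 D H M"

definition Wd :: "real => ('a \<times> real) set" where "Wd d = Omega1 D H (\<lambda>x. u x + d)"

definition Ud :: "real => ('a \<times> real) set" where
 "Ud d = {p. fst p \<in> D \<and> u (fst p) < snd p \<and> snd p < u (fst p) + d}"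

text \<open>The weight of the layer and its inverse, which occurs in the dual functional.\<close>

definition wt :: "real => 'a \<times> real => real" where
 "wt d p = indicator (Ud d) p * sg (fst p, snd p - u (fst p))"

definition iwt :: "real => 'a \<times> real => real" where
 "iwt d p = indicator (Ud d) p * inverse (sg (fst p, snd p - u (fst p)))"

definition Hd :: "real => 'a \<times> real => 'a \<times> real" where "Hd d p = indicator (Wd d) p *\<^sub>R hg d p"

text \<open>The functionals depend on \<open>\<theta>\<close> only through the total gradient \<open>w\<close> and, in the limit,
the trace \<open>\<tau>\<close>.\<close>

definition energy :: "real => ('a \<times> real => 'a \<times> real) => real" where
 "energy d w = \<sigma>1 / 2 * (LINT p|lborel. indicator \<Omega> p * (norm (w p))\<^sup>2) + d / 2 * (LINT p|lborel. wt d p * (norm (w p))\<^sup>2)"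

definition energy0 :: "('a \<times> real => 'a \<times> real) => ('a => real) => real" where
 "energy0 w \<tau> = \<sigma>1 / 2 * (LINT p|lborel. indicator \<Omega> p * (norm (w p))\<^sup>2)
   + 1 / 2 * (LINT x|lborel. indicator D x * (sg (x, 0) * (\<tau> x)\<^sup>2 * (norm (gnormal D u x))\<^sup>2))"

lemma Wd_domain: "0 \<le> d ==> graph_domain D H (c + d) (M + \<bar>d\<bar>) L (\<lambda>x. u x + d)"
 "x \<in> D ==> 0 \<le> d ==> gradient (\<lambda>x. u x + d) x = gradient u x"
 using shifted_domain[of "- d"] c by auto

lemma Wd_open: "0 \<le> d ==> open (Wd d)" unfolding Wd_def
 using graph_domain.Omega_open[OF Wd_domain(1)] by simp

lemma Wd_0: "Wd 0 = \<Omega>" by (simp add: Wd_def)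

lemma Wd_sub: "d \<le> 1 ==> Wd d \<subseteq> \<Omega>0" using v_up by (force simp: Wd_def Omega1_def Omega0_def)

lemma Omega_sub_Wd: "0 \<le> d ==> \<Omega> \<subseteq> Wd d" by (auto simp: Wd_def Omega1_def)

lemma Ud_borel [measurable]: "Ud d \<in> sets borel" unfolding Ud_def by measurable

lemma wt_m [measurable]: "wt d \<in> BM" "iwt d \<in> BM"
 unfolding wt_def iwt_def by measurable

lemma Omega0_open: "open \<Omega>0" unfolding Omega0_def by (intro open_Times D(1)) auto

lemma Omega0_borel [measurable]: "\<Omega>0 \<in> sets borel" using Omega0_open by simp

lemma Omega0_bounded: "bounded \<Omega>0" unfolding Omega0_def by (intro bounded_Times D(2)) auto

lemma wt_bounds:
 assumes "0 < d" "d \<le> 1"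
 shows "0 \<le> wt d p" "wt d p \<le> max \<sigma>C 0" "0 \<le> iwt d p" "iwt d p \<le> 1 / \<sigma>0"
proof -
 have "p \<in> Ud d ==> \<sigma>0 \<le> sg (fst p, snd p - u (fst p)) \<and> sg (fst p, snd p - u (fst p)) \<le> \<sigma>C"
  using sg_low[of "fst p" "snd p - u (fst p)"] sg_up[of "fst p" "snd p - u (fst p)"] assms by (auto simp: Ud_def)
 then show "0 \<le> wt d p" "wt d p \<le> max \<sigma>C 0" "0 \<le> iwt d p" "iwt d p \<le> 1 / \<sigma>0"
  using \<sigma>(2) le_imp_inverse_le[of \<sigma>0 "sg (fst p, snd p - u (fst p))"]
  by (auto simp: wt_def iwt_def inverse_eq_divide split: split_indicator)
qed

lemma Hd_borel:
 assumes "0 \<le> d" "d \<le> 1" shows "Hd d \<in> BM"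
proof -
 have "Wd d \<in> sets borel" using Wd_open[OF assms(1)] by simp
 moreover have "continuous_on (Wd d) (hg d)" by (rule continuous_on_subset[OF hg_cont[OF assms] Wd_sub[OF assms(2)]])
 ultimately show ?thesis unfolding Hd_def[abs_def] by (rule borel_measurable_continuous_on_indicator)
qed

lemma Hd_bound: "0 \<le> d ==> d \<le> 1 ==> norm (Hd d p) \<le> Ch"
 using hg_bd[of d p] Wd_sub[of d] Ch by (auto simp: Hd_def split: split_indicator)

lemma Hd_outside: "d \<le> 1 ==> p \<notin> \<Omega>0 ==> Hd d p = 0"
 using Wd_sub[of d] by (auto simp: Hd_def split: split_indicator)

lemma Hd_sqint: "0 \<le> d ==> d \<le> 1 ==> sqint (Hd d)"
 by (rule sqint_bounded_on[OF Omega0_bounded Omega0_borel Hd_borel Hd_bound Hd_outside])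

lemma Wd_split: "0 < d ==> snd p \<noteq> u (fst p) ==> indicator (Wd d) p = (indicator \<Omega> p + indicator (Ud d) p :: real)"
 using v_low[of "fst p"] c by (cases p) (auto simp: Wd_def Ud_def Omega1_def split: split_indicator)

lemma young_lower:
 fixes w V :: "'b::real_inner"
 assumes "k > 0" shows "V \<bullet> w - (norm V)\<^sup>2 / (2 * k) \<le> k / 2 * (norm w)\<^sup>2"
proof -
 have "0 \<le> (norm (V - k *\<^sub>R w))\<^sup>2" by simp
 also have "... = (norm V)\<^sup>2 - 2 * k * (V \<bullet> w) + k\<^sup>2 * (norm w)\<^sup>2"
  unfolding power2_norm_eq_inner
  by (simp add: inner_diff_left inner_diff_right inner_commute[of w V] power2_eq_square algebra_simps)
 finally have "2 * k * (V \<bullet> w) - (norm V)\<^sup>2 \<le> k\<^sup>2 * (norm w)\<^sup>2" by simp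
 then have "(2 * k * (V \<bullet> w) - (norm V)\<^sup>2) / (2 * k) \<le> k\<^sup>2 * (norm w)\<^sup>2 / (2 * k)"
  using assms by (intro divide_right_mono) auto
 then show ?thesis using assms by (simp add: diff_divide_distrib power2_eq_square)
qed

text \<open>Pointwise Young's inequality, with constant \<open>\<sigma>1\<close> in the subgraph and \<open>d \<sigma>\<close> in
the layer.\<close>

lemma energy_lower:
 assumes d: "0 < d" "d \<le> 1" and w: "sqint w" and V: "sqint V"
 shows "(LINT p|lborel. indicator (Wd d) p * (V p \<bullet> w p)) - 1 / (2 * \<sigma>1) * (LINT p|lborel. indicator \<Omega> p * (norm (V p))\<^sup>2)
   - 1 / (2 * d) * (LINT p|lborel. iwt d p * (norm (V p))\<^sup>2) \<le> energy d w"
proof -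
 have "Wd d \<in> sets borel" using Wd_open d by simp
 note [measurable] = this
 have [measurable]: "w \<in> BM" "V \<in> BM" using w V by (auto simp: sqint_def)
 note i\<Omega> = weighted_sqint(3)[where b="indicator \<Omega>" and B=1]
 have i1: "integrable lborel (\<lambda>p. indicator \<Omega> p * (norm (w p))\<^sup>2)" "integrable lborel (\<lambda>p. indicator \<Omega> p * (norm (V p))\<^sup>2)"
  using i\<Omega>[OF w] i\<Omega>[OF V] by (auto simp: indicator_def)
 have i2: "integrable lborel (\<lambda>p. wt d p * (norm (w p))\<^sup>2)" "integrable lborel (\<lambda>p. iwt d p * (norm (V p))\<^sup>2)"
  using weighted_sqint(3)[OF w wt_m(1) wt_bounds(1,2)[OF d]] weighted_sqint(3)[OF V wt_m(2) wt_bounds(3,4)[OF d]] by auto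
 have i3: "integrable lborel (\<lambda>p. indicator (Wd d) p * (V p \<bullet> w p))"
  by (rule Bochner_Integration.integrable_bound[OF sqint_inner(1)[OF V w]]) (auto split: split_indicator)
 have "(LINT p|lborel. indicator (Wd d) p * (V p \<bullet> w p)) - 1 / (2 * \<sigma>1) * (LINT p|lborel. indicator \<Omega> p * (norm (V p))\<^sup>2)
   - 1 / (2 * d) * (LINT p|lborel. iwt d p * (norm (V p))\<^sup>2)
   = (LINT p|lborel. indicator (Wd d) p * (V p \<bullet> w p) - 1 / (2 * \<sigma>1) * (indicator \<Omega> p * (norm (V p))\<^sup>2) - 1 / (2 * d) * (iwt d p * (norm (V p))\<^sup>2))"
  using i1 i2 i3 by simp
 also have "... \<le> (LINT p|lborel. \<sigma>1 / 2 * (indicator \<Omega> p * (norm (w p))\<^sup>2) + d / 2 * (wt d p * (norm (w p))\<^sup>2))"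
 proof (rule integral_mono_AE)
  show "AE p in lborel. indicator (Wd d) p * (V p \<bullet> w p) - 1 / (2 * \<sigma>1) * (indicator \<Omega> p * (norm (V p))\<^sup>2) - 1 / (2 * d) * (iwt d p * (norm (V p))\<^sup>2)
   \<le> \<sigma>1 / 2 * (indicator \<Omega> p * (norm (w p))\<^sup>2) + d / 2 * (wt d p * (norm (w p))\<^sup>2)"
   using AE_not_graph[OF v(2)]
  proof eventually_elim
   case (elim p)
   have disj: "\<not> (p \<in> \<Omega> \<and> p \<in> Ud d)" by (auto simp: Omega1_def Ud_def)
   have y1: "V p \<bullet> w p - (norm (V p))\<^sup>2 / (2 * \<sigma>1) \<le> \<sigma>1 / 2 * (norm (w p))\<^sup>2" by (rule young_lower[OF \<sigma>(1)])
   have y2: "V p \<bullet> w p - 1 / (2 * d) * (inverse (sg (fst p, snd p - u (fst p))) * (norm (V p))\<^sup>2) \<le> d / 2 * (sg (fst p, snd p - u (fst p)) * (norm (w p))\<^sup>2)" if "p \<in> Ud d"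
   proof -
    let ?s = "sg (fst p, snd p - u (fst p))"
    have s: "?s > 0" using sg_low[of "fst p" "snd p - u (fst p)"] \<sigma>(2) d that by (auto simp: Ud_def)
    have "V p \<bullet> w p - (norm (V p))\<^sup>2 / (2 * (d * ?s)) \<le> (d * ?s) / 2 * (norm (w p))\<^sup>2" by (rule young_lower) (use d s in simp)
    moreover have "1 / (2 * d) * (inverse ?s * (norm (V p))\<^sup>2) = (norm (V p))\<^sup>2 / (2 * (d * ?s))"
     using s d by (simp add: field_simps)
    moreover have "d / 2 * (?s * (norm (w p))\<^sup>2) = (d * ?s) / 2 * (norm (w p))\<^sup>2" by simp
    ultimately show ?thesis by argo
   qed
   show ?case unfolding Wd_split[OF d(1) elim] using disj y1 y2
    by (cases "p \<in> \<Omega>"; cases "p \<in> Ud d") (auto simp: wt_def iwt_def)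
  qed
 qed (use i1 i2 i3 in auto)
 also have "... = energy d w" using i1 i2 by (simp add: energy_def)
 finally show ?thesis .
qed

text \<open>The dual functional, in which the derivative of \<open>f\<close> has been moved to \<open>\<Phi>\<close>.\<close>

definition Jd :: "real => ('a \<times> real => real) => ('a \<times> real => 'a \<times> real => real) => real" where
 "Jd d f \<Phi> = (LINT p|lborel. vfield \<Phi> p \<bullet> Hd d p) - (LINT p|lborel. f p * divg \<Phi> p)
   - 1 / (2 * \<sigma>1) * (LINT p|lborel. indicator \<Omega> p * (norm (vfield \<Phi> p))\<^sup>2)
   - 1 / (2 * d) * (LINT p|lborel. iwt d p * (norm (vfield \<Phi> p))\<^sup>2)"

definition J0 :: "('a \<times> real => real) => ('a \<times> real => 'a \<times> real => real) => real" where
 "J0 f \<Phi> = (LINT p|lborel. vfield \<Phi> p \<bullet> Hd 0 p) - (LINT p|lborel. f p * divg \<Phi> p)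
   - 1 / (2 * \<sigma>1) * (LINT p|lborel. indicator \<Omega> p * (norm (vfield \<Phi> p))\<^sup>2)
   - 1 / 2 * (LINT x|lborel. indicator D x * (inverse (sg (x, 0)) * (norm (vfield \<Phi> (x, u x)))\<^sup>2))"

lemma energy_ge_Jd:
 assumes d: "0 < d" "d \<le> 1" and sp: "sobolev_pair (Wd d) f g" and gr: "green_trace D H (\<lambda>x. u x + d) f g (\<lambda>x. 0)"
  and \<Phi>: "\<And>e. \<Phi> e \<in> test_functions (D \<times> {-H<..})"
 shows "Jd d f \<Phi> \<le> energy d (\<lambda>p. g p + Hd d p)"
proof -
 have s: "sqint f" "sqint g" by (rule sobolev_pair_sqint[OF sp])+
 have H: "sqint (Hd d)" using Hd_sqint d by simp
 have V: "sqint (vfield \<Phi>)" by (rule vfield_sqint[OF \<Phi>])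
 have "(LINT p|lborel. f p * divg \<Phi> p) + (LINT p|lborel. vfield \<Phi> p \<bullet> g p) = 0"
  using green_vfield[OF gr s \<Phi> graph_domain.sqint_trace_test[OF Wd_domain(1) \<Phi>]] d by simp
 moreover have "(LINT p|lborel. indicator (Wd d) p * (vfield \<Phi> p \<bullet> (g p + Hd d p))) = (LINT p|lborel. vfield \<Phi> p \<bullet> g p + vfield \<Phi> p \<bullet> Hd d p)"
  by (intro integral_congr)
   (use sobolev_pair_outside[OF sp] in \<open>auto simp: Hd_def inner_add_right split: split_indicator\<close>)
 moreover have "... = (LINT p|lborel. vfield \<Phi> p \<bullet> g p) + (LINT p|lborel. vfield \<Phi> p \<bullet> Hd d p)"
  using sqint_inner(1)[OF V s(2)] sqint_inner(1)[OF V H] by simp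
 ultimately show ?thesis using energy_lower[OF d sqint_add(1)[OF s(2) H] V] by (simp add: Jd_def)
qed

text \<open>The last term of \<open>Jd\<close> is an average over the thickness of the layer and converges to an integral over the
graph.\<close>

lemma J_limit:
 assumes dn: "\<And>n. 0 < dn n" "\<And>n. dn n \<le> 1" "dn \<longlonglongrightarrow> 0"
  and f: "\<And>n. sqint (fn n)" "sqint f" "(\<lambda>n. sqn (\<lambda>p. fn n p - f p)) \<longlonglongrightarrow> 0"
  and \<Phi>: "\<And>e. \<Phi> e \<in> test_functions (D \<times> {-H<..})"
 shows "(\<lambda>n. Jd (dn n) (fn n) \<Phi>) \<longlonglongrightarrow> J0 f \<Phi>"
proof -
 have "\<exists>B\<ge>0. \<forall>p. norm (vfield \<Phi> p) \<le> B" by (rule vfield_bounded[OF \<Phi>])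
 then obtain B where B: "B \<ge> 0" "\<And>p. norm (vfield \<Phi> p) \<le> B" by blast
 have V: "sqint (vfield \<Phi>)" by (rule vfield_sqint[OF \<Phi>])
 have [measurable]: "vfield \<Phi> \<in> BM" using V by (simp add: sqint_def)
 have hlim: "(\<lambda>n. hg (dn n) p) \<longlonglongrightarrow> hg 0 p" if "p \<in> \<Omega>0" for p
 proof (rule LIMSEQ_I)
  fix \<epsilon> :: real assume "\<epsilon> > 0"
  from hg_lim[OF this] obtain \<delta> where \<delta>: "\<delta> > 0"
   "\<forall>d p. 0 \<le> d --> d \<le> 1 --> d < \<delta> --> p \<in> \<Omega>0 --> norm (hg d p - hg 0 p) < \<epsilon>" by (elim exE conjE)
  obtain N where "\<And>n. n \<ge> N ==> dn n < \<delta>" using order_tendstoD(2)[OF dn(3) \<delta>(1)] unfolding eventually_sequentially by blast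
  then have "norm (hg (dn n) p - hg 0 p) < \<epsilon>" if "n \<ge> N" for n
   using \<delta>(2)[rule_format, of "dn n" p] dn(1,2)[of n] \<open>p \<in> \<Omega>0\<close> that by auto
  then show "\<exists>N. \<forall>n\<ge>N. norm (hg (dn n) p - hg 0 p) < \<epsilon>" by blast
 qed
 have "(\<lambda>n. LINT p|lborel. vfield \<Phi> p \<bullet> Hd (dn n) p) \<longlonglongrightarrow> (LINT p|lborel. vfield \<Phi> p \<bullet> Hd 0 p)"
 proof (rule integral_dominated_tendsto[where w="\<lambda>p. (B * Ch) * indicator \<Omega>0 p"])
  show "integrable lborel (\<lambda>p. (B * Ch) * indicator \<Omega>0 p)" by (rule integrable_indicator_bounded[OF Omega0_bounded Omega0_borel])
  show "(\<lambda>p. vfield \<Phi> p \<bullet> Hd (dn n) p) \<in> BM" for n using Hd_borel[of "dn n"] dn(1,2)[of n] by (intro borel_measurable_inner) auto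
  show "(\<lambda>p. vfield \<Phi> p \<bullet> Hd 0 p) \<in> BM" using Hd_borel[of 0] by (intro borel_measurable_inner) auto
  show "\<bar>vfield \<Phi> p \<bullet> Hd (dn n) p\<bar> \<le> (B * Ch) * indicator \<Omega>0 p" for n p
  proof (cases "p \<in> \<Omega>0")
   case True
   have "norm (vfield \<Phi> p) * norm (Hd (dn n) p) \<le> B * Ch" using B Hd_bound[of "dn n" p] dn(1,2)[of n] by (intro mult_mono) auto
   then show ?thesis using True Cauchy_Schwarz_ineq2[of "vfield \<Phi> p" "Hd (dn n) p"] by simp
  qed (use Hd_outside[of "dn n" p] dn in simp)
  show "AE p in lborel. (\<lambda>n. vfield \<Phi> p \<bullet> Hd (dn n) p) \<longlonglongrightarrow> vfield \<Phi> p \<bullet> Hd 0 p"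
   using AE_not_graph[OF v(2)]
  proof eventually_elim
   case (elim p)
   have "(\<lambda>n. Hd (dn n) p) \<longlonglongrightarrow> Hd 0 p"
   proof (cases "p \<in> \<Omega>")
    case True
    then have "Hd (dn n) p = hg (dn n) p" for n using Omega_sub_Wd[of "dn n"] dn(1)[of n] by (auto simp: Hd_def)
    moreover have "Hd 0 p = hg 0 p" using True by (simp add: Hd_def Wd_0)
    moreover have "p \<in> \<Omega>0" using True Omega_sub_Wd[of 0] Wd_sub[of 0] by auto
    ultimately show ?thesis using hlim by simp
   next
    case False
    have "\<forall>\<^sub>F n in sequentially. p \<notin> Wd (dn n)"
    proof (cases "fst p \<in> D \<and> - H < snd p")
     case True
     then have "snd p - u (fst p) > 0" using False elim by (cases p) (auto simp: Omega1_def)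
     from order_tendstoD(2)[OF dn(3) this] show ?thesis
      by eventually_elim (auto simp: Wd_def Omega1_def split_beta)
    next
     case False
     then show ?thesis by (auto simp: Wd_def Omega1_def split_beta)
    qed
    then have "\<forall>\<^sub>F n in sequentially. Hd (dn n) p = 0" by eventually_elim (simp add: Hd_def)
    moreover have "Hd 0 p = 0" using False by (simp add: Hd_def Wd_0)
    ultimately show ?thesis by (simp add: tendsto_eventually)
   qed
   then show ?case by (intro tendsto_intros)
  qed
 qed
 moreover have "(\<lambda>n. LINT p|lborel. fn n p * divg \<Phi> p) \<longlonglongrightarrow> (LINT p|lborel. f p * divg \<Phi> p)"
  using sqint_inner_tendsto[OF f(1,2) divg_sqint[OF \<Phi>] f(3)] by simp
 moreover have "(\<lambda>n. 1 / (2 * dn n) * (LINT p|lborel. iwt (dn n) p * (norm (vfield \<Phi> p))\<^sup>2))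
   \<longlonglongrightarrow> 1 / 2 * (LINT x|lborel. indicator D x * (inverse (sg (x, 0)) * (norm (vfield \<Phi> (x, u x)))\<^sup>2))"
 proof -
  define K where "K n p = indicator (D \<times> {0<..<1}) p * (inverse (sg (fst p, dn n * snd p)) * (norm (vfield \<Phi> (fst p, u (fst p) + dn n * snd p)))\<^sup>2)" for n p
  define K0 where "K0 p = indicator (D \<times> {0<..<1::real}) p * (inverse (sg (fst p, 0)) * (norm (vfield \<Phi> (fst p, u (fst p))))\<^sup>2)" for p
  have [measurable]: "D \<times> {0<..<1::real} \<in> sets borel" by (rule borel_Times) auto
  have Km [measurable]: "K n \<in> BM" for n unfolding K_def by measurable
  have K0m [measurable]: "K0 \<in> BM" unfolding K0_def by measurable
  have sh: "1 / (2 * dn n) * (LINT p|lborel. iwt (dn n) p * (norm (vfield \<Phi> p))\<^sup>2) = 1 / 2 * (LINT p|lborel. K n p)" for n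
  proof -
   have "(LINT p|lborel. iwt (dn n) p * (norm (vfield \<Phi> p))\<^sup>2) = \<bar>dn n\<bar> *\<^sub>R (LINT p|lborel. iwt (dn n) (fst p, u (fst p) + dn n * snd p) * (norm (vfield \<Phi> (fst p, u (fst p) + dn n * snd p)))\<^sup>2)"
    by (rule integral_shear(1)) (use dn(1)[of n] in auto)
   also have "(LINT p|lborel. iwt (dn n) (fst p, u (fst p) + dn n * snd p) * (norm (vfield \<Phi> (fst p, u (fst p) + dn n * snd p)))\<^sup>2) = (LINT p|lborel. K n p)"
    using dn(1)[of n] by (intro integral_congr)
     (auto simp: K_def iwt_def Ud_def indicator_def zero_less_mult_iff mult_less_cancel_left1)
   finally show ?thesis using dn(1)[of n] by simp
  qed
  have "(\<lambda>n. LINT p|lborel. K n p) \<longlonglongrightarrow> (LINT p|lborel. K0 p)"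
  proof (rule integral_dominated_tendsto[OF K0m Km, where w="\<lambda>p. (1 / \<sigma>0 * B\<^sup>2) * indicator (D \<times> {0<..<1}) p"])
   show "integrable lborel (\<lambda>p. (1 / \<sigma>0 * B\<^sup>2) * indicator (D \<times> {0<..<1::real}) p)"
    by (rule integrable_indicator_bounded) (use D(2) in \<open>auto intro!: bounded_Times\<close>)
   show "\<bar>K n p\<bar> \<le> (1 / \<sigma>0 * B\<^sup>2) * indicator (D \<times> {0<..<1}) p" for n p
   proof (cases "p \<in> D \<times> {0<..<1}")
    case True
    then have "dn n * snd p \<in> {0..1}" using dn(1,2)[of n] by (auto intro: mult_le_one)
    then have s: "\<sigma>0 \<le> sg (fst p, dn n * snd p)" using sg_low[of "fst p"] True by auto
    then have "inverse (sg (fst p, dn n * snd p)) \<le> 1 / \<sigma>0" using le_imp_inverse_le[OF s \<sigma>(2)] by (simp add: inverse_eq_divide)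
    moreover have "(norm (vfield \<Phi> (fst p, u (fst p) + dn n * snd p)))\<^sup>2 \<le> B\<^sup>2" by (intro power_mono B) auto
    ultimately have "inverse (sg (fst p, dn n * snd p)) * (norm (vfield \<Phi> (fst p, u (fst p) + dn n * snd p)))\<^sup>2 \<le> 1 / \<sigma>0 * B\<^sup>2"
     using \<sigma>(2) by (intro mult_mono) auto
    moreover have "0 \<le> inverse (sg (fst p, dn n * snd p))" using s \<sigma>(2) by simp
    ultimately show ?thesis using True by (simp add: K_def)
   qed (simp add: K_def)
   show "AE p in lborel. (\<lambda>n. K n p) \<longlonglongrightarrow> K0 p"
   proof (intro always_eventually allI)
    fix p :: "'a \<times> real"
    show "(\<lambda>n. K n p) \<longlonglongrightarrow> K0 p"
    proof (cases "p \<in> D \<times> {0<..<1}")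
     case True
     have l: "(\<lambda>n. dn n * snd p) \<longlonglongrightarrow> 0" using tendsto_mult_left_zero[OF dn(3)] .
     have "(\<lambda>n. sg (fst p, dn n * snd p)) \<longlonglongrightarrow> sg (fst p, 0)"
      by (rule continuous_on_tendsto_compose[OF sg_cont l]) (use True dn in \<open>auto intro!: always_eventually mult_le_one mult_nonneg_nonneg less_imp_le[OF dn(1)]\<close>)
     moreover have "sg (fst p, 0) \<noteq> 0" using sg_low[of "fst p" 0] \<sigma>(2) True by auto
     moreover have "(\<lambda>n. vfield \<Phi> (fst p, u (fst p) + dn n * snd p)) \<longlonglongrightarrow> vfield \<Phi> (fst p, u (fst p) + 0)"
      by (rule continuous_on_tendsto_compose[OF vfield_continuous[OF \<Phi>, of UNIV] tendsto_Pair[OF tendsto_const tendsto_add[OF tendsto_const l]]]) auto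
     ultimately show ?thesis unfolding K_def K0_def by (intro tendsto_intros) auto
    qed (simp add: K_def K0_def)
   qed
  qed
  moreover have "(LINT p|lborel. K0 p) = (LINT x|lborel. indicator D x * (inverse (sg (x, 0)) * (norm (vfield \<Phi> (x, u x)))\<^sup>2))"
  proof -
   have "integrable lborel K0"
   proof (rule Bochner_Integration.integrable_bound[where f="\<lambda>p. (1 / \<sigma>0 * B\<^sup>2) * indicator (D \<times> {0<..<1::real}) p"])
    show "integrable lborel (\<lambda>p. (1 / \<sigma>0 * B\<^sup>2) * indicator (D \<times> {0<..<1::real}) p)"
     by (rule integrable_indicator_bounded) (use D(2) in \<open>auto intro!: bounded_Times\<close>)
    show "AE p in lborel. norm (K0 p) \<le> norm (1 / \<sigma>0 * B\<^sup>2 * indicator (D \<times> {0<..<1::real}) p)"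
    proof (intro always_eventually allI)
     fix p :: "'a \<times> real"
     show "norm (K0 p) \<le> norm (1 / \<sigma>0 * B\<^sup>2 * indicator (D \<times> {0<..<1::real}) p)"
     proof (cases "p \<in> D \<times> {0<..<1}")
      case True
      then have s: "\<sigma>0 \<le> sg (fst p, 0)" using sg_low[of "fst p" 0] by auto
      have "inverse (sg (fst p, 0)) * (norm (vfield \<Phi> (fst p, u (fst p))))\<^sup>2 \<le> 1 / \<sigma>0 * B\<^sup>2"
       using le_imp_inverse_le[OF s \<sigma>(2)] \<sigma>(2) by (intro mult_mono power_mono B) (auto simp: inverse_eq_divide)
      moreover have "0 \<le> inverse (sg (fst p, 0))" using s \<sigma>(2) by simp
      ultimately show ?thesis using True \<sigma>(2) by (simp add: K0_def)
     qed (simp add: K0_def)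
    qed
   qed simp
   from lborel_Fubini(1)[OF this] have "(LINT p|lborel. K0 p) = (LINT x|lborel. LINT z|lborel. K0 (x, z))" .
   also have "... = (LINT x|lborel. LINT z|lborel. indicator D x * (inverse (sg (x, 0)) * (norm (vfield \<Phi> (x, u x)))\<^sup>2) * indicator {0<..<1::real} z)"
    by (intro integral_congr) (auto simp: K0_def split: split_indicator)
   finally show ?thesis by simp
  qed
  ultimately have "(\<lambda>n. LINT p|lborel. K n p) \<longlonglongrightarrow> (LINT x|lborel. indicator D x * (inverse (sg (x, 0)) * (norm (vfield \<Phi> (x, u x)))\<^sup>2))"
   by simp
  then show ?thesis unfolding sh by (intro tendsto_intros)
 qed
 ultimately show ?thesis unfolding Jd_def J0_def by (intro tendsto_add tendsto_diff tendsto_minus tendsto_const)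
qed

end

context plate begin

definition bump :: "real => real" where "bump t = smooth_step (2 + t) * smooth_step (2 - t)"

lemma bump_simps: "bump 0 = 1" "2 \<le> \<bar>t\<bar> ==> bump t = 0" "0 \<le> bump t" "bump t \<le> 1"
proof -
 show "bump 0 = 1" by (simp add: bump_def smooth_step_1)
 show "2 \<le> \<bar>t\<bar> ==> bump t = 0" using smooth_step_0[of "2 + t"] smooth_step_0[of "2 - t"] by (cases "t \<ge> 0") (auto simp: bump_def)
 show "0 \<le> bump t" "bump t \<le> 1" by (auto simp: bump_def smooth_step_nonneg smooth_step_le_1 mult_le_one)
qed

lemma Cinf_bump: "Cinf bump UNIV"
proof -
 have "Cinf (\<lambda>t. 2 + t :: real) UNIV" "Cinf (\<lambda>t. 2 - t :: real) UNIV"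
  by (intro Cinf_add Cinf_diff Cinf_const Cinf_ident_real open_UNIV)+
 then have "Cinf (\<lambda>t. smooth_step (2 + t)) UNIV" "Cinf (\<lambda>t. smooth_step (2 - t)) UNIV"
  using Cinf_compose_real[OF open_UNIV open_UNIV _ _ Cinf_smooth_step, of "\<lambda>t. 2 + t"]
   Cinf_compose_real[OF open_UNIV open_UNIV _ _ Cinf_smooth_step, of "\<lambda>t. 2 - t"] by auto
 then show ?thesis unfolding bump_def[abs_def] by (intro Cinf_mult open_UNIV)
qed

text \<open>A cutoff to layers around the graph of thickness of order \<open>1/n\<close>, equal to one on the graph
itself.\<close>

definition lay :: "nat => 'a \<times> real => real" where
 "lay n p = bump (real (Suc n) * (4 / c) * (snd p - u (fst p)))"

lemma lay_outside: "c / 2 \<le> \<bar>snd p - u (fst p)\<bar> * real (Suc n) ==> lay n p = 0"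
proof -
 assume a: "c / 2 \<le> \<bar>snd p - u (fst p)\<bar> * real (Suc n)"
 have "2 = (4 / c) * (c / 2)" using c by simp
 also have "... \<le> (4 / c) * (\<bar>snd p - u (fst p)\<bar> * real (Suc n))" using a c by (intro mult_left_mono) auto
 also have "... = \<bar>real (Suc n) * (4 / c) * (snd p - u (fst p))\<bar>" using c by (simp add: abs_mult)
 finally show ?thesis unfolding lay_def by (rule bump_simps(2))
qed

lemma lay_graph: "lay n (x, u x) = 1" by (simp add: lay_def bump_simps)

lemma lay_measurable [measurable]: "lay n \<in> BM"
proof -
 have [measurable]: "bump \<in> BM" by (rule borel_measurable_continuous_onI[OF Cinf_continuous_on[OF Cinf_bump]])
 show ?thesis unfolding lay_def[abs_def] by measurable
qed

lemma lay_test: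
 assumes \<psi>: "\<psi> \<in> test_functions D"
 shows "(\<lambda>p. \<psi> (fst p) * lay n p) \<in> test_functions (D \<times> {-H<..})"
proof -
 have o: "open (D \<times> (UNIV :: real set))" using D by (simp add: open_Times)
 obtain K where K: "compact K" "K \<subseteq> D" "Cinf \<psi> UNIV" "\<And>x. x \<notin> K ==> \<psi> x = 0" using test_functionsE[OF \<psi>] by blast
 define k where "k = (\<lambda>(x, t). (x, u x + t)) ` (K \<times> {- (c / 2)..c / 2})"
 have ck: "compact k" unfolding k_def
 proof (rule compact_continuous_image)
  have "continuous_on (K \<times> {- (c / 2)..c / 2}) (\<lambda>p. (fst p, u (fst p) + snd p))"
   by (intro continuous_intros continuous_on_compose2[OF v_cont]) (use K(2) in auto)
  then show "continuous_on (K \<times> {- (c / 2)..c / 2}) (\<lambda>(x, t). (x, u x + t))" by (simp add: case_prod_beta')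
 qed (use K(1) in \<open>auto intro: compact_Times\<close>)
 have kW: "k \<subseteq> D \<times> {-H<..}"
 proof
  fix p assume "p \<in> k"
  then obtain x t where p: "p = (x, u x + t)" "x \<in> K" "- (c / 2) \<le> t" by (auto simp: k_def)
  then show "p \<in> D \<times> {-H<..}" using K(2) v_low[of x] c by auto
 qed
 have "Cinf (\<lambda>p. real (Suc n) * (4 / c) * (snd p - u (fst p))) (D \<times> UNIV)"
  by (intro Cinf_mult Cinf_diff Cinf_const o Cinf_fst[OF o v(1) D(1)] Cinf_linear[OF o bounded_linear_snd]) auto
 from Cinf_compose_real[OF o open_UNIV _ this Cinf_bump] have 1: "Cinf (lay n) (D \<times> UNIV)" unfolding lay_def[abs_def] by simp
 have 2: "Cinf (\<lambda>p. \<psi> (fst p)) (D \<times> (UNIV :: real set))" by (rule Cinf_fst[OF o K(3)]) auto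
 show ?thesis
 proof (rule test_functionsI[OF o Cinf_mult[OF o 2 1] ck _ kW])
  show "k \<subseteq> D \<times> UNIV" using kW by auto
  fix p assume p: "p \<notin> k"
  show "\<psi> (fst p) * lay n p = 0"
  proof (cases "fst p \<in> K")
   case True
   have "\<not> \<bar>snd p - u (fst p)\<bar> \<le> c / 2"
   proof
    assume a: "\<bar>snd p - u (fst p)\<bar> \<le> c / 2"
    have "p = (\<lambda>(x, t). (x, u x + t)) (fst p, snd p - u (fst p))" by simp
    moreover have "(fst p, snd p - u (fst p)) \<in> K \<times> {- (c / 2)..c / 2}" using True abs_le_D1[OF a] abs_le_D2[OF a] by (simp add: mem_Times_iff)
    ultimately have "p \<in> k" unfolding k_def by blast
    then show False using p by simp
   qed
   then have "c / 2 \<le> \<bar>snd p - u (fst p)\<bar> * real (Suc n)"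
    using mult_left_mono[of 1 "real (Suc n)" "\<bar>snd p - u (fst p)\<bar>"] by simp
   then show ?thesis by (simp add: lay_outside)
  qed (use K(4) in simp)
 qed
qed

text \<open>By Green's formula \<open>J0 f\<close> is the sum of a concave quadratic functional of \<open>\<Phi>\<close> in the
subgraph and another one of the values of \<open>\<Phi>\<close> on the graph.  Their maximisers are \<open>\<sigma>1 (g + Hd
0)\<close> and \<open>- \<sigma> \<tau> N\<close>.  Both are approximated by test fields; the one on the graph is multiplied by
\<open>lay n\<close>, so that its influence in the subgraph disappears as \<open>n\<close> grows.\<close>

lemma J0_sup:
 assumes sp: "sobolev_pair \<Omega> f g" and gr: "green_trace D H u f g \<tau>"
  and r: "r < energy0 (\<lambda>p. g p + Hd 0 p) \<tau>"
 shows "\<exists>\<Phi>. (\<forall>e. \<Phi> e \<in> test_functions (D \<times> {-H<..})) \<and> r < J0 f \<Phi>"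
proof -
 have s: "sqint f" "sqint g" by (rule sobolev_pair_sqint[OF sp])+
 have \<tau>: "sqint \<tau>" "\<And>x. x \<notin> D ==> \<tau> x = 0" using gr by (auto simp: green_trace_def)
 note [measurable] = sqint_measurable[OF \<tau>(1)]
 define a1 where "a1 p = g p + Hd 0 p" for p
 have a1: "sqint a1" unfolding a1_def by (intro sqint_add s Hd_sqint) auto
 have a1o: "a1 p = 0" if "p \<notin> \<Omega>" for p using sobolev_pair_outside[OF sp that] that by (simp add: a1_def Hd_def Wd_0)
 define b1 where "b1 p = indicator \<Omega> p / (2 * \<sigma>1)" for p :: "'a \<times> real"
 have b1: "b1 \<in> BM" "\<And>p. 0 \<le> b1 p" "\<And>p. b1 p \<le> 1 / (2 * \<sigma>1)"
  using \<sigma>(1) unfolding b1_def by (auto split: split_indicator)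
 define a2 where "a2 x = - \<tau> x *\<^sub>R gnormal D u x" for x
 have a2m: "a2 \<in> BM" unfolding a2_def by measurable
 have a2: "sqint a2"
 proof (rule sqint_bound(1)[OF \<tau>(1) a2m, of "L + 1"])
  show "AE x in lborel. norm (a2 x) \<le> (L + 1) * norm (\<tau> x)"
   using gnormal_bound by (auto simp: a2_def mult.commute intro!: always_eventually mult_left_mono)
 qed (use L in simp)
 define b2 where "b2 x = indicator D x * inverse (sg (x, 0)) / 2" for x
 have b2: "b2 \<in> BM" "\<And>x. 0 \<le> b2 x" "\<And>x. b2 x \<le> 1 / (2 * \<sigma>0)"
 proof -
  show "b2 \<in> BM" unfolding b2_def by measurable
  show "0 \<le> b2 x" "b2 x \<le> 1 / (2 * \<sigma>0)" for x
   using sg_low[of x 0] \<sigma>(2) le_imp_inverse_le[of \<sigma>0 "sg (x, 0)"] by (auto simp: b2_def inverse_eq_divide split: split_indicator)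
 qed
 define Q1 where "Q1 V = (LINT p|lborel. V p \<bullet> a1 p) - (LINT p|lborel. b1 p * (norm (V p))\<^sup>2)" for V
 define Q2 where "Q2 V = (LINT x|lborel. V x \<bullet> a2 x) - (LINT x|lborel. b2 x * (norm (V x))\<^sup>2)" for V
 have Jeq: "J0 f \<Phi> = Q1 (vfield \<Phi>) + Q2 (\<lambda>x. indicator D x *\<^sub>R vfield \<Phi> (x, u x))" if \<Phi>: "\<And>e. \<Phi> e \<in> test_functions (D \<times> {-H<..})" for \<Phi>
 proof -
  have V: "sqint (vfield \<Phi>)" by (rule vfield_sqint[OF \<Phi>])
  have "(LINT p|lborel. f p * divg \<Phi> p) + (LINT p|lborel. vfield \<Phi> p \<bullet> g p) = (LINT x|lborel. \<tau> x * (vfield \<Phi> (x, u x) \<bullet> gnormal D u x))"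
   by (rule green_vfield[OF gr s \<Phi> sqint_trace_test[OF \<Phi>]])
  moreover have "(LINT p|lborel. vfield \<Phi> p \<bullet> a1 p) = (LINT p|lborel. vfield \<Phi> p \<bullet> g p) + (LINT p|lborel. vfield \<Phi> p \<bullet> Hd 0 p)"
   using sqint_inner(1)[OF V s(2)] sqint_inner(1)[OF V Hd_sqint[of 0]] by (simp add: a1_def inner_add_right)
  moreover have "(LINT p|lborel. b1 p * (norm (vfield \<Phi> p))\<^sup>2) = 1 / (2 * \<sigma>1) * (LINT p|lborel. indicator \<Omega> p * (norm (vfield \<Phi> p))\<^sup>2)"
   by (simp add: b1_def)
  moreover have "(LINT x|lborel. (indicator D x *\<^sub>R vfield \<Phi> (x, u x)) \<bullet> a2 x) = - (LINT x|lborel. \<tau> x * (vfield \<Phi> (x, u x) \<bullet> gnormal D u x))"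
  proof -
   have "(LINT x|lborel. (indicator D x *\<^sub>R vfield \<Phi> (x, u x)) \<bullet> a2 x) = (LINT x|lborel. - (\<tau> x * (vfield \<Phi> (x, u x) \<bullet> gnormal D u x)))"
    by (intro integral_congr) (use \<tau>(2) in \<open>auto simp: a2_def split: split_indicator\<close>)
   then show ?thesis by simp
  qed
  moreover have "(LINT x|lborel. b2 x * (norm (indicator D x *\<^sub>R vfield \<Phi> (x, u x)))\<^sup>2) = 1 / 2 * (LINT x|lborel. indicator D x * (inverse (sg (x, 0)) * (norm (vfield \<Phi> (x, u x)))\<^sup>2))"
  proof -
   have "(LINT x|lborel. b2 x * (norm (indicator D x *\<^sub>R vfield \<Phi> (x, u x)))\<^sup>2) = (LINT x|lborel. 1 / 2 * (indicator D x * (inverse (sg (x, 0)) * (norm (vfield \<Phi> (x, u x)))\<^sup>2)))"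
    by (intro integral_congr) (auto simp: b2_def split: split_indicator)
   then show ?thesis by simp
  qed
  ultimately show ?thesis unfolding J0_def Q1_def Q2_def by simp
 qed
 have F1: "sqint (\<lambda>p. \<sigma>1 *\<^sub>R a1 p)" by (rule sqint_scale(1)[OF a1])
 obtain \<Phi>1 where \<Phi>1: "\<And>k e. \<Phi>1 k e \<in> test_functions \<Omega>" "(\<lambda>k. sqn (\<lambda>x. (\<Sum>e\<in>Basis. \<Phi>1 k e x *\<^sub>R e) - \<sigma>1 *\<^sub>R a1 x)) \<longlonglongrightarrow> 0"
  by (rule L2_density_vector[OF Omega_open F1]) (use a1o in simp, rule that)
 (* The pointwise maximisers of the two integrands. *)
 define F2 where "F2 x = - (indicator D x * (sg (x, 0) * \<tau> x)) *\<^sub>R gnormal D u x" for x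
 have F2m: "F2 \<in> BM" unfolding F2_def by measurable
 have F2: "sqint F2"
 proof (rule sqint_bound(1)[OF \<tau>(1) F2m, of "\<bar>\<sigma>C\<bar> * (L + 1)"])
  show "AE x in lborel. norm (F2 x) \<le> \<bar>\<sigma>C\<bar> * (L + 1) * norm (\<tau> x)"
  proof (intro always_eventually allI)
   fix x
   show "norm (F2 x) \<le> \<bar>\<sigma>C\<bar> * (L + 1) * norm (\<tau> x)"
   proof (cases "x \<in> D")
    case True
    have "\<bar>sg (x, 0)\<bar> \<le> \<bar>\<sigma>C\<bar>" using sg_low[OF True, of 0] sg_up[OF True, of 0] \<sigma>(2) by auto
    then have "\<bar>sg (x, 0)\<bar> * \<bar>\<tau> x\<bar> * norm (gnormal D u x) \<le> \<bar>\<sigma>C\<bar> * \<bar>\<tau> x\<bar> * (L + 1)"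
     using gnormal_bound[of x] by (intro mult_mono) auto
    then show ?thesis using True by (simp add: F2_def abs_mult mult_ac)
   qed (use L in \<open>simp add: F2_def\<close>)
  qed
 qed (use L in simp)
 obtain \<Psi> where \<Psi>: "\<And>k e. \<Psi> k e \<in> test_functions D" "(\<lambda>k. sqn (\<lambda>x. (\<Sum>e\<in>Basis. \<Psi> k e x *\<^sub>R e) - F2 x)) \<longlonglongrightarrow> 0"
  by (rule L2_density_vector[OF D(1) F2]) (simp add: F2_def, rule that)
 have v1: "sqint (vfield (\<Phi>1 k))" for k by (rule vfield_sqint[OF \<Phi>1(1)])
 have v2: "sqint (vfield (\<Psi> k))" for k by (rule vfield_sqint[OF \<Psi>(1)])
 have l1: "(\<lambda>k. Q1 (vfield (\<Phi>1 k))) \<longlonglongrightarrow> Q1 (\<lambda>p. \<sigma>1 *\<^sub>R a1 p)" unfolding Q1_def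
  by (rule quadratic_tendsto[OF v1 F1 _ a1 b1]) (use \<Phi>1(2) in \<open>simp add: vfield_def\<close>)
 have l2: "(\<lambda>k. Q2 (vfield (\<Psi> k))) \<longlonglongrightarrow> Q2 F2" unfolding Q2_def
  by (rule quadratic_tendsto[OF v2 F2 _ a2 b2]) (use \<Psi>(2) in \<open>simp add: vfield_def\<close>)
 have e1: "Q1 (\<lambda>p. \<sigma>1 *\<^sub>R a1 p) = \<sigma>1 / 2 * (LINT p|lborel. indicator \<Omega> p * (norm (a1 p))\<^sup>2)"
 proof -
  have "(LINT p|lborel. (\<sigma>1 *\<^sub>R a1 p) \<bullet> a1 p) = (LINT p|lborel. \<sigma>1 * (indicator \<Omega> p * (norm (a1 p))\<^sup>2))"
   by (intro integral_congr) (use a1o in \<open>auto simp: power2_norm_eq_inner split: split_indicator\<close>)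
  moreover have "(LINT p|lborel. b1 p * (norm (\<sigma>1 *\<^sub>R a1 p))\<^sup>2) = (LINT p|lborel. \<sigma>1 / 2 * (indicator \<Omega> p * (norm (a1 p))\<^sup>2))"
   by (intro integral_congr) (use \<sigma>(1) in \<open>auto simp: b1_def power_mult_distrib power2_eq_square split: split_indicator\<close>)
  ultimately show ?thesis by (simp add: Q1_def)
 qed
 have e2: "Q2 F2 = 1 / 2 * (LINT x|lborel. indicator D x * (sg (x, 0) * (\<tau> x)\<^sup>2 * (norm (gnormal D u x))\<^sup>2))"
 proof -
  let ?q = "\<lambda>x. indicator D x * (sg (x, 0) * (\<tau> x)\<^sup>2 * (norm (gnormal D u x))\<^sup>2)"
  have "(LINT x|lborel. F2 x \<bullet> a2 x) = (LINT x|lborel. ?q x)"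
   by (intro integral_congr) (auto simp: F2_def a2_def dot_square_norm power2_eq_square split: split_indicator)
  moreover have "(LINT x|lborel. b2 x * (norm (F2 x))\<^sup>2) = (LINT x|lborel. 1 / 2 * ?q x)"
  proof (intro integral_congr)
   fix x
   show "b2 x * (norm (F2 x))\<^sup>2 = 1 / 2 * ?q x"
   proof (cases "x \<in> D")
    case True
    then have "sg (x, 0) \<noteq> 0" using sg_low[of x 0] \<sigma>(2) by auto
    then show ?thesis using True by (simp add: b2_def F2_def power_mult_distrib power2_eq_square)
   qed (simp add: b2_def)
  qed
  ultimately show ?thesis by (simp add: Q2_def)
 qed
 have "(\<lambda>k. Q1 (vfield (\<Phi>1 k)) + Q2 (vfield (\<Psi> k))) \<longlonglongrightarrow> energy0 a1 \<tau>"
  using tendsto_add[OF l1 l2] unfolding e1 e2 energy0_def .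
 moreover have "r < energy0 a1 \<tau>" using r unfolding a1_def .
 ultimately have "\<forall>\<^sub>F k in sequentially. r < Q1 (vfield (\<Phi>1 k)) + Q2 (vfield (\<Psi> k))" by (rule order_tendstoD(1))
 from eventually_happens'[OF sequentially_bot this] obtain k where k: "r < Q1 (vfield (\<Phi>1 k)) + Q2 (vfield (\<Psi> k))" ..
 (* On the graph this equals the second approximation, as the first has compact support in the subgraph. *)
 define X where "X n e p = \<Phi>1 k e p + \<Psi> k e (fst p) * lay n p" for n e p
 have sub: "\<Omega> \<subseteq> D \<times> {-H<..}" by (rule Omega_sub)
 have X: "X n e \<in> test_functions (D \<times> {-H<..})" for n e
  unfolding X_def[abs_def] using test_functions_mono[OF sub] \<Phi>1(1)[of k e] by (intro test_functions_add lay_test \<Psi>(1)) auto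
 have Xv: "vfield (X n) p = vfield (\<Phi>1 k) p + lay n p *\<^sub>R vfield (\<Psi> k) (fst p)" for n p
  by (simp add: X_def vfield_def scaleR_add_left sum.distrib scaleR_sum_right mult.commute)
 have "\<exists>B\<ge>0. \<forall>p. norm (vfield (\<Psi> k) p) \<le> B" by (rule vfield_bounded[OF \<Psi>(1)])
 then obtain B where B: "B \<ge> 0" "\<And>p. norm (vfield (\<Psi> k) p) \<le> B" by blast
 have v2o: "vfield (\<Psi> k) x = 0" if "x \<notin> D" for x using test_function_outside[OF \<Psi>(1) that] by (simp add: vfield_def)
 have v1g: "vfield (\<Phi>1 k) (x, u x) = 0" for x
 proof -
  have "(x, u x) \<notin> \<Omega>" by (simp add: Omega1_def)
  then show ?thesis using test_function_outside[OF \<Phi>1(1)] by (simp add: vfield_def)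
 qed
 have trX: "indicator D x *\<^sub>R vfield (X n) (x, u x) = vfield (\<Psi> k) x" for n x
  using v2o by (auto simp: Xv v1g lay_graph split: split_indicator)
 have wsq: "sqint (\<lambda>p. indicator (D \<times> {- H<..<M + c}) p *\<^sub>R (B, 0::real))"
 proof (rule sqint_bounded_on[of "D \<times> {- H<..<M + c}" _ "norm (B, 0::real)"])
  show "bounded (D \<times> {- H<..<M + c})" by (intro bounded_Times D(2)) auto
  show "D \<times> {- H<..<M + c} \<in> sets borel" by (rule borel_Times) auto
  then show "(\<lambda>p. indicator (D \<times> {- H<..<M + c}) p *\<^sub>R (B, 0::real)) \<in> BM" by measurable
 qed (auto simp: zero_prod_def split: split_indicator)
 have nB: "norm (B, 0::real) = B" using B(1) by (simp add: norm_Pair)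
 have v2m: "(\<lambda>p. vfield (\<Psi> k) (fst p)) \<in> borel_measurable (borel :: ('a \<times> real) measure)"
  by (rule measurable_compose[OF fst_borel sqint_measurable[OF v2]])
 have laysm: "(\<lambda>p. lay n p *\<^sub>R vfield (\<Psi> k) (fst p)) \<in> BM" for n
  by (intro borel_measurable_scaleR lay_measurable v2m)
 have bdL: "norm (lay n p *\<^sub>R vfield (\<Psi> k) (fst p)) \<le> norm (indicator (D \<times> {- H<..<M + c}) p *\<^sub>R (B, 0::real))" for n p
 proof (cases "p \<in> D \<times> {- H<..<M + c}")
  case True
  have "lay n p * norm (vfield (\<Psi> k) (fst p)) \<le> 1 * B" using bump_simps(3,4) B by (intro mult_mono) (auto simp: lay_def)
  then show ?thesis using True bump_simps(3) nB by (simp add: lay_def)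
 next
  case False
  show ?thesis
  proof (cases "fst p \<in> D")
   case True
   then have "snd p \<le> - H \<or> M + c \<le> snd p" using False by (cases p) auto
   then have "c / 2 \<le> \<bar>snd p - u (fst p)\<bar>" using v_low[OF True] v_up[OF True] c by auto
   then have "c / 2 \<le> \<bar>snd p - u (fst p)\<bar> * real (Suc n)"
    using mult_left_mono[of 1 "real (Suc n)" "\<bar>snd p - u (fst p)\<bar>"] by simp
   then show ?thesis by (simp add: lay_outside)
  qed (simp add: v2o)
 qed
 have "(\<lambda>n. sqn (\<lambda>p. lay n p *\<^sub>R vfield (\<Psi> k) (fst p) - 0)) \<longlonglongrightarrow> 0"
 proof (rule sqn_dominated(3)[OF laysm _ wsq bdL])
  show "AE p in lborel. (\<lambda>n. lay n p *\<^sub>R vfield (\<Psi> k) (fst p)) \<longlonglongrightarrow> 0"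
   using AE_not_graph[OF v(2)]
  proof eventually_elim
   case (elim p)
   then have "\<bar>snd p - u (fst p)\<bar> > 0" by simp
   obtain m where m: "c / 2 / \<bar>snd p - u (fst p)\<bar> < real m" using reals_Archimedean2 by blast
   have "lay n p = 0" if "n \<ge> m" for n
   proof (rule lay_outside)
    have "c / 2 / \<bar>snd p - u (fst p)\<bar> \<le> real (Suc n)" using m that by simp
    then show "c / 2 \<le> \<bar>snd p - u (fst p)\<bar> * real (Suc n)" using \<open>\<bar>snd p - u (fst p)\<bar> > 0\<close> by (simp add: field_simps)
   qed
   then have "\<forall>\<^sub>F n in sequentially. lay n p *\<^sub>R vfield (\<Psi> k) (fst p) = 0" unfolding eventually_sequentially by auto
   then show ?case by (rule tendsto_eventually)
  qed
 qed simp
 then have "(\<lambda>n. sqn (\<lambda>p. vfield (X n) p - vfield (\<Phi>1 k) p)) \<longlonglongrightarrow> 0" by (simp add: Xv)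
 from quadratic_tendsto[OF vfield_sqint[OF X] v1 this a1 b1]
 have "(\<lambda>n. Q1 (vfield (X n))) \<longlonglongrightarrow> Q1 (vfield (\<Phi>1 k))" unfolding Q1_def .
 then have "(\<lambda>n. Q1 (vfield (X n)) + Q2 (vfield (\<Psi> k))) \<longlonglongrightarrow> Q1 (vfield (\<Phi>1 k)) + Q2 (vfield (\<Psi> k))" by (intro tendsto_intros)
 from eventually_happens'[OF sequentially_bot order_tendstoD(1)[OF this k]]
 obtain n where n: "r < Q1 (vfield (X n)) + Q2 (vfield (\<Psi> k))" ..
 have "r < J0 f (X n)" unfolding Jeq[OF X] trX by (rule n)
 then show ?thesis using X by blast
qed

lemma energy_liminf:
 assumes sp: "sobolev_pair \<Omega> f g" and gr: "green_trace D H u f g \<tau>"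
  and dn: "\<And>n. 0 < dn n" "\<And>n. dn n \<le> 1" "dn \<longlonglongrightarrow> 0"
  and spn: "\<And>n. sobolev_pair (Wd (dn n)) (fn n) (gn n)" "\<And>n. green_trace D H (\<lambda>x. u x + dn n) (fn n) (gn n) (\<lambda>x. 0)"
  and lim: "(\<lambda>n. sqn (\<lambda>p. fn n p - f p)) \<longlonglongrightarrow> 0"
  and r: "\<And>n. energy (dn n) (\<lambda>p. gn n p + Hd (dn n) p) \<le> r"
 shows "energy0 (\<lambda>p. g p + Hd 0 p) \<tau> \<le> r"
proof (rule ccontr)
 assume "\<not> ?thesis"
 then have "r < energy0 (\<lambda>p. g p + Hd 0 p) \<tau>" by simp
 from J0_sup[OF sp gr this] obtain \<Phi> where \<Phi>: "\<And>e. \<Phi> e \<in> test_functions (D \<times> {-H<..})" "r < J0 f \<Phi>" by blast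
 have l: "(\<lambda>n. Jd (dn n) (fn n) \<Phi>) \<longlonglongrightarrow> J0 f \<Phi>"
  by (rule J_limit[OF dn sobolev_pair_sqint(1)[OF spn(1)] sobolev_pair_sqint(1)[OF sp] lim \<Phi>(1)])
 have le: "Jd (dn n) (fn n) \<Phi> \<le> r" for n
  by (rule order_trans[OF energy_ge_Jd[OF dn(1,2) spn \<Phi>(1)] r])
 have "J0 f \<Phi> \<le> r" by (rule Lim_bounded[OF l, of 0]) (use le in simp)
 then show False using \<Phi>(2) by simp
qed

end

section \<open>The functionals as energies of representatives\<close>

text \<open>A boundary trace that vanishes almost everywhere on the surface vanishes almost everywhere over
\<open>D\<close>.\<close>

lemma (in graph_domain) zero_trace_green:
 assumes \<theta>: "\<theta> \<in> H1_zero_trace_on \<Omega> (frontier \<Omega>)"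
  and rep: "sobolev_pair \<Omega> f g" "AE p in lborel. p \<in> \<Omega> --> \<theta> p = f p"
 shows "green_trace D H v f g (\<lambda>x. 0)"
proof -
 obtain t where H1: "\<theta> \<in> H1 \<Omega>" and t: "has_boundary_trace \<Omega> \<theta> t"
  and tz: "AE p in surface_measure \<Omega>. p \<in> frontier \<Omega> --> t p = 0"
  using \<theta> unfolding H1_zero_trace_on_def by blast
 define \<tau> where "\<tau> = (\<lambda>x. if x \<in> D then t (x, v x) else 0)"
 have \<tau>: "sqint \<tau>" and gr: "green_trace D H v f g \<tau>"
  unfolding \<tau>_def by (rule trace_approximation[OF H1 t rep], assumption)+
 have tm: "t \<in> borel_measurable (surface_measure \<Omega>)" using t unfolding has_boundary_trace_def by auto
 have sets_fr: "frontier \<Omega> \<inter> space (hausdorff_measure DIM('a)) \<in> sets (hausdorff_measure DIM('a))" by simp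
 define t1 where "t1 p = indicator (frontier \<Omega>) p * t p" for p
 have t1m: "t1 \<in> BM"
  using tm borel_measurable_restrict_space_iff[OF sets_fr, of t] by (simp add: surface_measure_def t1_def[abs_def])
 have \<tau>eq: "\<tau> = (\<lambda>x. if x \<in> D then t1 (x, v x) else 0)"
  using graph_in_closure(2) by (auto simp: \<tau>_def t1_def fun_eq_iff)
 have "AE p in surface_measure \<Omega>. ennreal ((t1 p)\<^sup>2) = 0"
  using tz by eventually_elim (auto simp: t1_def split: split_indicator)
 then have "(\<integral>\<^sup>+p. ennreal ((t1 p)\<^sup>2) \<partial>surface_measure \<Omega>) = (\<integral>\<^sup>+p. 0 \<partial>surface_measure \<Omega>)"
  by (rule nn_integral_cong_AE)
 then have "(\<integral>\<^sup>+x. ennreal ((norm (\<tau> x))\<^sup>2) \<partial>lborel) = 0" using trace_L2_bound[OF t1m] by (simp add: \<tau>eq)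
 then have "ennreal (sqn \<tau>) = 0" using sqn_nn[OF \<tau>] by simp
 then have "sqn \<tau> = 0" using sqn_nonneg[of \<tau>] by (simp add: ennreal_eq_0_iff)
 note s = sobolev_pair_sqint[OF rep(1)]
 show ?thesis
  by (rule green_limit[OF s, where fk="\<lambda>_. f" and gk="\<lambda>_. g" and \<tau>k="\<lambda>_. \<tau>"])
   (use s gr \<open>sqn \<tau> = 0\<close> in \<open>simp_all add: sqn_def sqint_def\<close>)
qed

text \<open>The abstract data of the plate are tied to \<open>\<sigma>\<^sub>*\<close> and \<open>h\<close>.  Here
\<open>u\<close> is extended by zero, so that reflections make sense over the boundary of \<open>D\<close>; \<open>c \<le>
H\<close> keeps reflected points above the bottom there.\<close>

locale plate_functionals = plate D H c M L u \<sigma>1 \<sigma>0 \<sigma>C Ch sg hg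
 for D :: "'a::euclidean_space set" and H c M L u \<sigma>1 \<sigma>0 \<sigma>C Ch sg hg +
 fixes \<sigma>s :: "'a => real => real" and h :: "'a => real => real => real"
 assumes sg_eq: "\<And>x s. x \<in> D ==> s \<in> {0..1} ==> sg (x, s) = \<sigma>s x s"
  and h_der: "\<And>d p. 0 \<le> d ==> d \<le> 1 ==> p \<in> Omega0 D H M ==> (subst_boundary h (\<lambda>x. u x + d) has_derivative (\<lambda>e. hg d p \<bullet> e)) (at p)"
  and h_bd: "\<And>d p. 0 \<le> d ==> d \<le> 1 ==> p \<in> Omega0 D H M ==> \<bar>subst_boundary h (\<lambda>x. u x + d) p\<bar> \<le> Ch"
  and u_cont: "continuous_on UNIV u" and u_zero: "\<And>x. x \<notin> D ==> u x = 0" and cH: "c \<le> H"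
begin

lemma Omega_eq_Wd: "0 < d ==> Omega D H u d = Wd d"
 using v_low c by (force simp: Omega_def Omega1_def Omega2_def Sigma_graph_def Wd_def)

lemma Wd_bounded: "d \<le> 1 ==> bounded (Wd d)" by (rule bounded_subset[OF Omega0_bounded Wd_sub])

lemma weak_grad_total:
 assumes d: "0 \<le> d" "d \<le> 1" and sp: "sobolev_pair (Wd d) f g" and \<theta>: "AE p in lborel. p \<in> Wd d --> \<theta> p = f p"
 shows "AE p in lborel. p \<in> Wd d --> weak_grad (Wd d) (\<lambda>p. \<theta> p + subst_boundary h (\<lambda>x. u x + d) p) p = g p + Hd d p"
proof (rule weak_grad_AE[OF Wd_open[OF d(1)]])
 have sub: "Wd d \<subseteq> \<Omega>0" by (rule Wd_sub[OF d(2)])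
 have "sobolev_pair (Wd d) (\<lambda>p. indicator (Wd d) p * subst_boundary h (\<lambda>x. u x + d) p) (\<lambda>p. indicator (Wd d) p *\<^sub>R hg d p)"
  by (rule classical_sobolev_pair[OF Wd_open[OF d(1)] Wd_bounded[OF d(2)] _ continuous_on_subset[OF hg_cont[OF d] sub] _ _ Ch])
   (use sub h_der[OF d] h_bd[OF d] hg_bd[OF d] in auto)
 from sobolev_pair_add[OF sp this]
 have "sobolev_pair (Wd d) (\<lambda>p. f p + indicator (Wd d) p * subst_boundary h (\<lambda>x. u x + d) p) (\<lambda>p. g p + Hd d p)"
  by (simp add: Hd_def[abs_def])
 then show "has_weak_gradient (Wd d) (\<lambda>p. \<theta> p + subst_boundary h (\<lambda>x. u x + d) p) (\<lambda>p. g p + Hd d p)"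
  by (rule sobolev_pair_has_weak_gradient) (use \<theta> in \<open>eventually_elim, auto\<close>)
qed

lemma inner_integral:
 assumes W: "sqint W" and w: "AE p in lborel. p \<in> Wd d --> w p = W p" and d: "0 \<le> d" "d \<le> 1"
 shows "(LINT p:\<Omega>|lebesgue. (norm (w p))\<^sup>2) = (LINT p|lborel. indicator \<Omega> p * (norm (W p))\<^sup>2)"
proof (rule set_lebesgue_transfer(3))
 note [measurable] = sqint_measurable[OF W]
 show "AE p in lborel. p \<in> \<Omega> --> (norm (w p))\<^sup>2 = indicator \<Omega> p * (norm (W p))\<^sup>2"
  using w by eventually_elim (use Omega_sub_Wd[OF d(1)] in auto)
 show "(\<lambda>p. indicator \<Omega> p * (norm (W p))\<^sup>2) \<in> BM" by measurable
qed simp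

lemma layer_integral:
 assumes W: "sqint W" and w: "AE p in lborel. p \<in> Wd d --> w p = W p" and d: "0 < d" "d \<le> 1"
 shows "(LINT x:D|lebesgue. LINT z:{u x<..<u x + d}|lebesgue. \<sigma>s x (z - u x) * (norm (w (x, z)))\<^sup>2)
  = (LINT p|lborel. wt d p * (norm (W p))\<^sup>2)"
proof -
 note [measurable] = sqint_measurable[OF W]
 define K where "K p = wt d p * (norm (W p))\<^sup>2" for p
 have Km: "K \<in> BM" unfolding K_def by measurable
 have Ki: "integrable lborel K" unfolding K_def[abs_def]
  by (rule weighted_sqint(3)[OF W wt_m(1) wt_bounds(1,2)[OF d]])
 have Kz: "K (x, z) = 0" if "x \<notin> D \<or> z \<notin> {u x<..<u x + d}" for x z
  using that by (auto simp: K_def wt_def Ud_def)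
 have "(LINT x:D|lebesgue. LINT z:{u x<..<u x + d}|lebesgue. \<sigma>s x (z - u x) * (norm (w (x, z)))\<^sup>2)
  = (LINT x|lborel. LINT z|lborel. K (x, z))"
 proof (rule set_lebesgue_transfer(3))
  show "AE x in lborel. x \<in> D --> (LINT z:{u x<..<u x + d}|lebesgue. \<sigma>s x (z - u x) * (norm (w (x, z)))\<^sup>2) = (LINT z|lborel. K (x, z))"
   using AE_lborel_fst[OF w]
  proof (eventually_elim, intro impI)
   fix x assume ae: "AE z in lborel. (x, z) \<in> Wd d --> w (x, z) = W (x, z)" and x: "x \<in> D"
   show "(LINT z:{u x<..<u x + d}|lebesgue. \<sigma>s x (z - u x) * (norm (w (x, z)))\<^sup>2) = (LINT z|lborel. K (x, z))"
   proof (rule set_lebesgue_transfer(3))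
    show "AE z in lborel. z \<in> {u x<..<u x + d} --> \<sigma>s x (z - u x) * (norm (w (x, z)))\<^sup>2 = K (x, z)"
     using ae
    proof (eventually_elim, intro impI)
     fix z assume e: "(x, z) \<in> Wd d --> w (x, z) = W (x, z)" and z: "z \<in> {u x<..<u x + d}"
     have "(x, z) \<in> Wd d" using x z v_low[OF x] c by (auto simp: Wd_def Omega1_def)
     moreover have "sg (x, z - u x) = \<sigma>s x (z - u x)" by (rule sg_eq[OF x]) (use z d in auto)
     ultimately show "\<sigma>s x (z - u x) * (norm (w (x, z)))\<^sup>2 = K (x, z)"
      using e x z by (simp add: K_def wt_def Ud_def)
    qed
    show "(\<lambda>z. K (x, z)) \<in> BM" by (rule section_measurable[OF Km])
   qed (use Kz in blast)
  qed
  show "(\<lambda>x. LINT z|lborel. K (x, z)) \<in> BM"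
   using borel_measurable_integrable[OF lborel_Fubini(2)[OF Ki]] by simp
 qed (simp add: Kz)
 also have "... = (LINT p|lborel. K p)" by (rule lborel_Fubini(1)[OF Ki, symmetric])
 finally show ?thesis by (simp add: K_def)
qed

lemma G_eq_energy:
 assumes d: "0 < d" "d \<le> 1" and sp: "sobolev_pair (Wd d) f g" and \<theta>: "AE p in lborel. p \<in> Wd d --> \<theta> p = f p"
  and mem: "\<theta> \<in> extended_by_zero \<Omega>0 (Omega D H u d) (H10 D H u d)"
 shows "G D H M \<sigma>1 \<sigma>s h u d \<theta> = ereal (energy d (\<lambda>p. g p + Hd d p))"
proof -
 have d0: "0 \<le> d" using d by simp
 have W: "sqint (\<lambda>p. g p + Hd d p)" by (intro sqint_add sobolev_pair_sqint(2)[OF sp] Hd_sqint d0 d)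
 note wg = weak_grad_total[OF d0 d(2) sp \<theta>]
 show ?thesis using mem unfolding G_def Let_def energy_def Omega_eq_Wd[OF d(1)]
  by (simp add: inner_integral[OF W wg d0 d(2)] layer_integral[OF W wg d])
qed

lemma G0_eq_energy:
 assumes sp: "sobolev_pair \<Omega> f g" and \<theta>: "AE p in lborel. p \<in> \<Omega> --> \<theta> p = f p"
  and mem: "\<theta> \<in> extended_by_zero \<Omega>0 \<Omega> (HB1 D H u)" and t: "boundary_trace \<Omega> \<theta> = t"
  and \<tau>: "sqint (\<lambda>x. if x \<in> D then t (x, u x) else 0)"
 shows "G0 D H M \<sigma>1 \<sigma>s h u \<theta> = ereal (energy0 (\<lambda>p. g p + Hd 0 p) (\<lambda>x. if x \<in> D then t (x, u x) else 0))"
proof -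
 note [measurable] = sqint_measurable[OF \<tau>]
 have W: "sqint (\<lambda>p. g p + Hd 0 p)" by (intro sqint_add sobolev_pair_sqint(2)[OF sp] Hd_sqint) auto
 have wg: "AE p in lborel. p \<in> Wd 0 --> weak_grad \<Omega> (\<lambda>p. \<theta> p + subst_boundary h u p) p = g p + Hd 0 p"
  using weak_grad_total[of 0 f g \<theta>] sp \<theta> unfolding Wd_0 by simp
 have 1: "(LINT p:\<Omega>|lebesgue. (norm (weak_grad \<Omega> (\<lambda>p. \<theta> p + subst_boundary h u p) p))\<^sup>2) = (LINT p|lborel. indicator \<Omega> p * (norm (g p + Hd 0 p))\<^sup>2)"
  by (rule inner_integral[OF W wg]) auto
 have 2: "(LINT x:D|lebesgue. \<sigma>s x 0 * (t (x, u x))\<^sup>2 * (1 + (norm (gradient u x))\<^sup>2))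
  = (LINT x|lborel. indicator D x * (sg (x, 0) * (if x \<in> D then t (x, u x) else 0)\<^sup>2 * (norm (gnormal D u x))\<^sup>2))"
 proof (rule set_lebesgue_transfer(3))
  show "AE x in lborel. x \<in> D --> \<sigma>s x 0 * (t (x, u x))\<^sup>2 * (1 + (norm (gradient u x))\<^sup>2) =
    indicator D x * (sg (x, 0) * (if x \<in> D then t (x, u x) else 0)\<^sup>2 * (norm (gnormal D u x))\<^sup>2)"
   using sg_eq[of _ 0] by (auto simp: gnormal_def norm_Pair add.commute)
  show "(\<lambda>x. indicator D x * (sg (x, 0) * (if x \<in> D then t (x, u x) else 0)\<^sup>2 * (norm (gnormal D u x))\<^sup>2)) \<in> BM"
   by measurable
 qed simp
 show ?thesis using mem unfolding G0_def Let_def energy0_def by (simp add: 1 2[symmetric] t)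
qed

end

lemma weak_grad_cong:
 assumes "\<And>x. x \<in> S ==> f x = f' x" shows "weak_grad S f = weak_grad S f'"
proof -
 have "has_weak_gradient S f g = has_weak_gradient S f' g" for g
 proof -
  have "set_integrable lebesgue K f = set_integrable lebesgue K f'" if "K \<subseteq> S" for K
   unfolding set_integrable_def by (rule Bochner_Integration.integrable_cong) (use assms that in \<open>auto split: split_indicator\<close>)
  moreover have "(LINT x:S|lebesgue. f x *\<^sub>R gradient \<phi> x) = (LINT x:S|lebesgue. f' x *\<^sub>R gradient \<phi> x)" for \<phi>
   unfolding set_lebesgue_integral_def by (rule Bochner_Integration.integral_cong) (use assms in \<open>auto split: split_indicator\<close>)
  ultimately show ?thesis unfolding has_weak_gradient_def by (simp cong: conj_cong)
 qed
 then show ?thesis unfolding weak_grad_def by presburger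
qed

lemma gradient_cong:
 assumes "open S" "x \<in> S" "\<And>y. y \<in> S ==> f y = f' y" shows "gradient f x = gradient f' x"
proof -
 have "(GDERIV f x :> g) = (GDERIV f' x :> g)" for g
  unfolding gderiv_def using has_derivative_transform_within_open[OF _ assms(1,2), of f _ UNIV f']
   has_derivative_transform_within_open[OF _ assms(1,2), of f' _ UNIV f] assms(3) by auto
 then show ?thesis unfolding gradient_def by presburger
qed

text \<open>Replacing \<open>u\<close> by its extension by zero, which is continuous everywhere, changes none of the spaces and
functionals.\<close>

lemma functionals_cong:
 assumes D: "open D" and eq: "\<And>x. x \<in> D ==> u x = u' x"
 shows "Omega1 D H u = Omega1 D H u'" "HB1 D H u = HB1 D H u'" "G D H M \<sigma>1 \<sigma>s h u = G D H M \<sigma>1 \<sigma>s h u'" "G0 D H M \<sigma>1 \<sigma>s h u = G0 D H M \<sigma>1 \<sigma>s h u'"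
proof -
 have O1: "Omega1 D H u = Omega1 D H u'" using eq by (auto simp: Omega1_def)
 have S: "Sigma_graph D u = Sigma_graph D u'" using eq by (auto simp: Sigma_graph_def)
 have O: "Omega D H u = Omega D H u'" using eq O1 S by (auto simp: Omega_def Omega2_def fun_eq_iff)
 have HB: "HB1 D H u = HB1 D H u'" unfolding HB1_def O1 S ..
 have H10: "H10 D H u = H10 D H u'" by (simp add: H10_def[abs_def] O)
 have wd: "weak_grad (Omega D H u' d) (\<lambda>p. \<theta> p + subst_boundary h (\<lambda>x. u x + d) p) = weak_grad (Omega D H u' d) (\<lambda>p. \<theta> p + subst_boundary h (\<lambda>x. u' x + d) p)" for d \<theta>
  by (rule weak_grad_cong) (use eq in \<open>auto simp: subst_boundary_def Omega_def Omega1_def Omega2_def Sigma_graph_def\<close>)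
 have w0: "weak_grad (Omega1 D H u') (\<lambda>p. \<theta> p + subst_boundary h u p) = weak_grad (Omega1 D H u') (\<lambda>p. \<theta> p + subst_boundary h u' p)" for \<theta>
  by (rule weak_grad_cong) (use eq in \<open>auto simp: subst_boundary_def Omega1_def\<close>)
 have gr: "gradient u x = gradient u' x" if "x \<in> D" for x by (rule gradient_cong[OF D that eq])
 have i: "(LINT x:D|lebesgue. q x) = (LINT x:D|lebesgue. q' x)" if "\<And>x. x \<in> D ==> q x = q' x" for q q' :: "'a => real"
  unfolding set_lebesgue_integral_def by (rule Bochner_Integration.integral_cong) (use that in \<open>auto split: split_indicator\<close>)
 show "Omega1 D H u = Omega1 D H u'" "HB1 D H u = HB1 D H u'" by (rule O1, rule HB)
 have i1: "(LINT x:D|lebesgue. LINT z:{u x<..<u x + d}|lebesgue. \<sigma>s x (z - u x) * (norm (w (x, z)))\<^sup>2)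
  = (LINT x:D|lebesgue. LINT z:{u' x<..<u' x + d}|lebesgue. \<sigma>s x (z - u' x) * (norm (w (x, z)))\<^sup>2)" for d and w :: "'a \<times> real => 'a \<times> real"
  by (rule i) (simp add: eq)
 have i0: "(LINT x:D|lebesgue. \<sigma>s x 0 * (t (x, u x))\<^sup>2 * (1 + (norm (gradient u x))\<^sup>2))
  = (LINT x:D|lebesgue. \<sigma>s x 0 * (t (x, u' x))\<^sup>2 * (1 + (norm (gradient u' x))\<^sup>2))" for t :: "'a \<times> real => real"
  by (rule i) (simp add: eq gr)
 show "G D H M \<sigma>1 \<sigma>s h u = G D H M \<sigma>1 \<sigma>s h u'"
  by (intro ext) (simp only: G_def Let_def O O1 H10 wd i1)
 show "G0 D H M \<sigma>1 \<sigma>s h u = G0 D H M \<sigma>1 \<sigma>s h u'"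
  by (intro ext) (simp only: G0_def Let_def O1 HB w0 i0)
qed

section \<open>The recovery family\<close>

context plate_functionals begin

abbreviation "fE d \<equiv> reflection_domain.fU D u d"
abbreviation "gE d \<equiv> reflection_domain.gU D u d"

lemma reflect: "0 < d ==> d < c ==> reflection_domain D H c M L u d"
 by unfold_locales (use u_cont u_zero cH in auto)

text \<open>In the coordinates \<open>(x, s)\<close> with \<open>z = u(x) + d s\<close> the rescaled field \<open>d W\<close>
converges in \<open>L\<^sub>2\<close> to \<open>- \<tau> N\<close>.  The difference consists of the reflected gradient, the
difference quotient from \<open>strip_estimate\<close> and the boundary datum, each of order \<open>d\<close> in
\<open>L\<^sub>2\<close> of the layer and therefore of order \<open>\<surd>d\<close> after rescaling, and of the variation of the
permittivity across the layer.\<close>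

lemma recovery_energy:
 assumes sp: "sobolev_pair \<Omega> f g" and \<tau>: "sqint \<tau>" "\<And>x. x \<notin> D ==> \<tau> x = 0"
  and st: "\<And>d. 0 < d ==> d < c ==> sqint (strip f \<tau> d) \<and> sqn (strip f \<tau> d) \<le> 4 * d\<^sup>2 * sqn g"
  and dn: "\<And>n. 0 < dn n" "\<And>n. dn n \<le> 1" "\<And>n. dn n < c" "dn \<longlonglongrightarrow> 0"
 shows "(\<lambda>n. energy (dn n) (\<lambda>p. g p + gE (dn n) f g p + Hd (dn n) p)) \<longlonglongrightarrow> energy0 (\<lambda>p. g p + Hd 0 p) \<tau>"
proof -
 note s = sobolev_pair_sqint[OF sp]
 note [measurable] = sqint_measurable[OF s(1)] sqint_measurable[OF s(2)] sqint_measurable[OF \<tau>(1)]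
 have dn0: "0 \<le> dn n" for n using dn(1)[of n] by simp
 define W where "W n p = g p + gE (dn n) f g p + Hd (dn n) p" for n p
 have Ws: "sqint (W n)" for n unfolding W_def[abs_def]
  by (intro sqint_add s(2) reflection_domain.gU_sqint(1)[OF reflect[OF dn(1,3)] s] Hd_sqint dn0 dn(2))
 note [measurable] = sqint_measurable[OF Ws]
 have Hm [measurable]: "Hd (dn n) \<in> BM" "Hd 0 \<in> BM" for n
  using Hd_borel[OF dn0 dn(2)] Hd_borel[of 0] by auto
 define wH where "wH p = indicator \<Omega>0 p *\<^sub>R (2 * Ch)" for p
 have wH: "sqint wH"
  by (rule sqint_bounded_on[OF Omega0_bounded Omega0_borel, of _ "2 * Ch"]) (use Ch in \<open>auto simp: wH_def[abs_def] split: split_indicator\<close>)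
 have 1: "(\<lambda>n. LINT p|lborel. indicator \<Omega> p * (norm (W n p))\<^sup>2) \<longlonglongrightarrow> (LINT p|lborel. indicator \<Omega> p * (norm (g p + Hd 0 p))\<^sup>2)"
 proof -
  define A where "A n p = indicator \<Omega> p *\<^sub>R (g p + Hd (dn n) p)" for n p
  define A0 where "A0 p = indicator \<Omega> p *\<^sub>R (g p + Hd 0 p)" for p
  have A: "sqint (A n)" "sqint A0" for n
  proof -
   have ind: "sqint (\<lambda>p. indicator \<Omega> p *\<^sub>R q p)" if "sqint q" for q :: "'a \<times> real => 'a \<times> real"
   proof (rule sqint_bound(1)[OF that])
    note [measurable] = sqint_measurable[OF that]
    show "(\<lambda>p. indicator \<Omega> p *\<^sub>R q p) \<in> BM" by measurable
    show "AE p in lborel. norm (indicator \<Omega> p *\<^sub>R q p) \<le> 1 * norm (q p)" by (auto split: split_indicator)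
   qed simp
   show "sqint (A n)" "sqint A0" unfolding A_def[abs_def] A0_def[abs_def]
    by (intro ind sqint_add s(2) Hd_sqint dn0 dn(2); simp)+
  qed
  define \<delta> where "\<delta> n p = indicator \<Omega> p *\<^sub>R (Hd (dn n) p - Hd 0 p)" for n p
  have \<delta>m: "\<delta> n \<in> BM" for n unfolding \<delta>_def[abs_def] by measurable
  have \<delta>b: "norm (\<delta> n p) \<le> norm (wH p)" for n p
  proof (cases "p \<in> \<Omega>")
   case True
   then have "p \<in> \<Omega>0" using Omega_sub_Wd[of 0] Wd_sub[of 0] by auto
   moreover have "norm (Hd (dn n) p - Hd 0 p) \<le> Ch + Ch"
    by (rule norm_triangle_le_diff[OF add_mono[OF Hd_bound Hd_bound]]) (use dn0 dn(2) in auto)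
   ultimately show ?thesis using True Ch by (simp add: \<delta>_def wH_def)
  qed (simp add: \<delta>_def)
  have "(\<lambda>n. \<delta> n p) \<longlonglongrightarrow> 0" for p
  proof (cases "p \<in> \<Omega>")
   case True
   then have p: "p \<in> \<Omega>0" using Omega_sub_Wd[of 0] Wd_sub[of 0] by auto
   have e: "\<delta> n p = hg (dn n) p - hg 0 p" for n
    using True Omega_sub_Wd[OF dn0[of n]] by (auto simp: \<delta>_def Hd_def Wd_0)
   show ?thesis
   proof (rule LIMSEQ_I)
    fix \<epsilon> :: real assume "0 < \<epsilon>"
    from hg_lim[OF this] obtain \<delta>' where \<delta>': "\<delta>' > 0"
     "\<And>d p. 0 \<le> d ==> d \<le> 1 ==> d < \<delta>' ==> p \<in> \<Omega>0 ==> norm (hg d p - hg 0 p) < \<epsilon>" by blast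
    from order_tendstoD(2)[OF dn(4) \<delta>'(1)] obtain N where "\<And>n. n \<ge> N ==> dn n < \<delta>'" unfolding eventually_sequentially by blast
    then show "\<exists>N. \<forall>n\<ge>N. norm (\<delta> n p - 0) < \<epsilon>" using \<delta>'(2)[OF dn0 dn(2) _ p] unfolding e by auto
   qed
  qed (simp add: \<delta>_def)
  then have "(\<lambda>n. sqn (\<lambda>p. \<delta> n p - 0)) \<longlonglongrightarrow> 0"
   by (intro sqn_dominated(3)[OF \<delta>m _ wH \<delta>b]) auto
  moreover have "\<delta> n p - 0 = A n p - A0 p" for n p by (simp add: \<delta>_def A_def A0_def split: split_indicator)
  ultimately have "(\<lambda>n. sqn (\<lambda>p. A n p - A0 p)) \<longlonglongrightarrow> 0" by simp
  from sqn_tendsto[OF A this] have "(\<lambda>n. sqn (A n)) \<longlonglongrightarrow> sqn A0" .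
  moreover have "sqn (A n) = (LINT p|lborel. indicator \<Omega> p * (norm (W n p))\<^sup>2)" for n
   unfolding sqn_def
  proof (intro integral_congr)
   fix p
   have "gE (dn n) f g p = 0" if "p \<in> \<Omega>"
    using that by (auto simp: reflection_domain.gU_def[OF reflect[OF dn(1,3)]] reflection_domain.U_def[OF reflect[OF dn(1,3)]] Omega1_def)
   then show "(norm (A n p))\<^sup>2 = indicator \<Omega> p * (norm (W n p))\<^sup>2" by (auto simp: A_def W_def split: split_indicator)
  qed
  moreover have "sqn A0 = (LINT p|lborel. indicator \<Omega> p * (norm (g p + Hd 0 p))\<^sup>2)"
   unfolding sqn_def by (intro integral_congr) (auto simp: A0_def split: split_indicator)
  ultimately show ?thesis by simp
 qed
 define E where "E = D \<times> {0<..<1::real}"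
 have [measurable]: "E \<in> sets borel" unfolding E_def by (rule borel_Times) auto
 let ?C = "max \<sigma>C 0"
 have dE: "dn n * snd p \<in> {0..1}" "0 < dn n * snd p" "dn n * snd p < dn n" "fst p \<in> D" if "p \<in> E" for n p
  using that dn(1,2)[of n] by (auto simp: E_def intro: mult_le_one)
 have sgE: "0 < sg (fst p, dn n * snd p)" "sg (fst p, dn n * snd p) \<le> ?C" "0 < sg (fst p, 0)" "sg (fst p, 0) \<le> ?C" if "p \<in> E" for n p
  using sg_low[OF dE(4)[OF that] dE(1)[OF that, of n]] sg_up[OF dE(4)[OF that] dE(1)[OF that, of n]]
   sg_low[OF dE(4)[OF that], of 0] sg_up[OF dE(4)[OF that], of 0] \<sigma>(2) by auto
 define sh where "sh n p = (fst p, u (fst p) + dn n * snd p)" for n and p :: "'a \<times> real"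
 have [measurable]: "sh n \<in> BM" for n unfolding sh_def by measurable
 (* \<open>V n\<close> is the rescaled field with the square root of the weight, \<open>V'\<close> its limit, \<open>R n\<close> the remainder. *)
 define V where "V n p = indicator E p *\<^sub>R (sqrt (sg (fst p, dn n * snd p)) *\<^sub>R (dn n *\<^sub>R W n (sh n p)))" for n p
 define V' where "V' p = indicator E p *\<^sub>R (sqrt (sg (fst p, 0)) *\<^sub>R (- \<tau> (fst p) *\<^sub>R gnormal D u (fst p)))" for p
 define S where "S n p = strip f \<tau> (dn n) (fst p, - u (fst p) + 1 * snd p)" for n p
 define R1 where "R1 n p = indicator (Ud (dn n)) p *\<^sub>R (reflection_domain.taper u (dn n) p *\<^sub>R reflection_domain.Brefl D u (fst p) (g (fst p, 2 * u (fst p) + (-1) * snd p)))" for n p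
 define R where "R n p = dn n *\<^sub>R R1 n p - S n p *\<^sub>R gnormal D u (fst p) + dn n *\<^sub>R Hd (dn n) p" for n p
 define a where "a n p = indicator E p *\<^sub>R ((sqrt (sg (fst p, dn n * snd p)) - sqrt (sg (fst p, 0))) *\<^sub>R (- \<tau> (fst p) *\<^sub>R gnormal D u (fst p)))" for n p
 define b where "b n p = indicator E p *\<^sub>R (sqrt (sg (fst p, dn n * snd p)) *\<^sub>R R n (sh n p))" for n p
 have VV: "V n p - V' p = a n p + b n p" for n p
 proof (cases "p \<in> E")
  case True
  interpret R: reflection_domain D H c M L u "dn n" by (rule reflect[OF dn(1,3)])
  obtain x s where p: "p = (x, s)" by (cases p)
  have x: "x \<in> D" "0 < dn n * s" "dn n * s < dn n" using dE[OF True] p by auto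
  have q: "sh n p = (x, u x + dn n * s)" by (simp add: sh_def p)
  have U: "(x, u x + dn n * s) \<in> R.U" "(x, u x + dn n * s) \<in> Ud (dn n)" using x by (auto simp: R.U_def Ud_def)
  have "(x, u x + dn n * s) \<notin> \<Omega>" using x(2) by (simp add: Omega1_def)
  then have g0: "g (x, u x + dn n * s) = 0" using sobolev_pair_outside[OF sp] by blast
  have S: "S n (x, u x + dn n * s) = f (x, u x - dn n * s) - \<tau> x" using x by (simp add: S_def strip_def)
  have R1q: "R1 n (x, u x + dn n * s) = R.taper (x, u x + dn n * s) *\<^sub>R R.Brefl x (g (x, u x - dn n * s))"
   using U by (simp add: R1_def algebra_simps)
  have Rq: "R n (sh n p) = dn n *\<^sub>R (R.taper (sh n p) *\<^sub>R R.Brefl x (g (x, u x - dn n * s))) - (f (x, u x - dn n * s) - \<tau> x) *\<^sub>R gnormal D u x + dn n *\<^sub>R Hd (dn n) (sh n p)"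
   by (simp add: q R_def R1q S)
  have "dn n *\<^sub>R W n (sh n p) = - \<tau> x *\<^sub>R gnormal D u x + R n (sh n p)"
   unfolding Rq using dn(1)[of n] U by (simp add: q W_def g0 R.gU_def R.T_def scaleR_add_right scaleR_diff_right scaleR_diff_left)
  then have "V n p - V' p = sqrt (sg (x, dn n * s)) *\<^sub>R (- \<tau> x *\<^sub>R gnormal D u x + R n (sh n p)) - sqrt (sg (x, 0)) *\<^sub>R (- \<tau> x *\<^sub>R gnormal D u x)"
   using True by (simp add: V_def V'_def p)
  also have "... = a n p + b n p" using True by (simp add: a_def b_def p scaleR_add_right scaleR_diff_right scaleR_diff_left left_diff_distrib)
  finally show ?thesis .
 qed (simp add: V_def V'_def a_def b_def)
 have S: "sqint (S n)" "sqn (S n) \<le> 4 * (dn n)\<^sup>2 * sqn g" for n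
  using sqint_shear[where w="\<lambda>x. - u x" and c=1 and f="strip f \<tau> (dn n)"] st[OF dn(1,3), of n] unfolding S_def by auto
 have Hs: "sqint (Hd (dn n))" "sqn (Hd (dn n)) \<le> 1\<^sup>2 * sqn wH" for n
 proof -
  have "norm (Hd (dn n) p) \<le> 1 * norm (wH p)" for p
  proof (cases "p \<in> \<Omega>0")
   case True
   then have "norm (wH p) = 2 * Ch" using Ch by (simp add: wH_def)
   then show ?thesis using Hd_bound[OF dn0 dn(2), of n p] Ch by simp
  qed (simp add: Hd_outside[OF dn(2)])
  then have "AE p in lborel. norm (Hd (dn n) p) \<le> 1 * norm (wH p)" by simp
  from sqint_bound[OF wH Hm(1) this] show "sqint (Hd (dn n))" "sqn (Hd (dn n)) \<le> 1\<^sup>2 * sqn wH" by simp_all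
 qed
 have R1: "sqint (R1 n)" "sqn (R1 n) \<le> (2 * L + 4)\<^sup>2 * sqn g" for n
 proof -
  interpret R: reflection_domain D H c M L u "dn n" by (rule reflect[OF dn(1,3)])
  have gT: "sqint (\<lambda>p. g (fst p, 2 * u (fst p) + (-1) * snd p))" "sqn (\<lambda>p. g (fst p, 2 * u (fst p) + (-1) * snd p)) = sqn g"
   using sqint_shear[OF s(2), where w="\<lambda>x. 2 * u x" and c="-1"] by auto
  note [measurable] = sqint_measurable[OF gT(1)]
  have m: "R1 n \<in> BM" unfolding R1_def[abs_def]
   by (intro borel_measurable_scaleR R.Brefl_borel sqint_measurable[OF gT(1)] R.taper_borel borel_measurable_indicator Ud_borel)
  have "norm (R1 n p) \<le> (2 * L + 4) * norm (g (fst p, 2 * u (fst p) + (-1) * snd p))" for p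
  proof (cases "p \<in> Ud (dn n)")
   case True
   then have "p \<in> R.U" by (simp add: R.U_def Ud_def)
   then have "\<bar>R.taper p\<bar> \<le> 1" using R.U_taper[of p] by auto
   then have "\<bar>R.taper p\<bar> * norm (R.Brefl (fst p) (g (fst p, 2 * u (fst p) + (-1) * snd p))) \<le> 1 * ((2 * L + 4) * norm (g (fst p, 2 * u (fst p) + (-1) * snd p)))"
    using L by (intro mult_mono R.Brefl_bound) auto
   then show ?thesis using True by (simp add: R1_def)
  qed (use L in \<open>simp add: R1_def\<close>)
  then have "AE p in lborel. norm (R1 n p) \<le> (2 * L + 4) * norm (g (fst p, 2 * u (fst p) + (-1) * snd p))" by simp
  from sqint_bound[OF gT(1) m this] gT(2) L show "sqint (R1 n)" "sqn (R1 n) \<le> (2 * L + 4)\<^sup>2 * sqn g" by auto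
 qed
 have SN: "sqint (\<lambda>p. S n p *\<^sub>R gnormal D u (fst p))" "sqn (\<lambda>p. S n p *\<^sub>R gnormal D u (fst p)) \<le> (L + 1)\<^sup>2 * sqn (S n)" for n
 proof -
  have m: "(\<lambda>p. S n p *\<^sub>R gnormal D u (fst p)) \<in> BM"
   by (intro borel_measurable_scaleR sqint_measurable[OF S(1)] measurable_compose[OF fst_borel gnormal_measurable])
  have "norm (S n p *\<^sub>R gnormal D u (fst p)) \<le> (L + 1) * norm (S n p)" for p
   using mult_left_mono[OF gnormal_bound abs_ge_zero[of "S n p"], of "fst p"] by (simp add: mult.commute)
  then have "AE p in lborel. norm (S n p *\<^sub>R gnormal D u (fst p)) \<le> (L + 1) * norm (S n p)" by simp
  from sqint_bound[OF S(1) m this] L show "sqint (\<lambda>p. S n p *\<^sub>R gnormal D u (fst p))" "sqn (\<lambda>p. S n p *\<^sub>R gnormal D u (fst p)) \<le> (L + 1)\<^sup>2 * sqn (S n)" by auto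
 qed
 define K where "K = 4 * ((2 * L + 4)\<^sup>2 * sqn g) + 4 * ((L + 1)\<^sup>2 * (4 * sqn g)) + 2 * sqn wH"
 have Rs: "sqint (R n)" and Rn: "sqn (R n) \<le> (dn n)\<^sup>2 * K" for n
 proof -
  note i1 = sqint_scale(1)[OF R1(1)[of n], of "dn n"] and i3 = sqint_scale(1)[OF Hs(1)[of n], of "dn n"]
  note i2 = sqint_diff[OF i1 SN(1)[of n]]
  note i4 = sqint_add[OF i2(1) i3]
  have le: "x \<le> 2 * q + 2 * z" if "x \<le> 2 * y + 2 * z" "y \<le> q" for x y z q :: real using that by linarith
  show "sqint (R n)" using i4(1) unfolding R_def[abs_def] .
  have "sqn (R n) \<le> 2 * (2 * ((dn n)\<^sup>2 * sqn (R1 n)) + 2 * sqn (\<lambda>p. S n p *\<^sub>R gnormal D u (fst p))) + 2 * ((dn n)\<^sup>2 * sqn (Hd (dn n)))"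
   unfolding R_def[abs_def] by (rule le[OF i4(2)[unfolded sqint_scale(2)] i2(2)[unfolded sqint_scale(2)]])
  moreover have "(dn n)\<^sup>2 * sqn (R1 n) \<le> (dn n)\<^sup>2 * ((2 * L + 4)\<^sup>2 * sqn g)" "(dn n)\<^sup>2 * sqn (Hd (dn n)) \<le> (dn n)\<^sup>2 * sqn wH"
   using R1(2)[of n] Hs(2)[of n] by (auto intro!: mult_left_mono)
  moreover have "sqn (\<lambda>p. S n p *\<^sub>R gnormal D u (fst p)) \<le> (L + 1)\<^sup>2 * (4 * (dn n)\<^sup>2 * sqn g)"
   by (rule order_trans[OF SN(2) mult_left_mono[OF S(2)]]) simp
  ultimately show "sqn (R n) \<le> (dn n)\<^sup>2 * K" by (simp add: K_def algebra_simps)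
 qed
 have b: "sqint (b n)" "sqn (b n) \<le> ?C * (dn n * K)" for n
 proof -
  have shR: "sqint (\<lambda>p. R n (sh n p))" "sqn (R n) = dn n * sqn (\<lambda>p. R n (sh n p))"
   using sqint_shear[OF Rs[of n], where w=u and c="dn n"] dn(1)[of n] unfolding sh_def by auto
  note [measurable] = sqint_measurable[OF shR(1)]
  have m: "b n \<in> BM" unfolding b_def[abs_def] by measurable
  have "norm (b n p) \<le> sqrt ?C * norm (R n (sh n p))" for p
  proof (cases "p \<in> E")
   case True
   have "\<bar>sqrt (sg (fst p, dn n * snd p))\<bar> \<le> sqrt ?C" using sgE(1,2)[OF True, of n] by simp
   from mult_right_mono[OF this norm_ge_zero] show ?thesis using True by (simp add: b_def)
  qed (simp add: b_def)
  then have "AE p in lborel. norm (b n p) \<le> sqrt ?C * norm (R n (sh n p))" by simp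
  from sqint_bound[OF shR(1) m this] have *: "sqint (b n)" "sqn (b n) \<le> ?C * sqn (\<lambda>p. R n (sh n p))" by auto
  show "sqint (b n)" by (rule *)
  have "dn n * sqn (\<lambda>p. R n (sh n p)) \<le> dn n * (dn n * K)" using Rn[of n] unfolding shR(2) by (simp add: power2_eq_square)
  then have k: "sqn (\<lambda>p. R n (sh n p)) \<le> dn n * K" using dn(1)[of n] by simp
  show "sqn (b n) \<le> ?C * (dn n * K)" by (rule order_trans[OF *(2) mult_left_mono[OF k]]) simp
 qed
 have am: "a n \<in> BM" for n unfolding a_def[abs_def] by measurable
 define w where "w p = (2 * sqrt ?C * (L + 1)) *\<^sub>R (\<tau> (fst p) * indicator {0<..<1} (snd p))" for p :: "'a \<times> real"
 have w: "sqint w" unfolding w_def[abs_def] by (rule sqint_scale(1)[OF sqint_tensor(1)[OF \<tau>(1)]]) simp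
 have pt: "k * (\<bar>\<tau> (fst p)\<bar> * norm (gnormal D u (fst p))) \<le> norm (w p)" if "p \<in> E" "k \<le> 2 * sqrt ?C" "0 \<le> k" for p k
 proof -
  have "k * (\<bar>\<tau> (fst p)\<bar> * norm (gnormal D u (fst p))) \<le> 2 * sqrt ?C * (\<bar>\<tau> (fst p)\<bar> * (L + 1))"
   using that gnormal_bound by (intro mult_mono) auto
  also have "... = norm (w p)" using that(1) L by (simp add: w_def E_def mem_Times_iff abs_mult)
  finally show ?thesis .
 qed
 have ab: "norm (a n p) \<le> norm (w p)" for n p
 proof (cases "p \<in> E")
  case True
  have "0 \<le> sqrt (sg (fst p, dn n * snd p))" "sqrt (sg (fst p, dn n * snd p)) \<le> sqrt ?C" "0 \<le> sqrt (sg (fst p, 0))" "sqrt (sg (fst p, 0)) \<le> sqrt ?C"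
   using sgE(1,2)[OF True, of n] sgE(3,4)[OF True] by auto
  then have "\<bar>sqrt (sg (fst p, dn n * snd p)) - sqrt (sg (fst p, 0))\<bar> \<le> 2 * sqrt ?C" by linarith
  from pt[OF True this] show ?thesis using True by (simp add: a_def abs_mult mult.assoc)
 qed (simp add: a_def)
 have "(\<lambda>n. sqn (\<lambda>p. a n p - 0)) \<longlonglongrightarrow> 0"
 proof (rule sqn_dominated(3)[OF am _ w ab])
  show "AE p in lborel. (\<lambda>n. a n p) \<longlonglongrightarrow> 0"
  proof (intro always_eventually allI)
   fix p
   show "(\<lambda>n. a n p) \<longlonglongrightarrow> 0"
   proof (cases "p \<in> E")
    case True
    have l: "(\<lambda>n. dn n * snd p) \<longlonglongrightarrow> 0" using tendsto_mult_left_zero[OF dn(4)] .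
    have "(\<lambda>n. sg (fst p, dn n * snd p)) \<longlonglongrightarrow> sg (fst p, 0)"
     by (rule continuous_on_tendsto_compose[OF sg_cont[OF dE(4)[OF True]] l]) (use dE(1)[OF True] in auto)
    then have "(\<lambda>n. sqrt (sg (fst p, dn n * snd p)) - sqrt (sg (fst p, 0))) \<longlonglongrightarrow> sqrt (sg (fst p, 0)) - sqrt (sg (fst p, 0))"
     by (intro tendsto_intros)
    from tendsto_scaleR[OF this tendsto_const[of "- \<tau> (fst p) *\<^sub>R gnormal D u (fst p)"]]
    show ?thesis using True by (simp add: a_def)
   qed (simp add: a_def)
  qed
 qed simp
 then have a0: "(\<lambda>n. sqn (a n)) \<longlonglongrightarrow> 0" by simp
 have as: "sqint (a n)" for n by (rule sqint_bound(1)[OF w am _ zero_le_one]) (use ab in simp)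
 have V's: "sqint V'"
 proof (rule sqint_bound(1)[OF w, of _ 1])
  show "V' \<in> BM" unfolding V'_def[abs_def] by measurable
  have "norm (V' p) \<le> norm (w p)" for p
  proof (cases "p \<in> E")
   case True
   have "sqrt (sg (fst p, 0)) \<le> 2 * sqrt ?C"
    using real_sqrt_le_mono[OF sgE(4)[OF True]] real_sqrt_ge_zero[of ?C] by linarith
   from pt[OF True this] show ?thesis using True sgE(3)[OF True] by (simp add: V'_def abs_mult mult.assoc)
  qed (simp add: V'_def)
  then show "AE p in lborel. norm (V' p) \<le> 1 * norm (w p)" by simp
 qed simp
 have Vs: "sqint (V n)" for n
 proof -
  have "V n = (\<lambda>p. V' p + (a n p + b n p))" using VV[of n] by (simp add: fun_eq_iff algebra_simps)
  then show ?thesis using sqint_add(1)[OF V's sqint_add(1)[OF as b(1)]] by simp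
 qed
 have "(\<lambda>n. sqn (\<lambda>p. V n p - V' p)) \<longlonglongrightarrow> 0"
 proof (rule Lim_null_comparison)
  show "\<forall>\<^sub>F n in sequentially. norm (sqn (\<lambda>p. V n p - V' p)) \<le> 2 * sqn (a n) + 2 * (?C * (dn n * K))"
  proof (intro always_eventually allI)
   fix n
   have "sqn (\<lambda>p. V n p - V' p) \<le> 2 * sqn (a n) + 2 * sqn (b n)" unfolding VV by (rule sqint_add(2)[OF as b(1)])
   then show "norm (sqn (\<lambda>p. V n p - V' p)) \<le> 2 * sqn (a n) + 2 * (?C * (dn n * K))"
    using b(2)[of n] sqn_nonneg[of "\<lambda>p. V n p - V' p"] by simp
  qed
  have "(\<lambda>n. 2 * sqn (a n) + 2 * (?C * (dn n * K))) \<longlonglongrightarrow> 2 * 0 + 2 * (?C * (0 * K))"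
   by (intro tendsto_intros a0 dn(4))
  then show "(\<lambda>n. 2 * sqn (a n) + 2 * (?C * (dn n * K))) \<longlonglongrightarrow> 0" by simp
 qed
 from sqn_tendsto[OF Vs V's this] have "(\<lambda>n. sqn (V n)) \<longlonglongrightarrow> sqn V'" .
 moreover have "sqn (V n) = dn n * (LINT p|lborel. wt (dn n) p * (norm (W n p))\<^sup>2)" for n
 proof -
  have "(LINT p|lborel. wt (dn n) p * (norm (W n p))\<^sup>2) = \<bar>dn n\<bar> *\<^sub>R (LINT p|lborel. wt (dn n) (fst p, u (fst p) + dn n * snd p) * (norm (W n (fst p, u (fst p) + dn n * snd p)))\<^sup>2)"
   by (rule integral_shear(1)) (use dn(1)[of n] in auto)
  then have "dn n * (LINT p|lborel. wt (dn n) p * (norm (W n p))\<^sup>2) = (LINT p|lborel. (dn n)\<^sup>2 * (wt (dn n) (sh n p) * (norm (W n (sh n p)))\<^sup>2))"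
   using dn(1)[of n] by (simp add: sh_def power2_eq_square)
  also have "... = sqn (V n)" unfolding sqn_def
  proof (intro integral_congr)
   fix p
   show "(dn n)\<^sup>2 * (wt (dn n) (sh n p) * (norm (W n (sh n p)))\<^sup>2) = (norm (V n p))\<^sup>2"
   proof (cases "p \<in> E")
    case True
    then show ?thesis using dE(1-3)[OF True, of n] dE(4)[OF True] sgE(1)[OF True, of n]
     by (simp add: V_def wt_def sh_def Ud_def power_mult_distrib)
   next
    case False
    then have "sh n p \<notin> Ud (dn n)" using dn(1)[of n]
     by (cases p) (auto simp: sh_def Ud_def E_def zero_less_mult_iff mult_less_cancel_left1)
    then show ?thesis using False by (simp add: V_def wt_def)
   qed
  qed
  finally show ?thesis ..
 qed
 moreover have "sqn V' = (LINT x|lborel. indicator D x * (sg (x, 0) * (\<tau> x)\<^sup>2 * (norm (gnormal D u x))\<^sup>2))"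
 proof -
  have i: "integrable lborel (\<lambda>p. (norm (V' p))\<^sup>2)" using V's by (simp add: sqint_def)
  have "sqn V' = (LINT x|lborel. LINT z|lborel. (norm (V' (x, z)))\<^sup>2)" unfolding sqn_def by (rule lborel_Fubini(1)[OF i])
  also have "... = (LINT x|lborel. LINT z|lborel. indicator D x * (sg (x, 0) * (\<tau> x)\<^sup>2 * (norm (gnormal D u x))\<^sup>2) * indicator {0<..<1::real} z)"
  proof (intro integral_congr)
   fix x z
   show "(norm (V' (x, z)))\<^sup>2 = indicator D x * (sg (x, 0) * (\<tau> x)\<^sup>2 * (norm (gnormal D u x))\<^sup>2) * indicator {0<..<1::real} z"
    using sgE(3)[of "(x, z)"] by (cases "(x, z) \<in> E") (auto simp: V'_def E_def power_mult_distrib)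
  qed
  finally show ?thesis by simp
 qed
 ultimately have 2: "(\<lambda>n. dn n * (LINT p|lborel. wt (dn n) p * (norm (W n p))\<^sup>2)) \<longlonglongrightarrow> (LINT x|lborel. indicator D x * (sg (x, 0) * (\<tau> x)\<^sup>2 * (norm (gnormal D u x))\<^sup>2))"
  by simp
 have "(\<lambda>n. \<sigma>1 / 2 * (LINT p|lborel. indicator \<Omega> p * (norm (W n p))\<^sup>2) + 1 / 2 * (dn n * (LINT p|lborel. wt (dn n) p * (norm (W n p))\<^sup>2)))
  \<longlonglongrightarrow> energy0 (\<lambda>p. g p + Hd 0 p) \<tau>"
  unfolding energy0_def by (intro tendsto_add tendsto_mult tendsto_const 1 2)
 then show ?thesis unfolding energy_def W_def by simp
qed

lemma recovery_L2:
 assumes f: "sqint f" and dn: "\<And>n. 0 < dn n" "\<And>n. dn n < c" "dn \<longlonglongrightarrow> 0"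
 shows "(\<lambda>n. sqn (fE (dn n) f)) \<longlonglongrightarrow> 0"
proof -
 define s where "s n p = fE (dn n) f (fst p, 2 * u (fst p) + (-1) * snd p)" for n p
 have fs: "sqint (fE (dn n) f)" for n by (rule reflection_domain.fU_sqint(1)[OF reflect[OF dn(1,2)] f])
 have s: "sqint (s n)" "sqn (fE (dn n) f) = sqn (s n)" for n
  using sqint_shear[OF fs[of n], where w="\<lambda>x. 2 * u x" and c="-1"] unfolding s_def by auto
 have seq: "s n p = indicator {p. fst p \<in> D \<and> u (fst p) - dn n < snd p \<and> snd p < u (fst p)} p * (f p * reflection_domain.taper u (dn n) (fst p, 2 * u (fst p) + (-1) * snd p))" for n p
 proof -
  interpret R: reflection_domain D H c M L u "dn n" by (rule reflect[OF dn(1,2)])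
  show ?thesis unfolding s_def R.fU_def R.U_def R.T_def by (auto split: split_indicator)
 qed
 have sb: "norm (s n p) \<le> norm (f p)" for n p
 proof -
  interpret R: reflection_domain D H c M L u "dn n" by (rule reflect[OF dn(1,2)])
  show ?thesis
  proof (cases "(fst p, 2 * u (fst p) + (-1) * snd p) \<in> R.U")
   case True
   then have t: "\<bar>R.taper (fst p, 2 * u (fst p) + (-1) * snd p)\<bar> \<le> 1" using R.U_taper[OF True] by auto
   have "norm (s n p) \<le> \<bar>f p\<bar> * \<bar>R.taper (fst p, 2 * u (fst p) + (-1) * snd p)\<bar>"
    unfolding seq by (auto simp: abs_mult split: split_indicator)
   also have "... \<le> \<bar>f p\<bar> * 1" by (rule mult_left_mono[OF t]) simp
   finally show ?thesis by simp
  qed (simp add: s_def R.fU_def)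
 qed
 have "(\<lambda>n. sqn (\<lambda>p. s n p - 0)) \<longlonglongrightarrow> 0"
 proof (rule sqn_dominated(3)[OF sqint_measurable[OF s(1)] _ f sb])
  show "AE p in lborel. (\<lambda>n. s n p) \<longlonglongrightarrow> 0"
  proof (intro always_eventually allI)
   fix p :: "'a \<times> real"
   show "(\<lambda>n. s n p) \<longlonglongrightarrow> 0"
   proof (cases "snd p < u (fst p)")
    case True
    then have "0 < u (fst p) - snd p" by simp
    from order_tendstoD(2)[OF dn(3) this] have "\<forall>\<^sub>F n in sequentially. s n p = 0"
     by eventually_elim (simp add: seq)
    then show ?thesis by (rule tendsto_eventually)
   qed (simp add: seq)
  qed
 qed simp
 then show ?thesis by (simp add: s(2))
qed

end

section \<open>The limit of the functionals\<close>

lemma L2_norm_nonneg: "0 \<le> L2_norm S f"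
 by (simp add: L2_norm_def set_lebesgue_integral_def)

lemma L2_norm_tendsto_0:
 assumes "((\<lambda>n. (L2_norm S (f n))\<^sup>2) \<longlongrightarrow> 0) F" shows "((\<lambda>n. L2_norm S (f n)) \<longlongrightarrow> 0) F"
 using tendsto_real_sqrt[OF assms] by (simp add: L2_norm_nonneg)

context plate_functionals begin

text \<open>If the bound fails, the energies stay below some \<open>r\<close> less than the limit energy along a sequence of
thicknesses tending to zero, which contradicts \<open>energy_liminf\<close>.\<close>

lemma gamma_liminf:
 assumes sp: "sobolev_pair \<Omega> f g" and gr: "green_trace D H u f g \<tau>"
  and \<theta>: "AE p in lborel. p \<in> \<Omega>0 --> \<theta> p = f p" and fam: "L2_family \<Omega>0 \<theta>s \<theta>"
 shows "ereal (energy0 (\<lambda>p. g p + Hd 0 p) \<tau>) \<le> Liminf (at_right 0) (\<lambda>d. G D H M \<sigma>1 \<sigma>s h u d (\<theta>s d))"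
proof (rule ccontr)
 let ?G = "\<lambda>d. G D H M \<sigma>1 \<sigma>s h u d (\<theta>s d)"
 assume "\<not> ?thesis"
 then have "Liminf (at_right 0) ?G < ereal (energy0 (\<lambda>p. g p + Hd 0 p) \<tau>)" by simp
 from ereal_dense2[OF this] obtain r where r: "Liminf (at_right 0) ?G < ereal r" "r < energy0 (\<lambda>p. g p + Hd 0 p) \<tau>" by auto
 have "\<exists>d. 0 < d \<and> d < inverse (real (Suc n)) \<and> ?G d < ereal r" for n
 proof (rule ccontr)
  assume no: "\<not> ?thesis"
  have "\<forall>\<^sub>F d in at_right 0. d \<in> {0<..<inverse (real (Suc n))}" by (rule eventually_at_right_real) simp
  then have "\<forall>\<^sub>F d in at_right 0. ereal r \<le> ?G d"
  proof eventually_elim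
   case (elim d)
   show ?case
   proof (rule ccontr)
    assume "\<not> ?thesis"
    then have "0 < d \<and> d < inverse (real (Suc n)) \<and> ?G d < ereal r" using elim by (simp del: of_nat_Suc)
    then show False using no by blast
   qed
  qed
  from Liminf_bounded[OF this] r(1) show False by simp
 qed
 then have "\<forall>n. \<exists>d. 0 < d \<and> d < inverse (real (Suc n)) \<and> ?G d < ereal r" by blast
 from choice[OF this] obtain dn where dn: "\<And>n. 0 < dn n" "\<And>n. dn n < inverse (real (Suc n))" "\<And>n. ?G (dn n) < ereal r" by blast
 have dn1: "dn n \<le> 1" for n
 proof -
  have "inverse (real (Suc n)) \<le> 1" by (simp add: inverse_le_1_iff)
  then show ?thesis using dn(2)[of n] by simp
 qed
 have dl: "dn \<longlonglongrightarrow> 0"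
  by (rule tendsto_sandwich[OF _ _ tendsto_const LIMSEQ_inverse_real_of_nat]) (use dn(1,2) in \<open>auto intro!: always_eventually less_imp_le\<close>)
 have "\<exists>F. sobolev_pair (Wd (dn n)) (fst F) (snd F) \<and> green_trace D H (\<lambda>x. u x + dn n) (fst F) (snd F) (\<lambda>x. 0)
   \<and> energy (dn n) (\<lambda>p. snd F p + Hd (dn n) p) \<le> r \<and> sqn (\<lambda>p. fst F p - f p) = (L2_norm \<Omega>0 (\<lambda>p. \<theta>s (dn n) p - \<theta> p))\<^sup>2" for n
 proof -
  have dn0: "0 \<le> dn n" using dn(1)[of n] by simp
  have mem: "\<theta>s (dn n) \<in> extended_by_zero \<Omega>0 (Omega D H u (dn n)) (H10 D H u (dn n))"
   using dn(3)[of n] unfolding G_def by (auto split: if_splits)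
  then have H10: "\<theta>s (dn n) \<in> H1_zero_trace_on (Wd (dn n)) (frontier (Wd (dn n)))"
   and z: "AE p in lebesgue. p \<in> \<Omega>0 - Wd (dn n) --> \<theta>s (dn n) p = 0"
   unfolding extended_by_zero_def H10_def Omega_eq_Wd[OF dn(1)] by auto
  have "\<theta>s (dn n) \<in> H1 (Wd (dn n))" using H10 unfolding H1_zero_trace_on_def by blast
  then obtain fn gn where fg: "sobolev_pair (Wd (dn n)) fn gn" "AE p in lborel. p \<in> Wd (dn n) --> \<theta>s (dn n) p = fn p"
   by (rule H1_representative[OF _ Wd_open[OF dn0]])
  interpret up: graph_domain D H "c + dn n" "M + \<bar>dn n\<bar>" L "\<lambda>x. u x + dn n" by (rule Wd_domain(1)[OF dn0])
  have "green_trace D H (\<lambda>x. u x + dn n) fn gn (\<lambda>x. 0)"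
   by (rule up.zero_trace_green) (use H10 fg in \<open>simp_all add: Wd_def\<close>)
  moreover have "energy (dn n) (\<lambda>p. gn p + Hd (dn n) p) \<le> r"
   using dn(3)[of n] unfolding G_eq_energy[OF dn(1) dn1 fg mem] by simp
  moreover have "sqn (\<lambda>p. fn p - f p) = (L2_norm \<Omega>0 (\<lambda>p. \<theta>s (dn n) p - \<theta> p))\<^sup>2"
  proof (rule L2_from_representative(2)[symmetric])
   have o: "fn p = 0" if "p \<notin> Wd (dn n)" for p using sobolev_pair_outside[OF fg(1) that] by simp
   have "AE p in lborel. p \<in> \<Omega>0 - Wd (dn n) --> \<theta>s (dn n) p = 0" using z by (simp add: AE_completion_iff)
   then show "AE p in lborel. p \<in> \<Omega>0 --> \<theta>s (dn n) p - \<theta> p = fn p - f p"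
    using fg(2) \<theta> by eventually_elim (use o in auto)
   show "fn p - f p = 0" if "p \<notin> \<Omega>0" for p
   proof -
    have "p \<notin> Wd (dn n)" "p \<notin> \<Omega>" using that Wd_sub[OF dn1, of n] Wd_sub[of 0] unfolding Wd_0 by auto
    then show ?thesis using o[of p] sobolev_pair_outside[OF sp, of p] by simp
   qed
   show "sqint (\<lambda>p. fn p - f p)" by (intro sqint_diff sobolev_pair_sqint(1)[OF fg(1)] sobolev_pair_sqint(1)[OF sp])
  qed
  ultimately show ?thesis using fg(1) by (intro exI[of _ "(fn, gn)"]) simp
 qed
 then have "\<forall>n. \<exists>F. sobolev_pair (Wd (dn n)) (fst F) (snd F) \<and> green_trace D H (\<lambda>x. u x + dn n) (fst F) (snd F) (\<lambda>x. 0)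
   \<and> energy (dn n) (\<lambda>p. snd F p + Hd (dn n) p) \<le> r \<and> sqn (\<lambda>p. fst F p - f p) = (L2_norm \<Omega>0 (\<lambda>p. \<theta>s (dn n) p - \<theta> p))\<^sup>2" ..
 from choice[OF this] obtain F where F: "\<And>n. sobolev_pair (Wd (dn n)) (fst (F n)) (snd (F n))"
  "\<And>n. green_trace D H (\<lambda>x. u x + dn n) (fst (F n)) (snd (F n)) (\<lambda>x. 0)"
  "\<And>n. energy (dn n) (\<lambda>p. snd (F n) p + Hd (dn n) p) \<le> r"
  "\<And>n. sqn (\<lambda>p. fst (F n) p - f p) = (L2_norm \<Omega>0 (\<lambda>p. \<theta>s (dn n) p - \<theta> p))\<^sup>2" by auto
 have "((\<lambda>d. L2_norm \<Omega>0 (\<lambda>p. \<theta>s d p - \<theta> p)) \<longlongrightarrow> 0) (at_right 0)" using fam unfolding L2_family_def by blast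
 moreover have "filterlim dn (at_right 0) sequentially"
  by (rule tendsto_imp_filterlim_at_right[OF dl]) (simp add: dn(1))
 ultimately have "(\<lambda>n. L2_norm \<Omega>0 (\<lambda>p. \<theta>s (dn n) p - \<theta> p)) \<longlonglongrightarrow> 0" by (rule filterlim_compose)
 from tendsto_power[OF this, of 2] have "(\<lambda>n. sqn (\<lambda>p. fst (F n) p - f p)) \<longlonglongrightarrow> 0" unfolding F(4) by simp
 from energy_liminf[OF sp gr dn(1) dn1 dl F(1,2) this F(3)] r(2) show False by simp
qed

lemma gamma_limsup:
 assumes H1: "\<theta> \<in> H1 \<Omega>" and t: "has_boundary_trace \<Omega> \<theta> t"
  and tz: "AE p in surface_measure \<Omega>. p \<in> frontier \<Omega> - Sigma_graph D u --> t p = 0"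
  and sp: "sobolev_pair \<Omega> f g" and gr: "green_trace D H u f g \<tau>"
  and st: "\<And>d. 0 < d ==> d < c ==> sqint (strip f \<tau> d) \<and> sqn (strip f \<tau> d) \<le> 4 * d\<^sup>2 * sqn g"
  and \<theta>: "AE p in lborel. p \<in> \<Omega>0 --> \<theta> p = f p"
 shows "\<exists>\<theta>s. L2_family \<Omega>0 \<theta>s \<theta> \<and> Limsup (at_right 0) (\<lambda>d. G D H M \<sigma>1 \<sigma>s h u d (\<theta>s d)) \<le> ereal (energy0 (\<lambda>p. g p + Hd 0 p) \<tau>)"
proof -
 note s = sobolev_pair_sqint[OF sp]
 have \<Omega>sub: "\<Omega> \<subseteq> \<Omega>0" using Wd_sub[of 0] by (simp add: Wd_0)
 have \<theta>\<Omega>: "AE p in lborel. p \<in> \<Omega> --> \<theta> p = f p" using \<theta> by eventually_elim (use \<Omega>sub in auto)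
 have \<tau>: "sqint \<tau>" "\<And>x. x \<notin> D ==> \<tau> x = 0" using gr by (auto simp: green_trace_def)
 define \<theta>r where "\<theta>r d = (if d < c then (\<lambda>p. f p + fE d f p) else f)" for d
 have sE: "sobolev_pair (Wd d) (\<lambda>p. f p + fE d f p) (\<lambda>p. g p + gE d f g p)" if "0 < d" "d < c" for d
  using reflection_domain.reflection_sobolev_pair[OF reflect[OF that] sp gr] by (simp add: Wd_def)
 have \<theta>r: "sqint (\<theta>r d)" "p \<notin> \<Omega>0 ==> \<theta>r d p = 0" if "0 < d" "d \<le> 1" for d p
 proof -
  show "sqint (\<theta>r d)" using s(1) sobolev_pair_sqint(1)[OF sE[OF that(1)]] by (simp add: \<theta>r_def)
  assume "p \<notin> \<Omega>0"
  then have "p \<notin> \<Omega>" "p \<notin> Wd d" using \<Omega>sub Wd_sub[OF that(2)] by auto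
  then show "\<theta>r d p = 0" using sobolev_pair_outside[OF sp, of p] sobolev_pair_outside[OF sE[OF that(1)], of p] by (auto simp: \<theta>r_def)
 qed
 have b: "0 < min c 1" using c by simp
 have "((\<lambda>d. L2_norm \<Omega>0 (\<lambda>p. \<theta>r d p - \<theta> p)) \<longlongrightarrow> 0) (at_right 0)"
 proof (rule tendsto_at_right_sequentially[OF b], rule L2_norm_tendsto_0)
  fix dn :: "nat => real" assume dn: "\<And>n. 0 < dn n" "\<And>n. dn n < min c 1" "dn \<longlonglongrightarrow> 0"
  have dn': "dn n < c" "dn n \<le> 1" for n using dn(2)[of n] by auto
  have "(L2_norm \<Omega>0 (\<lambda>p. \<theta>r (dn n) p - \<theta> p))\<^sup>2 = sqn (\<lambda>p. \<theta>r (dn n) p - f p)" for n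
  proof (rule L2_from_representative(2))
   show "AE p in lborel. p \<in> \<Omega>0 --> \<theta>r (dn n) p - \<theta> p = \<theta>r (dn n) p - f p" using \<theta> by eventually_elim auto
   show "\<theta>r (dn n) p - f p = 0" if "p \<notin> \<Omega>0" for p
    using \<theta>r(2)[OF dn(1) dn'(2) that] sobolev_pair_outside[OF sp, of p] that \<Omega>sub by auto
   show "sqint (\<lambda>p. \<theta>r (dn n) p - f p)" by (intro sqint_diff \<theta>r(1)[OF dn(1) dn'(2)] s(1))
  qed
  then have "(L2_norm \<Omega>0 (\<lambda>p. \<theta>r (dn n) p - \<theta> p))\<^sup>2 = sqn (fE (dn n) f)" for n using dn' by (simp add: \<theta>r_def)
  then show "(\<lambda>n. (L2_norm \<Omega>0 (\<lambda>p. \<theta>r (dn n) p - \<theta> p))\<^sup>2) \<longlonglongrightarrow> 0" using recovery_L2[OF s(1) dn(1) dn'(1) dn(3)] by simp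
 qed
 moreover have "\<theta>r d \<in> L2 \<Omega>0" if "0 < d" "d \<le> 1" for d
  by (rule L2_from_representative(1)[OF _ \<theta>r(2)[OF that] \<theta>r(1)[OF that]]) simp_all
 ultimately have fam: "L2_family \<Omega>0 \<theta>r \<theta>" unfolding L2_family_def by simp
 define X where "X d = energy d (\<lambda>p. g p + gE d f g p + Hd d p)" for d
 have "(X \<longlongrightarrow> energy0 (\<lambda>p. g p + Hd 0 p) \<tau>) (at_right 0)"
 proof (rule tendsto_at_right_sequentially[OF b])
  fix dn :: "nat => real" assume dn: "\<And>n. 0 < dn n" "\<And>n. dn n < min c 1" "dn \<longlonglongrightarrow> 0"
  have dn': "dn n < c" "dn n \<le> 1" for n using dn(2)[of n] by auto
  show "(\<lambda>n. X (dn n)) \<longlonglongrightarrow> energy0 (\<lambda>p. g p + Hd 0 p) \<tau>" unfolding X_def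
   by (rule recovery_energy[OF sp \<tau> st dn(1) dn'(2,1) dn(3)])
 qed
 then have lim: "((\<lambda>d. ereal (X d)) \<longlongrightarrow> ereal (energy0 (\<lambda>p. g p + Hd 0 p) \<tau>)) (at_right 0)" by simp
 have "\<forall>\<^sub>F d in at_right 0. d \<in> {0<..<min c 1}" by (rule eventually_at_right_real[OF b])
 then have "\<forall>\<^sub>F d in at_right 0. G D H M \<sigma>1 \<sigma>s h u d (\<theta>r d) = ereal (X d)"
 proof eventually_elim
  case (elim d)
  then have d: "0 < d" "d \<le> 1" "d < c" by auto
  have e: "\<theta>r d = (\<lambda>p. f p + fE d f p)" using d by (simp add: \<theta>r_def)
  have "\<theta>r d \<in> H10 D H u d" unfolding H10_def Omega_eq_Wd[OF d(1)] e Wd_def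
   by (rule reflection_domain.reflection_H10[OF reflect[OF d(1,3)] H1 t tz sp \<theta>\<Omega>])
  moreover have "\<theta>r d \<in> L2 \<Omega>0" using fam d unfolding L2_family_def by auto
  moreover have "\<theta>r d p = 0" if "p \<in> \<Omega>0 - Omega D H u d" for p
   using sobolev_pair_outside[OF sE[OF d(1,3)], of p] that unfolding e Omega_eq_Wd[OF d(1)] by auto
  ultimately have mem: "\<theta>r d \<in> extended_by_zero \<Omega>0 (Omega D H u d) (H10 D H u d)" unfolding extended_by_zero_def by auto
  show ?case unfolding X_def
   by (rule G_eq_energy[OF d(1,2) sE[OF d(1,3)] _ mem]) (simp add: e)
 qed
 from tendsto_cong[THEN iffD2, OF this lim]
 have "Limsup (at_right 0) (\<lambda>d. G D H M \<sigma>1 \<sigma>s h u d (\<theta>r d)) = ereal (energy0 (\<lambda>p. g p + Hd 0 p) \<tau>)"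
  by (rule lim_imp_Limsup[rotated]) simp
 then show ?thesis using fam by (intro exI[of _ \<theta>r]) simp
qed

text \<open>The trace with vanishing lateral values provided by \<open>HB1\<close> and the one selected by
\<open>boundary_trace\<close> may differ; the former makes the extension an admissible function, the latter determines the
energy.\<close>

lemma gamma_limit:
 assumes mem: "\<theta> \<in> extended_by_zero \<Omega>0 \<Omega> (HB1 D H u)"
 shows "Gamma_limit_at \<Omega>0 (G D H M \<sigma>1 \<sigma>s h u) (G0 D H M \<sigma>1 \<sigma>s h u) \<theta>"
proof -
 have HB: "\<theta> \<in> HB1 D H u" and z: "AE p in lborel. p \<in> \<Omega>0 - \<Omega> --> \<theta> p = 0"
  using mem unfolding extended_by_zero_def by (auto simp: AE_completion_iff)
 from HB obtain t0 where H1: "\<theta> \<in> H1 \<Omega>" and t0: "has_boundary_trace \<Omega> \<theta> t0"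
  and tz: "AE p in surface_measure \<Omega>. p \<in> frontier \<Omega> - Sigma_graph D u --> t0 p = 0"
  unfolding HB1_def H1_zero_trace_on_def by blast
 define t where "t = boundary_trace \<Omega> \<theta>"
 have t: "has_boundary_trace \<Omega> \<theta> t" unfolding t_def boundary_trace_def by (rule someI[of "has_boundary_trace \<Omega> \<theta>", OF t0])
 obtain f g where sp: "sobolev_pair \<Omega> f g" and \<theta>: "AE p in lborel. p \<in> \<Omega> --> \<theta> p = f p"
  by (rule H1_representative[OF H1 Omega_open])
 note s = sobolev_pair_sqint[OF sp]
 define \<tau> where "\<tau> = (\<lambda>x. if x \<in> D then t (x, u x) else 0)"
 obtain F fk gk where A: "\<And>k. continuous_on (closure \<Omega>) (F k)" "\<And>k. sobolev_pair \<Omega> (fk k) (gk k)"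
  "\<And>k p. p \<in> \<Omega> ==> fk k p = F k p"
  "(\<lambda>k. sqn (\<lambda>p. fk k p - f p)) \<longlonglongrightarrow> 0" "(\<lambda>k. sqn (\<lambda>p. gk k p - g p)) \<longlonglongrightarrow> 0"
  "(\<lambda>k. \<integral>\<^sup>+p. ennreal ((F k p - t p)\<^sup>2) \<partial>surface_measure \<Omega>) \<longlonglongrightarrow> 0"
  "sqint \<tau>" "(\<lambda>k. sqn (\<lambda>x. (if x \<in> D then F k (x, u x) else 0) - \<tau> x)) \<longlonglongrightarrow> 0"
  and gr: "green_trace D H u f g \<tau>"
  by (rule trace_approximation[OF H1 t sp \<theta>]) (rule that, unfold \<tau>_def, assumption+)
 have st: "sqint (strip f \<tau> d) \<and> sqn (strip f \<tau> d) \<le> 4 * d\<^sup>2 * sqn g" if "0 < d" "d < c" for d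
  using strip_estimate[OF A(1-5) s A(7,8) that] by blast
 have o: "f p = 0" if "p \<notin> \<Omega>" for p using sobolev_pair_outside[OF sp that] by simp
 have \<theta>0: "AE p in lborel. p \<in> \<Omega>0 --> \<theta> p = f p" using \<theta> z by eventually_elim (use o in auto)
 have E0: "G0 D H M \<sigma>1 \<sigma>s h u \<theta> = ereal (energy0 (\<lambda>p. g p + Hd 0 p) \<tau>)"
  unfolding \<tau>_def by (rule G0_eq_energy[OF sp \<theta> mem t_def[symmetric]]) (use A(7) in \<open>simp add: \<tau>_def\<close>)
 show ?thesis unfolding Gamma_limit_at_def E0
  using gamma_liminf[OF sp gr \<theta>0] gamma_limsup[OF H1 t0 tz sp gr st \<theta>0] by blast
qed

end

theorem proposition3p3:
  fixes D :: "'a::euclidean_space set"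
    and H V M \<sigma>1 \<sigma>0 :: real
    and u :: "'a \<Rightarrow> real"
    and \<sigma>s :: "'a \<Rightarrow> real \<Rightarrow> real"
    and h :: "'a \<Rightarrow> real \<Rightarrow> real \<Rightarrow> real"
    and \<theta> :: "'a \<times> real \<Rightarrow> real"
  assumes dim: "DIM('a) = 1 \<or> DIM('a) = 2"
    and D: "open D" "connected D" "bounded D" "D \<noteq> {}" "C1_boundary D"
    and pos: "H > 0" "V > 0" "M > 0" "\<sigma>1 > 0"
    and u_smooth: "smooth_on (closure D) u"
    and u_range: "\<forall>x\<in>closure D. - H < u x \<and> u x < M"
    and u_bdry: "\<forall>p\<in>frontier D. u p = 0"
    and u_normal: "\<forall>p\<in>frontier D. \<forall>\<nu>. outward_unit_normal D p \<nu> \<longrightarrow>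
          (\<exists>u'. (u has_derivative u') (at p within closure D) \<and> u' \<nu> = 0)"
    and \<sigma>s_cont: "continuous_on (closure D \<times> {0..1}) (\<lambda>(x, s). \<sigma>s x s)"
    and \<sigma>s_lower: "\<sigma>0 > 0" "\<forall>x\<in>closure D. \<forall>s\<in>{0..1}. \<sigma>0 \<le> \<sigma>s x s"
    and h_smooth: "smooth_on (closure D \<times> {- H..} \<times> {- H<..}) (\<lambda>(x, z, w). h x z w)"
    and h_top: "\<forall>x\<in>closure D. \<forall>w>- H. h x w w = V"
    and h_bottom: "\<forall>x\<in>closure D. \<forall>w>- H. h x (- H) w = 0"
    and \<theta>: "\<theta> \<in> extended_by_zero (Omega0 D H M) (Omega1 D H u) (HB1 D H u)"
  shows "Gamma_limit_at (Omega0 D H M) (G D H M \<sigma>1 \<sigma>s h u) (G0 D H M \<sigma>1 \<sigma>s h u) \<theta>"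
proof -
 obtain ug U where U: "open U" "closure D \<subseteq> U" "Cinf ug U" and ug: "\<And>x. x \<in> closure D ==> u x = ug x"
  using u_smooth unfolding smooth_on_def Cinf_def by blast
 have clD: "compact (closure D)" using D(3) by (simp add: compact_closure)
 have DclD: "x \<in> D ==> x \<in> closure D" for x using closure_subset by blast
 (* Continuous on the whole space because \<open>u\<close> vanishes on the boundary of \<open>D\<close>. *)
 define u0 where "u0 x = (if x \<in> D then u x else 0)" for x
 have u0: "u0 x = u x" if "x \<in> D" for x using that by (simp add: u0_def)
 have ucl: "continuous_on (closure D) u"
  using continuous_on_subset[OF Cinf_continuous_on[OF U(3)] U(2)] ug by (simp cong: continuous_on_cong)
 have u0c: "continuous_on UNIV u0"
 proof -
  have "continuous_on (closure D \<union> - D) (\<lambda>x. if x \<in> D then u x else 0)"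
   by (rule continuous_on_cases) (use D(1) ucl u_bdry in \<open>auto simp: frontier_def interior_open closed_Compl\<close>)
  moreover have "closure D \<union> - D = UNIV" using DclD by auto
  ultimately show ?thesis by (simp add: u0_def[abs_def])
 qed
 have u0C: "Cinf u0 D"
 proof -
  have "Cinf ug D" using U by (meson Cinf_subset DclD subsetD subsetI)
  then show ?thesis using Cinf_cong[OF D(1), of u0 ug] ug DclD u0 by auto
 qed
 obtain xm where xm: "xm \<in> closure D" "\<And>x. x \<in> closure D ==> u xm \<le> u x"
  using continuous_attains_inf[OF clD _ ucl] D(4) by auto
 (* The least height of the subgraph, capped by the height over the boundary of \<open>D\<close>. *)
 define c where "c = min (u xm + H) H"
 have c: "c > 0" "c \<le> H" using u_range xm(1) pos(1) by (auto simp: c_def)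
 have "continuous_on (closure D) (gradient ug)" by (rule continuous_on_subset[OF gradient_continuous_on[OF U(3)] U(2)])
 from compact_imp_bounded[OF compact_continuous_image[OF this clD]] obtain L' where L': "\<And>x. x \<in> closure D ==> norm (gradient ug x) \<le> L'"
  unfolding bounded_iff by blast
 define L where "L = max L' 0"
 have gr: "norm (gradient u0 x) \<le> L" if "x \<in> D" for x
 proof -
  have "gradient u0 x = gradient ug x" by (rule gradient_cong[OF D(1) that]) (use u0 ug DclD in auto)
  then show ?thesis using L'[OF DclD[OF that]] by (simp add: L_def)
 qed
 have cp: "compact (closure D \<times> {0..1::real})" by (intro compact_Times clD) simp
 from compact_imp_bounded[OF compact_continuous_image[OF \<sigma>s_cont cp]] obtain \<sigma>C where \<sigma>C: "\<And>x s. x \<in> closure D ==> s \<in> {0..1} ==> \<bar>\<sigma>s x s\<bar> \<le> \<sigma>C"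
  unfolding bounded_iff by force
 define sg where "sg p = indicator (closure D \<times> {0..1}) p *\<^sub>R (case p of (x, s) => \<sigma>s x s)" for p
 have sg: "sg (x, s) = \<sigma>s x s" if "x \<in> D" "s \<in> {0..1}" for x s using that DclD by (simp add: sg_def)
 have sgm: "sg \<in> BM" unfolding sg_def[abs_def]
  by (rule borel_measurable_continuous_on_indicator[OF _ \<sigma>s_cont]) (simp add: borel_closed closed_Times)
 have sgc: "continuous_on {0..1} (\<lambda>s. sg (x, s))" if x: "x \<in> D" for x
 proof -
  have "continuous_on {0..1} (\<lambda>s. (\<lambda>(x, s). \<sigma>s x s) (x, s))"
   by (rule continuous_on_compose2[OF \<sigma>s_cont]) (use DclD[OF x] in \<open>auto intro!: continuous_intros\<close>)
  then show ?thesis by (rule continuous_on_eq) (simp add: sg[OF x])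
 qed
 have u_low: "\<forall>x\<in>closure D. - H < u x" using u_range by blast
 obtain hg Ch where hg: "Ch \<ge> 0"
  "\<And>d p. 0 \<le> d ==> d \<le> 1 ==> p \<in> Omega0 D H M ==> (subst_boundary h (\<lambda>x. u x + d) has_derivative (\<lambda>e. hg d p \<bullet> e)) (at p)"
  "\<And>d. 0 \<le> d ==> d \<le> 1 ==> continuous_on (Omega0 D H M) (hg d)"
  "\<And>d p. 0 \<le> d ==> d \<le> 1 ==> p \<in> Omega0 D H M ==> norm (hg d p) \<le> Ch"
  "\<And>d p. 0 \<le> d ==> d \<le> 1 ==> p \<in> Omega0 D H M ==> \<bar>subst_boundary h (\<lambda>x. u x + d) p\<bar> \<le> Ch"
  "\<And>\<epsilon>. \<epsilon> > 0 ==> \<exists>\<delta>>0. \<forall>d p. 0 \<le> d --> d \<le> 1 --> d < \<delta> --> p \<in> Omega0 D H M --> norm (hg d p - hg 0 p) < \<epsilon>"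
  by (rule boundary_data[OF D(1) D(3) u_smooth u_low h_smooth]) (rule that)
 have sb: "subst_boundary h (\<lambda>x. u x + d) p = subst_boundary h (\<lambda>x. u0 x + d) p" if "p \<in> Omega0 D H M" for d p
  using that u0 by (auto simp: subst_boundary_def Omega0_def)
 have op: "open (Omega0 D H M)" unfolding Omega0_def by (intro open_Times D(1)) auto
 interpret plate_functionals D H c M L u0 \<sigma>1 \<sigma>0 \<sigma>C Ch sg hg \<sigma>s h
 proof unfold_locales
  show "u0 \<in> BM" by (rule borel_measurable_continuous_onI[OF u0c])
  show "- H + c \<le> u0 x" if "x \<in> D" for x using xm(2)[OF DclD[OF that]] u0[OF that] by (simp add: c_def)
  show "u0 x \<le> M" if "x \<in> D" for x using u_range DclD[OF that] u0[OF that] by force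
  show "(subst_boundary h (\<lambda>x. u0 x + d) has_derivative (\<lambda>e. hg d p \<bullet> e)) (at p)" if "0 \<le> d" "d \<le> 1" "p \<in> Omega0 D H M" for d p
   by (rule has_derivative_transform_within_open[OF hg(2)[OF that] op that(3) sb])
  show "\<bar>subst_boundary h (\<lambda>x. u0 x + d) p\<bar> \<le> Ch" if "0 \<le> d" "d \<le> 1" "p \<in> Omega0 D H M" for d p
   using hg(5)[OF that] sb[OF that(3)] by simp
  show "sg (x, s) \<le> \<sigma>C" if "x \<in> D" "s \<in> {0..1}" for x s using \<sigma>C[OF DclD[OF that(1)] that(2)] sg[OF that] by simp
  show "\<sigma>0 \<le> sg (x, s)" if "x \<in> D" "s \<in> {0..1}" for x s using \<sigma>s_lower(2) DclD[OF that(1)] that(2) sg[OF that] by simp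
 qed (rule D(1) D(3) u0C c gr sgm sgc sg hg \<sigma>s_lower(1) pos(4) u0c | simp add: L_def | simp add: u0_def)+
 have eq: "Omega1 D H u = Omega1 D H u0" "HB1 D H u = HB1 D H u0"
  "G D H M \<sigma>1 \<sigma>s h u = G D H M \<sigma>1 \<sigma>s h u0" "G0 D H M \<sigma>1 \<sigma>s h u = G0 D H M \<sigma>1 \<sigma>s h u0"
  by (rule functionals_cong[OF D(1)], simp add: u0)+
 have "\<theta> \<in> extended_by_zero (Omega0 D H M) (Omega1 D H u0) (HB1 D H u0)" using \<theta> unfolding eq(1,2) .
 from gamma_limit[OF this] show ?thesis unfolding eq(3,4) .
qed

end
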